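(* Let $G$ be a finitely generated group, with $b_1(G)\ge2$. The Alexander polynomial $\Delta^G$ has a single essential variable if and only if either $\mathcal{W}_1(G)=\emptyset$, or all the irreducible components of $\mathcal{W}_1(G)$ are parallel, codimension-one subtori of $\mathbb{T}_G^0$.
   Context: Let $G$ be a finitely generated group, $n=b_1(G)$, and $G_{\mathrm{abf}}=G_{\mathrm{ab}}/\mathrm{Torsion}\cong\mathbb{Z}^n$. Identify $\mathbb{Z}[G_{\mathrm{abf}}]$ with $\Lambda_n=\mathbb{Z}[t_1^{\pm1},\dots,t_n^{\pm1}]$. Let $\mathbb{T}_G=\mathrm{Hom}(G,\mathbb{C}^* )$, with identity component $\mathbb{T}_G^0=\mathrm{Hom}(G_{\mathrm{abf}},\mathbb{C}^* )\cong(\mathbb{C}^* )^n$. For $\rho\in\mathbb{T}_G$, let $\mathbb{C}_\rho$ be the corresponding rank one local system, and let $\mathcal{V}_1(G)=\{\rho\in\mathbb{T}_G\mid\dim_{\mathbb{C}}H_1(G;\mathbb{C}_\rho)\ge1\}$. Denote by $\mathcal{W}_1(G)$ the union of all codimension-one irreducible components of $\mathcal{V}_1(G)$ which are contained in $\mathbb{T}_G^0$. The Alexander module is $A_G=\mathbb{Z}[G_{\mathrm{abf}}]\otimes_{\mathbb{Z}[G]}I_G$, where $I_G$ is the augmentation ideal of $\mathbb{Z}[G]$. If $\Lambda_n^h\to\Lambda_n^m\to A_G\to0$ is a presentation, $\mathcal{E}_1(A_G)$ is the ideal generated by the minors of size $m-1$ of the presentation matrix (equal to $\Lambda_n$ if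 $m\le1$, and to $0$ if $m-1>h$). The Alexander polynomial $\Delta^G\in\Lambda_n$ is the greatest common divisor of all elements of $\mathcal{E}_1(A_G)$, well defined up to units of $\Lambda_n$; $\doteq$ denotes equality up to units of $\Lambda_n$. An element $\Delta\in\mathbb{Z}[H]$, with $H$ a finitely generated free abelian group, has a single essential variable if $\Delta\doteq\tilde\nu(P)$ for some Laurent polynomial $P\in\mathbb{Z}[\mathbb{Z}]=\mathbb{Z}[t^{\pm1}]$ and some homomorphism $\nu\colon\mathbb{Z}\to H$, where $\tilde\nu\colon\mathbb{Z}[\mathbb{Z}]\to\mathbb{Z}[H]$ is the linear extension of $\nu$. For a finitely generated abelian group $H$ with character group $\mathbb{T}_H=\mathrm{Hom}(H,\mathbb{C}^* )$, a subtorus of $\mathbb{T}_H$ is a subvariety of the form $W=\rho\cdot S$, where $\rho\in\mathbb{T}_H$ and $S=f^*(\mathbb{T}_D)$ for some epimorphism $f\colon H\to D$ onto a free abelian group $D$ (so subtori may be translated). The subgroup $S$ is determined by $W$ and is denoted $\mathrm{dir}(W)$. Two subtori $W,W'$ are parallel if $\mathrm{dir}(W)\subset\mathrm{dir}(W')$ or $\mathrm{dir}(W')\subset\mathrm{dir}(W)$; for codimension-one subtori this means $\mathrm{dir}(W)=\mathrm{dir}(W')$. *)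

theory Defs
  imports
    "HOL-Algebra.Algebra"
    "HOL-Algebra.Algebraic_Closure_Type"
    "HOL-Combinatorics.Permutations"
    "HOL-Library.Extended_Nat"
    "HOL-Analysis.Abstract_Topology"
begin

section \<open>The free abelian quotient of a group\<close>

definition finitely_generated :: "('a, 'm) monoid_scheme \<Rightarrow> bool" where
  "finitely_generated G \<longleftrightarrow> (\<exists>S. finite S \<and> S \<subseteq> carrier G \<and> generate G S = carrier G)"

definition G_ab :: "('a, 'm) monoid_scheme \<Rightarrow> 'a set monoid" where
  "G_ab G = G Mod derived G (carrier G)"

definition torsion :: "('a, 'm) monoid_scheme \<Rightarrow> 'a set" where
  "torsion H = {x \<in> carrier H. \<exists>k::nat. k > 0 \<and> x [^]\<^bsub>H\<^esub> k = \<one>\<^bsub>H\<^esub>}"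

definition G_abf :: "('a, 'm) monoid_scheme \<Rightarrow> 'a set set monoid" where
  "G_abf G = G_ab G Mod torsion (G_ab G)"

definition abf_proj :: "('a, 'm) monoid_scheme \<Rightarrow> 'a \<Rightarrow> 'a set set" where
  "abf_proj G g = torsion (G_ab G) #>\<^bsub>G_ab G\<^esub> (derived G (carrier G) #>\<^bsub>G\<^esub> g)"

definition b1 :: "('a, 'm) monoid_scheme \<Rightarrow> nat" where
  "b1 G = (THE n. G_abf G \<cong> free_Abelian_group {..<n})"

section \<open>Group rings\<close>

definition group_ring :: "('a, 'm) monoid_scheme \<Rightarrow> ('a \<Rightarrow>\<^sub>0 'r::comm_ring_1) ring" where
  "group_ring G =
    \<lparr>carrier = {f. Poly_Mapping.keys f \<subseteq> carrier G},
     monoid.mult = (\<lambda>f g. \<Sum>x\<in>Poly_Mapping.keys f. \<Sum>y\<in>Poly_Mapping.keys g.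
        Poly_Mapping.single (x \<otimes>\<^bsub>G\<^esub> y) (Poly_Mapping.lookup f x * Poly_Mapping.lookup g y)),
     monoid.one = Poly_Mapping.single \<one>\<^bsub>G\<^esub> 1,
     ring.zero = 0,
     add = (+)\<rparr>"

abbreviation int_group_ring :: "('a, 'm) monoid_scheme \<Rightarrow> ('a \<Rightarrow>\<^sub>0 int) ring" where
  "int_group_ring \<equiv> group_ring"

abbreviation complex_group_ring :: "('a, 'm) monoid_scheme \<Rightarrow> ('a \<Rightarrow>\<^sub>0 complex) ring" where
  "complex_group_ring \<equiv> group_ring"

definition group_ring_map :: "('a \<Rightarrow> 'b) \<Rightarrow> ('a \<Rightarrow>\<^sub>0 int) \<Rightarrow> ('b \<Rightarrow>\<^sub>0 int)" where
  "group_ring_map \<phi> = frag_extend (\<lambda>x. frag_of (\<phi> x))"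

section \<open>Modules\<close>

text \<open>In all module records below the fields \<open>mult\<close> and \<open>one\<close>, inherited from \<open>ring\<close>, carry no
  meaning and are left undefined.\<close>

text \<open>The augmentation ideal, as a left module over the integral group ring.\<close>

definition augmentation_ideal ::
    "('a, 'm) monoid_scheme \<Rightarrow> ('a \<Rightarrow>\<^sub>0 int, 'a \<Rightarrow>\<^sub>0 int) module" where
  "augmentation_ideal G =
    \<lparr>carrier = {f \<in> carrier (int_group_ring G).
                 (\<Sum>x\<in>Poly_Mapping.keys f. Poly_Mapping.lookup f x) = 0},
     monoid.mult = undefined, monoid.one = undefined,
     ring.zero = 0, add = (+),
     module.smult = monoid.mult (int_group_ring G)\<rparr>"

text \<open>If \<open>C = N +> x\<close> is a coset of a submodule \<open>N\<close>, then the union in \<open>smult\<close> is \<open>N +> (s \<odot> x)\<close>.\<close>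

definition quotient_module :: "('r, 'a, 'm) module_scheme \<Rightarrow> 'a set \<Rightarrow> ('r, 'a set) module" where
  "quotient_module M N =
    \<lparr>carrier = a_rcosets\<^bsub>M\<^esub> N,
     monoid.mult = undefined, monoid.one = undefined,
     ring.zero = N, add = set_add M,
     module.smult = (\<lambda>s C. \<Union>x\<in>C. N +>\<^bsub>M\<^esub> (s \<odot>\<^bsub>M\<^esub> x))\<rparr>"

text \<open>For a ring homomorphism \<open>\<phi>\<close> from a not necessarily commutative ring \<open>R\<close> to \<open>S\<close> and a left
  \<open>R\<close>-module \<open>N\<close>, the left \<open>S\<close>-module \<open>S \<otimes>\<^sub>R N\<close>, where \<open>S\<close> is a right \<open>R\<close>-module through \<open>\<phi>\<close>:
  the free abelian group on \<open>S \<times> N\<close> modulo the additivity and balancing relations.\<close>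

definition tensor_relations ::
    "('r, 'p) ring_scheme \<Rightarrow> ('s, 'q) ring_scheme \<Rightarrow> ('r \<Rightarrow> 's) \<Rightarrow> ('r, 'm, 'k) module_scheme
      \<Rightarrow> ('s \<times> 'm \<Rightarrow>\<^sub>0 int) set" where
  "tensor_relations R S \<phi> N =
    {frag_of (s \<oplus>\<^bsub>S\<^esub> s', x) - frag_of (s, x) - frag_of (s', x) | s s' x.
       s \<in> carrier S \<and> s' \<in> carrier S \<and> x \<in> carrier N} \<union>
    {frag_of (s, x \<oplus>\<^bsub>N\<^esub> x') - frag_of (s, x) - frag_of (s, x') | s x x'.
       s \<in> carrier S \<and> x \<in> carrier N \<and> x' \<in> carrier N} \<union>
    {frag_of (s \<otimes>\<^bsub>S\<^esub> \<phi> r, x) - frag_of (s, r \<odot>\<^bsub>N\<^esub> x) | s r x.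
       s \<in> carrier S \<and> r \<in> carrier R \<and> x \<in> carrier N}"

definition free_on_pairs ::
    "('s, 'q) ring_scheme \<Rightarrow> ('r, 'm, 'k) module_scheme \<Rightarrow> ('s, 's \<times> 'm \<Rightarrow>\<^sub>0 int) module" where
  "free_on_pairs S N =
    \<lparr>carrier = carrier (free_Abelian_group (carrier S \<times> carrier N)),
     monoid.mult = undefined, monoid.one = undefined,
     ring.zero = 0, add = (+),
     module.smult = (\<lambda>s. frag_extend (\<lambda>(u, x). frag_of (s \<otimes>\<^bsub>S\<^esub> u, x)))\<rparr>"

definition extension_of_scalars ::
    "('r, 'p) ring_scheme \<Rightarrow> ('s, 'q) ring_scheme \<Rightarrow> ('r \<Rightarrow> 's) \<Rightarrow> ('r, 'm, 'k) module_scheme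
      \<Rightarrow> ('s, ('s \<times> 'm \<Rightarrow>\<^sub>0 int) set) module" where
  "extension_of_scalars R S \<phi> N =
    quotient_module (free_on_pairs S N)
      (generate (free_Abelian_group (carrier S \<times> carrier N)) (tensor_relations R S \<phi> N))"

section \<open>Alexander module and Alexander polynomial\<close>

definition alexander_module where
  "alexander_module G =
    extension_of_scalars (int_group_ring G) (int_group_ring (G_abf G))
      (group_ring_map (abf_proj G)) (augmentation_ideal G)"

text \<open>\<open>Q\<close> is an \<open>m \<times> h\<close> matrix over \<open>R\<close>, its columns being the relations, with
  \<open>R\<^sup>h \<rightarrow> R\<^sup>m \<rightarrow> A \<rightarrow> 0\<close> exact.\<close>

definition presentation_matrix ::
    "('r, 'p) ring_scheme \<Rightarrow> ('r, 'a, 'k) module_scheme \<Rightarrow> nat \<Rightarrow> nat \<Rightarrow> (nat \<Rightarrow> nat \<Rightarrow> 'r) \<Rightarrow> bool" where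
  "presentation_matrix R A m h Q \<longleftrightarrow>
    (\<forall>i<m. \<forall>j<h. Q i j \<in> carrier R) \<and>
    (\<exists>a \<in> {..<m} \<rightarrow> carrier A.
      (\<forall>x\<in>carrier A. \<exists>c \<in> {..<m} \<rightarrow> carrier R. x = (\<Oplus>\<^bsub>A\<^esub>i\<in>{..<m}. c i \<odot>\<^bsub>A\<^esub> a i)) \<and>
      (\<forall>c \<in> {..<m} \<rightarrow> carrier R.
         (\<Oplus>\<^bsub>A\<^esub>i\<in>{..<m}. c i \<odot>\<^bsub>A\<^esub> a i) = \<zero>\<^bsub>A\<^esub> \<longleftrightarrow>
         (\<exists>d \<in> {..<h} \<rightarrow> carrier R. \<forall>i<m. c i = (\<Oplus>\<^bsub>R\<^esub>j\<in>{..<h}. Q i j \<otimes>\<^bsub>R\<^esub> d j))))"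

definition ring_det :: "('r, 'p) ring_scheme \<Rightarrow> nat \<Rightarrow> (nat \<Rightarrow> nat \<Rightarrow> 'r) \<Rightarrow> 'r" where
  "ring_det R k B =
    (\<Oplus>\<^bsub>R\<^esub>\<sigma>\<in>{\<sigma>. \<sigma> permutes {..<k}}. [(sign \<sigma> :: int)] \<cdot>\<^bsub>R\<^esub> (\<Otimes>\<^bsub>R\<^esub>i\<in>{..<k}. B i (\<sigma> i)))"

definition minors ::
    "('r, 'p) ring_scheme \<Rightarrow> nat \<Rightarrow> nat \<Rightarrow> (nat \<Rightarrow> nat \<Rightarrow> 'r) \<Rightarrow> nat \<Rightarrow> 'r set" where
  "minors R m h Q k =
    {ring_det R k (\<lambda>i j. Q (r i) (c j)) | r c.
       strict_mono_on {..<k} r \<and> r ` {..<k} \<subseteq> {..<m} \<and>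
       strict_mono_on {..<k} c \<and> c ` {..<k} \<subseteq> {..<h}}"

text \<open>For \<open>m \<le> 1\<close> the truncated difference \<open>m - 1\<close> is \<open>0\<close>, and the only minor is the empty
  determinant \<open>\<one>\<close>; for \<open>m - 1 > h\<close> there are no minors and the ideal is zero.\<close>

definition elementary_ideal_1 ::
    "('r, 'p) ring_scheme \<Rightarrow> nat \<Rightarrow> nat \<Rightarrow> (nat \<Rightarrow> nat \<Rightarrow> 'r) \<Rightarrow> 'r set" where
  "elementary_ideal_1 R m h Q = Idl\<^bsub>R\<^esub> (minors R m h Q (m - 1))"

definition is_gcd_of :: "('r, 'p) ring_scheme \<Rightarrow> 'r \<Rightarrow> 'r set \<Rightarrow> bool" where
  "is_gcd_of R d E \<longleftrightarrow> greatest (division_rel R) d (Lower (division_rel R) E)"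

text \<open>The Alexander polynomial is only defined up to units; the predicate holds of each of its
  representatives.\<close>

definition is_alexander_polynomial :: "('a, 'm) monoid_scheme \<Rightarrow> ('a set set \<Rightarrow>\<^sub>0 int) \<Rightarrow> bool" where
  "is_alexander_polynomial G \<Delta> \<longleftrightarrow>
    (\<exists>m h Q. presentation_matrix (int_group_ring (G_abf G)) (alexander_module G) m h Q \<and>
       is_gcd_of (int_group_ring (G_abf G)) \<Delta> (elementary_ideal_1 (int_group_ring (G_abf G)) m h Q))"

definition equal_up_to_units :: "('r, 'p) ring_scheme \<Rightarrow> 'r \<Rightarrow> 'r \<Rightarrow> bool" where
  "equal_up_to_units R a b \<longleftrightarrow> (\<exists>u\<in>Units R. a = u \<otimes>\<^bsub>R\<^esub> b)"

definition single_essential_variable :: "('a, 'm) monoid_scheme \<Rightarrow> ('a \<Rightarrow>\<^sub>0 int) \<Rightarrow> bool" where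
  "single_essential_variable H \<Delta> \<longleftrightarrow>
    (\<exists>P \<in> carrier (int_group_ring integer_group). \<exists>\<nu> \<in> hom integer_group H.
       equal_up_to_units (int_group_ring H) \<Delta> (group_ring_map \<nu> P))"

section \<open>Character groups and the Zariski topology\<close>

abbreviation complex_field :: "complex ring" where
  "complex_field \<equiv> ring_of_type_algebra"

definition char_group :: "('a, 'm) monoid_scheme \<Rightarrow> ('a \<Rightarrow> complex) monoid" where
  "char_group H =
    \<lparr>carrier = hom H (units_of complex_field) \<inter> extensional (carrier H),
     monoid.mult = (\<lambda>\<rho> \<sigma>. \<lambda>x\<in>carrier H. \<rho> x * \<sigma> x),
     monoid.one = (\<lambda>x\<in>carrier H. 1)\<rparr>"

definition char_value :: "('a \<Rightarrow> complex) \<Rightarrow> ('a \<Rightarrow>\<^sub>0 complex) \<Rightarrow> complex" where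
  "char_value \<rho> f = (\<Sum>x\<in>Poly_Mapping.keys f. Poly_Mapping.lookup f x * \<rho> x)"

text \<open>The coordinate ring of the character group of \<open>H\<close> is \<open>\<complex>[H\<^sub>a\<^sub>b]\<close>, so its regular functions are
  the \<open>\<rho> \<mapsto> \<rho>(f)\<close> with \<open>f \<in> \<complex>[H]\<close>. The Zariski topology is generated by the basic open sets where
  one of these does not vanish.\<close>

definition zariski :: "('a, 'm) monoid_scheme \<Rightarrow> ('a \<Rightarrow> complex) topology" where
  "zariski H =
    topology_generated_by
      ((\<lambda>f. {\<rho> \<in> carrier (char_group H). char_value \<rho> f \<noteq> 0}) ` carrier (complex_group_ring H))"

definition irreducible_in :: "'x topology \<Rightarrow> 'x set \<Rightarrow> bool" where
  "irreducible_in \<T> S \<longleftrightarrow>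
    S \<subseteq> topspace \<T> \<and> S \<noteq> {} \<and>
    (\<forall>A B. closedin \<T> A \<and> closedin \<T> B \<and> S \<subseteq> A \<union> B \<longrightarrow> S \<subseteq> A \<or> S \<subseteq> B)"

definition irreducible_components :: "'x topology \<Rightarrow> 'x set \<Rightarrow> 'x set set" where
  "irreducible_components \<T> V =
    {C. irreducible_in \<T> C \<and> C \<subseteq> V \<and>
        (\<forall>C'. irreducible_in \<T> C' \<and> C' \<subseteq> V \<and> C \<subseteq> C' \<longrightarrow> C' = C)}"

text \<open>Codimension of an irreducible closed set \<open>Z\<close>: the supremum of the lengths of chains of
  irreducible closed sets \<open>Z = Y 0 \<subset> Y 1 \<subset> \<dots> \<subset> Y k\<close>.\<close>

definition codimension :: "'x topology \<Rightarrow> 'x set \<Rightarrow> enat" where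
  "codimension \<T> Z =
    Sup {enat k | k. \<exists>Y. Y 0 = Z \<and> (\<forall>i\<le>k. closedin \<T> (Y i) \<and> irreducible_in \<T> (Y i)) \<and>
                        (\<forall>i<k. Y i \<subset> Y (Suc i))}"

text \<open>The identification of \<open>Hom(G\<^sub>a\<^sub>b\<^sub>f, \<complex>\<^sup>*)\<close> with the identity component of \<open>Hom(G, \<complex>\<^sup>*)\<close>.\<close>

definition abf_pullback :: "('a, 'm) monoid_scheme \<Rightarrow> ('a set set \<Rightarrow> complex) \<Rightarrow> 'a \<Rightarrow> complex" where
  "abf_pullback G \<chi> = compose (carrier G) \<chi> (abf_proj G)"

definition T0 :: "('a, 'm) monoid_scheme \<Rightarrow> ('a \<Rightarrow> complex) set" where
  "T0 G = abf_pullback G ` carrier (char_group (G_abf G))"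

text \<open>A subset of the identity component, viewed inside \<open>Hom(G\<^sub>a\<^sub>b\<^sub>f, \<complex>\<^sup>*)\<close>.\<close>

definition in_abf_chars ::
    "('a, 'm) monoid_scheme \<Rightarrow> ('a \<Rightarrow> complex) set \<Rightarrow> ('a set set \<Rightarrow> complex) set" where
  "in_abf_chars G C = {\<chi> \<in> carrier (char_group (G_abf G)). abf_pullback G \<chi> \<in> C}"

section \<open>Twisted homology and the characteristic variety\<close>

definition lin_indep :: "('k, 'p) ring_scheme \<Rightarrow> ('k, 'v, 'q) module_scheme \<Rightarrow> 'v set \<Rightarrow> bool" where
  "lin_indep K V S \<longleftrightarrow>
    (\<forall>c \<in> S \<rightarrow> carrier K. (\<Oplus>\<^bsub>V\<^esub>v\<in>S. c v \<odot>\<^bsub>V\<^esub> v) = \<zero>\<^bsub>V\<^esub> \<longrightarrow> (\<forall>v\<in>S. c v = \<zero>\<^bsub>K\<^esub>))"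

definition vs_dim :: "('k, 'p) ring_scheme \<Rightarrow> ('k, 'v, 'q) module_scheme \<Rightarrow> enat" where
  "vs_dim K V = Sup {enat (card S) | S. finite S \<and> S \<subseteq> carrier V \<and> lin_indep K V S}"

text \<open>Inhomogeneous bar complex in degrees 2, 1, 0, with coefficients in \<open>\<complex>\<close> on which \<open>g\<close> acts
  from the right as multiplication by \<open>\<rho> g\<close>:
  \<open>\<partial>\<^sub>2 [g|h] = \<rho>(g) [h] - [gh] + [g]\<close> and \<open>\<partial>\<^sub>1 [g] = \<rho>(g) - 1\<close>.\<close>

definition bar_boundary2 ::
    "('a, 'm) monoid_scheme \<Rightarrow> ('a \<Rightarrow> complex) \<Rightarrow> ('a \<times> 'a \<Rightarrow>\<^sub>0 complex) \<Rightarrow> ('a \<Rightarrow>\<^sub>0 complex)" where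
  "bar_boundary2 G \<rho> c =
    (\<Sum>(g, h)\<in>Poly_Mapping.keys c.
       Poly_Mapping.single h (Poly_Mapping.lookup c (g, h) * \<rho> g)
       - Poly_Mapping.single (g \<otimes>\<^bsub>G\<^esub> h) (Poly_Mapping.lookup c (g, h))
       + Poly_Mapping.single g (Poly_Mapping.lookup c (g, h)))"

definition bar_boundary1 :: "('a \<Rightarrow> complex) \<Rightarrow> ('a \<Rightarrow>\<^sub>0 complex) \<Rightarrow> complex" where
  "bar_boundary1 \<rho> c = (\<Sum>g\<in>Poly_Mapping.keys c. Poly_Mapping.lookup c g * (\<rho> g - 1))"

definition twisted_cycles1 ::
    "('a, 'm) monoid_scheme \<Rightarrow> ('a \<Rightarrow> complex) \<Rightarrow> (complex, 'a \<Rightarrow>\<^sub>0 complex) module" where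
  "twisted_cycles1 G \<rho> =
    \<lparr>carrier = {c. Poly_Mapping.keys c \<subseteq> carrier G \<and> bar_boundary1 \<rho> c = 0},
     monoid.mult = undefined, monoid.one = undefined,
     ring.zero = 0, add = (+),
     module.smult = (\<lambda>z. Poly_Mapping.map ((*) z))\<rparr>"

definition twisted_boundaries1 ::
    "('a, 'm) monoid_scheme \<Rightarrow> ('a \<Rightarrow> complex) \<Rightarrow> ('a \<Rightarrow>\<^sub>0 complex) set" where
  "twisted_boundaries1 G \<rho> =
    bar_boundary2 G \<rho> ` {c. Poly_Mapping.keys c \<subseteq> carrier G \<times> carrier G}"

definition twisted_H1 ::
    "('a, 'm) monoid_scheme \<Rightarrow> ('a \<Rightarrow> complex) \<Rightarrow> (complex, ('a \<Rightarrow>\<^sub>0 complex) set) module" where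
  "twisted_H1 G \<rho> = quotient_module (twisted_cycles1 G \<rho>) (twisted_boundaries1 G \<rho>)"

definition V1 :: "('a, 'm) monoid_scheme \<Rightarrow> ('a \<Rightarrow> complex) set" where
  "V1 G = {\<rho> \<in> carrier (char_group G). vs_dim complex_field (twisted_H1 G \<rho>) \<ge> 1}"

definition W1 :: "('a, 'm) monoid_scheme \<Rightarrow> ('a \<Rightarrow> complex) set" where
  "W1 G = \<Union> {C \<in> irreducible_components (zariski G) (V1 G). codimension (zariski G) C = 1 \<and> C \<subseteq> T0 G}"

section \<open>Subtori\<close>

text \<open>The targets are the free abelian groups of finite rank, which for finitely generated \<open>H\<close> are
  up to isomorphism all free abelian quotients of \<open>H\<close>.\<close>

definition is_direction :: "('a, 'm) monoid_scheme \<Rightarrow> ('a \<Rightarrow> complex) set \<Rightarrow> bool" where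
  "is_direction H S \<longleftrightarrow>
    (\<exists>k::nat. \<exists>f \<in> epi H (free_Abelian_group {..<k}).
       S = (\<lambda>\<chi>. compose (carrier H) \<chi> f) ` carrier (char_group (free_Abelian_group {..<k})))"

definition is_subtorus_along ::
    "('a, 'm) monoid_scheme \<Rightarrow> ('a \<Rightarrow> complex) set \<Rightarrow> ('a \<Rightarrow> complex) set \<Rightarrow> bool" where
  "is_subtorus_along H W S \<longleftrightarrow>
    is_direction H S \<and> (\<exists>\<rho> \<in> carrier (char_group H). W = \<rho> <#\<^bsub>char_group H\<^esub> S)"

definition is_subtorus :: "('a, 'm) monoid_scheme \<Rightarrow> ('a \<Rightarrow> complex) set \<Rightarrow> bool" where
  "is_subtorus H W \<longleftrightarrow> (\<exists>S. is_subtorus_along H W S)"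

definition dir :: "('a, 'm) monoid_scheme \<Rightarrow> ('a \<Rightarrow> complex) set \<Rightarrow> ('a \<Rightarrow> complex) set" where
  "dir H W = (THE S. is_subtorus_along H W S)"

definition parallel ::
    "('a, 'm) monoid_scheme \<Rightarrow> ('a \<Rightarrow> complex) set \<Rightarrow> ('a \<Rightarrow> complex) set \<Rightarrow> bool" where
  "parallel H W W' \<longleftrightarrow> dir H W \<subseteq> dir H W' \<or> dir H W' \<subseteq> dir H W"

end

theory Submission
  imports Defs "HOL-Computational_Algebra.Field_as_Ring"
    "HOL-Computational_Algebra.Fundamental_Theorem_Algebra"
    "Jordan_Normal_Form.Determinant"
begin

text \<open>In coordinates \<open>G\<^sub>a\<^sub>b\<^sub>f \<cong> \<int>\<^sup>n\<close> a character \<open>\<rho>\<close> of the identity component lies in \<open>V1 G\<close> if and only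
  if there are two independent crossed homomorphisms from \<open>G\<close> to \<open>\<complex>\<^sub>\<rho>\<close>. These are the \<open>\<rho>\<close>-semilinear
  functionals on the Alexander module, that is, the left kernel of the presentation matrix evaluated
  at \<open>\<rho>\<close>; hence \<open>V1 G\<close> meets the identity component in the zero set of the elementary ideal.
  By unique factorization, the irreducible sets of codimension one in that zero set are the ones on
  which \<open>\<Delta>\<close> vanishes, so \<open>W1 G\<close> is the zero set of \<open>\<Delta>\<close>, or empty if \<open>\<Delta>\<close> is zero.

  If \<open>\<Delta>\<close> is a unit times a polynomial in a power of one coordinate \<open>z\<^sub>j\<close>, the components of \<open>W1 G\<close>
  are parallel level sets of \<open>z\<^sub>j\<close>. Conversely, after a change of basis of \<open>\<int>\<^sup>n\<close> a component that is a
  codimension-one subtorus becomes a level set of some \<open>z\<^sub>j\<close>. If two exponents of \<open>\<Delta>\<close> differed in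
  another coordinate \<open>i\<close>, then \<open>\<Delta>\<close> would have a complex prime factor that really involves \<open>z\<^sub>i\<close>. No nonzero
  Laurent polynomial in the remaining coordinates vanishes on the zero set of this factor, whereas on a
  subtorus parallel to a level set of \<open>z\<^sub>j\<close> some power of \<open>z\<^sub>j\<close> is constant.\<close>

hide_const (open) Poly_Mapping.degree Polynomials.degree UnivPoly.coeff UnivPoly.monom Module.smult

section \<open>Minors and kernels\<close>

text \<open>No dimension theory of the torus is used. Codimension one amounts to maximality among
  proper irreducible closed sets, and the geometry is reduced to one variable \<open>t_j\<close>
  over the Laurent polynomials in the others. An element that really involves \<open>t_j\<close> is,
  up to a power of \<open>t_j\<close>, a polynomial of positive degree over that ring. For a prime
  \<open>p\<close> of this kind, Euclid's algorithm with denominators cleared gives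
  \<open>x p + y g = r\<close> with \<open>r \<noteq> 0\<close> free of \<open>t_j\<close>, unless
  \<open>p\<close> divides \<open>g\<close>. Over the complex numbers \<open>p\<close> has zeros on
  a general fibre, and this yields the Nullstellensatz for hypersurfaces. The Alexander polynomial
  is a gcd over the integers, whereas the variety is complex. The bridge is to run the same
  elimination with integral coefficients and to evaluate the result on the variety. The bound on
  \<open>b1 G\<close> matters at the trivial character, where principal crossed homomorphisms
  vanish: two independent homomorphisms to the complex numbers exist there, so the description by
  minors holds at this point as well.\<close>

definition leibniz :: "nat \<Rightarrow> (nat \<Rightarrow> nat \<Rightarrow> complex) \<Rightarrow> complex" where
  "leibniz k B = (\<Sum>\<sigma>\<in>{\<sigma>. \<sigma> permutes {..<k}}. of_int (sign \<sigma>) * (\<Prod>i<k. B i (\<sigma> i)))"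

lemma leibniz_det: "leibniz k B = Determinant.det (Matrix.mat k k (\<lambda>(i, j). B i j))"
proof -
  have "(\<Prod>i<k. B i (\<sigma> i)) = (\<Prod>i = 0..<k. Matrix.mat k k (\<lambda>(i, j). B i j) $$ (i, \<sigma> i))" if "\<sigma> permutes {0..<k}" for \<sigma>
  proof (rule prod.cong)
    fix i assume "i \<in> {0..<k}"
    moreover from this have "\<sigma> i \<in> {0..<k}" using permutes_in_image[OF that] by blast
    ultimately show "B i (\<sigma> i) = Matrix.mat k k (\<lambda>(i, j). B i j) $$ (i, \<sigma> i)" by simp
  qed auto
  then have "(\<Sum>\<sigma>\<in>{\<sigma>. \<sigma> permutes {0..<k}}. of_int (sign \<sigma>) * (\<Prod>i<k. B i (\<sigma> i))) =
    (\<Sum>\<sigma>\<in>{\<sigma>. \<sigma> permutes {0..<k}}. signof \<sigma> * (\<Prod>i = 0..<k. Matrix.mat k k (\<lambda>(i, j). B i j) $$ (i, \<sigma> i)))"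
    by (intro sum.cong refl) simp
  then show ?thesis by (simp add: leibniz_def Determinant.det_def lessThan_atLeast0)
qed

text \<open>The kernel vectors act on the rows, whereas the criterion
  \<open>det_0_iff_vec_prod_zero\<close> concerns columns; passing to the transpose bridges the
  two.\<close>

lemma leibniz_0_iff:
  "leibniz k B = 0 \<longleftrightarrow> (\<exists>y. (\<exists>i<k. y i \<noteq> 0) \<and> (\<forall>j<k. (\<Sum>i<k. B i j * y i) = 0))"
proof -
  let ?M = "Matrix.mat k k (\<lambda>(i, j). B j i)"
  have "Matrix.mat k k (\<lambda>(i, j). B i j) = transpose_mat ?M" by (intro eq_matI) auto
  then have "leibniz k B = Determinant.det ?M" using leibniz_det[of k B] Determinant.det_transpose[of ?M k] by simp
  also have "Determinant.det ?M = 0 \<longleftrightarrow> (\<exists>v. v \<in> carrier_vec k \<and> v \<noteq> 0\<^sub>v k \<and> ?M *\<^sub>v v = 0\<^sub>v k)"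
    by (rule det_0_iff_vec_prod_zero) simp
  also have "\<dots> \<longleftrightarrow> (\<exists>y. (\<exists>i<k. y i \<noteq> 0) \<and> (\<forall>j<k. (\<Sum>i<k. B i j * y i) = 0))"
  proof
    assume "\<exists>v. v \<in> carrier_vec k \<and> v \<noteq> 0\<^sub>v k \<and> ?M *\<^sub>v v = 0\<^sub>v k"
    then obtain v where v: "v \<in> carrier_vec k" "v \<noteq> 0\<^sub>v k" "?M *\<^sub>v v = 0\<^sub>v k" by blast
    have "\<exists>i<k. v $ i \<noteq> 0" using v(1,2) by (metis carrier_vecD eq_vecI index_zero_vec)
    moreover have "(\<Sum>i<k. B i j * v $ i) = 0" if "j < k" for j
    proof -
      have "(?M *\<^sub>v v) $ j = (\<Sum>i<k. B i j * v $ i)"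
        using that v(1) by (simp add: scalar_prod_def lessThan_atLeast0)
      then show ?thesis using v(3) that by simp
    qed
    ultimately show "\<exists>y. (\<exists>i<k. y i \<noteq> 0) \<and> (\<forall>j<k. (\<Sum>i<k. B i j * y i) = 0)" by (intro exI[of _ "\<lambda>i. v $ i"]) simp
  next
    assume "\<exists>y. (\<exists>i<k. y i \<noteq> 0) \<and> (\<forall>j<k. (\<Sum>i<k. B i j * y i) = 0)"
    then obtain y i where y: "i < k" "y i \<noteq> 0" "\<forall>j<k. (\<Sum>i<k. B i j * y i) = 0" by blast
    let ?v = "Matrix.vec k y"
    have "?v $ i \<noteq> 0" using y by simp
    then have "?v \<noteq> 0\<^sub>v k" using y(1) by (metis index_zero_vec(1))
    moreover have "?M *\<^sub>v ?v = 0\<^sub>v k"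
      using y(3) by (intro eq_vecI) (auto simp: scalar_prod_def lessThan_atLeast0)
    ultimately show "\<exists>v. v \<in> carrier_vec k \<and> v \<noteq> 0\<^sub>v k \<and> ?M *\<^sub>v v = 0\<^sub>v k" by (intro exI[of _ ?v]) simp
  qed
  finally show ?thesis .
qed

lemma underdetermined_system:
  fixes P :: "nat \<Rightarrow> nat \<Rightarrow> complex"
  assumes "finite J" "card J = k"
  shows "\<exists>y. (\<exists>i<Suc k. y i \<noteq> 0) \<and> (\<forall>j\<in>J. (\<Sum>i<Suc k. P i j * y i) = 0)"
proof -
  obtain e where e: "bij_betw e {..<k} J" using ex_bij_betw_strict_mono_card[OF assms(1)] assms(2) by metis
  \<comment> \<open>A zero column with index \<open>k\<close> makes the system square. Every
    permutation sends some row to that column, so each term of the determinant vanishes.\<close>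
  let ?B = "\<lambda>i j. if j < k then P i (e j) else 0"
  have "(\<Prod>i<Suc k. ?B i (\<sigma> i)) = 0" if \<sigma>: "\<sigma> permutes {..<Suc k}" for \<sigma>
  proof -
    obtain i where i: "\<sigma> i = k" using permutes_surj[OF \<sigma>] by (metis surjD)
    then have "i < Suc k" using permutes_in_image[OF \<sigma>, of i] by simp
    then show ?thesis using i by (intro prod_zero) auto
  qed
  then have "leibniz (Suc k) ?B = 0" unfolding leibniz_def by (intro sum.neutral) auto
  then obtain y where y: "\<exists>i<Suc k. y i \<noteq> 0" "\<forall>j<Suc k. (\<Sum>i<Suc k. ?B i j * y i) = 0"
    unfolding leibniz_0_iff by blast
  have "(\<Sum>i<Suc k. P i j * y i) = 0" if "j \<in> J" for j
  proof -
    obtain j' where j': "j' < k" "j = e j'" using e \<open>j \<in> J\<close> unfolding bij_betw_def by auto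
    then have "(\<Sum>i<Suc k. ?B i j' * y i) = 0" using y(2) by (meson less_SucI)
    then show ?thesis using j' by simp
  qed
  then show ?thesis using y(1) by blast
qed

text \<open>Row rank equals column rank, by adding one row at a time. With one more row than
  selected columns there is a nonzero \<open>w\<close> that solves the selected equations, and a
  column on which \<open>w\<close> fails is added. Any solution of the enlarged system is a multiple
  of \<open>w\<close>, hence zero.\<close>

lemma independent_rows_columns:
  fixes P :: "nat \<Rightarrow> nat \<Rightarrow> complex"
  assumes "\<And>y. (\<forall>j<h. (\<Sum>i<k. P i j * y i) = 0) \<Longrightarrow> \<forall>i<k. y i = 0"
  shows "\<exists>J\<subseteq>{..<h}. card J = k \<and> (\<forall>y. (\<forall>j\<in>J. (\<Sum>i<k. P i j * y i) = 0) \<longrightarrow> (\<forall>i<k. y i = 0))"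
  using assms
proof (induction k)
  case 0
  then show ?case by (intro exI[of _ "{}"]) auto
next
  case (Suc k)
  have "\<forall>i<k. y i = 0" if "\<forall>j<h. (\<Sum>i<k. P i j * y i) = 0" for y
  proof -
    have "(\<Sum>i<Suc k. P i j * (if i < k then y i else 0)) = (\<Sum>i<k. P i j * y i)" for j by simp
    then have "\<forall>i<Suc k. (if i < k then y i else 0) = 0" using that by (intro Suc.prems) simp
    then show ?thesis by (metis less_SucI)
  qed
  then obtain J where J: "J \<subseteq> {..<h}" "card J = k" "\<And>y. \<forall>j\<in>J. (\<Sum>i<k. P i j * y i) = 0 \<Longrightarrow> \<forall>i<k. y i = 0"
    using Suc.IH by blast
  have fJ: "finite J" using J(1) finite_subset by blast
  obtain w where w: "\<exists>i<Suc k. w i \<noteq> 0" "\<And>j. j \<in> J \<Longrightarrow> (\<Sum>i<Suc k. P i j * w i) = 0"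
    using underdetermined_system[OF fJ J(2)] by blast
  have wk: "w k \<noteq> 0"
  proof
    assume "w k = 0"
    then have "\<forall>j\<in>J. (\<Sum>i<k. P i j * w i) = 0" using w(2) by fastforce
    then have "\<forall>i<k. w i = 0" by (rule J(3))
    then show False using w(1) \<open>w k = 0\<close> by (metis less_Suc_eq)
  qed
  obtain j0 where j0: "j0 < h" "(\<Sum>i<Suc k. P i j0 * w i) \<noteq> 0" using Suc.prems[of w] w(1) by blast
  have j0J: "j0 \<notin> J" using w(2) j0 by blast
  have "\<forall>i<Suc k. y i = 0" if y: "\<forall>j\<in>insert j0 J. (\<Sum>i<Suc k. P i j * y i) = 0" for y
  proof -
    \<comment> \<open>Subtracting \<open>c\<close> times \<open>w\<close> clears the last entry of
      \<open>y\<close>; the remaining entries then vanish by the choice of \<open>J\<close> for the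
      first \<open>k\<close> rows.\<close>
    define c where "c = y k / w k"
    have "(\<Sum>i<k. P i j * (y i - c * w i)) = 0" if "j \<in> J" for j
    proof -
      have "(\<Sum>i<Suc k. P i j * (y i - c * w i)) = (\<Sum>i<Suc k. P i j * y i) - c * (\<Sum>i<Suc k. P i j * w i)"
        by (simp only: right_diff_distrib sum_subtractf sum_distrib_left mult.left_commute)
      also have "\<dots> = 0" using y w(2)[OF that] that by simp
      finally show ?thesis using wk by (simp add: c_def)
    qed
    then have "\<forall>i<k. y i - c * w i = 0" using J(3)[of "\<lambda>i. y i - c * w i"] by blast
    then have yc: "y i = c * w i" if "i < Suc k" for i
      using that wk by (cases "i = k") (auto simp: c_def less_Suc_eq)
    have "(\<Sum>i<Suc k. P i j0 * y i) = (\<Sum>i<Suc k. c * (P i j0 * w i))"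
      by (intro sum.cong refl) (simp add: yc)
    then have "c * (\<Sum>i<Suc k. P i j0 * w i) = 0" using y by (simp only: sum_distrib_left) simp
    then have "c = 0" using j0(2) by simp
    then show ?thesis using yc by simp
  qed
  then show ?case using J(1,2) j0(1) j0J fJ by (intro exI[of _ "insert j0 J"]) auto
qed

lemma independent_rows_minor:
  fixes P :: "nat \<Rightarrow> nat \<Rightarrow> complex"
  assumes "\<And>y. (\<forall>j<h. (\<Sum>i<k. P i j * y i) = 0) \<Longrightarrow> \<forall>i<k. y i = 0"
  obtains c where "strict_mono_on {..<k} c" "c ` {..<k} \<subseteq> {..<h}" "leibniz k (\<lambda>i j. P i (c j)) \<noteq> 0"
proof -
  obtain J where J: "J \<subseteq> {..<h}" "card J = k" "\<And>y. \<forall>j\<in>J. (\<Sum>i<k. P i j * y i) = 0 \<Longrightarrow> \<forall>i<k. y i = 0"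
    using independent_rows_columns[OF assms] by blast
  then have "finite J" using finite_subset by blast
  then obtain c where c: "bij_betw c {..<k} J" "strict_mono_on {..<k} c"
    using ex_bij_betw_strict_mono_card J(2) by metis
  have img: "c ` {..<k} = J" using c(1) by (simp add: bij_betw_def)
  have "leibniz k (\<lambda>i j. P i (c j)) \<noteq> 0"
  proof
    assume "leibniz k (\<lambda>i j. P i (c j)) = 0"
    then obtain y where y: "\<exists>i<k. y i \<noteq> 0" "\<forall>j<k. (\<Sum>i<k. P i (c j) * y i) = 0" unfolding leibniz_0_iff by blast
    have "\<forall>j\<in>J. (\<Sum>i<k. P i j * y i) = 0" using y(2) unfolding img[symmetric] by blast
    then show False using J(3) y(1) by blast
  qed
  then show thesis using that c(2) img J(1) by blast
qed

text \<open>Independence is tested on \<open>T\<close> alone, because vectors of length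
  \<open>m\<close> are functions on all naturals and crossed homomorphisms are functions on a whole
  type.\<close>

definition indep2 :: "'x set \<Rightarrow> ('x \<Rightarrow> complex) \<Rightarrow> ('x \<Rightarrow> complex) \<Rightarrow> bool" where
  "indep2 T u v \<longleftrightarrow> (\<forall>\<alpha> \<beta>. (\<forall>x\<in>T. \<alpha> * u x + \<beta> * v x = 0) \<longrightarrow> \<alpha> = 0 \<and> \<beta> = 0)"

text \<open>The increasing enumeration of the naturals other than \<open>i0\<close>; it serves again
  later to drop a coordinate of a lattice.\<close>

definition row_skip :: "nat \<Rightarrow> nat \<Rightarrow> nat" where "row_skip i0 i = (if i < i0 then i else Suc i)"

lemma row_skip_image: "i0 < m \<Longrightarrow> row_skip i0 ` {..<m - 1} = {..<m} - {i0}"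
proof (intro equalityI subsetI)
  fix i assume "i0 < m" "i \<in> {..<m} - {i0}"
  then show "i \<in> row_skip i0 ` {..<m - 1}"
    by (intro image_eqI[of _ _ "if i < i0 then i else i - 1"]) (auto simp: row_skip_def)
qed (auto simp: row_skip_def split: if_splits)

lemma strict_mono_row_skip: "strict_mono_on S (row_skip i0)"
  by (auto simp: strict_mono_on_def row_skip_def)

text \<open>All minors of size \<open>m - 1\<close> vanish exactly when the rank is at most
  \<open>m - 2\<close>. For \<open>m = 0\<close> the truncated size is 0: the empty minor is 1, and
  no two functions are independent on the empty set, so both sides fail.\<close>

lemma two_left_kernel_vectors_iff:
  fixes P :: "nat \<Rightarrow> nat \<Rightarrow> complex" and m h k :: nat
  assumes k: "k = m - 1"
  defines "K \<equiv> {y. \<forall>j<h. (\<Sum>i<m. P i j * y i) = 0}"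
  shows "(\<exists>y\<in>K. \<exists>y'\<in>K. indep2 {..<m} y y') \<longleftrightarrow>
    (\<forall>r c. strict_mono_on {..<k} r \<and> r ` {..<k} \<subseteq> {..<m} \<and>
      strict_mono_on {..<k} c \<and> c ` {..<k} \<subseteq> {..<h} \<longrightarrow> leibniz k (\<lambda>i j. P (r i) (c j)) = 0)"
    (is "?L \<longleftrightarrow> ?R")
proof
  assume ?L
  then obtain y y' where y: "y \<in> K" "y' \<in> K" "indep2 {..<m} y y'" by blast
  have "m > 0" using y(3) unfolding indep2_def by (cases m) (auto dest: spec[of _ 1])
  show ?R
  proof (intro allI impI)
    fix r c assume rc: "strict_mono_on {..<k} r \<and> r ` {..<k} \<subseteq> {..<m} \<and>
      strict_mono_on {..<k} c \<and> c ` {..<k} \<subseteq> {..<h}"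
    have inj: "inj_on r {..<k}" using rc by (meson strict_mono_on_imp_inj_on)
    have card: "card (r ` {..<k}) = k" using card_image[OF inj] by simp
    have "r ` {..<k} \<noteq> {..<m}"
    proof
      assume "r ` {..<k} = {..<m}"
      then have "m = k" using card by simp
      then show False using k \<open>m > 0\<close> by simp
    qed
    then obtain i0 where i0: "i0 < m" "i0 \<notin> r ` {..<k}" using rc by blast
    have "card ({..<m} - {i0}) = k" using i0 k by simp
    then have img: "r ` {..<k} = {..<m} - {i0}"
      using card rc i0 by (intro card_subset_eq) auto
    \<comment> \<open>One linear condition on two coefficients has a nonzero solution. Hence some
      nonzero combination \<open>w\<close> vanishes in the omitted row and is a kernel vector of the
      square submatrix.\<close>
    obtain \<alpha> \<beta> where ab: "\<alpha> \<noteq> 0 \<or> \<beta> \<noteq> 0" "\<alpha> * y i0 + \<beta> * y' i0 = 0"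
    proof (cases "y i0 = 0 \<and> y' i0 = 0")
      case True
      then show thesis using that[of 1 0] by simp
    next
      case False
      then show thesis using that[of "y' i0" "- y i0"] by auto
    qed
    define w where "w i = \<alpha> * y i + \<beta> * y' i" for i
    obtain i1 where i1: "i1 < m" "w i1 \<noteq> 0" using y(3) ab(1) unfolding indep2_def w_def by blast
    have w0: "w i0 = 0" using ab(2) by (simp add: w_def)
    have "i1 \<in> r ` {..<k}" using i1 w0 img by auto
    then obtain k1 where k1: "k1 < k" "i1 = r k1" by blast
    have "(\<Sum>l<k. P (r l) (c j) * w (r l)) = 0" if j: "j < k" for j
    proof -
      have cj: "c j < h" using rc j by blast
      have "(\<Sum>l<k. P (r l) (c j) * w (r l)) = (\<Sum>i\<in>{..<m} - {i0}. P i (c j) * w i)"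
        unfolding img[symmetric] by (simp add: sum.reindex[OF inj])
      also have "\<dots> = (\<Sum>i<m. P i (c j) * w i)" using i0 w0 by (intro sum.mono_neutral_left) auto
      also have "\<dots> = \<alpha> * (\<Sum>i<m. P i (c j) * y i) + \<beta> * (\<Sum>i<m. P i (c j) * y' i)"
        by (simp add: w_def sum_distrib_left sum.distrib algebra_simps)
      also have "\<dots> = 0" using y(1,2) cj by (simp add: K_def)
      finally show ?thesis .
    qed
    then show "leibniz k (\<lambda>i j. P (r i) (c j)) = 0"
      unfolding leibniz_0_iff using k1 i1 by (intro exI[of _ "\<lambda>k. w (r k)"]) auto
  qed
next
  assume R: ?R
  show ?L
  proof (rule ccontr)
    assume nL: "\<not> ?L"
    have "\<exists>r. strict_mono_on {..<k} r \<and> r ` {..<k} \<subseteq> {..<m} \<and>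
       (\<forall>y. (\<forall>j<h. (\<Sum>i<k. P (r i) j * y i) = 0) \<longrightarrow> (\<forall>i<k. y i = 0))"
    proof (cases "m = 0")
      case False
      \<comment> \<open>The kernel has dimension at most one. Omitting a row in which its generator
        is nonzero, or any row if the kernel is trivial, leaves independent rows.\<close>
      obtain i0 where i0: "i0 < m" "\<And>y. y \<in> K \<Longrightarrow> y i0 = 0 \<Longrightarrow> \<forall>i<m. y i = 0"
      proof (cases "\<exists>w\<in>K. \<exists>i<m. w i \<noteq> 0")
        case True
        then obtain w i0 where w: "w \<in> K" "i0 < m" "w i0 \<noteq> 0" by blast
        have "\<forall>i<m. y i = 0" if y: "y \<in> K" "y i0 = 0" for y
        proof (rule ccontr)
          assume ny: "\<not> ?thesis"
          have "indep2 {..<m} y w"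
            unfolding indep2_def
          proof (intro allI impI)
            fix \<alpha> \<beta> assume e: "\<forall>x\<in>{..<m}. \<alpha> * y x + \<beta> * w x = 0"
            then have "\<beta> = 0" using w y by force
            then show "\<alpha> = 0 \<and> \<beta> = 0" using e ny by auto
          qed
          then show False using nL y w by blast
        qed
        then show thesis using that w by blast
      next
        case False
        then show thesis using that[of 0] \<open>m \<noteq> 0\<close> by blast
      qed
      let ?r = "row_skip i0"
      have img: "?r ` {..<k} = {..<m} - {i0}" using row_skip_image[OF i0(1)] k by simp
      have inj: "inj_on ?r {..<k}" by (rule strict_mono_on_imp_inj_on[OF strict_mono_row_skip])
      have "\<forall>i<k. y i = 0" if y: "\<forall>j<h. (\<Sum>i<k. P (?r i) j * y i) = 0" for y
      proof -
        \<comment> \<open>Extension of \<open>y\<close> by zero in the omitted row.\<close>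
        define w where "w i = (if i \<in> ?r ` {..<k} then y (the_inv_into {..<k} ?r i) else 0)" for i
        have wr: "w (?r l) = y l" if "l < k" for l
          using that by (simp add: w_def the_inv_into_f_f[OF inj])
        have w0: "w i0 = 0" by (simp add: w_def img)
        have "(\<Sum>i<m. P i j * w i) = 0" if "j < h" for j
        proof -
          have "(\<Sum>i<m. P i j * w i) = (\<Sum>i\<in>{..<m} - {i0}. P i j * w i)"
            using i0 w0 by (intro sum.mono_neutral_right) auto
          also have "\<dots> = (\<Sum>l<k. P (?r l) j * y l)"
            unfolding img[symmetric] by (simp add: sum.reindex[OF inj] wr)
          finally show ?thesis using y that by simp
        qed
        then have "w \<in> K" by (simp add: K_def)
        then have "\<forall>i<m. w i = 0" using i0(2) w0 by blast
        then show ?thesis using wr img by (metis DiffD1 imageI lessThan_iff)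
      qed
      then show ?thesis using img strict_mono_row_skip by (intro exI[of _ ?r]) blast
    next
      case True
      then have "k = 0" using k by simp
      then show ?thesis by (intro exI[of _ id]) (simp add: strict_mono_on_def)
    qed
    then obtain r where r: "strict_mono_on {..<k} r" "r ` {..<k} \<subseteq> {..<m}"
      "\<And>y. \<forall>j<h. (\<Sum>i<k. P (r i) j * y i) = 0 \<Longrightarrow> \<forall>i<k. y i = 0" by blast
    obtain c where "strict_mono_on {..<k} c" "c ` {..<k} \<subseteq> {..<h}" "leibniz k (\<lambda>i j. P (r i) (c j)) \<noteq> 0"
      using independent_rows_minor[where h = h and k = k and P = "\<lambda>i. P (r i)", OF r(3)] by auto
    then show False using R r by blast
  qed
qed

section \<open>Unique factorization in Laurent extensions\<close>


text \<open>Rings are subsets of an ambient domain, so that the Laurent polynomial rings in varying sets of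
  variables live in one type.\<close>

definition subring_set :: "'r::idom set \<Rightarrow> bool" where
  "subring_set A \<longleftrightarrow> 0 \<in> A \<and> 1 \<in> A \<and> (\<forall>a\<in>A. - a \<in> A) \<and> (\<forall>a\<in>A. \<forall>b\<in>A. a + b \<in> A \<and> a * b \<in> A)"

definition dvd_in :: "'r::idom set \<Rightarrow> 'r \<Rightarrow> 'r \<Rightarrow> bool" where
  "dvd_in A a b \<longleftrightarrow> (\<exists>c\<in>A. b = a * c)"

definition prime_in :: "'r::idom set \<Rightarrow> 'r \<Rightarrow> bool" where
  "prime_in A p \<longleftrightarrow> p \<in> A \<and> p \<noteq> 0 \<and> \<not> dvd_in A p 1 \<and>
     (\<forall>a\<in>A. \<forall>b\<in>A. dvd_in A p (a * b) \<longrightarrow> dvd_in A p a \<or> dvd_in A p b)"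

text \<open>Asking for prime rather than irreducible factors builds uniqueness into
  existence.\<close>

definition ufd_on :: "'r::idom set \<Rightarrow> bool" where
  "ufd_on A \<longleftrightarrow> subring_set A \<and> (\<forall>a\<in>A. a \<noteq> 0 \<longrightarrow>
     (\<exists>u ps. u \<in> A \<and> dvd_in A u 1 \<and> (\<forall>p\<in>set ps. prime_in A p) \<and> a = u * prod_list ps))"

definition polys_over :: "'r::idom set \<Rightarrow> 'r poly set" where
  "polys_over A = {p. \<forall>i. coeff p i \<in> A}"

lemma subring_setD:
  assumes "subring_set A"
  shows "0 \<in> A" "1 \<in> A" "a \<in> A \<Longrightarrow> b \<in> A \<Longrightarrow> a + b \<in> A" "a \<in> A \<Longrightarrow> b \<in> A \<Longrightarrow> a * b \<in> A"
    "a \<in> A \<Longrightarrow> - a \<in> A" "a \<in> A \<Longrightarrow> b \<in> A \<Longrightarrow> a - b \<in> A" "a \<in> A \<Longrightarrow> a ^ k \<in> A"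
proof -
  show c: "0 \<in> A" "1 \<in> A" "a \<in> A \<Longrightarrow> b \<in> A \<Longrightarrow> a + b \<in> A" "\<And>a b. a \<in> A \<Longrightarrow> b \<in> A \<Longrightarrow> a * b \<in> A"
    "a \<in> A \<Longrightarrow> - a \<in> A" for a b using assms by (auto simp: subring_set_def)
  show "a \<in> A \<Longrightarrow> b \<in> A \<Longrightarrow> a - b \<in> A"
    using assms unfolding subring_set_def by (metis add_uminus_conv_diff)
  show "a \<in> A \<Longrightarrow> a ^ k \<in> A" by (induction k) (auto intro: c)
qed

lemma subring_set_sum:
  assumes "subring_set A" "\<And>i. i \<in> I \<Longrightarrow> f i \<in> A"
  shows "sum f I \<in> A"
  using assms(2) by (induction I rule: infinite_finite_induct) (auto intro: subring_setD[OF assms(1)])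

lemma subring_set_prod_list:
  assumes "subring_set A" "set ps \<subseteq> A"
  shows "prod_list ps \<in> A"
  using assms(2) by (induction ps) (auto intro: subring_setD[OF assms(1)])

lemma dvd_inI: "c \<in> A \<Longrightarrow> b = a * c \<Longrightarrow> dvd_in A a b"
  by (auto simp: dvd_in_def)

lemma prime_list_in:
  assumes "subring_set A" "u \<in> A" "\<forall>p\<in>set ps. prime_in A p"
  shows "u * prod_list ps \<in> A"
  using assms by (intro subring_setD(4) subring_set_prod_list) (auto simp: prime_in_def)

lemma dvd_in_sum:
  assumes "subring_set A" "\<And>i. i \<in> I \<Longrightarrow> dvd_in A q (f i)"
  shows "dvd_in A q (sum f I)"
  using assms(2)
proof (induction I rule: infinite_finite_induct)
  case (insert x F)
  then obtain c d where "c \<in> A" "f x = q * c" "d \<in> A" "sum f F = q * d"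
    unfolding dvd_in_def by (metis insertCI)
  then show ?case using insert subring_setD(3)[OF assms(1), of c d]
    by (auto simp: dvd_in_def distrib_left intro!: bexI[of _ "c + d"])
qed (use subring_setD(1)[OF assms(1)] in \<open>auto simp: dvd_in_def\<close>)

lemma subring_polys_over:
  assumes "subring_set A"
  shows "subring_set (polys_over A)"
proof -
  have "coeff (1 :: 'a poly) i \<in> A" for i
    using assms by (cases i) (auto simp: subring_set_def)
  moreover have "coeff (p * q) i \<in> A" if "p \<in> polys_over A" "q \<in> polys_over A" for p q i
    unfolding coeff_mult using that subring_setD(4)[OF assms]
    by (intro subring_set_sum[OF assms]) (auto simp: polys_over_def)
  ultimately show ?thesis
    using assms unfolding subring_set_def polys_over_def by simp
qed

lemma const_in_polys_over: "subring_set A \<Longrightarrow> a \<in> A \<Longrightarrow> [:a:] \<in> polys_over A"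
  by (auto simp: polys_over_def coeff_pCons subring_set_def split: nat.splits)

lemma smult_in_polys_over: "subring_set A \<Longrightarrow> a \<in> A \<Longrightarrow> p \<in> polys_over A \<Longrightarrow> smult a p \<in> polys_over A"
  by (auto simp: polys_over_def subring_set_def)

lemma monom_in_polys_over: "subring_set A \<Longrightarrow> a \<in> A \<Longrightarrow> monom a k \<in> polys_over A"
  by (auto simp: polys_over_def coeff_monom subring_set_def)

section \<open>Gauss's lemma and factorization of polynomials\<close>

lemma dvd_in_const_iff:
  assumes "subring_set A" "q \<noteq> 0"
  shows "dvd_in (polys_over A) [:q:] f \<longleftrightarrow> (\<forall>i. dvd_in A q (coeff f i))"
proof
  assume "dvd_in (polys_over A) [:q:] f"
  then show "\<forall>i. dvd_in A q (coeff f i)"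
    unfolding dvd_in_def polys_over_def by force
next
  assume "\<forall>i. dvd_in A q (coeff f i)"
  then obtain c where c: "\<And>i. c i \<in> A" "\<And>i. coeff f i = q * c i"
    unfolding dvd_in_def by metis
  have "\<forall>i>degree f. c i = 0"
    using c(2) assms(2) by (metis coeff_eq_0 mult_eq_0_iff)
  then have "coeff (Abs_poly c) = c"
    by (intro coeff_Abs_poly) auto
  then show "dvd_in (polys_over A) [:q:] f"
    using c unfolding dvd_in_def polys_over_def
    by (intro bexI[of _ "Abs_poly c"]) (auto simp: poly_eq_iff)
qed

text \<open>Gauss's lemma. Let \<open>i\<close> and \<open>j\<close> be the least indices at which
  the coefficients of \<open>f\<close> and \<open>g\<close> escape \<open>q\<close>. In the
  coefficient of \<open>f * g\<close> at \<open>i + j\<close> every other term contains a factor of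
  smaller index and is divisible by \<open>q\<close>, so the product of the two coefficients would
  be divisible as well.\<close>

lemma prime_in_const:
  assumes A: "subring_set A" and q: "prime_in A q"
  shows "prime_in (polys_over A) [:q:]"
proof -
  have q0: "q \<noteq> 0" and qA: "q \<in> A" using q by (auto simp: prime_in_def)
  note iff = dvd_in_const_iff[OF A q0]
  have "\<not> dvd_in (polys_over A) [:q:] 1"
    using q iff[of 1] unfolding prime_in_def by (metis coeff_1 of_bool_eq(2))
  moreover have "dvd_in (polys_over A) [:q:] f \<or> dvd_in (polys_over A) [:q:] g"
    if fg: "f \<in> polys_over A" "g \<in> polys_over A" "dvd_in (polys_over A) [:q:] (f * g)" for f g
  proof (rule ccontr)
    assume "\<not> ?thesis"
    then have ex: "\<exists>i. \<not> dvd_in A q (coeff f i)" "\<exists>i. \<not> dvd_in A q (coeff g i)" using iff by auto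
    define i where "i = (LEAST i. \<not> dvd_in A q (coeff f i))"
    define j where "j = (LEAST i. \<not> dvd_in A q (coeff g i))"
    have i: "\<not> dvd_in A q (coeff f i)" "\<And>k. k < i \<Longrightarrow> dvd_in A q (coeff f k)"
      unfolding i_def using LeastI_ex[OF ex(1)] not_less_Least by blast+
    have j: "\<not> dvd_in A q (coeff g j)" "\<And>k. k < j \<Longrightarrow> dvd_in A q (coeff g k)"
      unfolding j_def using LeastI_ex[OF ex(2)] not_less_Least by blast+
    have fA: "coeff f k \<in> A" "coeff g k \<in> A" for k using fg by (auto simp: polys_over_def)
    have eq: "coeff (f * g) (i + j) = coeff f i * coeff g j + (\<Sum>k\<in>{..i+j}-{i}. coeff f k * coeff g (i + j - k))"
      unfolding coeff_mult by (subst sum.remove[of _ i]) auto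
    have "dvd_in A q (\<Sum>k\<in>{..i+j}-{i}. coeff f k * coeff g (i + j - k))"
    proof (rule dvd_in_sum[OF A])
      fix k assume k: "k \<in> {..i+j}-{i}"
      show "dvd_in A q (coeff f k * coeff g (i + j - k))"
      proof (cases "k < i")
        case True
        then obtain c where "c \<in> A" "coeff f k = q * c" using i(2) unfolding dvd_in_def by blast
        then show ?thesis using fA subring_setD(4)[OF A] unfolding dvd_in_def
          by (intro bexI[of _ "c * coeff g (i + j - k)"]) auto
      next
        case False
        then have "i + j - k < j" using k by auto
        then obtain c where "c \<in> A" "coeff g (i + j - k) = q * c" using j(2) unfolding dvd_in_def by blast
        then show ?thesis using fA subring_setD(4)[OF A] unfolding dvd_in_def
          by (intro bexI[of _ "coeff f k * c"]) auto
      qed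
    qed
    moreover have "dvd_in A q (coeff (f * g) (i + j))" using fg(3) iff by blast
    ultimately obtain c d where "c \<in> A" "coeff f i * coeff g j + q * c = q * d" "d \<in> A"
      unfolding eq dvd_in_def by auto
    then have "coeff f i * coeff g j = q * (d - c)" "d - c \<in> A"
      using subring_setD(6)[OF A] by (auto simp: right_diff_distrib eq_diff_eq)
    then have "dvd_in A q (coeff f i * coeff g j)" unfolding dvd_in_def by blast
    then show False using q i(1) j(1) fA unfolding prime_in_def by blast
  qed
  ultimately show ?thesis
    using const_in_polys_over[OF A qA] q0 unfolding prime_in_def by auto
qed

lemma prime_in_dvd_prod_list:
  assumes "subring_set A" "prime_in A p" "set qs \<subseteq> A" "dvd_in A p (prod_list qs)"
  shows "\<exists>q\<in>set qs. dvd_in A p q"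
  using assms(3,4)
proof (induction qs)
  case Nil
  then show ?case using assms by (auto simp: prime_in_def)
next
  case (Cons q qs)
  then show ?case using assms(2) subring_set_prod_list[OF assms(1), of qs]
    unfolding prime_in_def by auto
qed

text \<open>Division with remainder in a ring without inverses: multiplying by the leading
  coefficient of \<open>e\<close> at each step keeps all quotients in \<open>A\<close>.\<close>

lemma poly_pseudo_division:
  assumes A: "subring_set A" and e: "e \<in> polys_over A" "e \<noteq> 0" and f: "f \<in> polys_over A"
  shows "\<exists>k. \<exists>q\<in>polys_over A. \<exists>r\<in>polys_over A. smult (lead_coeff e ^ k) f = e * q + r \<and> (r = 0 \<or> degree r < degree e)"
  using f
proof (induction "degree f" arbitrary: f rule: less_induct)
  case less
  note P = subring_setD[OF subring_polys_over[OF A]]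
  show ?case
  proof (cases "f = 0 \<or> degree f < degree e")
    case True
    then show ?thesis using less P by (intro exI[of _ 0] bexI[of _ 0] bexI[of _ f]) auto
  next
    case False
    then have f: "f \<noteq> 0" "degree e \<le> degree f" by auto
    have lA: "lead_coeff e \<in> A" "lead_coeff f \<in> A" using e less(2) by (auto simp: polys_over_def)
    define m where "m = monom (lead_coeff f) (degree f - degree e)"
    define f' where "f' = smult (lead_coeff e) f - e * m"
    have mP: "m \<in> polys_over A" unfolding m_def using lA A by (intro monom_in_polys_over)
    have f'P: "f' \<in> polys_over A" unfolding f'_def
      using lA e less(2) mP A by (intro P smult_in_polys_over)
    have m0: "m \<noteq> 0" "degree m = degree f - degree e" "lead_coeff m = lead_coeff f"
      unfolding m_def using f by (auto simp: degree_monom_eq)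
    have deg: "degree (e * m) = degree f" using m0 e f by (simp add: degree_mult_eq)
    have lc: "coeff (e * m) (degree f) = lead_coeff e * lead_coeff f"
      using lead_coeff_mult[of e m] deg m0 by simp
    show ?thesis
    proof (cases "f' = 0")
      case True
      then have "smult (lead_coeff e ^ 1) f = e * m + 0" unfolding f'_def by simp
      then show ?thesis using mP P by blast
    next
      case False
      have le: "degree f' \<le> degree f" unfolding f'_def
        using deg degree_diff_le[of "smult (lead_coeff e) f" "degree f" "e * m"] by simp
      have "coeff f' (degree f) = 0" unfolding f'_def using lc by simp
      then have "degree f' < degree f" using le False
        by (metis leading_coeff_0_iff nat_less_le)
      from less(1)[OF this f'P] obtain k q r where
        k: "q \<in> polys_over A" "r \<in> polys_over A" "smult (lead_coeff e ^ k) f' = e * q + r" "r = 0 \<or> degree r < degree e"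
        by blast
      have "smult (lead_coeff e ^ Suc k) f = e * (smult (lead_coeff e ^ k) m + q) + r"
        using k(3) unfolding f'_def
        by (simp add: smult_diff_right algebra_simps mult_smult_right power_commutes)
      moreover have "smult (lead_coeff e ^ k) m + q \<in> polys_over A"
        using P smult_in_polys_over[OF A] subring_setD(7)[OF A] lA mP k by auto
      ultimately show ?thesis using k by blast
    qed
  qed
qed

text \<open>A greatest common divisor over the field of fractions, with denominators cleared.\<close>

lemma poly_min_combination:
  assumes A: "subring_set A" and e: "e \<in> polys_over A" "e \<noteq> 0" and a: "a \<in> polys_over A"
  obtains m x y s h h' where "x \<in> polys_over A" "y \<in> polys_over A" "h \<in> polys_over A" "h' \<in> polys_over A"
    "s \<in> A" "s \<noteq> 0" "m = x * a + y * e" "m \<noteq> 0" "smult s e = m * h" "smult s a = m * h'" "m \<in> polys_over A"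
proof -
  note P = subring_setD[OF subring_polys_over[OF A]]
  define I where "I = {x * a + y * e | x y. x \<in> polys_over A \<and> y \<in> polys_over A}"
  have "e = 0 * a + 1 * e" by simp
  then have "e \<in> I" unfolding I_def using P by blast
  then obtain m where m: "m \<in> I" "m \<noteq> 0" "\<And>m'. m' \<in> I \<Longrightarrow> m' \<noteq> 0 \<Longrightarrow> degree m \<le> degree m'"
    using e(2) ex_has_least_nat[of "\<lambda>m. m \<in> I \<and> m \<noteq> 0" e degree] by blast
  then obtain x y where xy: "x \<in> polys_over A" "y \<in> polys_over A" "m = x * a + y * e" unfolding I_def by blast
  then have mP: "m \<in> polys_over A" using P a e by auto
  then have lA: "lead_coeff m \<in> A" "lead_coeff m \<noteq> 0" using m by (auto simp: polys_over_def)
  \<comment> \<open>The pseudo-remainder of \<open>b\<close> modulo \<open>m\<close> belongs again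
    to \<open>I\<close> and would have smaller degree than \<open>m\<close>, so by minimality it is
    zero.\<close>
  have red: "\<exists>k. \<exists>h\<in>polys_over A. smult (lead_coeff m ^ k) b = m * h" if b: "b \<in> {a, e}" for b
  proof -
    have bP: "b \<in> polys_over A" and bI: "\<exists>u\<in>polys_over A. \<exists>v\<in>polys_over A. b = u * a + v * e"
    proof -
      show "b \<in> polys_over A" using b a e by auto
      have "a = 1 * a + 0 * e" "e = 0 * a + 1 * e" by auto
      then show "\<exists>u\<in>polys_over A. \<exists>v\<in>polys_over A. b = u * a + v * e" using b P by blast
    qed
    obtain k q r where k: "q \<in> polys_over A" "r \<in> polys_over A" "smult (lead_coeff m ^ k) b = m * q + r"
      "r = 0 \<or> degree r < degree m" using poly_pseudo_division[OF A mP m(2) bP] by blast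
    obtain u v where uv: "u \<in> polys_over A" "v \<in> polys_over A" "b = u * a + v * e" using bI by blast
    let ?l = "lead_coeff m ^ k"
    have "r = (smult ?l u - x * q) * a + (smult ?l v - y * q) * e"
    proof -
      have "r = smult ?l (u * a + v * e) - (x * a + y * e) * q"
        using k(3) uv(3) xy(3) by (metis add_diff_cancel_left')
      then show ?thesis by (simp add: algebra_simps smult_add_right)
    qed
    moreover have "smult ?l u - x * q \<in> polys_over A" "smult ?l v - y * q \<in> polys_over A"
      using P uv k xy subring_setD(7)[OF A lA(1)] smult_in_polys_over[OF A] by auto
    ultimately have "r \<in> I" unfolding I_def by blast
    then have "r = 0" using m(3) k(4) by (metis not_less)
    then show ?thesis using k by auto
  qed
  obtain k h where h: "h \<in> polys_over A" "smult (lead_coeff m ^ k) e = m * h" using red[of e] by blast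
  obtain k' h' where h': "h' \<in> polys_over A" "smult (lead_coeff m ^ k') a = m * h'" using red[of a] by blast
  \<comment> \<open>One multiplier that works for both \<open>e\<close> and
    \<open>a\<close>.\<close>
  let ?s = "lead_coeff m ^ (k + k')"
  have "smult ?s e = m * smult (lead_coeff m ^ k') h"
  proof -
    have "smult ?s e = smult (lead_coeff m ^ k') (smult (lead_coeff m ^ k) e)"
      by (simp add: power_add mult.commute)
    then show ?thesis using h(2) by simp
  qed
  moreover have "smult ?s a = m * smult (lead_coeff m ^ k) h'"
  proof -
    have "smult ?s a = smult (lead_coeff m ^ k) (smult (lead_coeff m ^ k') a)"
      by (simp add: power_add)
    then show ?thesis using h'(2) by simp
  qed
  ultimately show thesis
    using that[of x y "smult (lead_coeff m ^ k') h" "smult (lead_coeff m ^ k) h'" ?s m]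
      xy m mP h h' lA smult_in_polys_over[OF A] subring_setD(7)[OF A lA(1)] by auto
qed

text \<open>The denominator \<open>s\<close> is removed one prime factor at a time: a prime
  \<open>q\<close> that divides \<open>e * h\<close> divides \<open>h\<close>, since the constant
  \<open>q\<close> is prime among polynomials and \<open>e\<close> is primitive.\<close>

lemma poly_strip:
  assumes U: "ufd_on A" and e: "e \<in> polys_over A" "\<And>q. prime_in A q \<Longrightarrow> \<not> dvd_in (polys_over A) [:q:] e"
    and s: "s \<in> A" "s \<noteq> 0" and f: "f \<in> polys_over A" and sf: "dvd_in (polys_over A) e (smult s f)"
  shows "dvd_in (polys_over A) e f"
proof -
  have A: "subring_set A" using U by (auto simp: ufd_on_def)
  note P = subring_setD[OF subring_polys_over[OF A]]
  have "(\<forall>p\<in>set ps. prime_in A p) \<Longrightarrow> dvd_in A u 1 \<Longrightarrow> u \<in> A \<Longrightarrow> dvd_in (polys_over A) e (smult (u * prod_list ps) f)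
     \<Longrightarrow> dvd_in (polys_over A) e f" for u ps
  proof (induction ps)
    case Nil
    then obtain v h where v: "v \<in> A" "1 = u * v" and h: "h \<in> polys_over A" "smult u f = e * h"
      by (auto simp: dvd_in_def)
    then have "f = e * smult v h"
      by (metis (no_types, opaque_lifting) mult.commute mult_smult_right smult_1_left smult_smult)
    then show ?case using v h smult_in_polys_over[OF A] unfolding dvd_in_def by blast
  next
    case (Cons q ps)
    then obtain h where h: "h \<in> polys_over A" "smult (u * (q * prod_list ps)) f = e * h"
      by (auto simp: dvd_in_def)
    have q: "prime_in A q" "q \<noteq> 0" using Cons by (auto simp: prime_in_def)
    have psA: "u * prod_list ps \<in> A"
      using Cons.prems by (intro prime_list_in[OF A]) auto
    have "e * h = [:q:] * smult (u * prod_list ps) f" using h(2) by (simp add: ac_simps)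
    then have "dvd_in (polys_over A) [:q:] (e * h)"
      using smult_in_polys_over[OF A psA f] unfolding dvd_in_def by blast
    then have "dvd_in (polys_over A) [:q:] h"
      using prime_in_const[OF A q(1)] e q(1) h(1) unfolding prime_in_def by blast
    then obtain h1 where h1: "h1 \<in> polys_over A" "h = [:q:] * h1" unfolding dvd_in_def by blast
    have "[:q:] * smult (u * prod_list ps) f = [:q:] * (e * h1)"
      using h(2) h1(2) by (simp add: ac_simps)
    then have "smult (u * prod_list ps) f = e * h1"
      using q(2) by (subst (asm) mult_left_cancel) auto
    then show ?case using Cons h1 unfolding dvd_in_def by auto
  qed
  then show ?thesis using U s sf unfolding ufd_on_def by metis
qed

lemma ufd_onI_prod:
  assumes "ufd_on A" "a \<in> A" "a \<noteq> 0"
  obtains u ps where "u \<in> A" "dvd_in A u 1" "\<And>p. p \<in> set ps \<Longrightarrow> prime_in A p" "a = u * prod_list ps"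
  using assms unfolding ufd_on_def by metis

definition prime_product :: "'r::idom set \<Rightarrow> 'r \<Rightarrow> bool" where
  "prime_product A a \<longleftrightarrow> (\<exists>u ps. u \<in> A \<and> dvd_in A u 1 \<and> (\<forall>p\<in>set ps. prime_in A p) \<and> a = u * prod_list ps)"

lemma prime_product_mult:
  assumes "subring_set A" "prime_product A a" "prime_product A b"
  shows "prime_product A (a * b)"
proof -
  obtain u ps v qs where *: "u \<in> A" "dvd_in A u 1" "\<forall>p\<in>set ps. prime_in A p" "a = u * prod_list ps"
    "v \<in> A" "dvd_in A v 1" "\<forall>p\<in>set qs. prime_in A p" "b = v * prod_list qs"
    using assms unfolding prime_product_def by metis
  then obtain c d where cd: "c \<in> A" "1 = u * c" "d \<in> A" "1 = v * d" by (auto simp: dvd_in_def)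
  then have "1 = (u * v) * (c * d)"
    by (metis (no_types, opaque_lifting) mult.assoc mult.commute mult_1)
  then have "dvd_in A (u * v) 1" using cd subring_setD(4)[OF assms(1)] unfolding dvd_in_def by blast
  then show ?thesis using * subring_setD(4)[OF assms(1)] unfolding prime_product_def
    by (intro exI[of _ "u * v"] exI[of _ "ps @ qs"]) auto
qed

lemma prime_product_prime: "subring_set A \<Longrightarrow> prime_in A p \<Longrightarrow> prime_product A p"
  unfolding prime_product_def dvd_in_def
  by (intro exI[of _ 1] exI[of _ "[p]"]) (auto dest: subring_setD)

text \<open>The content is extracted without gcds, by induction on the number of prime factors of
  the leading coefficient. A prime that divides \<open>f\<close> divides this coefficient, so it is
  associated to a factor in the list, which can be split off.\<close>

lemma primitive_part:
  assumes U: "ufd_on A" and f: "f \<in> polys_over A" "f \<noteq> 0"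
  obtains c e where "c \<in> A" "c \<noteq> 0" "e \<in> polys_over A" "f = smult c e"
    "\<And>q. prime_in A q \<Longrightarrow> \<not> dvd_in (polys_over A) [:q:] e" "prime_product (polys_over A) [:c:]"
proof -
  have A: "subring_set A" using U by (auto simp: ufd_on_def)
  note PA = subring_polys_over[OF A]
  have lA: "lead_coeff f \<in> A" "lead_coeff f \<noteq> 0" using f by (auto simp: polys_over_def)
  obtain u ps where u: "u \<in> A" "dvd_in A u 1" "\<And>p. p \<in> set ps \<Longrightarrow> prime_in A p" "lead_coeff f = u * prod_list ps"
    using ufd_onI_prod[OF U lA] by metis
  have "f \<in> polys_over A \<Longrightarrow> (\<forall>p\<in>set ps. prime_in A p) \<Longrightarrow> lead_coeff f = u * prod_list ps \<Longrightarrow> lead_coeff f \<noteq> 0 \<Longrightarrow>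
     \<exists>c e. c \<in> A \<and> c \<noteq> 0 \<and> e \<in> polys_over A \<and> f = smult c e \<and>
      (\<forall>q. prime_in A q \<longrightarrow> \<not> dvd_in (polys_over A) [:q:] e) \<and> prime_product (polys_over A) [:c:]" for ps
  proof (induction "length ps" arbitrary: f ps rule: less_induct)
    case less
    show ?case
    proof (cases "\<exists>q. prime_in A q \<and> dvd_in (polys_over A) [:q:] f")
      case False
      have "prime_product (polys_over A) [:1:]" unfolding prime_product_def
        using subring_setD[OF PA]
        by (intro exI[of _ 1] exI[of _ "[]"]) (auto simp: dvd_in_def one_pCons)
      then show ?thesis using False less subring_setD[OF A]
        by (intro exI[of _ 1] exI[of _ f]) auto
    next
      case True
      then obtain q f1 where q: "prime_in A q" and f1: "f1 \<in> polys_over A" "f = smult q f1"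
        unfolding dvd_in_def by (metis mult_pCons_left add_0_right mult_zero_left pCons_0_0 smult_0_right)
      have q0: "q \<noteq> 0" "q \<in> A" using q by (auto simp: prime_in_def)
      have lf: "lead_coeff f = q * lead_coeff f1" using f1 by simp
      have f1A: "lead_coeff f1 \<in> A" using f1 by (auto simp: polys_over_def)
      obtain v where v: "v \<in> A" "u * v = 1" using u(2) by (auto simp: dvd_in_def)
      have "prod_list ps = q * (v * lead_coeff f1)"
        using lf less(4) v(2) by (metis mult.assoc mult.commute mult.right_neutral)
      then have "dvd_in A q (prod_list ps)" using v f1A subring_setD(4)[OF A] unfolding dvd_in_def by blast
      then obtain p where p: "p \<in> set ps" "dvd_in A q p"
        using prime_in_dvd_prod_list[OF A q, of ps] less(3) by (auto simp: prime_in_def)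
      then obtain w where w: "w \<in> A" "p = q * w" by (auto simp: dvd_in_def)
      have pp: "prime_in A p" using less(3) p by auto
      then have "dvd_in A p q \<or> dvd_in A p w" using w q0 subring_setD[OF A]
        unfolding prime_in_def dvd_in_def by (metis mult.right_neutral)
      moreover have "\<not> dvd_in A p w"
      proof
        assume "dvd_in A p w"
        then obtain z where z: "z \<in> A" "w = p * z" by (auto simp: dvd_in_def)
        then have "p * 1 = p * (q * z)" using w by (simp add: algebra_simps)
        then have "1 = q * z" using pp by (simp add: prime_in_def)
        then show False using z q unfolding prime_in_def dvd_in_def by blast
      qed
      ultimately obtain z where z: "z \<in> A" "q = p * z" by (auto simp: dvd_in_def)
      have "q * 1 = q * (w * z)" using z w by (simp add: algebra_simps)
      then have wz: "w * z = 1" using q0 by (simp add: mult.assoc)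
      obtain xs ys where ps: "ps = xs @ p # ys" using p split_list by metis
      obtain f2 where f2: "f2 = smult z f1" by auto
      have f2': "f = smult p f2" using f1(2) z f2 by simp
      have "f2 \<in> polys_over A" using f2 f1 z smult_in_polys_over[OF A] by auto
      moreover have "lead_coeff f2 = u * prod_list (xs @ ys)"
      proof -
        have "p * lead_coeff f2 = p * (u * prod_list (xs @ ys))"
          using less(4) unfolding ps f2'
          by (simp only: prod_list.append prod_list.Cons ac_simps lead_coeff_smult)
        then show ?thesis using pp mult_left_cancel[of p] unfolding prime_in_def by blast
      qed
      moreover have "lead_coeff f2 \<noteq> 0" using less(5) f2' by auto
      ultimately obtain c e where ce: "c \<in> A" "c \<noteq> 0" "e \<in> polys_over A" "f2 = smult c e"
        "\<And>q. prime_in A q \<Longrightarrow> \<not> dvd_in (polys_over A) [:q:] e" "prime_product (polys_over A) [:c:]"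
        using less(1)[of "xs @ ys" f2] less(3) ps by auto
      have "prime_product (polys_over A) ([:p:] * [:c:])"
        using prime_product_mult[OF PA prime_product_prime[OF PA prime_in_const[OF A pp]] ce(6)] .
      then have "prime_product (polys_over A) [:p * c:]" by (simp add: ac_simps)
      moreover have "f = smult (p * c) e" using f2' ce by simp
      moreover have "p * c \<in> A" "p * c \<noteq> 0" using pp ce subring_setD(4)[OF A] by (auto simp: prime_in_def)
      ultimately show ?thesis using ce by blast
    qed
  qed
  then have "\<exists>c e. c \<in> A \<and> c \<noteq> 0 \<and> e \<in> polys_over A \<and> f = smult c e \<and>
      (\<forall>q. prime_in A q \<longrightarrow> \<not> dvd_in (polys_over A) [:q:] e) \<and> prime_product (polys_over A) [:c:]"
    using f u lA by blast
  then show thesis using that by blast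
qed

lemma const_of_degree_0: "degree p = 0 \<Longrightarrow> p \<in> polys_over A \<Longrightarrow> \<exists>a\<in>A. p = [:a:]"
  by (metis (mono_tags, lifting) degree_eq_zeroE coeff_pCons_0 mem_Collect_eq polys_over_def)

text \<open>Gauss's theorem. Among the nonconstant polynomials that divide a nonzero constant
  multiple of \<open>f\<close>, one of least degree is irreducible over the field of fractions. Its
  primitive part divides \<open>f\<close> itself and is prime, and the cofactor has smaller
  degree.\<close>

theorem ufd_on_polys_over:
  assumes U: "ufd_on A"
  shows "ufd_on (polys_over A)"
proof -
  have A: "subring_set A" using U by (auto simp: ufd_on_def)
  note PA = subring_polys_over[OF A]
  note P = subring_setD[OF PA]
  have const: "prime_product (polys_over A) [:a:]" if a: "a \<in> A" "a \<noteq> 0" for a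
  proof -
    obtain c e where c: "c \<in> A" "c \<noteq> 0" "e \<in> polys_over A" "[:a:] = smult c e"
      "\<And>q. prime_in A q \<Longrightarrow> \<not> dvd_in (polys_over A) [:q:] e" "prime_product (polys_over A) [:c:]"
      using primitive_part[OF U const_in_polys_over[OF A a(1)]] a by auto
    have "degree e = 0" using c by (metis degree_pCons_0 degree_smult_eq)
    then obtain b where b: "b \<in> A" "e = [:b:]" using const_of_degree_0 c by metis
    have b0: "b \<noteq> 0" using c b a by auto
    obtain u ps where u: "u \<in> A" "dvd_in A u 1" "\<And>p. p \<in> set ps \<Longrightarrow> prime_in A p" "b = u * prod_list ps"
      using ufd_onI_prod[OF U b(1) b0] by metis
    \<comment> \<open>A primitive constant has no prime factor and is therefore a unit.\<close>
    have "ps = []"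
    proof (cases ps)
      case (Cons q qs)
      then have "[:b:] = [:q:] * [:u * prod_list qs:]" using u by (simp add: ac_simps)
      moreover have "u * prod_list qs \<in> A"
        using u Cons by (intro prime_list_in[OF A]) auto
      ultimately have "dvd_in (polys_over A) [:q:] e"
        using const_in_polys_over[OF A, of "u * prod_list qs"] b
        unfolding dvd_in_def by (intro bexI[of _ "[:u * prod_list qs:]"]) auto
      then show ?thesis using c(5) u(3) Cons by auto
    qed auto
    then have bu: "dvd_in A b 1" using u by auto
    then obtain v where v: "v \<in> A" "1 = b * v" by (auto simp: dvd_in_def)
    then have "[:b * v:] = 1" by (metis one_pCons)
    then have "1 = [:b:] * [:v:]" by (simp add: mult.commute)
    then have "dvd_in (polys_over A) [:b:] 1" using const_in_polys_over[OF A v(1)] unfolding dvd_in_def by blast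
    then have "prime_product (polys_over A) [:b:]"
      using const_in_polys_over[OF A b(1)] unfolding prime_product_def
      by (intro exI[of _ "[:b:]"] exI[of _ "[]"]) auto
    then have "prime_product (polys_over A) ([:c:] * e)"
      unfolding b(2) by (rule prime_product_mult[OF PA c(6)])
    then show ?thesis using c(4) by simp
  qed
  have "prime_product (polys_over A) f" if "f \<in> polys_over A" "f \<noteq> 0" for f
    using that
  proof (induction "degree f" arbitrary: f rule: less_induct)
    case (less f)
    show ?case
    proof (cases "degree f = 0")
      case True
      then show ?thesis using const const_of_degree_0 less by (metis pCons_0_0)
    next
      case False
      let ?D = "\<lambda>e. e \<in> polys_over A \<and> degree e > 0 \<and> (\<exists>s\<in>A. s \<noteq> 0 \<and> dvd_in (polys_over A) e (smult s f))"
      have "?D f" using False less P subring_setD[OF A] unfolding dvd_in_def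
        by (auto intro!: bexI[of _ 1])
      then obtain e0 where e0: "?D e0" and min0: "\<And>e. ?D e \<Longrightarrow> degree e0 \<le> degree e"
        using ex_has_least_nat[of ?D f degree] by blast
      then have "e0 \<noteq> 0" by auto
      then obtain c e where ce: "c \<in> A" "c \<noteq> 0" "e \<in> polys_over A" "e0 = smult c e"
        "\<And>q. prime_in A q \<Longrightarrow> \<not> dvd_in (polys_over A) [:q:] e"
        using primitive_part[OF U] e0 by metis
      have dege: "degree e = degree e0" using ce by simp
      have e_ne: "e \<noteq> 0" using ce \<open>e0 \<noteq> 0\<close> by auto
      obtain s h0 where s: "s \<in> A" "s \<noteq> 0" "h0 \<in> polys_over A" "smult s f = e0 * h0"
        using e0 by (auto simp: dvd_in_def)
      have "smult s f = e * smult c h0" using s ce by simp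
      then have "dvd_in (polys_over A) e (smult s f)"
        using smult_in_polys_over[OF A ce(1) s(3)] unfolding dvd_in_def by blast
      then have "dvd_in (polys_over A) e f"
        using poly_strip[OF U ce(3) ce(5) s(1,2) less(2)] by blast
      then obtain g where g: "g \<in> polys_over A" "f = e * g" by (auto simp: dvd_in_def)
      have "prime_in (polys_over A) e"
        unfolding prime_in_def
      proof (intro conjI ballI impI)
        show "\<not> dvd_in (polys_over A) e 1"
        proof
          assume "dvd_in (polys_over A) e 1"
          then obtain z where "1 = e * z" by (auto simp: dvd_in_def)
          then have "degree e = 0" by (metis add_is_0 degree_1 degree_mult_eq mult_eq_0_iff zero_neq_one)
          then show False using e0 dege by auto
        qed
        fix a b assume ab: "a \<in> polys_over A" "b \<in> polys_over A" "dvd_in (polys_over A) e (a * b)"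
        obtain m x y s h h' where m: "x \<in> polys_over A" "y \<in> polys_over A" "h \<in> polys_over A" "h' \<in> polys_over A"
          "s \<in> A" "s \<noteq> 0" "m = x * a + y * e" "m \<noteq> 0" "smult s e = m * h" "smult s a = m * h'" "m \<in> polys_over A"
          using poly_min_combination[OF A ce(3) e_ne ab(1)] by metis
        obtain z where z: "z \<in> polys_over A" "a * b = e * z" using ab by (auto simp: dvd_in_def)
        \<comment> \<open>\<open>m\<close> plays the gcd of \<open>a\<close> and \<open>e\<close>
          over the field of fractions. If it is constant, \<open>e\<close> divides a constant
          multiple of \<open>b\<close>. Otherwise \<open>m\<close> divides a multiple of
          \<open>f\<close>, so its degree is at least that of \<open>e\<close>, the cofactor
          \<open>h\<close> is constant, and \<open>e\<close> divides a constant multiple of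
          \<open>a\<close>. \<open>poly_strip\<close> removes the constants.\<close>
        show "dvd_in (polys_over A) e a \<or> dvd_in (polys_over A) e b"
        proof (cases "degree m = 0")
          case True
          then obtain r where r: "r \<in> A" "m = [:r:]" using const_of_degree_0 m by metis
          have "smult r b = m * b" using r by simp
          also have "\<dots> = x * (a * b) + y * e * b" using m(7) by (simp add: algebra_simps)
          also have "\<dots> = e * (x * z + y * b)" using z(2) by (simp add: algebra_simps)
          finally have "dvd_in (polys_over A) e (smult r b)"
            by (rule dvd_inI[rotated]) (intro P m z ab)
          then have "dvd_in (polys_over A) e b"
            using poly_strip[OF U ce(3) ce(5) r(1) _ ab(2)] r m by auto
          then show ?thesis by simp
        next
          case False
          have "smult s f = m * (h * g)" using m(9) g(2) by (metis mult.assoc mult_smult_left)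
          then have "?D m" using False m g dvd_inI[OF P(4)[OF m(3) g(1)]] by blast
          then have "degree e \<le> degree m" using min0 dege by auto
          moreover have "degree e = degree m + degree h"
            using m(6,8,9) e_ne by (metis degree_mult_eq degree_smult_eq mult_eq_0_iff smult_eq_0_iff)
          ultimately have "degree h = 0" by auto
          then obtain r where r: "r \<in> A" "h = [:r:]" using const_of_degree_0 m by metis
          have r0: "r \<noteq> 0" using r m e_ne by auto
          have "smult (r * s) a = h * (m * h')" using r m(10) by (metis mult_pCons_left add_0_right mult_zero_left pCons_0_0 smult_smult)
          also have "\<dots> = e * smult s h'" using m(9) by (metis mult.assoc mult.commute mult_smult_left)
          finally have "dvd_in (polys_over A) e (smult (r * s) a)"
            using smult_in_polys_over[OF A m(5,4)] unfolding dvd_in_def by blast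
          then have "dvd_in (polys_over A) e a"
            using poly_strip[OF U ce(3) ce(5) _ _ ab(1), of "r * s"] r r0 m subring_setD(4)[OF A] by auto
          then show ?thesis by simp
        qed
      qed (use ce e_ne in auto)
      then have pe: "prime_product (polys_over A) e" using prime_product_prime[OF PA] by auto
      have "degree f = degree e + degree g" "g \<noteq> 0" using g less(3) by (auto simp: degree_mult_eq)
      then have "prime_product (polys_over A) g" using less(1)[of g] g e0 dege by auto
      then show ?thesis using prime_product_mult[OF PA pe] g by auto
    qed
  qed
  then show ?thesis using PA unfolding ufd_on_def prime_product_def by blast
qed

section \<open>Laurent extension by one variable\<close>

lemma poly_shift_decomp:
  assumes "p \<noteq> 0"
  obtains l q where "p = monom 1 l * q" "coeff q 0 \<noteq> (0::'r::idom)"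
proof -
  obtain q where q: "p = [:- 0, 1:] ^ order 0 p * q" "\<not> [:- 0, 1:] dvd q"
    using order_decomp[OF assms] by blast
  have "coeff q 0 \<noteq> 0" using q(2) by (simp add: dvd_iff_poly_eq_0 poly_0_coeff_0)
  moreover have "[:- 0, 1:] ^ order 0 p = (monom 1 (order 0 p) :: 'r poly)"
    by (simp add: monom_altdef)
  ultimately show thesis using that q(1) by metis
qed

text \<open>As \<open>P\<close> has a nonzero constant term, the lowest exponent of
  \<open>P * Z\<close> is that of \<open>Z\<close>, so it equals \<open>k\<close>; but the degree of
  \<open>Z\<close> is \<open>k\<close> minus the degree of \<open>P\<close>.\<close>

lemma monom_factor_degree_0:
  assumes "P * Z = monom s k" "s \<noteq> (0::'r::idom)" "coeff P 0 \<noteq> 0"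
  shows "degree P = 0"
proof -
  have Z: "Z \<noteq> 0" and P: "P \<noteq> 0" using assms by auto
  obtain l Z' where l: "Z = monom 1 l * Z'" "coeff Z' 0 \<noteq> 0" using poly_shift_decomp[OF Z] by metis
  have "Z' \<noteq> 0" using l by auto
  then have "degree Z = l + degree Z'" unfolding l(1) by (subst degree_mult_eq) (auto simp: degree_monom_eq)
  moreover have "degree P + degree Z = k"
    using assms degree_mult_eq[OF P Z] by (simp add: degree_monom_eq)
  moreover have "coeff (P * Z) l = coeff P 0 * coeff Z' 0"
    using coeff_monom_mult[of 1 l "P * Z'" l] unfolding l(1) by (simp add: ac_simps coeff_mult_0)
  then have "l = k" using assms l by (auto simp: coeff_monom split: if_splits)
  ultimately show ?thesis by auto
qed

lemma prime_product_unit: "u \<in> A \<Longrightarrow> dvd_in A u 1 \<Longrightarrow> prime_product A u"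
  unfolding prime_product_def by (intro exI[of _ u] exI[of _ "[]"]) auto

lemma poly_prod_list: "poly (prod_list ps) x = (\<Prod>p\<leftarrow>ps. poly p x)" for x :: "'a::comm_ring_1"
  by (induction ps) auto

text \<open>Algebraic independence of \<open>t\<close> over \<open>A\<close> lets an element of
  \<open>A[t]\<close> be handled through the unique polynomial whose value at \<open>t\<close> it
  is, although everything lives in one ambient domain.\<close>

locale laurent_extension =
  fixes A :: "'r::idom set" and t ti :: 'r
  assumes ufd_A: "ufd_on A" and t_ti: "t * ti = 1"
    and transcendental: "\<And>p. p \<in> polys_over A \<Longrightarrow> poly p t = 0 \<Longrightarrow> p = 0"
begin

text \<open>The ring \<open>A[t, 1/t]\<close>, described as the elements that some power of
  \<open>t\<close> brings into \<open>A[t]\<close>.\<close>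

definition B :: "'r set" where
  "B = {b. \<exists>p\<in>polys_over A. \<exists>k. t ^ k * b = poly p t}"

text \<open>The elements that are not a power of \<open>t\<close> times an element of \<open>A\<close>.\<close>

definition essential :: "'r \<Rightarrow> bool" where
  "essential b \<longleftrightarrow> (\<exists>P\<in>polys_over A. \<exists>k l. t ^ k * b = t ^ l * poly P t \<and> coeff P 0 \<noteq> 0 \<and> degree P > 0)"

lemma essentialI:
  "P \<in> polys_over A \<Longrightarrow> t ^ k * b = t ^ l * poly P t \<Longrightarrow> coeff P 0 \<noteq> 0 \<Longrightarrow> degree P > 0 \<Longrightarrow> essential b"
  unfolding essential_def by (rule bexI[of _ P], rule exI[of _ k], rule exI[of _ l]) (rule conjI; assumption?)+

lemma A: "subring_set A" using ufd_A by (auto simp: ufd_on_def)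
lemmas PA = subring_polys_over[OF A]
lemmas AD = subring_setD[OF A]
lemmas PD = subring_setD[OF PA]

lemma t_pow: "t ^ k \<noteq> 0" "t ^ k * ti ^ k = 1"
  using t_ti by (auto simp: power_mult_distrib[symmetric])

lemma t_move:
  assumes "t ^ k * x = y"
  shows "x = ti ^ k * y"
proof -
  have "ti ^ k * (t ^ k * x) = (t ^ k * ti ^ k) * x" by (simp only: ac_simps)
  then show ?thesis using assms t_pow(2) by simp
qed

lemma t_nonzero: "t \<noteq> 0" using t_ti by auto

lemma poly_t_inj: "p \<in> polys_over A \<Longrightarrow> q \<in> polys_over A \<Longrightarrow> poly p t = poly q t \<Longrightarrow> p = q"
  using transcendental[of "p - q"] PD(6) by auto

lemma monom1: "monom 1 k \<in> polys_over A"
  using monom_in_polys_over[OF A] AD by auto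

lemma B_I: "p \<in> polys_over A \<Longrightarrow> t ^ k * b = poly p t \<Longrightarrow> b \<in> B"
  unfolding B_def by blast

lemma A_sub_B: "a \<in> A \<Longrightarrow> a \<in> B"
  unfolding B_def using const_in_polys_over[OF A, of a] by (auto intro!: bexI[of _ "[:a:]"] exI[of _ 0])

lemma poly_in_B: "p \<in> polys_over A \<Longrightarrow> poly p t \<in> B"
  unfolding B_def by (auto intro!: bexI[of _ p] exI[of _ 0])

lemma subring_B: "subring_set B"
  unfolding subring_set_def
proof (intro conjI ballI)
  show "0 \<in> B" "1 \<in> B" using A_sub_B AD by auto
  fix a assume "a \<in> B"
  then obtain p k where p: "p \<in> polys_over A" "t ^ k * a = poly p t" unfolding B_def by blast
  have "t ^ k * (- a) = poly (- p) t" using p by simp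
  then show "- a \<in> B" by (rule B_I[OF PD(5)[OF p(1)]])
  fix b assume "b \<in> B"
  then obtain q l where q: "q \<in> polys_over A" "t ^ l * b = poly q t" unfolding B_def by blast
  have "t ^ (k + l) * (a + b) = t ^ l * (t ^ k * a) + t ^ k * (t ^ l * b)"
    by (simp add: power_add algebra_simps)
  also have "\<dots> = poly (monom 1 l * p + monom 1 k * q) t" using p q by (simp add: poly_monom)
  finally show "a + b \<in> B" by (rule B_I[rotated]) (intro PD monom1 p q)
  have "t ^ (k + l) * (a * b) = (t ^ k * a) * (t ^ l * b)"
    by (simp add: power_add algebra_simps)
  also have "\<dots> = poly (p * q) t" using p q by simp
  finally show "a * b \<in> B" by (rule B_I[rotated]) (intro PD p q)
qed

lemmas BD = subring_setD[OF subring_B]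

lemma t_ti_in_B: "t \<in> B" "ti \<in> B" "t ^ k \<in> B" "ti ^ k \<in> B"
proof -
  have "t = poly (monom 1 1) t" by (simp add: poly_monom)
  then show t: "t \<in> B" using poly_in_B monom1 by metis
  have "t ^ 1 * ti = poly 1 t" using t_ti by simp
  then show ti: "ti \<in> B" by (rule B_I[OF PD(2)])
  show "t ^ k \<in> B" "ti ^ k \<in> B" using t ti BD by auto
qed

lemma B_normal_form:
  assumes "b \<in> B" "b \<noteq> 0"
  obtains P k l where "P \<in> polys_over A" "coeff P 0 \<noteq> 0" "t ^ k * b = t ^ l * poly P t"
proof -
  obtain p k where p: "p \<in> polys_over A" "t ^ k * b = poly p t" using assms unfolding B_def by blast
  then have "p \<noteq> 0" using assms t_nonzero by auto
  then obtain l q where q: "p = monom 1 l * q" "coeff q 0 \<noteq> 0" using poly_shift_decomp by metis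
  have "coeff q i = coeff p (l + i)" for i unfolding q by (simp add: coeff_monom_mult)
  then have "q \<in> polys_over A" using p by (auto simp: polys_over_def)
  then show thesis using that[of q k l] q p by (simp add: poly_monom)
qed

lemma dvd_in_B_poly:
  assumes "P \<in> polys_over A" "Q \<in> polys_over A" "dvd_in B (poly P t) (poly Q t)"
  shows "\<exists>k. dvd_in (polys_over A) P (monom 1 k * Q)"
proof -
  obtain c where c: "c \<in> B" "poly Q t = poly P t * c" using assms by (auto simp: dvd_in_def)
  then obtain p k where p: "p \<in> polys_over A" "t ^ k * c = poly p t" unfolding B_def by blast
  have "poly (monom 1 k * Q) t = poly (P * p) t"
    using c p by (simp add: poly_monom algebra_simps)
  then have "monom 1 k * Q = P * p" by (rule poly_t_inj[rotated 2]) (intro PD(4) monom1 assms p)+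
  then show ?thesis using dvd_inI[OF p(1)] by blast
qed

lemma dvd_in_polyI: "P \<in> polys_over A \<Longrightarrow> dvd_in (polys_over A) P Q \<Longrightarrow> dvd_in B (poly P t) (poly Q t)"
  unfolding dvd_in_def using poly_in_B by force

text \<open>Inverting \<open>t\<close> keeps a prime that does not divide \<open>t\<close>: the
  denominators of \<open>a\<close> and \<open>b\<close> are powers of \<open>t\<close>, and such
  powers can be cancelled in divisibility by \<open>P\<close>.\<close>

lemma prime_in_B:
  assumes P: "prime_in (polys_over A) P" and X: "\<not> dvd_in (polys_over A) P (monom 1 1)"
  shows "prime_in B (poly P t)"
proof -
  have Pp: "P \<in> polys_over A" "P \<noteq> 0" using P by (auto simp: prime_in_def)
  have Xk: "\<not> dvd_in (polys_over A) P (monom 1 k)" for k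
  proof (induction k)
    case 0
    then show ?case using P by (auto simp: prime_in_def)
  next
    case (Suc k)
    have "monom 1 (Suc k) = (monom 1 1 * monom 1 k :: 'r poly)" by (simp add: mult_monom)
    then show ?case using Suc X P monom1[of 1] monom1[of k] unfolding prime_in_def by auto
  qed
  show ?thesis
    unfolding prime_in_def
  proof (intro conjI ballI impI)
    show "poly P t \<in> B" "poly P t \<noteq> 0" using Pp poly_in_B transcendental by auto
    show "\<not> dvd_in B (poly P t) 1"
      using dvd_in_B_poly[OF Pp(1), of 1] PD Xk by auto
    fix a b assume ab: "a \<in> B" "b \<in> B" "dvd_in B (poly P t) (a * b)"
    obtain p k where p: "p \<in> polys_over A" "t ^ k * a = poly p t" using ab unfolding B_def by blast
    obtain q l where q: "q \<in> polys_over A" "t ^ l * b = poly q t" using ab unfolding B_def by blast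
    obtain c where c: "c \<in> B" "a * b = poly P t * c" using ab by (auto simp: dvd_in_def)
    have "poly (p * q) t = (t ^ k * t ^ l) * (a * b)"
      by (simp add: ac_simps flip: p(2) q(2))
    also have "\<dots> = poly P t * (t ^ k * t ^ l * c)"
      unfolding c by (simp add: ac_simps)
    finally have "dvd_in B (poly P t) (poly (p * q) t)"
      by (rule dvd_inI[rotated]) (intro BD(4) t_ti_in_B c)
    then obtain m where "dvd_in (polys_over A) P (monom 1 m * (p * q))"
      using dvd_in_B_poly[OF Pp(1) PD(4)[OF p(1) q(1)]] by blast
    then have "dvd_in (polys_over A) P (p * q)"
      using P Xk[of m] monom1[of m] PD(4)[OF p(1) q(1)] unfolding prime_in_def by blast
    then have "dvd_in (polys_over A) P p \<or> dvd_in (polys_over A) P q"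
      using P p(1) q(1) unfolding prime_in_def by blast
    moreover have "dvd_in B (poly P t) c" if "dvd_in B (poly P t) (t ^ j * c)" for c j
    proof -
      obtain d where d: "d \<in> B" "t ^ j * c = poly P t * d" using \<open>dvd_in B (poly P t) (t ^ j * c)\<close> by (auto simp: dvd_in_def)
      have "c = poly P t * (ti ^ j * d)" using t_move[OF d(2)] by (simp only: ac_simps)
      then show ?thesis by (rule dvd_inI[OF BD(4)[OF t_ti_in_B(4) d(1)]])
    qed
    ultimately show "dvd_in B (poly P t) a \<or> dvd_in B (poly P t) b"
      using p q dvd_in_polyI[OF Pp(1)] by metis
  qed
qed

text \<open>A prime factor in \<open>A[t]\<close> either divides \<open>t\<close> and becomes a
  unit, or stays prime. A factorization of \<open>t ^ k * b\<close> in \<open>A[t]\<close> is thus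
  one of \<open>b\<close> up to units.\<close>

lemma ufd_B: "ufd_on B"
proof -
  have "prime_product B b" if b: "b \<in> B" "b \<noteq> 0" for b
  proof -
    obtain p k where p: "p \<in> polys_over A" "t ^ k * b = poly p t" using b unfolding B_def by blast
    then have "p \<noteq> 0" using b t_nonzero by auto
    then obtain u ps where u: "u \<in> polys_over A" "dvd_in (polys_over A) u 1"
      "\<And>q. q \<in> set ps \<Longrightarrow> prime_in (polys_over A) q" "p = u * prod_list ps"
      using ufd_onI_prod[OF ufd_on_polys_over[OF ufd_A] p(1)] by metis
    have one: "prime_product B (poly q t)" if q: "prime_in (polys_over A) q" for q
    proof (cases "dvd_in (polys_over A) q (monom 1 1)")
      case True
      then obtain h where h: "h \<in> polys_over A" "monom 1 1 = q * h" by (auto simp: dvd_in_def)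
      have "t = poly q t * poly h t"
        using arg_cong[OF h(2), of "\<lambda>p. poly p t"] by (simp add: poly_monom)
      then have "1 = poly q t * (poly h t * ti)" using t_ti by (simp add: mult.assoc[symmetric])
      then have "dvd_in B (poly q t) 1" by (rule dvd_inI[OF BD(4)[OF poly_in_B[OF h(1)] t_ti_in_B(2)]])
      then show ?thesis using poly_in_B q by (intro prime_product_unit) (auto simp: prime_in_def)
    qed (use prime_in_B[OF q] prime_product_prime[OF subring_B] in auto)
    have "prime_product B (\<Prod>q\<leftarrow>ps. poly q t)" using u(3)
    proof (induction ps)
      case Nil
      then show ?case using BD by (auto intro!: prime_product_unit simp: dvd_in_def)
    next
      case (Cons q qs)
      then show ?case using prime_product_mult[OF subring_B one[of q]] by auto
    qed
    moreover have "prime_product B (poly u t)"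
      using dvd_in_polyI[OF u(1,2)] poly_in_B[OF u(1)] by (auto intro!: prime_product_unit)
    moreover have "prime_product B (ti ^ k)"
      using t_pow t_ti_in_B by (intro prime_product_unit) (auto simp: dvd_in_def mult.commute intro!: bexI[of _ "t ^ k"])
    moreover have "b = ti ^ k * (poly u t * (\<Prod>q\<leftarrow>ps. poly q t))"
    proof -
      have "b = ti ^ k * (t ^ k * b)" using t_move by blast
      then show ?thesis using p u by (simp add: poly_prod_list)
    qed
    ultimately show ?thesis using prime_product_mult[OF subring_B] by auto
  qed
  then show ?thesis using subring_B unfolding ufd_on_def prime_product_def by blast
qed

lemma essential_factor_monomial:
  assumes "P \<in> polys_over A" "coeff P 0 \<noteq> 0" "Z \<in> B" "s \<in> A" "s \<noteq> 0" "t ^ j * (poly P t * Z) = t ^ i * s"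
  shows "degree P = 0"
proof -
  obtain z k where z: "z \<in> polys_over A" "t ^ k * Z = poly z t" using assms unfolding B_def by blast
  have "poly (P * (monom 1 j * z)) t = poly (monom s (i + k)) t"
  proof -
    have "poly (P * (monom 1 j * z)) t = poly P t * (t ^ j * poly z t)"
      by (simp add: poly_monom ac_simps)
    also have "\<dots> = t ^ k * (t ^ j * (poly P t * Z))"
      unfolding z(2)[symmetric] by (simp add: ac_simps)
    also have "\<dots> = t ^ k * (t ^ i * s)" unfolding assms(6) ..
    also have "\<dots> = poly (monom s (i + k)) t" by (simp add: poly_monom power_add ac_simps)
    finally show ?thesis .
  qed
  then have "P * (monom 1 j * z) = monom s (i + k)"
    by (rule poly_t_inj[rotated 2]) (intro PD(4) monom1 assms z monom_in_polys_over[OF A])+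
  then show ?thesis by (rule monom_factor_degree_0) (use assms in auto)
qed

lemma essential_not_dvd_const:
  assumes "essential p" "r \<in> A" "dvd_in B p r"
  shows "r = 0"
proof (rule ccontr)
  assume r: "r \<noteq> 0"
  obtain P k l where P: "P \<in> polys_over A" "t ^ k * p = t ^ l * poly P t" "coeff P 0 \<noteq> 0" "degree P > 0"
    using assms unfolding essential_def by blast
  obtain c where c: "c \<in> B" "r = p * c" using assms by (auto simp: dvd_in_def)
  have "t ^ l * (poly P t * c) = (t ^ l * poly P t) * c" by (simp add: ac_simps)
  also have "\<dots> = t ^ k * r" unfolding P(2)[symmetric] c(2) by (simp add: ac_simps)
  finally have "t ^ l * (poly P t * c) = t ^ k * r" .
  then have "degree P = 0" using essential_factor_monomial[OF P(1,3) c(1) assms(2) r] by auto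
  then show False using P by auto
qed

text \<open>Two elements without common factor generate, over the field of fractions of \<open>A\<close>, the unit ideal.\<close>

lemma essential_prime_combination:
  assumes p: "prime_in B p" "essential p" and g: "g \<in> B" "\<not> dvd_in B p g"
  shows "\<exists>x\<in>B. \<exists>y\<in>B. \<exists>r\<in>A. r \<noteq> 0 \<and> x * p + y * g = r"
proof -
  obtain P k l where P: "P \<in> polys_over A" "t ^ k * p = t ^ l * poly P t" "coeff P 0 \<noteq> 0" "degree P > 0"
    using p unfolding essential_def by blast
  obtain G j where G: "G \<in> polys_over A" "t ^ j * g = poly G t" using g unfolding B_def by blast
  have P0: "P \<noteq> 0" using P by auto
  obtain m x y s h h' where m: "x \<in> polys_over A" "y \<in> polys_over A" "h \<in> polys_over A" "h' \<in> polys_over A"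
    "s \<in> A" "s \<noteq> 0" "m = x * G + y * P" "m \<noteq> 0" "smult s P = m * h" "smult s G = m * h'" "m \<in> polys_over A"
    using poly_min_combination[OF A P(1) P0 G(1)] by metis
  have pB: "p \<in> B" using p by (auto simp: prime_in_def)
  have Pp: "poly P t = ti ^ l * t ^ k * p" using t_move[OF P(2)[symmetric]] by (simp only: mult.assoc)
  show ?thesis
  proof (cases "degree m = 0")
    case True
    then obtain r where r: "r \<in> A" "m = [:r:]" using const_of_degree_0[OF _ m(11)] by blast
    have "r = poly m t" using r by simp
    also have "\<dots> = (poly y t * (ti ^ l * t ^ k)) * p + (poly x t * t ^ j) * g"
    proof -
      have "poly m t = poly x t * (t ^ j * g) + poly y t * (ti ^ l * t ^ k * p)"
        unfolding m(7) G(2) Pp[symmetric] by simp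
      then show ?thesis by (simp only: ac_simps)
    qed
    finally have "(poly y t * (ti ^ l * t ^ k)) * p + (poly x t * t ^ j) * g = r" ..
    moreover have "poly y t * (ti ^ l * t ^ k) \<in> B" "poly x t * t ^ j \<in> B"
      by (intro BD(4) t_ti_in_B poly_in_B m(1,2))+
    moreover have "r \<noteq> 0" using r m by auto
    ultimately show ?thesis using r by blast
  next
    case False
    have m0: "coeff m 0 \<noteq> 0"
    proof -
      have "coeff m 0 * coeff h 0 = s * coeff P 0" using m(9) by (metis coeff_mult_0 coeff_smult)
      then show ?thesis using m(6) P(3) by auto
    qed
    have e: "s * poly P t = poly m t * poly h t" using arg_cong[OF m(9), of "\<lambda>p. poly p t"] by simp
    have "poly m t * poly h t = p * (ti ^ l * t ^ k * s)" unfolding e[symmetric] Pp by (simp only: ac_simps)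
    then have "dvd_in B p (poly m t * poly h t)"
      by (rule dvd_inI[of "ti ^ l * t ^ k * s", rotated]) (intro BD(4) t_ti_in_B A_sub_B m(5))
    \<comment> \<open>\<open>m h = s P\<close> is \<open>s p\<close> up to a unit. If
      \<open>p\<close> divides \<open>m\<close>, it divides \<open>s G\<close> and hence
      \<open>g\<close>, which is excluded. If it divides \<open>h\<close>, cancelling
      \<open>p\<close> leaves \<open>m\<close> as a factor of \<open>s\<close> times a power of
      \<open>t\<close>, so \<open>m\<close> would be constant.\<close>
    then consider "dvd_in B p (poly m t)" | "dvd_in B p (poly h t)"
      using p poly_in_B m unfolding prime_in_def by blast
    then show ?thesis
    proof cases
      case 1
      then obtain c where c: "c \<in> B" "poly m t = p * c" by (auto simp: dvd_in_def)
      have "s * poly G t = poly m t * poly h' t" using arg_cong[OF m(10), of "\<lambda>p. poly p t"] by simp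
      then have "s * poly G t = p * (c * poly h' t)" unfolding c(2) by (simp only: ac_simps)
      then have "dvd_in B p (s * poly G t)"
        by (rule dvd_inI[OF BD(4)[OF c(1) poly_in_B[OF m(4)]]])
      then have "dvd_in B p s \<or> dvd_in B p (poly G t)"
        using p A_sub_B m poly_in_B G unfolding prime_in_def by blast
      moreover have "\<not> dvd_in B p s" using essential_not_dvd_const p m by blast
      ultimately obtain d where d: "d \<in> B" "t ^ j * g = p * d" using G by (auto simp: dvd_in_def)
      have "g = p * (ti ^ j * d)" using t_move[OF d(2)] by (simp only: ac_simps)
      then show ?thesis using g(2) dvd_inI[OF BD(4)[OF t_ti_in_B(4) d(1)]] by blast
    next
      case 2
      then obtain c where c: "c \<in> B" "poly h t = p * c" by (auto simp: dvd_in_def)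
      have "p \<noteq> 0" using p by (auto simp: prime_in_def)
      have "p * (poly m t * c) = p * (ti ^ l * t ^ k * s)"
        using \<open>poly m t * poly h t = p * (ti ^ l * t ^ k * s)\<close> unfolding c(2) by (simp only: ac_simps)
      then have "poly m t * c = ti ^ l * t ^ k * s" using \<open>p \<noteq> 0\<close> by (subst (asm) mult_left_cancel) auto
      then have "t ^ l * (poly m t * c) = (t ^ l * ti ^ l) * (t ^ k * s)" by (simp only: ac_simps)
      then have "t ^ l * (poly m t * c) = t ^ k * s" using t_pow(2) by simp
      then have "degree m = 0" using essential_factor_monomial[OF m(11) m0 c(1) m(5,6)] by blast
      then show ?thesis using False by auto
    qed
  qed
qed

lemma not_essentialE:
  assumes "b \<in> B" "b \<noteq> 0" "\<not> essential b"
  obtains a k l where "a \<in> A" "a \<noteq> 0" "t ^ k * b = t ^ l * a"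
proof -
  obtain P k l where P: "P \<in> polys_over A" "coeff P 0 \<noteq> 0" "t ^ k * b = t ^ l * poly P t"
    using B_normal_form[OF assms(1,2)] by metis
  then have "\<not> degree P > 0" using assms(3) essentialI by metis
  then obtain a where a: "a \<in> A" "P = [:a:]" using const_of_degree_0[OF _ P(1)] by auto
  then show thesis using that[of a k l] P by auto
qed

text \<open>A product of inessential factors is inessential, and so is a unit, because it divides 1.
  Some prime factor therefore has to be essential.\<close>

lemma essential_prime_factor:
  assumes "b \<in> B" "essential b"
  obtains p c where "prime_in B p" "essential p" "c \<in> B" "b = p * c"
proof -
  have mono: "\<exists>a\<in>A. \<exists>k l. a \<noteq> 0 \<and> t ^ k * prod_list ps = t ^ l * a"
    if "\<forall>p\<in>set ps. p \<in> B \<and> p \<noteq> 0 \<and> \<not> essential p" for ps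
    using that
  proof (induction ps)
    case Nil
    have "t ^ 0 * prod_list [] = t ^ 0 * 1" by simp
    then show ?case using AD(2) zero_neq_one by metis
  next
    case (Cons p ps)
    then obtain a k l where a: "a \<in> A" "a \<noteq> 0" "t ^ k * prod_list ps = t ^ l * a" by (metis list.set_intros(2))
    obtain a' k' l' where a': "a' \<in> A" "a' \<noteq> 0" "t ^ k' * p = t ^ l' * a'"
      using not_essentialE[of p] Cons.prems by (metis list.set_intros(1))
    have "t ^ (k' + k) * prod_list (p # ps) = (t ^ k' * p) * (t ^ k * prod_list ps)"
      by (simp add: power_add ac_simps)
    also have "\<dots> = t ^ (l' + l) * (a' * a)" unfolding a a' by (simp add: power_add ac_simps)
    finally show ?case using a a' AD(4)[OF a'(1) a(1)] by (metis mult_eq_0_iff)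
  qed
  have b0: "b \<noteq> 0"
  proof
    assume "b = 0"
    then obtain P l where P: "P \<in> polys_over A" "0 = t ^ l * poly P t" "degree P > 0"
      using assms(2) unfolding essential_def by (metis mult_zero_right)
    then have "poly P t = 0" using t_nonzero by (metis mult_eq_0_iff power_not_zero)
    then show False using transcendental[OF P(1)] P(3) by auto
  qed
  obtain u ps where u: "u \<in> B" "dvd_in B u 1" "\<And>q. q \<in> set ps \<Longrightarrow> prime_in B q" "b = u * prod_list ps"
    using ufd_onI_prod[OF ufd_B assms(1) b0] by metis
  have "\<exists>p\<in>set ps. essential p"
  proof (rule ccontr)
    assume c: "\<not> ?thesis"
    have "\<not> essential u" using essential_not_dvd_const[of u 1] u AD by auto
    then have "\<forall>p\<in>set (u # ps). p \<in> B \<and> p \<noteq> 0 \<and> \<not> essential p"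
      using u c b0 by (auto simp: prime_in_def)
    from mono[OF this] obtain a k l where a: "a \<in> A" "a \<noteq> 0" "t ^ k * b = t ^ l * a"
      unfolding u(4) by (metis prod_list.Cons)
    obtain P k' l' where P: "P \<in> polys_over A" "t ^ k' * b = t ^ l' * poly P t" "coeff P 0 \<noteq> 0" "degree P > 0"
      using assms unfolding essential_def by blast
    have "t ^ (k + l') * (poly P t * 1) = t ^ k * (t ^ l' * poly P t)" by (simp add: power_add ac_simps)
    also have "\<dots> = t ^ k' * (t ^ k * b)" unfolding P(2)[symmetric] by (simp add: ac_simps)
    also have "\<dots> = t ^ (k' + l) * a" unfolding a(3) by (simp add: power_add ac_simps)
    finally have "t ^ (k + l') * (poly P t * 1) = t ^ (k' + l) * a" .
    then have "degree P = 0" using essential_factor_monomial[OF P(1,3) BD(2) a(1,2)] by blast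
    then show False using P by auto
  qed
  then obtain p xs ys where p: "essential p" "ps = xs @ p # ys" by (metis split_list)
  have "u * prod_list (xs @ ys) \<in> B" using u(1,3) p(2) by (intro prime_list_in[OF subring_B]) auto
  moreover have "b = p * (u * prod_list (xs @ ys))" using u(4) p(2) by (simp add: ac_simps)
  ultimately show thesis using that[of p] u p by auto
qed

end

section \<open>Laurent polynomials\<close>

type_synonym 'k laurent = "(nat \<Rightarrow>\<^sub>0 int) \<Rightarrow>\<^sub>0 'k"

text \<open>Equal to the carrier of \<open>free_Abelian_group J\<close>, which lets charts of
  lattices take values directly in exponents.\<close>

definition exps :: "nat set \<Rightarrow> (nat \<Rightarrow>\<^sub>0 int) set" where
  "exps J = {u. Poly_Mapping.keys u \<subseteq> J}"

definition laur :: "nat set \<Rightarrow> ('k::idom) laurent set" where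
  "laur J = {f. Poly_Mapping.keys f \<subseteq> exps J}"

definition lvar :: "nat \<Rightarrow> int \<Rightarrow> ('k::idom) laurent" where
  "lvar j k = Poly_Mapping.single (Poly_Mapping.single j k) 1"

lemma exps_add: "u \<in> exps J \<Longrightarrow> v \<in> exps J \<Longrightarrow> u + v \<in> exps J"
  unfolding exps_def using Poly_Mapping.keys_add by fastforce

lemma exps_uminus: "- u \<in> exps J \<longleftrightarrow> u \<in> exps J"
  unfolding exps_def by (auto simp: in_keys_iff)

lemma exps_0: "0 \<in> exps J" by (simp add: exps_def)

lemma exps_diff: "u \<in> exps J \<Longrightarrow> v \<in> exps J \<Longrightarrow> u - v \<in> exps J"
  using exps_add[of u J "- v"] exps_uminus by auto

lemma exps_mono: "J \<subseteq> K \<Longrightarrow> exps J \<subseteq> exps K" by (auto simp: exps_def)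
lemma laur_mono: "J \<subseteq> K \<Longrightarrow> laur J \<subseteq> laur K" unfolding laur_def
  by (intro Collect_mono impI) (rule order_trans[OF _ exps_mono])

lemma single_in_exps: "j \<in> J \<Longrightarrow> Poly_Mapping.single j k \<in> exps J" by (auto simp: exps_def)
lemma single_in_laur: "u \<in> exps J \<Longrightarrow> Poly_Mapping.single u c \<in> laur J" by (auto simp: laur_def)

lemma subring_laur: "subring_set (laur J)"
  unfolding subring_set_def
proof (intro conjI ballI)
  show "0 \<in> laur J" "1 \<in> laur J" by (auto simp: laur_def exps_0)
  fix a :: "'a laurent" assume a: "a \<in> laur J"
  then show "- a \<in> laur J" by (simp add: laur_def)
  fix b :: "'a laurent" assume b: "b \<in> laur J"
  show "a + b \<in> laur J" using a b Poly_Mapping.keys_add[of a b] by (auto simp: laur_def)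
  show "a * b \<in> laur J" using a b Poly_Mapping.keys_mult[of a b] exps_add by (fastforce simp: laur_def)
qed

lemmas laurD = subring_setD[OF subring_laur]

lemma lvar_pow: "lvar j 1 ^ k = lvar j (int k)"
  by (induction k) (auto simp: lvar_def mult_single simp flip: single_add)

lemma lvar_mult: "lvar j k * lvar j l = lvar j (k + l)"
  by (simp add: lvar_def mult_single single_add)

lemma lvar_0: "lvar j 0 = 1" by (simp add: lvar_def)

lemma lvar_in_laur: "j \<in> J \<Longrightarrow> lvar j k \<in> laur J"
  unfolding lvar_def by (intro single_in_laur single_in_exps)

lemma poly_mapping_sum_single: "f = (\<Sum>u\<in>Poly_Mapping.keys f. Poly_Mapping.single u (Poly_Mapping.lookup f u))"
proof (rule poly_mapping_eqI)
  fix k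
  have "(\<Sum>u\<in>Poly_Mapping.keys f. Poly_Mapping.lookup (Poly_Mapping.single u (Poly_Mapping.lookup f u)) k)
      = (\<Sum>u\<in>Poly_Mapping.keys f. if u = k then Poly_Mapping.lookup f k else 0)"
    by (intro sum.cong) (auto simp: lookup_single when_def)
  then show "Poly_Mapping.lookup f k =
      Poly_Mapping.lookup (\<Sum>u\<in>Poly_Mapping.keys f. Poly_Mapping.single u (Poly_Mapping.lookup f u)) k"
    by (auto simp: lookup_sum sum.delta in_keys_iff)
qed

lemma lookup_mult_single:
  fixes f :: "('e::ab_group_add) \<Rightarrow>\<^sub>0 ('k::comm_ring_1)"
  shows "Poly_Mapping.lookup (f * Poly_Mapping.single v c) w = Poly_Mapping.lookup f (w - v) * c"
proof -
  have "f * Poly_Mapping.single v c = (\<Sum>u\<in>Poly_Mapping.keys f. Poly_Mapping.single (u + v) (Poly_Mapping.lookup f u * c))"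
    by (subst poly_mapping_sum_single[of f]) (simp add: sum_distrib_right mult_single)
  then have "Poly_Mapping.lookup (f * Poly_Mapping.single v c) w =
    (\<Sum>u\<in>Poly_Mapping.keys f. if u = w - v then Poly_Mapping.lookup f (w - v) * c else 0)"
    by (auto simp: lookup_sum lookup_single when_def eq_diff_eq intro!: sum.cong)
  then show ?thesis by (auto simp: in_keys_iff simp del: lookup_not_eq_zero_eq_in_keys)
qed

text \<open>Powers of \<open>t_j\<close> shift exponents in a direction absent from
  \<open>J\<close>. The terms of \<open>poly p (lvar j 1)\<close> thus have disjoint supports, and
  the coefficient of index \<open>k\<close> can be read off at the exponents whose
  \<open>j\<close>-entry is \<open>k\<close>.\<close>

lemma laurent_transcendental:
  fixes p :: "('k::idom) laurent poly"
  assumes j: "j \<notin> J" and p: "p \<in> polys_over (laur J)" and 0: "poly p (lvar j 1) = 0"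
  shows "p = 0"
proof -
  have "Poly_Mapping.lookup (coeff p k) u = 0" for k u
  proof (cases "u \<in> exps J \<and> k \<le> degree p")
    case False
    have "Poly_Mapping.keys (coeff p k) \<subseteq> exps J" using p by (auto simp: polys_over_def laur_def)
    then show ?thesis using False by (cases "k \<le> degree p") (auto simp: in_keys_iff coeff_eq_0)
  next
    case True
    have "Poly_Mapping.lookup (coeff p i * lvar j 1 ^ i) (u + Poly_Mapping.single j (int k))
        = (if i = k then Poly_Mapping.lookup (coeff p k) u else 0)" for i
    proof -
      have e: "u + Poly_Mapping.single j (int k) - Poly_Mapping.single j (int i) = u + Poly_Mapping.single j (int k - int i)"
        by (simp add: single_diff algebra_simps)
      have "u + Poly_Mapping.single j (int k - int i) \<notin> exps J" if "i \<noteq> k"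
      proof -
        have "Poly_Mapping.lookup u j = 0" using True j by (auto simp: exps_def in_keys_iff)
        then have "j \<in> Poly_Mapping.keys (u + Poly_Mapping.single j (int k - int i))"
          using that by (auto simp: in_keys_iff lookup_add)
        then show ?thesis using j by (auto simp: exps_def)
      qed
      moreover have "Poly_Mapping.keys (coeff p i) \<subseteq> exps J" using p by (auto simp: polys_over_def laur_def)
      ultimately have "i \<noteq> k \<Longrightarrow> Poly_Mapping.lookup (coeff p i) (u + Poly_Mapping.single j (int k - int i)) = 0"
        by (auto simp: in_keys_iff)
      then show ?thesis unfolding lvar_pow unfolding lvar_def lookup_mult_single e by auto
    qed
    then have "Poly_Mapping.lookup (poly p (lvar j 1)) (u + Poly_Mapping.single j (int k)) =
      Poly_Mapping.lookup (coeff p k) u"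
      using True by (simp add: poly_altdef lookup_sum sum.delta)
    then show ?thesis using 0 by simp
  qed
  then show ?thesis by (intro poly_eqI poly_mapping_eqI) auto
qed

lemma laurent_extension_laur:
  assumes "ufd_on (laur J :: ('k::idom) laurent set)" "j \<notin> J"
  shows "laurent_extension (laur J :: 'k laurent set) (lvar j 1) (lvar j (- 1))"
  using assms laurent_transcendental[OF assms(2)] by unfold_locales (auto simp: lvar_mult lvar_0)

lemma laur_insert:
  assumes "ufd_on (laur J :: ('k::idom) laurent set)" "j \<notin> J"
  shows "laurent_extension.B (laur J :: 'k laurent set) (lvar j 1) = laur (insert j J)"
proof -
  interpret laurent_extension "laur J :: 'k laurent set" "lvar j 1" "lvar j (- 1)"
    using assms by (rule laurent_extension_laur)
  have sub: "laur J \<subseteq> (laur (insert j J) :: 'k laurent set)" by (intro laur_mono) auto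
  show ?thesis
  proof (intro equalityI subsetI)
    fix b assume "b \<in> B"
    then obtain p k where p: "p \<in> polys_over (laur J)" "lvar j 1 ^ k * b = poly p (lvar j 1)" unfolding B_def by blast
    have "poly p (lvar j 1) \<in> laur (insert j J)"
      unfolding poly_altdef using p sub
      by (intro subring_set_sum[OF subring_laur] laurD(4) laurD(7) lvar_in_laur) (auto simp: polys_over_def)
    moreover have "b = lvar j (- int k) * (lvar j 1 ^ k * b)"
      by (simp add: lvar_pow lvar_mult lvar_0 flip: mult.assoc)
    ultimately show "b \<in> laur (insert j J)" using p laurD(4) lvar_in_laur[of j "insert j J"] by (metis insertI1)
  next
    fix b :: "'k laurent" assume b: "b \<in> laur (insert j J)"
    have v: "lvar j k \<in> B" for k
    proof (cases "k \<ge> 0")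
      case True
      then show ?thesis using t_ti_in_B(3)[of "nat k"] by (simp add: lvar_pow)
    next
      case False
      have "lvar j (- 1) ^ m = (lvar j (- int m) :: 'k laurent)" for m
        by (induction m) (auto simp: lvar_0 lvar_mult)
      then show ?thesis using t_ti_in_B(4)[of "nat (- k)"] False by simp
    qed
    have "Poly_Mapping.single u (Poly_Mapping.lookup b u) \<in> B" if u: "u \<in> Poly_Mapping.keys b" for u
    proof -
      define k where "k = Poly_Mapping.lookup u j"
      have "u - Poly_Mapping.single j k \<in> exps J"
      proof -
        have "Poly_Mapping.keys u \<subseteq> insert j J" using u b by (auto simp: laur_def exps_def)
        then show ?thesis unfolding exps_def k_def
          by (auto simp: in_keys_iff lookup_minus lookup_single when_def split: if_splits)
      qed
      then have "Poly_Mapping.single (u - Poly_Mapping.single j k) (Poly_Mapping.lookup b u) * lvar j k \<in> B"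
        by (intro BD A_sub_B v single_in_laur)
      then show ?thesis by (simp add: lvar_def mult_single)
    qed
    then have "(\<Sum>u\<in>Poly_Mapping.keys b. Poly_Mapping.single u (Poly_Mapping.lookup b u)) \<in> B"
      by (intro subring_set_sum[OF subring_B])
    then show "b \<in> B" using poly_mapping_sum_single[of b] by simp
  qed
qed

lemma laur_empty_const:
  assumes f: "f \<in> laur {}"
  shows "f = Poly_Mapping.single 0 (Poly_Mapping.lookup f 0)"
proof (rule poly_mapping_eqI)
  fix u
  show "Poly_Mapping.lookup f u = Poly_Mapping.lookup (Poly_Mapping.single 0 (Poly_Mapping.lookup f 0)) u"
  proof (cases "u = 0")
    case False
    then have "u \<notin> Poly_Mapping.keys f" using f by (auto simp: laur_def exps_def)
    then show ?thesis using False by (simp add: lookup_single in_keys_iff)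
  qed simp
qed

text \<open>The induction on variables starts at the coefficient ring. The sort admits both the
  integers and the complex numbers, the latter as a field. \<open>prime_factorization_exists\<close>
  determines the product only up to association, whence the unit \<open>u\<close>.\<close>

lemma ufd_laur_empty: "ufd_on (laur {} :: ('k::{idom,factorial_semiring}) laurent set)"
proof -
  have char: "f \<in> laur {} \<longleftrightarrow> (\<exists>c. f = Poly_Mapping.single 0 c)" for f :: "'k laurent"
    using laur_empty_const[of f] single_in_laur[OF exps_0] by metis
  have mult: "Poly_Mapping.single 0 a * Poly_Mapping.single 0 b = (Poly_Mapping.single 0 (a * b) :: 'k laurent)" for a b
    by (simp add: mult_single)
  have inj: "Poly_Mapping.single 0 a = (Poly_Mapping.single 0 b :: 'k laurent) \<longleftrightarrow> a = b" for a b :: 'k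
    by (metis lookup_single_eq)
  have dvd: "dvd_in (laur {}) (Poly_Mapping.single 0 a) (Poly_Mapping.single 0 b :: 'k laurent) \<longleftrightarrow> a dvd b" for a b
    unfolding dvd_in_def dvd_def Bex_def char using mult inj by metis
  have one: "(1 :: 'k laurent) = Poly_Mapping.single 0 1" by simp
  have pr: "prime_in (laur {}) (Poly_Mapping.single 0 p :: 'k laurent)" if p: "prime_elem p" for p
    unfolding prime_in_def
  proof (intro conjI ballI impI)
    show "Poly_Mapping.single 0 p \<in> laur {}" "\<not> dvd_in (laur {}) (Poly_Mapping.single 0 p) (1 :: 'k laurent)"
      unfolding one dvd char using p by auto
    show "Poly_Mapping.single 0 p \<noteq> (0 :: 'k laurent)" using p inj[of p 0] by auto
    fix a b :: "'k laurent" assume "a \<in> laur {}" "b \<in> laur {}" "dvd_in (laur {}) (Poly_Mapping.single 0 p) (a * b)"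
    then show "dvd_in (laur {}) (Poly_Mapping.single 0 p) a \<or> dvd_in (laur {}) (Poly_Mapping.single 0 p) b"
      unfolding char using p by (auto simp: mult dvd prime_elem_dvd_mult_iff)
  qed
  have "prime_product (laur {}) (Poly_Mapping.single 0 c :: 'k laurent)" if c: "c \<noteq> 0" for c
  proof -
    obtain M where M: "\<And>x. x \<in># M \<Longrightarrow> prime_elem x" "normalize (prod_mset M) = normalize c"
      using prime_factorization_exists[OF c] by blast
    obtain ps where ps: "mset ps = M" using ex_mset by blast
    have "prod_list ps dvd c" "c dvd prod_list ps"
      using M(2) ps by (metis associatedD1 prod_mset_prod_list, metis associatedD2 prod_mset_prod_list)
    then obtain u v where uv: "c = prod_list ps * u" "prod_list ps = c * v" by (metis dvdE)
    then have "c * (v * u) = c * 1" by (simp flip: mult.assoc)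
    then have "u dvd 1" using c by (metis dvd_triv_right mult_left_cancel)
    then have "prime_product (laur {}) (Poly_Mapping.single 0 u :: 'k laurent)"
      unfolding prime_product_def by (intro exI[of _ "Poly_Mapping.single 0 u"] exI[of _ "[]"]) (auto simp: char one dvd simp del: single_one)
    moreover have "prime_product (laur {}) (Poly_Mapping.single 0 (prod_list ps) :: 'k laurent)"
    proof -
      have "\<And>x. x \<in> set ps \<Longrightarrow> prime_elem x" using M(1) ps by (metis in_multiset_in_set)
      then show ?thesis
      proof (induction ps)
        case Nil
        then show ?case using laurD(2) by (auto intro!: prime_product_unit simp: dvd_in_def)
      next
        case (Cons a as)
        then show ?case using prime_product_mult[OF subring_laur prime_product_prime[OF subring_laur pr]] by (metis list.set_intros mult prod_list.Cons)
      qed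
    qed
    ultimately show ?thesis using prime_product_mult[OF subring_laur] uv(1) mult by metis
  qed
  then show ?thesis unfolding ufd_on_def prime_product_def using subring_laur char by (metis single_zero)
qed

theorem ufd_laur:
  assumes "finite J"
  shows "ufd_on (laur J :: ('k::{idom,factorial_semiring}) laurent set)"
  using assms
proof (induction J)
  case (insert j J)
  interpret laurent_extension "laur J :: 'k laurent set" "lvar j 1" "lvar j (- 1)"
    using insert by (intro laurent_extension_laur) auto
  show ?case using ufd_B laur_insert insert by metis
qed (rule ufd_laur_empty)

section \<open>Hypersurfaces in the torus\<close>

definition monom_at :: "(nat \<Rightarrow> complex) \<Rightarrow> (nat \<Rightarrow>\<^sub>0 int) \<Rightarrow> complex" where
  "monom_at z u = (\<Prod>i\<in>Poly_Mapping.keys u. z i powi Poly_Mapping.lookup u i)"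

text \<open>The coefficient map \<open>h\<close> makes one evaluation serve integral and complex
  Laurent polynomials.\<close>

definition eval_at :: "('k::zero \<Rightarrow> complex) \<Rightarrow> (nat \<Rightarrow> complex) \<Rightarrow> 'k laurent \<Rightarrow> complex" where
  "eval_at h z f = (\<Sum>u\<in>Poly_Mapping.keys f. h (Poly_Mapping.lookup f u) * monom_at z u)"

definition coeff_hom :: "('k::idom \<Rightarrow> complex) \<Rightarrow> bool" where
  "coeff_hom h \<longleftrightarrow> h 0 = 0 \<and> h 1 = 1 \<and> (\<forall>a b. h (a + b) = h a + h b) \<and> (\<forall>a b. h (a * b) = h a * h b)"

abbreviation cev :: "(nat \<Rightarrow> complex) \<Rightarrow> complex laurent \<Rightarrow> complex" where "cev \<equiv> eval_at (\<lambda>x. x)"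
abbreviation zev :: "(nat \<Rightarrow> complex) \<Rightarrow> int laurent \<Rightarrow> complex" where "zev \<equiv> eval_at of_int"

lemma coeff_hom_id: "coeff_hom (\<lambda>x. x)" by (simp add: coeff_hom_def)
lemma coeff_hom_of_int: "coeff_hom of_int" by (simp add: coeff_hom_def)

lemma monom_at_superset:
  "finite K \<Longrightarrow> Poly_Mapping.keys u \<subseteq> K \<Longrightarrow> monom_at z u = (\<Prod>i\<in>K. z i powi Poly_Mapping.lookup u i)"
  unfolding monom_at_def by (rule prod.mono_neutral_left) (auto simp: in_keys_iff)

lemma monom_at_0: "monom_at z 0 = 1" by (simp add: monom_at_def)

lemma monom_at_add:
  assumes "\<forall>i. z i \<noteq> 0"
  shows "monom_at z (u + v) = monom_at z u * monom_at z v"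
proof -
  let ?K = "Poly_Mapping.keys u \<union> Poly_Mapping.keys v"
  have K: "finite ?K" "Poly_Mapping.keys (u + v) \<subseteq> ?K" using Poly_Mapping.keys_add[of u v] by auto
  show ?thesis using assms
    by (simp add: monom_at_superset[OF K] monom_at_superset[of ?K u] monom_at_superset[of ?K v]
        lookup_add power_int_add flip: prod.distrib)
qed

lemma monom_at_nonzero: "\<forall>i. z i \<noteq> 0 \<Longrightarrow> monom_at z u \<noteq> 0"
  by (simp add: monom_at_def)

lemma monom_at_single: "monom_at z (Poly_Mapping.single j k) = z j powi k"
  by (simp add: monom_at_def)

lemma monom_at_upd: "u \<in> exps J \<Longrightarrow> j \<notin> J \<Longrightarrow> monom_at (z(j := s)) u = monom_at z u"
  unfolding monom_at_def exps_def by (intro prod.cong) auto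

lemma eval_at_superset:
  "h 0 = 0 \<Longrightarrow> finite K \<Longrightarrow> Poly_Mapping.keys f \<subseteq> K \<Longrightarrow>
    eval_at h z f = (\<Sum>u\<in>K. h (Poly_Mapping.lookup f u) * monom_at z u)"
  unfolding eval_at_def by (rule sum.mono_neutral_left) (auto simp: in_keys_iff)

context
  fixes h :: "'k::idom \<Rightarrow> complex" assumes h: "coeff_hom h"
begin

lemma h_simps: "h 0 = 0" "h 1 = 1" "h (a + b) = h a + h b" "h (a * b) = h a * h b"
  using h by (auto simp: coeff_hom_def)

lemma eval_0: "eval_at h z 0 = 0" by (simp add: eval_at_def)

lemma eval_single: "eval_at h z (Poly_Mapping.single u c) = h c * monom_at z u"
  by (simp add: eval_at_def h_simps)

lemma eval_1: "eval_at h z 1 = 1"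
  using eval_single[of z 0 1] by (simp add: h_simps monom_at_0)

lemma eval_add: "eval_at h z (f + g) = eval_at h z f + eval_at h z g"
proof -
  let ?K = "Poly_Mapping.keys f \<union> Poly_Mapping.keys g"
  have K: "finite ?K" "Poly_Mapping.keys (f + g) \<subseteq> ?K" using Poly_Mapping.keys_add[of f g] by auto
  show ?thesis
    using K by (simp add: eval_at_superset[of h ?K "f + g"] eval_at_superset[of h ?K f] eval_at_superset[of h ?K g]
        lookup_add h_simps distrib_right flip: sum.distrib)
qed

lemma eval_sum: "eval_at h z (sum f I) = (\<Sum>i\<in>I. eval_at h z (f i))"
  by (induction I rule: infinite_finite_induct) (auto simp: eval_0 eval_add)

lemma eval_uminus: "eval_at h z (- f) = - eval_at h z f"
  using eval_add[of z f "- f"] by (simp add: eval_0 eq_neg_iff_add_eq_0 add.commute)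

lemma eval_diff: "eval_at h z (f - g) = eval_at h z f - eval_at h z g"
  using eval_add[of z f "- g"] by (simp add: eval_uminus)

lemma eval_mult:
  assumes z: "\<forall>i. z i \<noteq> 0"
  shows "eval_at h z (f * g) = eval_at h z f * eval_at h z g"
proof -
  have "f * g = (\<Sum>u\<in>Poly_Mapping.keys f. \<Sum>v\<in>Poly_Mapping.keys g.
      Poly_Mapping.single (u + v) (Poly_Mapping.lookup f u * Poly_Mapping.lookup g v))"
    by (subst poly_mapping_sum_single[of f], subst poly_mapping_sum_single[of g])
      (simp add: sum_product mult_single)
  then show ?thesis
    by (simp add: eval_sum eval_single h_simps monom_at_add[OF z])
      (simp add: eval_at_def sum_product ac_simps)
qed

lemma eval_power: "\<forall>i. z i \<noteq> 0 \<Longrightarrow> eval_at h z (f ^ k) = eval_at h z f ^ k"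
  by (induction k) (auto simp: eval_1 eval_mult)

lemma eval_prod_list: "\<forall>i. z i \<noteq> 0 \<Longrightarrow> eval_at h z (prod_list ps) = (\<Prod>p\<leftarrow>ps. eval_at h z p)"
  by (induction ps) (auto simp: eval_1 eval_mult)

lemma eval_upd: "f \<in> laur J \<Longrightarrow> j \<notin> J \<Longrightarrow> eval_at h (z(j := s)) f = eval_at h z f"
  unfolding eval_at_def laur_def by (intro sum.cong) (auto simp: monom_at_upd)

lemma eval_lvar: "eval_at h z (lvar j k) = z j powi k"
  unfolding lvar_def by (simp add: eval_single h_simps monom_at_single)

text \<open>Along a coordinate line the value is an ordinary polynomial in one complex variable,
  whose coefficients do not see the moving coordinate.\<close>

lemma eval_fiber:
  assumes "P \<in> polys_over (laur J)" "j \<notin> J" "\<forall>i. (z(j := s)) i \<noteq> 0"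
  shows "eval_at h (z(j := s)) (poly P (lvar j 1)) = poly (map_poly (eval_at h z) P) s"
  using assms(1)
proof (induction P)
  case 0
  then show ?case by (simp add: eval_0)
next
  case (pCons a p)
  have a: "a \<in> laur J" using pCons(3) by (auto simp: polys_over_def dest: spec[of _ 0])
  have p: "p \<in> polys_over (laur J)" unfolding polys_over_def
  proof clarify
    fix i show "coeff p i \<in> laur J" using pCons(3) unfolding polys_over_def by (auto dest: spec[of _ "Suc i"])
  qed
  have "map_poly (eval_at h z) (pCons a p) = pCons (eval_at h z a) (map_poly (eval_at h z) p)"
    by (intro poly_eqI) (auto simp: coeff_map_poly eval_0 coeff_pCons split: nat.splits)
  then show ?case
    using pCons(2)[OF p] eval_mult[OF assms(3)]
    by (simp add: eval_add eval_upd[OF a assms(2)] eval_lvar del: fun_upd_apply) simp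
qed

end

text \<open>Variables are treated one at a time: a choice of the other coordinates keeps the lowest
  coefficient of \<open>P\<close> nonzero, and then all but finitely many values of the new
  coordinate work.\<close>

lemma laurent_nonvanishing:
  assumes "finite J" "f \<in> laur J" "f \<noteq> 0"
  shows "\<exists>z. (\<forall>i. z i \<noteq> 0) \<and> (\<forall>i. i \<notin> J \<longrightarrow> z i = 1) \<and> cev z f \<noteq> 0"
  using assms
proof (induction J arbitrary: f)
  case empty
  then have "f = Poly_Mapping.single 0 (Poly_Mapping.lookup f 0)" by (intro laur_empty_const)
  then have "cev (\<lambda>_. 1) f = Poly_Mapping.lookup f 0" "Poly_Mapping.lookup f 0 \<noteq> 0"
    using eval_single[OF coeff_hom_id, of "\<lambda>_. 1" 0 "Poly_Mapping.lookup f 0"] empty(2)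
    by (auto simp: monom_at_0)
  then show ?case by (intro exI[of _ "\<lambda>_. 1"]) auto
next
  case (insert j J)
  interpret laurent_extension "laur J :: complex laurent set" "lvar j 1" "lvar j (- 1)"
    using insert by (intro laurent_extension_laur ufd_laur) auto
  have "B = laur (insert j J)" using laur_insert ufd_laur insert by metis
  then obtain P k l where P: "P \<in> polys_over (laur J)" "coeff P 0 \<noteq> 0" "lvar j 1 ^ k * f = lvar j 1 ^ l * poly P (lvar j 1)"
    using B_normal_form[of f] insert by metis
  have "coeff P 0 \<in> laur J" using P by (auto simp: polys_over_def)
  then obtain z where z: "\<forall>i. z i \<noteq> 0" "\<forall>i. i \<notin> J \<longrightarrow> z i = 1" "cev z (coeff P 0) \<noteq> 0"
    using insert P by blast
  let ?M = "map_poly (cev z) P"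
  have "coeff ?M 0 \<noteq> 0" using z by (simp add: coeff_map_poly eval_0[OF coeff_hom_id])
  then have "?M \<noteq> 0" by auto
  then have "finite ({s. poly ?M s = 0} \<union> {0})" using poly_roots_finite by blast
  then obtain s where s: "s \<noteq> 0" "poly ?M s \<noteq> 0" using ex_new_if_finite[OF infinite_UNIV_char_0] by blast
  let ?w = "z(j := s)"
  have nz: "\<forall>i. ?w i \<noteq> 0" using z s by auto
  have "cev ?w (lvar j 1 ^ k * f) = s ^ l * poly ?M s"
    unfolding P eval_mult[OF coeff_hom_id nz] eval_power[OF coeff_hom_id nz] eval_lvar[OF coeff_hom_id]
      eval_fiber[OF coeff_hom_id P(1) insert(2) nz] by simp
  then have "cev ?w f \<noteq> 0"
    using s unfolding eval_mult[OF coeff_hom_id nz] by (metis mult_eq_0_iff power_not_zero)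
  moreover have "\<forall>i. i \<notin> insert j J \<longrightarrow> ?w i = 1" using z by auto
  ultimately show ?case using nz by metis
qed

text \<open>Points of \<open>(\<complex>\<^sup>*)\<^sup>n\<close> are padded by \<open>1\<close>, so that every coordinate is invertible.\<close>

definition torus :: "nat \<Rightarrow> (nat \<Rightarrow> complex) set" where
  "torus n = {z. (\<forall>i<n. z i \<noteq> 0) \<and> (\<forall>i\<ge>n. z i = 1)}"

text \<open>The vanishing ideal of \<open>S\<close> is prime. This form needs no topology on
  \<open>torus n\<close>; \<open>irreducible_pull_iff\<close> matches it with
  \<open>irreducible_in\<close>.\<close>

definition irr :: "nat \<Rightarrow> (nat \<Rightarrow> complex) set \<Rightarrow> bool" where
  "irr n S \<longleftrightarrow> S \<subseteq> torus n \<and> S \<noteq> {} \<and>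
    (\<forall>f\<in>laur {..<n}. \<forall>g\<in>laur {..<n}. (\<forall>z\<in>S. cev z f * cev z g = 0) \<longrightarrow> (\<forall>z\<in>S. cev z f = 0) \<or> (\<forall>z\<in>S. cev z g = 0))"

definition zclosure :: "nat \<Rightarrow> (nat \<Rightarrow> complex) set \<Rightarrow> (nat \<Rightarrow> complex) set" where
  "zclosure n S = {z \<in> torus n. \<forall>f\<in>laur {..<n}. (\<forall>w\<in>S. cev w f = 0) \<longrightarrow> cev z f = 0}"

definition zclosed :: "nat \<Rightarrow> (nat \<Rightarrow> complex) set \<Rightarrow> bool" where
  "zclosed n S \<longleftrightarrow> zclosure n S = S"

text \<open>The torus is irreducible and contains every set considered, so having chains of length
  one but none of length two above \<open>S\<close> amounts to maximality of \<open>S\<close> below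
  the torus.\<close>

definition codim1 :: "nat \<Rightarrow> (nat \<Rightarrow> complex) set \<Rightarrow> bool" where
  "codim1 n S \<longleftrightarrow> irr n S \<and> zclosed n S \<and> S \<noteq> torus n \<and>
    (\<forall>Y. irr n Y \<and> zclosed n Y \<and> S \<subseteq> Y \<longrightarrow> Y = S \<or> Y = torus n)"

lemma torus_nonzero: "z \<in> torus n \<Longrightarrow> \<forall>i. z i \<noteq> 0"
  unfolding torus_def by (metis (mono_tags, lifting) mem_Collect_eq not_le zero_neq_one)

lemma torus_upd: "z \<in> torus n \<Longrightarrow> j < n \<Longrightarrow> s \<noteq> 0 \<Longrightarrow> z(j := s) \<in> torus n"
  by (auto simp: torus_def)

lemma torus_nonvanishing:
  assumes "f \<in> laur {..<n}" "f \<noteq> 0"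
  shows "\<exists>z\<in>torus n. cev z f \<noteq> 0"
proof -
  obtain z where "\<forall>i. z i \<noteq> 0" "\<forall>i. i \<notin> {..<n} \<longrightarrow> z i = 1" "cev z f \<noteq> 0"
    using laurent_nonvanishing[OF finite_lessThan assms] by metis
  then show ?thesis by (intro bexI[of _ z]) (auto simp: torus_def)
qed

lemma torus_nonempty: "torus n \<noteq> {}"
proof -
  have "(\<lambda>_. 1) \<in> torus n" by (auto simp: torus_def)
  then show ?thesis by blast
qed

lemma irr_torus: "irr n (torus n)"
  unfolding irr_def
proof (intro conjI ballI impI subset_refl torus_nonempty)
  fix f g :: "complex laurent"
  assume fg: "f \<in> laur {..<n}" "g \<in> laur {..<n}" "\<forall>z\<in>torus n. cev z f * cev z g = 0"
  then have "\<forall>z\<in>torus n. cev z (f * g) = 0"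
    using eval_mult[OF coeff_hom_id torus_nonzero] by auto
  then have "f * g = 0" using torus_nonvanishing laurD(4) fg by metis
  then show "(\<forall>z\<in>torus n. cev z f = 0) \<or> (\<forall>z\<in>torus n. cev z g = 0)"
    by (auto simp: eval_0[OF coeff_hom_id])
qed

lemma zclosure_subset: "S \<subseteq> torus n \<Longrightarrow> S \<subseteq> zclosure n S" by (auto simp: zclosure_def)
lemma zclosure_torus: "zclosure n S \<subseteq> torus n" by (auto simp: zclosure_def)

lemma zclosure_mono: "S \<subseteq> S' \<Longrightarrow> zclosure n S \<subseteq> zclosure n S'"
  unfolding zclosure_def by blast

lemma zclosed_zclosure: "zclosed n (zclosure n S)"
  unfolding zclosed_def zclosure_def by auto

lemma zclosed_zeros: "F \<subseteq> laur {..<n} \<Longrightarrow> zclosed n {z \<in> torus n. \<forall>f\<in>F. cev z f = 0}"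
  unfolding zclosed_def zclosure_def by auto

lemma zclosed_torus: "zclosed n (torus n)"
  using zclosed_zeros[of "{}"] by simp

lemma zclosure_le: "S \<subseteq> Y \<Longrightarrow> zclosed n Y \<Longrightarrow> zclosure n S \<subseteq> Y"
  using zclosure_mono unfolding zclosed_def by metis

lemma irr_zclosure:
  assumes "irr n S"
  shows "irr n (zclosure n S)"
  unfolding irr_def
proof (intro conjI ballI impI zclosure_torus)
  show "zclosure n S \<noteq> {}" using assms zclosure_subset[of S n] by (auto simp: irr_def)
  fix f g :: "complex laurent"
  assume fg: "f \<in> laur {..<n}" "g \<in> laur {..<n}" "\<forall>z\<in>zclosure n S. cev z f * cev z g = 0"
  then have "(\<forall>z\<in>S. cev z f = 0) \<or> (\<forall>z\<in>S. cev z g = 0)"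
    using assms zclosure_subset[of S n] unfolding irr_def by blast
  then show "(\<forall>z\<in>zclosure n S. cev z f = 0) \<or> (\<forall>z\<in>zclosure n S. cev z g = 0)"
    using fg unfolding zclosure_def by auto
qed

lemma irr_prod_list:
  assumes S: "irr n S" and "set fs \<subseteq> laur {..<n}" "\<forall>z\<in>S. cev z (prod_list fs) = 0"
  shows "\<exists>f\<in>set fs. \<forall>z\<in>S. cev z f = 0"
  using assms(2,3)
proof (induction fs)
  case Nil
  then show ?case using S by (auto simp: irr_def eval_1[OF coeff_hom_id])
next
  case (Cons f fs)
  have nz: "\<And>z. z \<in> S \<Longrightarrow> \<forall>i. z i \<noteq> 0" using S torus_nonzero by (auto simp: irr_def)
  have "\<forall>z\<in>S. cev z f * cev z (prod_list fs) = 0"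
    using Cons.prems eval_mult[OF coeff_hom_id nz] by auto
  moreover have "prod_list fs \<in> laur {..<n}" using Cons.prems subring_set_prod_list[OF subring_laur] by auto
  moreover have "f \<in> laur {..<n}" using Cons.prems by simp
  ultimately have "(\<forall>z\<in>S. cev z f = 0) \<or> (\<forall>z\<in>S. cev z (prod_list fs) = 0)"
    using S unfolding irr_def by blast
  then show ?case using Cons by auto
qed

lemma eval_dvd_unit:
  assumes "coeff_hom h" "dvd_in A u 1" "\<forall>i. z i \<noteq> 0"
  shows "eval_at h z u \<noteq> 0"
proof -
  obtain c where "1 = u * c" using assms by (auto simp: dvd_in_def)
  then have "eval_at h z u * eval_at h z c = 1" using eval_mult[OF assms(1,3)] eval_1[OF assms(1)] by metis
  then show ?thesis by auto
qed

lemma eval_dvd: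
  assumes "coeff_hom h" "dvd_in A p g" "\<forall>i. z i \<noteq> 0" "eval_at h z p = 0"
  shows "eval_at h z g = 0"
  using assms eval_mult[OF assms(1,3)] by (auto simp: dvd_in_def)

section \<open>Elimination of one coordinate and hypersurfaces\<close>

abbreviation others :: "nat \<Rightarrow> nat \<Rightarrow> nat set" where "others n j \<equiv> {..<n} - {j}"

lemma laurent_extension_others:
  "laurent_extension (laur (others n j) :: ('k::{idom,factorial_semiring}) laurent set) (lvar j 1) (lvar j (- 1))"
  by (intro laurent_extension_laur ufd_laur) auto

lemma B_others:
  "j < n \<Longrightarrow> laurent_extension.B (laur (others n j) :: ('k::{idom,factorial_semiring}) laurent set) (lvar j 1) = laur {..<n}"
  using laur_insert[OF ufd_laur, of "others n j" j] by (simp add: insert_absorb)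

definition essential_in :: "nat \<Rightarrow> nat \<Rightarrow> ('k::{idom,factorial_semiring}) laurent \<Rightarrow> bool" where
  "essential_in n j p \<longleftrightarrow> laurent_extension.essential (laur (others n j)) (lvar j 1) p"

context
  fixes n j :: nat assumes j: "j < n"
begin
lemmas ess_comb = laurent_extension.essential_prime_combination[OF laurent_extension_others[of n j], unfolded B_others[OF j], folded essential_in_def]
lemmas ess_const = laurent_extension.essential_not_dvd_const[OF laurent_extension_others[of n j], unfolded B_others[OF j], folded essential_in_def]
lemmas ess_notE = laurent_extension.not_essentialE[OF laurent_extension_others[of n j], unfolded B_others[OF j], folded essential_in_def]
lemmas ess_factor = laurent_extension.essential_prime_factor[OF laurent_extension_others[of n j], unfolded B_others[OF j], folded essential_in_def]
lemmas laur_normal_form = laurent_extension.B_normal_form[OF laurent_extension_others[of n j], unfolded B_others[OF j]]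
end
lemmas ess_def = laurent_extension.essential_def[OF laurent_extension_others, folded essential_in_def]

text \<open>If \<open>p\<close> does not divide \<open>g\<close>, elimination produces a nonzero
  \<open>r\<close> free of \<open>t_j\<close> in the ideal of \<open>p\<close> and \<open>g\<close>.
  Over a point where \<open>r\<close> is nonzero, \<open>p\<close> still has a zero in the fibre;
  there \<open>g\<close>, and hence \<open>r\<close>, would vanish.\<close>

lemma hypersurface_nullstellensatz:
  assumes j: "j < n" and p: "prime_in (laur {..<n}) p" "essential_in n j p"
    and g: "g \<in> laur {..<n}" "\<And>z. z \<in> torus n \<Longrightarrow> cev z p = 0 \<Longrightarrow> cev z g = 0"
  shows "dvd_in (laur {..<n}) p g"
proof (rule ccontr)
  assume "\<not> ?thesis"
  then obtain x y r where xy: "x \<in> laur {..<n}" "y \<in> laur {..<n}" "r \<in> laur (others n j)" "r \<noteq> 0" "x * p + y * g = r"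
    using ess_comb[OF j] j p g by blast
  obtain P k l where P: "P \<in> polys_over (laur (others n j))" "lvar j 1 ^ k * p = lvar j 1 ^ l * poly P (lvar j 1)"
    "coeff P 0 \<noteq> 0" "degree P > 0"
    using p(2) unfolding ess_def by blast
  \<comment> \<open>Besides \<open>r\<close>, both end coefficients of \<open>P\<close> must
    survive: the top one keeps the degree positive so that a root exists, the bottom one makes the
    root nonzero.\<close>
  define q where "q = r * (coeff P 0 * lead_coeff P)"
  have "P \<noteq> 0" using P by auto
  then have "q \<noteq> 0" using xy P by (auto simp: q_def)
  moreover have "q \<in> laur (others n j)" unfolding q_def using xy P by (intro laurD(4)) (auto simp: polys_over_def)
  ultimately obtain z where z: "\<forall>i. z i \<noteq> 0" "\<forall>i. i \<notin> others n j \<longrightarrow> z i = 1" "cev z q \<noteq> 0"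
    using laurent_nonvanishing[of "others n j" q] by auto
  then have ne: "cev z r \<noteq> 0" "cev z (coeff P 0) \<noteq> 0" "cev z (lead_coeff P) \<noteq> 0"
    unfolding q_def eval_mult[OF coeff_hom_id z(1)] by auto
  let ?M = "map_poly (cev z) P"
  have M: "coeff ?M i = cev z (coeff P i)" for i by (simp add: coeff_map_poly eval_0[OF coeff_hom_id])
  have "degree ?M > 0" using P(4) ne(3) M le_degree[of ?M "degree P"] by auto
  then have "\<not> constant (poly ?M)" by (simp add: constant_degree)
  then obtain s where s: "poly ?M s = 0" using fundamental_theorem_of_algebra by blast
  have "s \<noteq> 0" using s ne(2) M[of 0] by (auto simp: poly_0_coeff_0)
  let ?w = "z(j := s)"
  have nz: "\<forall>i. ?w i \<noteq> 0" using z \<open>s \<noteq> 0\<close> by auto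
  have w: "?w \<in> torus n" using z \<open>s \<noteq> 0\<close> j by (auto simp: torus_def)
  have "cev ?w (lvar j 1 ^ k * p) = 0"
    unfolding P(2) eval_mult[OF coeff_hom_id nz] using eval_fiber[OF coeff_hom_id P(1) _ nz] s by auto
  then have p0: "cev ?w p = 0"
    unfolding eval_mult[OF coeff_hom_id nz] eval_power[OF coeff_hom_id nz] eval_lvar[OF coeff_hom_id]
    using \<open>s \<noteq> 0\<close> by auto
  have "cev ?w r = 0"
    unfolding xy(5)[symmetric] eval_add[OF coeff_hom_id] eval_mult[OF coeff_hom_id nz] using p0 g(2)[OF w p0] by auto
  then show False using ne(1) eval_upd[OF coeff_hom_id xy(3), of j z s] by auto
qed

text \<open>A proper irreducible closed set \<open>Y\<close> that contains the hypersurface lies in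
  the zero set of a single prime \<open>q\<close>, found by factoring an equation of
  \<open>Y\<close>. By the Nullstellensatz \<open>p\<close> divides \<open>q\<close>, so the two
  primes are associated and \<open>Y\<close> is no larger.\<close>

lemma hypersurface_codim1:
  assumes j: "j < n" and p: "prime_in (laur {..<n}) p" "essential_in n j p"
  shows "codim1 n {z \<in> torus n. cev z p = 0}" (is "codim1 n ?V")
proof -
  have pl: "p \<in> laur {..<n}" using p by (auto simp: prime_in_def)
  note null = hypersurface_nullstellensatz[OF j p]
  have irrV: "irr n ?V"
    unfolding irr_def
  proof (intro conjI ballI impI)
    show "?V \<noteq> {}"
    proof
      assume "?V = {}"
      then have "dvd_in (laur {..<n}) p 1" by (intro null laurD) auto
      then show False using p by (auto simp: prime_in_def)
    qed
    fix f g :: "complex laurent" assume fg: "f \<in> laur {..<n}" "g \<in> laur {..<n}" "\<forall>z\<in>?V. cev z f * cev z g = 0"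
    then have "dvd_in (laur {..<n}) p (f * g)"
      using eval_mult[OF coeff_hom_id torus_nonzero] by (intro null laurD(4)) auto
    then have "dvd_in (laur {..<n}) p f \<or> dvd_in (laur {..<n}) p g" using p fg unfolding prime_in_def by blast
    then show "(\<forall>z\<in>?V. cev z f = 0) \<or> (\<forall>z\<in>?V. cev z g = 0)"
      using eval_dvd[OF coeff_hom_id _ torus_nonzero] by blast
  qed auto
  have cl: "zclosed n ?V" using zclosed_zeros[of "{p}" n] pl by simp
  have "?V \<noteq> torus n" using torus_nonvanishing[OF pl] p by (auto simp: prime_in_def)
  moreover have "Y = ?V \<or> Y = torus n" if Y: "irr n Y" "zclosed n Y" "?V \<subseteq> Y" for Y
  proof (cases "Y = torus n")
    case False
    then obtain z where "z \<in> torus n" "z \<notin> zclosure n Y" using Y zclosure_torus unfolding zclosed_def by blast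
    then obtain f where f: "f \<in> laur {..<n}" "\<And>w. w \<in> Y \<Longrightarrow> cev w f = 0" "cev z f \<noteq> 0"
      unfolding zclosure_def by auto
    then have "f \<noteq> 0" by (auto simp: eval_0[OF coeff_hom_id])
    then obtain u qs where u: "u \<in> laur {..<n}" "dvd_in (laur {..<n}) u 1"
      "\<And>q. q \<in> set qs \<Longrightarrow> prime_in (laur {..<n}) q" "f = u * prod_list qs"
      using ufd_onI_prod[OF ufd_laur[OF finite_lessThan] f(1)] by metis
    have nz: "\<And>z. z \<in> Y \<Longrightarrow> \<forall>i. z i \<noteq> 0" using Y torus_nonzero by (auto simp: irr_def)
    have "\<forall>z\<in>Y. cev z (prod_list qs) = 0"
      using f(2) eval_mult[OF coeff_hom_id nz] eval_dvd_unit[OF coeff_hom_id u(2) nz] unfolding u(4) by auto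
    then obtain q where q: "q \<in> set qs" "\<And>z. z \<in> Y \<Longrightarrow> cev z q = 0"
      using irr_prod_list[OF Y(1), of qs] u(3) unfolding prime_in_def by blast
    have qp: "prime_in (laur {..<n}) q" "q \<in> laur {..<n}" "q \<noteq> 0" using u(3)[OF q(1)] by (auto simp: prime_in_def)
    have "dvd_in (laur {..<n}) p q" using q(2) Y(3) qp by (intro null) auto
    then obtain c where c: "c \<in> laur {..<n}" "q = p * c" by (auto simp: dvd_in_def)
    have "dvd_in (laur {..<n}) q (p * c)" using c laurD(2) unfolding dvd_in_def by (metis mult.right_neutral)
    then consider "dvd_in (laur {..<n}) q p" | "dvd_in (laur {..<n}) q c" using qp c pl unfolding prime_in_def by blast
    then have "dvd_in (laur {..<n}) q p"
    proof cases
      case 2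
      then obtain d where d: "d \<in> laur {..<n}" "c = q * d" by (auto simp: dvd_in_def)
      then have "q * 1 = q * (p * d)" using c(2) by (metis mult.left_commute mult.right_neutral)
      then have "1 = p * d" using qp(3) by (subst (asm) mult_left_cancel)
      then show ?thesis using p d unfolding prime_in_def dvd_in_def by blast
    qed
    then have "Y \<subseteq> ?V" using eval_dvd[OF coeff_hom_id _ nz] q(2) Y(1) unfolding irr_def by blast
    then show ?thesis using Y by auto
  qed auto
  ultimately show ?thesis unfolding codim1_def using irrV cl by auto
qed

section \<open>Translation in a coordinate direction\<close>

lemma monom_at_scale:
  assumes "\<forall>i. z i \<noteq> 0" "a \<noteq> 0"
  shows "monom_at (z(j := z j * a)) u = a powi Poly_Mapping.lookup u j * monom_at z u"
proof -
  let ?K = "insert j (Poly_Mapping.keys u)"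
  have "monom_at (z(j := z j * a)) u = (\<Prod>i\<in>?K. (if i = j then a powi Poly_Mapping.lookup u j else 1) * z i powi Poly_Mapping.lookup u i)"
    by (subst monom_at_superset[of ?K]) (auto intro!: prod.cong simp: power_int_mult_distrib)
  also have "\<dots> = (\<Prod>i\<in>?K. (if i = j then a powi Poly_Mapping.lookup u j else 1)) * (\<Prod>i\<in>?K. z i powi Poly_Mapping.lookup u i)"
    by (rule prod.distrib)
  also have "(\<Prod>i\<in>?K. (if i = j then a powi Poly_Mapping.lookup u j else 1)) = a powi Poly_Mapping.lookup u j"
    by (subst prod.delta) auto
  also have "(\<Prod>i\<in>?K. z i powi Poly_Mapping.lookup u i) = monom_at z u"
    by (subst monom_at_superset[of ?K]) auto
  finally show ?thesis .
qed

text \<open>Substitution of \<open>a * t_j\<close> for \<open>t_j\<close>, that is, pullback under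
  translation by \<open>a\<close> in coordinate \<open>j\<close>.\<close>

definition twist :: "nat \<Rightarrow> complex \<Rightarrow> complex laurent \<Rightarrow> complex laurent" where
  "twist j a f = (\<Sum>u\<in>Poly_Mapping.keys f. Poly_Mapping.single u (Poly_Mapping.lookup f u * a powi Poly_Mapping.lookup u j))"

lemma twist_in_laur: "f \<in> laur J \<Longrightarrow> twist j a f \<in> laur J"
  unfolding twist_def by (intro subring_set_sum[OF subring_laur] single_in_laur) (auto simp: laur_def)

lemma eval_twist:
  assumes "\<forall>i. z i \<noteq> 0" "a \<noteq> 0"
  shows "cev z (twist j a f) = cev (z(j := z j * a)) f"
  unfolding twist_def eval_sum[OF coeff_hom_id] eval_single[OF coeff_hom_id]
  unfolding eval_at_def monom_at_scale[OF assms] by (simp add: ac_simps)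

lemma eval_poly:
  assumes "coeff_hom h" "\<forall>i. z i \<noteq> 0"
  shows "eval_at h z (poly P x) = poly (map_poly (eval_at h z) P) (eval_at h z x)"
proof (induction P)
  case 0
  then show ?case by (simp add: eval_0[OF assms(1)])
next
  case (pCons a p)
  have "map_poly (eval_at h z) (pCons a p) = pCons (eval_at h z a) (map_poly (eval_at h z) p)"
    by (intro poly_eqI) (auto simp: coeff_map_poly eval_0[OF assms(1)] coeff_pCons split: nat.splits)
  then show ?case using pCons by (simp add: eval_add[OF assms(1)] eval_mult[OF assms])
qed

lemma fiber_zero:
  assumes j: "j < n" and z: "z \<in> torus n" and f: "f \<in> laur {..<n}"
    and inf: "infinite {s. s \<noteq> 0 \<and> cev (z(j := s)) f = 0}" and s: "s \<noteq> 0"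
  shows "cev (z(j := s)) f = 0"
proof (cases "f = 0")
  case False
  obtain P k l where P: "P \<in> polys_over (laur (others n j))" "lvar j 1 ^ k * f = lvar j 1 ^ l * poly P (lvar j 1)"
    using laur_normal_form[OF j f False] by metis
  let ?M = "map_poly (cev z) P"
  have e: "s ^ k * cev (z(j := s)) f = s ^ l * poly ?M s" if "s \<noteq> 0" for s
  proof -
    have nz: "\<forall>i. (z(j := s)) i \<noteq> 0" using torus_nonzero[OF z] that by simp
    have "cev (z(j := s)) (lvar j 1 ^ k * f) = cev (z(j := s)) (lvar j 1 ^ l * poly P (lvar j 1))" using P(2) by simp
    then show ?thesis
      unfolding eval_mult[OF coeff_hom_id nz] eval_power[OF coeff_hom_id nz] eval_lvar[OF coeff_hom_id]
        eval_fiber[OF coeff_hom_id P(1) _ nz, simplified] by simp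
  qed
  have "{s. s \<noteq> 0 \<and> cev (z(j := s)) f = 0} \<subseteq> {s. poly ?M s = 0}"
  proof clarify
    fix s assume s: "s \<noteq> 0" "cev (z(j := s)) f = 0"
    have "s ^ l * poly ?M s = 0" using e[OF s(1)] s(2) by (metis mult_zero_right)
    then show "poly ?M s = 0" using s(1) by (metis mult_eq_0_iff power_not_zero)
  qed
  then have "?M = 0" using inf poly_roots_finite finite_subset by blast
  then have "s ^ k * cev (z(j := s)) f = 0" unfolding e[OF s] by (metis mult_zero_right poly_0)
  then show ?thesis using s by (metis mult_eq_0_iff power_not_zero)
qed (simp add: eval_0[OF coeff_hom_id])

text \<open>For each nonzero \<open>a\<close> the twist of \<open>f\<close> or that of
  \<open>g\<close> vanishes on \<open>C\<close>. One of the two does so for infinitely many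
  \<open>a\<close>, and a Laurent polynomial with infinitely many zeros on a fibre vanishes on all
  of it.\<close>

lemma irr_coordinate_orbit:
  assumes j: "j < n" and C: "irr n C"
  shows "irr n {z(j := s) | z s. z \<in> C \<and> s \<noteq> 0}" (is "irr n ?D")
proof -
  have CT: "C \<subseteq> torus n" using C by (auto simp: irr_def)
  have half: "\<forall>w\<in>?D. cev w f = 0"
    if f: "f \<in> laur {..<n}" and A: "infinite {a. a \<noteq> 0 \<and> (\<forall>z\<in>C. cev z (twist j a f) = 0)}" for f
  proof clarify
    fix z s assume z: "z \<in> C" "s \<noteq> (0::complex)"
    have nz: "\<forall>i. z i \<noteq> 0" using torus_nonzero z CT by blast
    have "inj ((*) (z j))" using nz by (auto intro: injI)
    then have "infinite ((*) (z j) ` {a. a \<noteq> 0 \<and> (\<forall>z\<in>C. cev z (twist j a f) = 0)})"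
      using A finite_imageD inj_on_subset by blast
    moreover have "(*) (z j) ` {a. a \<noteq> 0 \<and> (\<forall>z\<in>C. cev z (twist j a f) = 0)} \<subseteq> {s. s \<noteq> 0 \<and> cev (z(j := s)) f = 0}"
    proof clarify
      fix a assume a: "a \<noteq> 0" "\<forall>z\<in>C. cev z (twist j a f) = 0"
      then show "z j * a \<noteq> 0 \<and> cev (z(j := z j * a)) f = 0"
        using nz z(1) eval_twist[OF nz a(1)] by (metis mult_eq_0_iff)
    qed
    ultimately have "infinite {s. s \<noteq> 0 \<and> cev (z(j := s)) f = 0}" using finite_subset by blast
    then show "cev (z(j := s)) f = 0" using fiber_zero[OF j _ f] z CT by blast
  qed
  show ?thesis
    unfolding irr_def
  proof (intro conjI ballI impI)
    show "?D \<subseteq> torus n" using CT torus_upd[OF _ j] by blast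
    obtain z where "z \<in> C" using C by (auto simp: irr_def)
    then have "z(j := 1) \<in> ?D" using one_neq_zero by blast
    then show "?D \<noteq> {}" by blast
    fix f g :: "complex laurent"
    assume f: "f \<in> laur {..<n}" and g: "g \<in> laur {..<n}" and fg: "\<forall>z\<in>?D. cev z f * cev z g = 0"
    let ?A = "\<lambda>f. {a. a \<noteq> 0 \<and> (\<forall>z\<in>C. cev z (twist j a f) = 0)}"
    have "a \<in> ?A f \<union> ?A g" if a: "a \<noteq> 0" for a
    proof -
      have "cev z (twist j a f) * cev z (twist j a g) = 0" if z: "z \<in> C" for z
      proof -
        have nz: "\<forall>i. z i \<noteq> 0" using torus_nonzero z CT by blast
        have "z j * a \<noteq> 0" using nz a by simp
        then have "z(j := z j * a) \<in> ?D" using z by blast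
        then show ?thesis using fg unfolding eval_twist[OF nz a] by blast
      qed
      then have "(\<forall>z\<in>C. cev z (twist j a f) = 0) \<or> (\<forall>z\<in>C. cev z (twist j a g) = 0)"
        using C twist_in_laur f g unfolding irr_def by blast
      then show ?thesis using a by blast
    qed
    then have "UNIV - {0::complex} \<subseteq> ?A f \<union> ?A g" by blast
    moreover have "infinite (UNIV - {0::complex})" using infinite_UNIV_char_0 by simp
    ultimately have "infinite (?A f) \<or> infinite (?A g)" using finite_subset finite_UnI by blast
    then show "(\<forall>z\<in>?D. cev z f = 0) \<or> (\<forall>z\<in>?D. cev z g = 0)" using half f g by blast
  qed
qed

text \<open>A hypersurface lying over a proper subvariety of every coordinate hyperplane would be
  invariant under translation in every coordinate direction.\<close>

lemma codim1_dominant: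
  assumes C: "codim1 n C"
  shows "\<exists>j<n. \<forall>r\<in>laur (others n j). (\<forall>z\<in>C. cev z r = 0) \<longrightarrow> r = 0"
proof (rule ccontr)
  assume neg: "\<not> ?thesis"
  have Ci: "irr n C" "C \<subseteq> torus n" using C by (auto simp: codim1_def irr_def)
  have inv: "z(j := s) \<in> C" if j: "j < n" and z: "z \<in> C" and s: "s \<noteq> 0" for j z s
  proof -
    obtain r where r: "r \<in> laur (others n j)" "\<forall>z\<in>C. cev z r = 0" "r \<noteq> 0" using neg j by blast
    have rn: "r \<in> laur {..<n}" using r(1) laur_mono[of "others n j" "{..<n}"] by blast
    let ?D = "{z(j := s) | z s. z \<in> C \<and> s \<noteq> 0}"
    have D: "irr n ?D" by (rule irr_coordinate_orbit[OF j Ci(1)])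
    then have DT: "?D \<subseteq> zclosure n ?D" by (intro zclosure_subset) (auto simp: irr_def)
    have "C \<subseteq> ?D"
    proof
      fix z assume z: "z \<in> C"
      then have "z = z(j := z j)" "z j \<noteq> 0" using Ci torus_nonzero by auto
      then show "z \<in> ?D" using z by blast
    qed
    \<comment> \<open>The closure of the orbit is irreducible and contains \<open>C\<close>. It is
      not the torus, since \<open>r\<close> ignores coordinate \<open>j\<close> and vanishes on it;
      maximality leaves only \<open>C\<close> itself.\<close>
    then have "C \<subseteq> zclosure n ?D" using DT by blast
    then have "zclosure n ?D = C \<or> zclosure n ?D = torus n"
      using C irr_zclosure[OF D] zclosed_zclosure unfolding codim1_def by blast
    moreover have "zclosure n ?D \<noteq> torus n"
    proof -
      have "\<forall>w\<in>?D. cev w r = 0" using r(2) eval_upd[OF coeff_hom_id r(1)] by auto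
      then have "\<forall>w\<in>zclosure n ?D. cev w r = 0" using rn unfolding zclosure_def by blast
      then show ?thesis using torus_nonvanishing[OF rn r(3)] by blast
    qed
    moreover have "z(j := s) \<in> ?D" using z s by blast
    ultimately show ?thesis using DT by blast
  qed
  obtain z where z: "z \<in> C" using Ci by (auto simp: irr_def)
  have "torus n \<subseteq> C"
  proof
    fix w assume w: "w \<in> torus n"
    \<comment> \<open>The coordinates of \<open>z\<close> are exchanged for those of
      \<open>w\<close> one after another without leaving \<open>C\<close>.\<close>
    have "m \<le> n \<Longrightarrow> (\<lambda>i. if i < m then w i else z i) \<in> C" for m
    proof (induction m)
      case (Suc m)
      have "(\<lambda>i. if i < Suc m then w i else z i) = (\<lambda>i. if i < m then w i else z i)(m := w m)"
        by (auto simp: less_Suc_eq)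
      then show ?case using inv[of m _ "w m"] Suc torus_nonzero[OF w] by auto
    qed (use z in auto)
    moreover have "(\<lambda>i. if i < n then w i else z i) = w" using w z Ci(2) by (force simp: torus_def)
    ultimately show "w \<in> C" by (metis order_refl)
  qed
  then show False using C Ci unfolding codim1_def by blast
qed

section \<open>Integral gcds on complex hypersurfaces\<close>

definition complexify :: "int laurent \<Rightarrow> complex laurent" where
  "complexify f = (\<Sum>u\<in>Poly_Mapping.keys f. Poly_Mapping.single u (of_int (Poly_Mapping.lookup f u)))"

lemma lookup_complexify: "Poly_Mapping.lookup (complexify f) u = of_int (Poly_Mapping.lookup f u)"
proof -
  have "Poly_Mapping.lookup (complexify f) u = (\<Sum>v\<in>Poly_Mapping.keys f. if v = u then of_int (Poly_Mapping.lookup f u) else 0)"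
    unfolding complexify_def lookup_sum by (intro sum.cong) (auto simp: lookup_single)
  then show ?thesis by (auto simp: in_keys_iff)
qed

lemma keys_complexify: "Poly_Mapping.keys (complexify f) = Poly_Mapping.keys f"
  by (auto simp: in_keys_iff lookup_complexify)

lemma complexify_in_laur: "complexify f \<in> laur J \<longleftrightarrow> f \<in> laur J"
  by (simp add: laur_def keys_complexify)

lemma eval_complexify: "cev z (complexify f) = zev z f"
  by (simp add: eval_at_def keys_complexify lookup_complexify)

lemma complexify_eq_0: "complexify f = 0 \<longleftrightarrow> f = 0"
  by (simp add: poly_mapping_eq_iff fun_eq_iff lookup_complexify)

lemma irr_int:
  assumes "irr n S" "f \<in> laur {..<n}" "g \<in> laur {..<n}" "\<forall>z\<in>S. zev z f * zev z g = 0"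
  shows "(\<forall>z\<in>S. zev z f = 0) \<or> (\<forall>z\<in>S. zev z g = 0)"
  using assms unfolding irr_def by (metis complexify_in_laur eval_complexify)

text \<open>If \<open>D\<close> were nonzero somewhere on \<open>C\<close>, the cofactors of all
  elements of \<open>E\<close> would vanish on \<open>C\<close> by irreducibility. A prime factor
  \<open>p\<close> of one cofactor that vanishes on \<open>C\<close> turns out to divide all of
  them, so \<open>D * p\<close> would be a common divisor. All factorizations are integral; only the
  evaluation on \<open>C\<close> is complex.\<close>

lemma codim1_subset_gcd:
  fixes D :: "int laurent"
  assumes C: "codim1 n C" and D: "D \<in> laur {..<n}" "D \<noteq> 0"
    and E: "E \<subseteq> laur {..<n}" "\<And>e. e \<in> E \<Longrightarrow> dvd_in (laur {..<n}) D e"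
    and gcd: "\<And>d. d \<in> laur {..<n} \<Longrightarrow> (\<And>e. e \<in> E \<Longrightarrow> dvd_in (laur {..<n}) d e) \<Longrightarrow> dvd_in (laur {..<n}) d D"
    and van: "\<And>e z. e \<in> E \<Longrightarrow> z \<in> C \<Longrightarrow> zev z e = 0" and z: "z \<in> C"
  shows "zev z D = 0"
proof (rule ccontr)
  assume ne: "zev z D \<noteq> 0"
  let ?L = "laur {..<n} :: int laurent set"
  have Ci: "irr n C" "C \<subseteq> torus n" using C by (auto simp: codim1_def irr_def)
  have nz: "\<And>z. z \<in> C \<Longrightarrow> \<forall>i. z i \<noteq> 0" using Ci torus_nonzero by blast
  define q where "q e = (SOME c. c \<in> ?L \<and> e = D * c)" for e
  have q: "q e \<in> ?L" "e = D * q e" if "e \<in> E" for e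
  proof -
    have "\<exists>c. c \<in> ?L \<and> e = D * c" using E(2)[OF that] by (auto simp: dvd_in_def)
    from someI_ex[OF this] show "q e \<in> ?L" "e = D * q e" unfolding q_def by auto
  qed
  have qv: "zev w (q e) = 0" if e: "e \<in> E" and w: "w \<in> C" for e w
  proof -
    have "\<forall>z\<in>C. zev z D * zev z (q e) = 0"
      using van[OF e] q(2)[OF e] eval_mult[OF coeff_hom_of_int nz] by metis
    then show ?thesis using irr_int[OF Ci(1) D(1) q(1)[OF e]] ne z w by blast
  qed
  \<comment> \<open>In this coordinate no nonzero Laurent polynomial in the others vanishes on
    \<open>C\<close>. Hence \<open>p\<close> must involve \<open>t_j\<close>, and eliminating it
    against a cofactor cannot leave a nonzero \<open>r\<close>.\<close>
  obtain j where j: "j < n" and dom: "\<And>r. r \<in> laur (others n j) \<Longrightarrow> (\<forall>z\<in>C. cev z r = 0) \<Longrightarrow> r = 0"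
    using codim1_dominant[OF C] by blast
  have domZ: "r = 0" if "r \<in> laur (others n j)" "\<And>z. z \<in> C \<Longrightarrow> zev z r = 0" for r
    using dom[of "complexify r"] that by (simp add: complexify_in_laur eval_complexify complexify_eq_0)
  \<comment> \<open>Were all of \<open>E\<close> zero, 0 would be a common divisor and would divide
    \<open>D\<close>.\<close>
  obtain e0 where e0: "e0 \<in> E" "e0 \<noteq> 0"
  proof -
    have "\<not> dvd_in ?L 0 D" using D by (auto simp: dvd_in_def)
    then obtain e where "e \<in> E" "\<not> dvd_in ?L 0 e" using gcd[of 0] laurD(1) by blast
    then show thesis using that laurD(1) by (metis dvd_in_def mult_zero_left)
  qed
  have q0: "q e0 \<noteq> 0" using q(2)[OF e0(1)] e0(2) by (metis mult_zero_right)
  obtain u ps where u: "u \<in> ?L" "dvd_in ?L u 1" "\<And>p. p \<in> set ps \<Longrightarrow> prime_in ?L p" "q e0 = u * prod_list ps"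
    using ufd_onI_prod[OF ufd_laur[OF finite_lessThan] q(1)[OF e0(1)] q0] by metis
  have "\<forall>w\<in>C. zev w (prod_list ps) = 0"
  proof
    fix w assume w: "w \<in> C"
    have "zev w u * zev w (prod_list ps) = 0"
      using qv[OF e0(1) w] eval_mult[OF coeff_hom_of_int nz[OF w]] u(4) by metis
    then show "zev w (prod_list ps) = 0" using eval_dvd_unit[OF coeff_hom_of_int u(2) nz[OF w]] by simp
  qed
  then have "\<exists>p\<in>set ps. \<forall>w\<in>C. zev w p = 0" using u(3)
  proof (induction ps)
    case Nil
    then show ?case using z by (simp add: eval_1[OF coeff_hom_of_int])
  next
    case (Cons p ps)
    have p: "p \<in> ?L" "\<And>p. p \<in> set ps \<Longrightarrow> p \<in> ?L" using Cons.prems(2) by (auto simp: prime_in_def)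
    then have ps: "prod_list ps \<in> ?L" by (intro subring_set_prod_list[OF subring_laur]) auto
    have "\<forall>w\<in>C. zev w p * zev w (prod_list ps) = 0"
      using Cons.prems(1) eval_mult[OF coeff_hom_of_int nz] by (metis prod_list.Cons)
    then show ?case using irr_int[OF Ci(1) p(1) ps] Cons by auto
  qed
  then obtain p where p: "prime_in ?L p" "\<And>w. w \<in> C \<Longrightarrow> zev w p = 0" using u(3) by blast
  have pL: "p \<in> ?L" "p \<noteq> 0" using p by (auto simp: prime_in_def)
  have ess: "essential_in n j p"
  proof (rule ccontr)
    assume "\<not> essential_in n j p"
    then obtain a k l where a: "a \<in> laur (others n j)" "a \<noteq> 0" "lvar j 1 ^ k * p = lvar j 1 ^ l * a"
      using ess_notE[OF j pL] by metis
    have "zev w a = 0" if w: "w \<in> C" for w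
    proof -
      have "zev w (lvar j 1 ^ l * a) = 0"
        unfolding a(3)[symmetric] eval_mult[OF coeff_hom_of_int nz[OF w]] using p(2)[OF w] by simp
      then show ?thesis
        unfolding eval_mult[OF coeff_hom_of_int nz[OF w]] eval_power[OF coeff_hom_of_int nz[OF w]] eval_lvar[OF coeff_hom_of_int]
        using nz[OF w] by simp
    qed
    then show False using domZ a by blast
  qed
  have pq: "dvd_in ?L p (q e)" if e: "e \<in> E" for e
  proof (rule ccontr)
    assume "\<not> ?thesis"
    then obtain x y r where r: "x \<in> ?L" "y \<in> ?L" "r \<in> laur (others n j)" "r \<noteq> 0" "x * p + y * q e = r"
      using ess_comb[OF j p(1) ess q(1)[OF e]] by blast
    have "zev w r = 0" if w: "w \<in> C" for w
      unfolding r(5)[symmetric] eval_add[OF coeff_hom_of_int] eval_mult[OF coeff_hom_of_int nz[OF w]]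
      using p(2)[OF w] qv[OF e w] by simp
    then show False using domZ r by blast
  qed
  have "dvd_in ?L (D * p) e" if e: "e \<in> E" for e
  proof -
    obtain c where "c \<in> ?L" "q e = p * c" using pq[OF e] by (auto simp: dvd_in_def)
    then show ?thesis using q(2)[OF e] by (intro dvd_inI[of c]) (auto simp: mult.assoc)
  qed
  then have "dvd_in ?L (D * p) D" using gcd laurD(4)[OF D(1) pL(1)] by blast
  then obtain c where c: "c \<in> ?L" "D = D * p * c" by (auto simp: dvd_in_def)
  then have "D * 1 = D * (p * c)" by (metis mult.assoc mult.right_neutral)
  then have "1 = p * c" using D(2) by (subst (asm) mult_left_cancel)
  then show False using p(1) dvd_inI[OF c(1)] unfolding prime_in_def by blast
qed

section \<open>Level sets of a coordinate\<close>

lemma irr_coordinate_level: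
  assumes j: "j < n" and w: "w \<noteq> 0"
  shows "irr n {z \<in> torus n. z j = w}" (is "irr n ?H")
proof -
  have red: "\<exists>f'\<in>laur (others n j). \<forall>z\<in>?H. cev z f = 0 \<longleftrightarrow> cev z f' = 0" if f: "f \<in> laur {..<n}" for f
  proof (cases "f = 0")
    case True
    then show ?thesis using laurD(1) by (intro bexI[of _ 0]) auto
  next
    case False
    obtain P k l where P: "P \<in> polys_over (laur (others n j))" "lvar j 1 ^ k * f = lvar j 1 ^ l * poly P (lvar j 1)"
      using laur_normal_form[OF j f False] by metis
    \<comment> \<open>The constant \<open>w\<close> is put in place of \<open>t_j\<close>. On the
      level set this changes values only by nonzero factors, and since the result is free of
      \<open>t_j\<close>, a vanishing product on the level set vanishes on the whole torus.\<close>
    let ?f' = "poly P (Poly_Mapping.single 0 w)"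
    have "?f' \<in> laur (others n j)" unfolding poly_altdef
      using P(1) by (intro subring_set_sum[OF subring_laur] laurD(4) laurD(7) single_in_laur exps_0) (auto simp: polys_over_def)
    moreover have "cev z f = 0 \<longleftrightarrow> cev z ?f' = 0" if z: "z \<in> ?H" for z
    proof -
      have nz: "\<forall>i. z i \<noteq> 0" and zj: "z j = w" using z torus_nonzero by auto
      have "cev z (lvar j 1) = w" "cev z (Poly_Mapping.single 0 w) = w"
        by (simp_all add: eval_lvar[OF coeff_hom_id] eval_single[OF coeff_hom_id] monom_at_0 zj)
      then have "cev z (lvar j 1 ^ k * f) = w ^ l * cev z ?f'"
        unfolding P(2) eval_mult[OF coeff_hom_id nz] eval_power[OF coeff_hom_id nz] eval_poly[OF coeff_hom_id nz] by simp
      moreover have "cev z (lvar j 1 ^ k * f) = w ^ k * cev z f"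
        unfolding eval_mult[OF coeff_hom_id nz] eval_power[OF coeff_hom_id nz] eval_lvar[OF coeff_hom_id] zj by simp
      ultimately have "w ^ k * cev z f = w ^ l * cev z ?f'" by simp
      then show ?thesis using w by (metis mult_eq_0_iff power_not_zero)
    qed
    ultimately show ?thesis by blast
  qed
  show ?thesis
    unfolding irr_def
  proof (intro conjI ballI impI)
    have "(\<lambda>_. 1)(j := w) \<in> torus n" using torus_upd[OF _ j w, of "\<lambda>_. 1"] by (auto simp: torus_def)
    then show "?H \<noteq> {}" by (metis (mono_tags, lifting) empty_iff fun_upd_same mem_Collect_eq)
    fix f g :: "complex laurent"
    assume f: "f \<in> laur {..<n}" and g: "g \<in> laur {..<n}" and fg: "\<forall>z\<in>?H. cev z f * cev z g = 0"
    obtain f' where f': "f' \<in> laur (others n j)" "\<And>z. z \<in> ?H \<Longrightarrow> cev z f = 0 \<longleftrightarrow> cev z f' = 0" using red[OF f] by blast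
    obtain g' where g': "g' \<in> laur (others n j)" "\<And>z. z \<in> ?H \<Longrightarrow> cev z g = 0 \<longleftrightarrow> cev z g' = 0" using red[OF g] by blast
    have fg': "f' * g' \<in> laur (others n j)" using laurD(4) f' g' by blast
    have "cev z (f' * g') = 0" if z: "z \<in> torus n" for z
    proof -
      have zH: "z(j := w) \<in> ?H" using torus_upd[OF z j w] by simp
      have nz: "\<forall>i. (z(j := w)) i \<noteq> 0" using torus_nonzero zH by blast
      have "cev (z(j := w)) f = 0 \<or> cev (z(j := w)) g = 0" using bspec[OF fg zH] by simp
      then have "cev (z(j := w)) f' = 0 \<or> cev (z(j := w)) g' = 0" using f'(2)[OF zH] g'(2)[OF zH] by blast
      then have "cev (z(j := w)) (f' * g') = 0"
        unfolding eval_mult[OF coeff_hom_id nz] by (metis mult_eq_0_iff)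
      then show ?thesis using eval_upd[OF coeff_hom_id fg', of j z w] by simp
    qed
    then have "f' * g' = 0" using torus_nonvanishing[of "f' * g'" n] fg' laur_mono[of "others n j" "{..<n}"] by blast
    then have "f' = 0 \<or> g' = 0" by simp
    then show "(\<forall>z\<in>?H. cev z f = 0) \<or> (\<forall>z\<in>?H. cev z g = 0)"
    proof
      assume "f' = 0"
      then have "cev z f = 0" if "z \<in> ?H" for z using f'(2)[OF that] eval_0[OF coeff_hom_id] by simp
      then show ?thesis by blast
    next
      assume "g' = 0"
      then have "cev z g = 0" if "z \<in> ?H" for z using g'(2)[OF that] eval_0[OF coeff_hom_id] by simp
      then show ?thesis by blast
    qed
  qed auto
qed

lemma zclosed_coordinate_level:
  assumes "j < n"
  shows "zclosed n {z \<in> torus n. z j = w}"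
proof -
  let ?f = "lvar j 1 - Poly_Mapping.single 0 w"
  have "?f \<in> laur {..<n}" using assms by (intro laurD(6) lvar_in_laur single_in_laur exps_0) auto
  moreover have "cev z ?f = z j - w" for z
    by (simp add: eval_diff[OF coeff_hom_id] eval_lvar[OF coeff_hom_id] eval_single[OF coeff_hom_id] monom_at_0)
  ultimately show ?thesis using zclosed_zeros[of "{?f}" n] by simp
qed

lemma coordinate_level_proper:
  assumes "j < n"
  shows "{z \<in> torus n. z j = w} \<noteq> torus n"
proof -
  obtain s :: complex where s: "s \<notin> {0, w}" using ex_new_if_finite[OF infinite_UNIV_char_0, of "{0, w}"] by blast
  have "(\<lambda>_. 1)(j := s) \<in> torus n" using torus_upd[OF _ assms, of "\<lambda>_. 1" s] s by (auto simp: torus_def)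
  then show ?thesis using s by (metis (mono_tags, lifting) fun_upd_same insert_iff mem_Collect_eq)
qed

lemma codim1_subset_level:
  assumes "codim1 n C" "j < n" "w \<noteq> 0" "C \<subseteq> {z \<in> torus n. z j = w}"
  shows "C = {z \<in> torus n. z j = w}"
proof -
  have "\<forall>Y. irr n Y \<and> zclosed n Y \<and> C \<subseteq> Y \<longrightarrow> Y = C \<or> Y = torus n"
    using assms(1) unfolding codim1_def by blast
  from spec[OF this, of "{z \<in> torus n. z j = w}"] show ?thesis
    using irr_coordinate_level[OF assms(2,3)] zclosed_coordinate_level[OF assms(2)]
      coordinate_level_proper[OF assms(2)] assms(4) by metis
qed

text \<open>An inessential \<open>f\<close> is a power of \<open>t_j\<close> times an element free
  of \<open>t_j\<close>, so all its exponents share the \<open>j\<close>-entry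
  \<open>l - k\<close>.\<close>

lemma essential_of_exponents:
  fixes f :: "('k::{idom,factorial_semiring}) laurent"
  assumes f: "f \<in> laur {..<n}" and j: "j < n" and u: "u \<in> Poly_Mapping.keys f" "v \<in> Poly_Mapping.keys f"
    "Poly_Mapping.lookup u j \<noteq> Poly_Mapping.lookup v j"
  shows "essential_in n j f"
proof (rule ccontr)
  assume "\<not> essential_in n j f"
  moreover have "f \<noteq> 0" using u by auto
  ultimately obtain a k l where a: "a \<in> laur (others n j)" "lvar j 1 ^ k * f = lvar j 1 ^ l * a"
    using ess_notE[OF j f] by metis
  have "Poly_Mapping.lookup u j + int k = int l" if "u \<in> Poly_Mapping.keys f" for u
  proof -
    have "f * lvar j 1 ^ k = a * lvar j 1 ^ l" using a(2) by (simp add: mult.commute)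
    then have "Poly_Mapping.lookup (f * lvar j 1 ^ k) (u + Poly_Mapping.single j (int k)) =
      Poly_Mapping.lookup (a * lvar j 1 ^ l) (u + Poly_Mapping.single j (int k))" by simp
    then have "Poly_Mapping.lookup f u = Poly_Mapping.lookup a (u + Poly_Mapping.single j (int k) - Poly_Mapping.single j (int l))"
      unfolding lvar_pow unfolding lvar_def lookup_mult_single by simp
    then have "u + Poly_Mapping.single j (int k) - Poly_Mapping.single j (int l) \<in> Poly_Mapping.keys a"
      using that by (simp add: in_keys_iff)
    then have "j \<notin> Poly_Mapping.keys (u + Poly_Mapping.single j (int k) - Poly_Mapping.single j (int l))"
      using a(1) by (auto simp: laur_def exps_def)
    then show ?thesis by (simp add: in_keys_iff lookup_add lookup_minus)
  qed
  from this[OF u(1)] this[OF u(2)] show False using u(3) by simp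
qed

lemma keys_sum_subset:
  assumes "\<And>i. i \<in> I \<Longrightarrow> Poly_Mapping.keys (f i) \<subseteq> S"
  shows "Poly_Mapping.keys (sum f I) \<subseteq> S"
  using assms
proof (induction I rule: infinite_finite_induct)
  case (insert i I)
  then show ?case using Poly_Mapping.keys_add[of "f i" "sum f I"] by auto
qed auto

lemma keys_single_subset: "x \<in> S \<Longrightarrow> Poly_Mapping.keys (Poly_Mapping.single x c) \<subseteq> S" by simp

section \<open>Characters evaluated on group rings\<close>

lemma char_value_superset:
  "finite K \<Longrightarrow> Poly_Mapping.keys f \<subseteq> K \<Longrightarrow> char_value \<rho> f = (\<Sum>x\<in>K. Poly_Mapping.lookup f x * \<rho> x)"
  unfolding char_value_def by (rule sum.mono_neutral_left) (auto simp: in_keys_iff)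

lemma char_value_single: "char_value \<rho> (Poly_Mapping.single x c) = c * \<rho> x"
  by (simp add: char_value_def)

lemma char_value_add: "char_value \<rho> (f + g) = char_value \<rho> f + char_value \<rho> g"
proof -
  let ?K = "Poly_Mapping.keys f \<union> Poly_Mapping.keys g"
  have K: "finite ?K" "Poly_Mapping.keys (f + g) \<subseteq> ?K" using Poly_Mapping.keys_add[of f g] by auto
  show ?thesis
    using K by (simp add: char_value_superset[of ?K "f + g"] char_value_superset[of ?K f] char_value_superset[of ?K g]
        lookup_add distrib_right flip: sum.distrib)
qed

lemma char_value_0: "char_value \<rho> 0 = 0" by (simp add: char_value_def)

lemma char_value_sum: "char_value \<rho> (sum f I) = (\<Sum>i\<in>I. char_value \<rho> (f i))"
  by (induction I rule: infinite_finite_induct) (auto simp: char_value_0 char_value_add)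

lemma char_value_diff: "char_value \<rho> (f - g) = char_value \<rho> f - char_value \<rho> g"
  using char_value_add[of \<rho> "f - g" g] by simp

lemma char_group_iff:
  "\<rho> \<in> carrier (char_group H) \<longleftrightarrow> \<rho> \<in> extensional (carrier H) \<and> (\<forall>x\<in>carrier H. \<rho> x \<noteq> 0) \<and>
     (\<forall>x\<in>carrier H. \<forall>y\<in>carrier H. \<rho> (x \<otimes>\<^bsub>H\<^esub> y) = \<rho> x * \<rho> y)"
proof -
  have "carrier (units_of complex_field) = {x. x \<noteq> 0}"
  proof -
    have "\<exists>y. y * x = 1 \<and> x * y = 1" if "x \<noteq> 0" for x :: complex
      using that by (intro exI[of _ "inverse x"]) simp
    then show ?thesis by (auto simp: units_of_def Units_def ring_of_type_algebra_def)
  qed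
  moreover have "x \<otimes>\<^bsub>units_of complex_field\<^esub> y = x * y" for x y
    by (simp add: units_of_def ring_of_type_algebra_def)
  ultimately show ?thesis by (auto simp: char_group_def hom_def)
qed

lemma char_one:
  assumes "group H" "\<rho> \<in> carrier (char_group H)"
  shows "\<rho> \<one>\<^bsub>H\<^esub> = 1"
proof -
  interpret group H by fact
  have "\<rho> (\<one>\<^bsub>H\<^esub> \<otimes>\<^bsub>H\<^esub> \<one>\<^bsub>H\<^esub>) = \<rho> \<one>\<^bsub>H\<^esub> * \<rho> \<one>\<^bsub>H\<^esub>" "\<rho> \<one>\<^bsub>H\<^esub> \<noteq> 0"
    using assms(2) unfolding char_group_iff by blast+
  then show ?thesis by simp
qed

lemma char_pow:
  assumes "group H" "\<rho> \<in> carrier (char_group H)" "x \<in> carrier H"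
  shows "\<rho> (x [^]\<^bsub>H\<^esub> (k::nat)) = \<rho> x ^ k"
proof -
  interpret group H by fact
  show ?thesis
    by (induction k) (use assms char_one[OF assms(1,2)] in \<open>auto simp: char_group_iff\<close>)
qed

lemma char_inv:
  assumes "group H" "\<rho> \<in> carrier (char_group H)" "x \<in> carrier H"
  shows "\<rho> (inv\<^bsub>H\<^esub> x) = inverse (\<rho> x)"
proof -
  interpret group H by fact
  have "\<rho> (x \<otimes>\<^bsub>H\<^esub> inv\<^bsub>H\<^esub> x) = \<rho> x * \<rho> (inv\<^bsub>H\<^esub> x)"
    using assms(2,3) inv_closed[OF assms(3)] unfolding char_group_iff by blast
  then have "\<rho> x * \<rho> (inv\<^bsub>H\<^esub> x) = 1" using assms char_one[OF assms(1,2)] by simp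
  then show ?thesis by (metis inverse_unique)
qed

lemma carrier_group_ring: "carrier (group_ring H) = {f. Poly_Mapping.keys f \<subseteq> carrier H}"
  by (simp add: group_ring_def)

lemma char_value_mult:
  assumes "\<rho> \<in> carrier (char_group H)" "f \<in> carrier (complex_group_ring H)" "g \<in> carrier (complex_group_ring H)"
  shows "char_value \<rho> (f \<otimes>\<^bsub>complex_group_ring H\<^esub> g) = char_value \<rho> f * char_value \<rho> g"
proof -
  have "char_value \<rho> (f \<otimes>\<^bsub>complex_group_ring H\<^esub> g) =
    (\<Sum>x\<in>Poly_Mapping.keys f. \<Sum>y\<in>Poly_Mapping.keys g. Poly_Mapping.lookup f x * Poly_Mapping.lookup g y * \<rho> (x \<otimes>\<^bsub>H\<^esub> y))"
    by (simp add: group_ring_def char_value_sum char_value_single)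
  also have "\<dots> = (\<Sum>x\<in>Poly_Mapping.keys f. \<Sum>y\<in>Poly_Mapping.keys g.
      (Poly_Mapping.lookup f x * \<rho> x) * (Poly_Mapping.lookup g y * \<rho> y))"
  proof (intro sum.cong refl)
    fix x y assume "x \<in> Poly_Mapping.keys f" "y \<in> Poly_Mapping.keys g"
    then have "\<rho> (x \<otimes>\<^bsub>H\<^esub> y) = \<rho> x * \<rho> y" using assms unfolding char_group_iff carrier_group_ring by blast
    then show "Poly_Mapping.lookup f x * Poly_Mapping.lookup g y * \<rho> (x \<otimes>\<^bsub>H\<^esub> y) =
      (Poly_Mapping.lookup f x * \<rho> x) * (Poly_Mapping.lookup g y * \<rho> y)" by simp
  qed
  finally show ?thesis by (simp add: char_value_def sum_product)
qed

lemma group_ring_mult_closed: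
  fixes f g :: "'a \<Rightarrow>\<^sub>0 'r::comm_ring_1"
  assumes "group H" "f \<in> carrier (group_ring H)" "g \<in> carrier (group_ring H)"
  shows "f \<otimes>\<^bsub>group_ring H\<^esub> g \<in> carrier (group_ring H)"
proof -
  interpret group H by fact
  have "Poly_Mapping.keys (Poly_Mapping.single (x \<otimes>\<^bsub>H\<^esub> y) (c :: 'r)) \<subseteq> carrier H"
    if "x \<in> Poly_Mapping.keys f" "y \<in> Poly_Mapping.keys g" for x y c
    using that assms(2,3) by (auto simp: carrier_group_ring)
  then show ?thesis
    unfolding group_ring_def by (simp add: keys_sum_subset)
qed

lemma single_in_group_ring: "x \<in> carrier H \<Longrightarrow> Poly_Mapping.single x c \<in> carrier (group_ring H)"
  by (simp add: carrier_group_ring)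

section \<open>The Zariski topology\<close>

abbreviation nonvanishing :: "('a, 'm) monoid_scheme \<Rightarrow> ('a \<Rightarrow>\<^sub>0 complex) \<Rightarrow> ('a \<Rightarrow> complex) set" where
  "nonvanishing H f \<equiv> {\<rho> \<in> carrier (char_group H). char_value \<rho> f \<noteq> 0}"

lemma zariski_basic_open: "f \<in> carrier (complex_group_ring H) \<Longrightarrow> openin (zariski H) (nonvanishing H f)"
  unfolding zariski_def openin_topology_generated_by_iff by (intro generate_topology_on.Basis) blast

text \<open>The generating sets form a basis, since nonvanishing of two functions is nonvanishing of
  their product.\<close>

lemma zariski_base:
  assumes "group H" "openin (zariski H) U" "\<rho> \<in> U"
  shows "\<exists>f\<in>carrier (complex_group_ring H). \<rho> \<in> nonvanishing H f \<and> nonvanishing H f \<subseteq> U"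
proof -
  have "generate_topology_on (nonvanishing H ` carrier (complex_group_ring H)) U"
    using assms(2) unfolding zariski_def openin_topology_generated_by_iff .
  then show ?thesis using assms(3)
  proof (induction arbitrary: \<rho>)
    case (Int a b)
    obtain f g where f: "f \<in> carrier (complex_group_ring H)" "\<rho> \<in> nonvanishing H f" "nonvanishing H f \<subseteq> a"
      and g: "g \<in> carrier (complex_group_ring H)" "\<rho> \<in> nonvanishing H g" "nonvanishing H g \<subseteq> b"
      using Int by blast
    have eq: "nonvanishing H (f \<otimes>\<^bsub>complex_group_ring H\<^esub> g) = nonvanishing H f \<inter> nonvanishing H g"
      using char_value_mult[OF _ f(1) g(1)] by auto
    show ?case
      using f g group_ring_mult_closed[OF assms(1) f(1) g(1)] eq
      by (intro bexI[of _ "f \<otimes>\<^bsub>complex_group_ring H\<^esub> g"]) auto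
  next
    case (UN K)
    then show ?case by (meson Union_iff Union_upper order_trans)
  qed auto
qed

lemma topspace_zariski:
  assumes "group H"
  shows "topspace (zariski H) = carrier (char_group H)"
proof -
  interpret group H by fact
  have "nonvanishing H (Poly_Mapping.single \<one>\<^bsub>H\<^esub> 1) = carrier (char_group H)"
  proof -
    have "\<rho> \<one>\<^bsub>H\<^esub> \<noteq> 0" if "\<rho> \<in> carrier (char_group H)" for \<rho> using char_one[OF assms that] by simp
    then show ?thesis by (auto simp: char_value_single)
  qed
  moreover have "Poly_Mapping.single \<one>\<^bsub>H\<^esub> 1 \<in> carrier (complex_group_ring H)" by (intro single_in_group_ring) simp
  ultimately show ?thesis
    unfolding zariski_def topology_generated_by_topspace by blast
qed

lemma zariski_closed_zeros:
  assumes "group H" "f \<in> carrier (complex_group_ring H)"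
  shows "closedin (zariski H) {\<rho> \<in> carrier (char_group H). char_value \<rho> f = 0}"
  unfolding closedin_def topspace_zariski[OF assms(1)]
proof
  have "carrier (char_group H) - {\<rho> \<in> carrier (char_group H). char_value \<rho> f = 0} = nonvanishing H f" by auto
  then show "openin (zariski H) (carrier (char_group H) - {\<rho> \<in> carrier (char_group H). char_value \<rho> f = 0})"
    using zariski_basic_open[OF assms(2)] by simp
qed auto

lemma zariski_closed_separate:
  assumes "group H" "closedin (zariski H) A" "\<rho> \<in> carrier (char_group H)" "\<rho> \<notin> A"
  shows "\<exists>f\<in>carrier (complex_group_ring H). char_value \<rho> f \<noteq> 0 \<and> (\<forall>\<sigma>\<in>A. char_value \<sigma> f = 0)"
proof -
  have "openin (zariski H) (carrier (char_group H) - A)" "A \<subseteq> carrier (char_group H)"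
    using assms(2) topspace_zariski[OF assms(1)] by (auto simp: closedin_def)
  then show ?thesis using zariski_base[OF assms(1), of "carrier (char_group H) - A" \<rho>] assms(3,4) by blast
qed

lemma zariski_closedI:
  assumes "group H" "A \<subseteq> carrier (char_group H)"
    and "\<And>\<rho>. \<rho> \<in> carrier (char_group H) \<Longrightarrow> \<rho> \<notin> A \<Longrightarrow>
      \<exists>f\<in>carrier (complex_group_ring H). char_value \<rho> f \<noteq> 0 \<and> (\<forall>\<sigma>\<in>A. char_value \<sigma> f = 0)"
  shows "closedin (zariski H) A"
  unfolding closedin_def topspace_zariski[OF assms(1)]
proof (intro conjI assms(2), subst openin_subopen, intro ballI)
  fix \<rho> assume \<rho>: "\<rho> \<in> carrier (char_group H) - A"
  then obtain f where f: "f \<in> carrier (complex_group_ring H)" "char_value \<rho> f \<noteq> 0" "\<forall>\<sigma>\<in>A. char_value \<sigma> f = 0"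
    using assms(3) by blast
  then show "\<exists>T. openin (zariski H) T \<and> \<rho> \<in> T \<and> T \<subseteq> carrier (char_group H) - A"
    using \<rho> zariski_basic_open[OF f(1)] by (intro exI[of _ "nonvanishing H f"]) auto
qed

text \<open>For a set that is not closed and irreducible there are no chains, and the supremum is
  the default 0; the value 1 thus contains both properties.\<close>

lemma codimension_1D:
  assumes "codimension T Z = 1"
  shows "closedin T Z" "irreducible_in T Z"
proof -
  let ?A = "{enat k | k. \<exists>Y. Y 0 = Z \<and> (\<forall>i\<le>k. closedin T (Y i) \<and> irreducible_in T (Y i)) \<and> (\<forall>i<k. Y i \<subset> Y (Suc i))}"
  have "?A \<noteq> {}"
  proof
    assume "?A = {}"
    then have "codimension T Z = 0" unfolding codimension_def by (metis Sup_empty bot_enat_def)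
    then show False using assms by simp
  qed
  then obtain k Y where "Y 0 = Z" "\<forall>i\<le>(k::nat). closedin T (Y i) \<and> irreducible_in T (Y i)" by blast
  then show "closedin T Z" "irreducible_in T Z" by auto
qed

text \<open>A chain of length at least two can be cut down to its first two steps. The supremum is 1
  exactly when the length 1 occurs and no length from 2 on does, which also excludes an infinite
  supremum.\<close>

lemma codimension_eq_1_iff:
  "codimension T Z = 1 \<longleftrightarrow>
    closedin T Z \<and> irreducible_in T Z \<and>
    (\<exists>Y. closedin T Y \<and> irreducible_in T Y \<and> Z \<subset> Y) \<and>
    (\<nexists>Y Y'. closedin T Y \<and> irreducible_in T Y \<and> closedin T Y' \<and> irreducible_in T Y' \<and> Z \<subset> Y \<and> Y \<subset> Y')"
  (is "?L \<longleftrightarrow> ?R")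
proof -
  define A where "A = {k. \<exists>Y. Y 0 = Z \<and> (\<forall>i\<le>k. closedin T (Y i) \<and> irreducible_in T (Y i)) \<and> (\<forall>i<k. Y i \<subset> Y (Suc i))}"
  have cod: "codimension T Z = Sup (enat ` A)"
    unfolding codimension_def A_def by (rule arg_cong[where f = Sup]) auto
  have A0: "0 \<in> A \<longleftrightarrow> closedin T Z \<and> irreducible_in T Z"
    unfolding A_def by (auto intro!: exI[of _ "\<lambda>_. Z"])
  have A1: "1 \<in> A \<longleftrightarrow> closedin T Z \<and> irreducible_in T Z \<and> (\<exists>Y. closedin T Y \<and> irreducible_in T Y \<and> Z \<subset> Y)"
  proof
    assume "1 \<in> A"
    then obtain Y where Y: "Y 0 = Z" "\<forall>i\<le>Suc 0. closedin T (Y i) \<and> irreducible_in T (Y i)" "Y 0 \<subset> Y (Suc 0)"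
      unfolding A_def by auto
    then show "closedin T Z \<and> irreducible_in T Z \<and> (\<exists>Y. closedin T Y \<and> irreducible_in T Y \<and> Z \<subset> Y)" by auto
  next
    assume "closedin T Z \<and> irreducible_in T Z \<and> (\<exists>Y. closedin T Y \<and> irreducible_in T Y \<and> Z \<subset> Y)"
    then obtain Y where "closedin T Z" "irreducible_in T Z" "closedin T Y" "irreducible_in T Y" "Z \<subset> Y" by blast
    then show "1 \<in> A" unfolding A_def by (auto intro!: exI[of _ "\<lambda>i. if i = 0 then Z else Y"])
  qed
  have A2: "(\<exists>k\<in>A. k \<ge> 2) \<longleftrightarrow> closedin T Z \<and> irreducible_in T Z \<and>
    (\<exists>Y Y'. closedin T Y \<and> irreducible_in T Y \<and> closedin T Y' \<and> irreducible_in T Y' \<and> Z \<subset> Y \<and> Y \<subset> Y')"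
  proof
    assume "\<exists>k\<in>A. k \<ge> 2"
    then obtain k Y where k: "k \<ge> 2" "Y 0 = Z" "\<forall>i\<le>k. closedin T (Y i) \<and> irreducible_in T (Y i)" "\<forall>i<k. Y i \<subset> Y (Suc i)"
      unfolding A_def by auto
    then have "Z \<subset> Y 1" "Y 1 \<subset> Y 2" by (auto dest: spec[of _ 0] spec[of _ 1] simp: numeral_2_eq_2)
    then show "closedin T Z \<and> irreducible_in T Z \<and>
      (\<exists>Y Y'. closedin T Y \<and> irreducible_in T Y \<and> closedin T Y' \<and> irreducible_in T Y' \<and> Z \<subset> Y \<and> Y \<subset> Y')"
      using k by (metis le_trans nat_le_linear not_less_eq_eq one_le_numeral zero_le)
  next
    assume "closedin T Z \<and> irreducible_in T Z \<and>
      (\<exists>Y Y'. closedin T Y \<and> irreducible_in T Y \<and> closedin T Y' \<and> irreducible_in T Y' \<and> Z \<subset> Y \<and> Y \<subset> Y')"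
    then obtain Y Y' where "closedin T Z" "irreducible_in T Z" "closedin T Y" "irreducible_in T Y"
      "closedin T Y'" "irreducible_in T Y'" "Z \<subset> Y" "Y \<subset> Y'" by blast
    then have "2 \<in> A" unfolding A_def
      by (auto intro!: exI[of _ "\<lambda>i. if i = 0 then Z else if i = 1 then Y else Y'"] simp: less_2_cases_iff)
    then show "\<exists>k\<in>A. k \<ge> 2" by blast
  qed
  have "codimension T Z = 1 \<longleftrightarrow> 1 \<in> A \<and> \<not> (\<exists>k\<in>A. k \<ge> 2)"
  proof
    assume c: "codimension T Z = 1"
    have le: "k \<le> 1" if "k \<in> A" for k
      using Sup_upper[of "enat k" "enat ` A"] that c cod by (simp add: one_enat_def)
    have "1 \<in> A"
    proof (rule ccontr)
      assume "1 \<notin> A"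
      then have "\<forall>k\<in>A. k = 0" using le by (metis One_nat_def le_Suc_eq le_zero_eq)
      then have "Sup (enat ` A) \<le> 0" by (intro Sup_least) (auto simp: zero_enat_def)
      then show False using c cod by simp
    qed
    then show "1 \<in> A \<and> \<not> (\<exists>k\<in>A. k \<ge> 2)" using le by fastforce
  next
    assume a: "1 \<in> A \<and> \<not> (\<exists>k\<in>A. k \<ge> 2)"
    have "Sup (enat ` A) \<le> 1"
    proof (intro Sup_least)
      fix x assume "x \<in> enat ` A"
      then obtain k where "k \<in> A" "x = enat k" by blast
      moreover have "k \<le> 1" using a \<open>k \<in> A\<close> by (metis Suc_1 not_less_eq_eq)
      ultimately show "x \<le> 1" by (simp add: one_enat_def)
    qed
    moreover have "1 \<le> Sup (enat ` A)" using a Sup_upper[of "enat 1" "enat ` A"] by (simp add: one_enat_def)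
    ultimately show "codimension T Z = 1" using cod by simp
  qed
  then show ?thesis using A1 A2 by blast
qed

section \<open>Coordinates on the identity component\<close>

text \<open>Instantiated both for \<open>G\<close>, whose characters may form several components,
  and for its free abelian quotient. \<open>\<pi>_kernel\<close> bounds the order of character
  values on the kernel of \<open>\<pi>\<close>; it is what separates the identity component from the
  others.\<close>

locale torus_coordinates = group K for K (structure) +
  fixes n :: nat and \<pi> :: "'a \<Rightarrow> (nat \<Rightarrow>\<^sub>0 int)"
  assumes \<pi>_mult: "\<And>x y. x \<in> carrier K \<Longrightarrow> y \<in> carrier K \<Longrightarrow> \<pi> (x \<otimes> y) = \<pi> x + \<pi> y"
    and \<pi>_image: "\<pi> ` carrier K = exps {..<n}"
    and \<pi>_kernel: "\<And>x. x \<in> carrier K \<Longrightarrow> \<pi> x = 0 \<Longrightarrow> \<exists>N>0. \<forall>\<rho>\<in>carrier (char_group K). \<rho> x ^ N = 1"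
begin

definition pull :: "(nat \<Rightarrow> complex) \<Rightarrow> 'a \<Rightarrow> complex" where
  "pull z = (\<lambda>x\<in>carrier K. monom_at z (\<pi> x))"

definition push :: "('a \<Rightarrow>\<^sub>0 'r::idom) \<Rightarrow> 'r laurent" where
  "push f = (\<Sum>x\<in>Poly_Mapping.keys f. Poly_Mapping.single (\<pi> x) (Poly_Mapping.lookup f x))"

lemma \<pi>_in_exps: "x \<in> carrier K \<Longrightarrow> \<pi> x \<in> exps {..<n}"
  using \<pi>_image by blast

lemma pull_in_chars: "z \<in> torus n \<Longrightarrow> pull z \<in> carrier (char_group K)"
  unfolding char_group_iff pull_def
  using torus_nonzero[of z n] by (auto simp: monom_at_nonzero monom_at_add \<pi>_mult)

lemma push_in_laur: "f \<in> carrier (group_ring K) \<Longrightarrow> push f \<in> laur {..<n}"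
  unfolding push_def carrier_group_ring
  by (intro subring_set_sum[OF subring_laur] single_in_laur \<pi>_in_exps) auto

lemma eval_push: "f \<in> carrier (complex_group_ring K) \<Longrightarrow> cev z (push f) = char_value (pull z) f"
  unfolding push_def eval_sum[OF coeff_hom_id] eval_single[OF coeff_hom_id] char_value_def pull_def carrier_group_ring
  by (intro sum.cong) auto

lemma push_surj:
  assumes "F \<in> laur {..<n}"
  shows "\<exists>f\<in>carrier (group_ring K). \<forall>z. char_value (pull z) f = cev z F"
proof -
  have "\<forall>u\<in>exps {..<n}. \<exists>x\<in>carrier K. \<pi> x = u" using \<pi>_image by (metis imageE)
  then obtain s where s: "\<And>u. u \<in> exps {..<n} \<Longrightarrow> s u \<in> carrier K \<and> \<pi> (s u) = u" by metis
  have kF: "Poly_Mapping.keys F \<subseteq> exps {..<n}" using assms by (auto simp: laur_def)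
  let ?f = "\<Sum>u\<in>Poly_Mapping.keys F. Poly_Mapping.single (s u) (Poly_Mapping.lookup F u)"
  have "?f \<in> carrier (group_ring K)" unfolding carrier_group_ring
    by (intro CollectI keys_sum_subset keys_single_subset) (use s kF in blast)
  moreover have "char_value (pull z) ?f = cev z F" for z
    unfolding char_value_sum char_value_single eval_at_def
    using s kF by (intro sum.cong) (auto simp: pull_def)
  ultimately show ?thesis by blast
qed

lemma pull_inj:
  assumes "z \<in> torus n" "w \<in> torus n" "pull z = pull w"
  shows "z = w"
proof
  fix i
  show "z i = w i"
  proof (cases "i < n")
    case True
    then obtain x where x: "x \<in> carrier K" "\<pi> x = Poly_Mapping.single i 1"
      using \<pi>_image single_in_exps[of i "{..<n}" 1] by (metis imageE lessThan_iff)
    then show ?thesis using fun_cong[OF assms(3), of x] by (simp add: pull_def monom_at_single)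
  qed (use assms in \<open>auto simp: torus_def\<close>)
qed

lemma inj_on_pull: "inj_on pull (torus n)" using pull_inj by (auto intro: inj_onI)

text \<open>Such a character factors through the lattice of exponents, where it is determined by its
  nonzero values at the unit vectors; these values are the coordinates \<open>z\<close>.\<close>

lemma kernel_chars:
  assumes \<rho>: "\<rho> \<in> carrier (char_group K)" and ker: "\<And>x. x \<in> carrier K \<Longrightarrow> \<pi> x = 0 \<Longrightarrow> \<rho> x = 1"
  shows "\<rho> \<in> pull ` torus n"
proof -
  have dep: "\<rho> x = \<rho> y" if "x \<in> carrier K" "y \<in> carrier K" "\<pi> x = \<pi> y" for x y
  proof -
    have "\<pi> (x \<otimes> inv y) + \<pi> y = \<pi> x" using \<pi>_mult[of "x \<otimes> inv y" y] that by (simp add: m_assoc)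
    then have "\<rho> (x \<otimes> inv y) = 1" using ker that by simp
    then have "\<rho> x * inverse (\<rho> y) = 1" using \<rho> that char_inv[OF is_group \<rho>] unfolding char_group_iff by simp
    then show ?thesis using \<rho> that unfolding char_group_iff by (metis inverse_inverse_eq inverse_unique mult.commute)
  qed
  have "\<forall>u\<in>exps {..<n}. \<exists>x\<in>carrier K. \<pi> x = u" using \<pi>_image by (metis imageE)
  then obtain s where s: "\<And>u. u \<in> exps {..<n} \<Longrightarrow> s u \<in> carrier K" "\<And>u. u \<in> exps {..<n} \<Longrightarrow> \<pi> (s u) = u" by metis
  define r where "r u = \<rho> (s u)" for u
  have r_add: "r (u + v) = r u * r v" if "u \<in> exps {..<n}" "v \<in> exps {..<n}" for u v
  proof -
    have "\<pi> (s (u + v)) = \<pi> (s u \<otimes> s v)" using s \<pi>_mult that exps_add by metis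
    then have "r (u + v) = \<rho> (s u \<otimes> s v)" unfolding r_def using dep s that exps_add by (metis m_closed)
    then show ?thesis using \<rho> s that unfolding r_def char_group_iff by simp
  qed
  have r_nz: "r u \<noteq> 0" if "u \<in> exps {..<n}" for u using \<rho> s that unfolding r_def char_group_iff by simp
  have r0: "r 0 = 1" using r_add[of 0 0] r_nz[OF exps_0] exps_0 by simp
  define z where "z i = (if i < n then r (Poly_Mapping.single i 1) else 1)" for i
  have zT: "z \<in> torus n" using r_nz single_in_exps by (auto simp: torus_def z_def)
  have pos: "r (Poly_Mapping.single i (int k)) = z i ^ k" if i: "i < n" for i k
  proof (induction k)
    case (Suc k)
    have "Poly_Mapping.single i (int (Suc k)) = Poly_Mapping.single i 1 + Poly_Mapping.single i (int k)"
      by (simp add: single_add)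
    then show ?case using Suc r_add[of "Poly_Mapping.single i 1" "Poly_Mapping.single i (int k)"] i
      by (simp add: single_in_exps z_def)
  qed (simp add: r0)
  have single: "r (Poly_Mapping.single i k) = z i powi k" if i: "i < n" for i k
  proof (cases "k \<ge> 0")
    case True
    then show ?thesis using pos[OF i, of "nat k"] by (simp add: power_int_def)
  next
    case False
    have "r (Poly_Mapping.single i k + Poly_Mapping.single i (- k)) = r (Poly_Mapping.single i k) * r (Poly_Mapping.single i (- k))"
      using i by (intro r_add single_in_exps) auto
    moreover have "Poly_Mapping.single i k + Poly_Mapping.single i (- k) = 0" by (simp flip: single_add)
    moreover have "r (Poly_Mapping.single i (- k)) = z i ^ nat (- k)" using pos[OF i, of "nat (- k)"] False by simp
    ultimately have "z i ^ nat (- k) * r (Poly_Mapping.single i k) = 1" using r0 by (metis mult.commute)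
    then have "inverse (z i ^ nat (- k)) = r (Poly_Mapping.single i k)" by (rule inverse_unique)
    then show ?thesis using False by (simp add: power_int_def power_inverse)
  qed
  have fin: "I \<subseteq> {..<n} \<Longrightarrow> r (\<Sum>i\<in>I. Poly_Mapping.single i (c i)) = (\<Prod>i\<in>I. z i powi c i)" if "finite I" for I c
    using that
  proof (induction I)
    case (insert i I)
    have "(\<Sum>i\<in>I. Poly_Mapping.single i (c i)) \<in> exps {..<n}"
      unfolding exps_def using insert by (intro CollectI keys_sum_subset keys_single_subset) blast
    then show ?case using insert by (simp add: r_add single_in_exps single)
  qed (simp add: r0)
  have "\<rho> = pull z"
  proof
    fix x
    show "\<rho> x = pull z x"
    proof (cases "x \<in> carrier K")
      case True
      have k: "Poly_Mapping.keys (\<pi> x) \<subseteq> {..<n}" using \<pi>_in_exps[OF True] by (simp add: exps_def)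
      have "\<rho> x = r (\<pi> x)" unfolding r_def using dep True s \<pi>_in_exps by metis
      also have "\<dots> = monom_at z (\<pi> x)"
        using fin[OF finite_keys k, of "Poly_Mapping.lookup (\<pi> x)"] poly_mapping_sum_single[of "\<pi> x"]
        by (simp add: monom_at_def)
      finally show ?thesis using True by (simp add: pull_def)
    next
      case False
      then show ?thesis using \<rho> by (auto simp: char_group_iff pull_def extensional_def)
    qed
  qed
  then show ?thesis using zT by blast
qed

lemma pull_kernel: "x \<in> carrier K \<Longrightarrow> \<pi> x = 0 \<Longrightarrow> pull z x = 1"
  by (simp add: pull_def monom_at_0)

text \<open>At a kernel element \<open>x\<close> every character value is a root of
  \<open>t^N - 1 = (t - 1)(1 + ... + t^(N-1))\<close>. By irreducibility one of the two factors
  vanishes on all of \<open>Y\<close>, and the second has the nonzero value \<open>N\<close> at a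
  point of the identity component.\<close>

lemma irreducible_meets_component:
  assumes Y: "irreducible_in (zariski K) Y" and ne: "Y \<inter> pull ` torus n \<noteq> {}"
  shows "Y \<subseteq> pull ` torus n"
proof
  fix \<rho> assume \<rho>: "\<rho> \<in> Y"
  have YC: "Y \<subseteq> carrier (char_group K)" using Y topspace_zariski[OF is_group] by (auto simp: irreducible_in_def)
  show "\<rho> \<in> pull ` torus n"
  proof (rule kernel_chars)
    show "\<rho> \<in> carrier (char_group K)" using YC \<rho> by blast
    fix x assume x: "x \<in> carrier K" "\<pi> x = 0"
    obtain N where N: "N > 0" "\<And>\<sigma>. \<sigma> \<in> carrier (char_group K) \<Longrightarrow> \<sigma> x ^ N = 1" using \<pi>_kernel[OF x] by blast
    let ?f = "Poly_Mapping.single x 1 - Poly_Mapping.single \<one> 1 :: 'a \<Rightarrow>\<^sub>0 complex"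
    let ?g = "\<Sum>i<N. Poly_Mapping.single (x [^] i) 1 :: 'a \<Rightarrow>\<^sub>0 complex"
    have f: "?f \<in> carrier (complex_group_ring K)"
      using x Poly_Mapping.keys_diff[of "Poly_Mapping.single x (1::complex)" "Poly_Mapping.single \<one> 1"]
      by (auto simp: carrier_group_ring)
    have g: "?g \<in> carrier (complex_group_ring K)"
      unfolding carrier_group_ring by (intro CollectI keys_sum_subset keys_single_subset nat_pow_closed x)
    have vf: "char_value \<sigma> ?f = \<sigma> x - 1" if "\<sigma> \<in> carrier (char_group K)" for \<sigma>
      using char_one[OF is_group that] by (simp add: char_value_diff char_value_single)
    have vg: "char_value \<sigma> ?g = (\<Sum>i<N. \<sigma> x ^ i)" if "\<sigma> \<in> carrier (char_group K)" for \<sigma>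
      using char_pow[OF is_group that x(1)] by (simp add: char_value_sum char_value_single)
    let ?A = "\<lambda>f. {\<rho> \<in> carrier (char_group K). char_value \<rho> f = 0}"
    have "Y \<subseteq> ?A ?f \<union> ?A ?g"
    proof
      fix \<sigma> assume "\<sigma> \<in> Y"
      then have \<sigma>: "\<sigma> \<in> carrier (char_group K)" using YC by blast
      have "(\<sigma> x - 1) * (\<Sum>i<N. \<sigma> x ^ i) = 0" using N(2)[OF \<sigma>] power_diff_1_eq[of "\<sigma> x" N] by simp
      then show "\<sigma> \<in> ?A ?f \<union> ?A ?g" using \<sigma> vf vg by auto
    qed
    then have "Y \<subseteq> ?A ?f \<or> Y \<subseteq> ?A ?g"
      using Y zariski_closed_zeros[OF is_group f] zariski_closed_zeros[OF is_group g] unfolding irreducible_in_def by blast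
    moreover have "\<not> Y \<subseteq> ?A ?g"
    proof
      assume "Y \<subseteq> ?A ?g"
      moreover obtain z where z: "z \<in> torus n" "pull z \<in> Y" using ne by blast
      ultimately have "(\<Sum>i<N. pull z x ^ i) = 0" using vg[of "pull z"] by auto
      then show False using pull_kernel[OF x] N(1) by simp
    qed
    ultimately have "char_value \<rho> ?f = 0" "\<rho> \<in> carrier (char_group K)" using \<rho> by blast+
    then show "\<rho> x = 1" using vf by simp
  qed
qed

lemma irreducible_pull_iff:
  assumes S: "S \<subseteq> torus n"
  shows "irreducible_in (zariski K) (pull ` S) \<longleftrightarrow> irr n S"
proof
  assume irr: "irreducible_in (zariski K) (pull ` S)"
  show "irr n S"
    unfolding irr_def
  proof (intro conjI ballI impI S)
    show "S \<noteq> {}" using irr by (auto simp: irreducible_in_def)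
    fix F G :: "complex laurent" assume FG: "F \<in> laur {..<n}" "G \<in> laur {..<n}" "\<forall>z\<in>S. cev z F * cev z G = 0"
    obtain f where f: "f \<in> carrier (complex_group_ring K)" "\<And>z. char_value (pull z) f = cev z F" using push_surj[OF FG(1)] by blast
    obtain g where g: "g \<in> carrier (complex_group_ring K)" "\<And>z. char_value (pull z) g = cev z G" using push_surj[OF FG(2)] by blast
    let ?A = "\<lambda>f. {\<rho> \<in> carrier (char_group K). char_value \<rho> f = 0}"
    have "pull ` S \<subseteq> ?A f \<union> ?A g"
      using FG(3) f(2) g(2) pull_in_chars S by (auto simp: subset_iff)
    then have "pull ` S \<subseteq> ?A f \<or> pull ` S \<subseteq> ?A g"
      using irr zariski_closed_zeros[OF is_group f(1)] zariski_closed_zeros[OF is_group g(1)] unfolding irreducible_in_def by blast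
    then show "(\<forall>z\<in>S. cev z F = 0) \<or> (\<forall>z\<in>S. cev z G = 0)" using f(2) g(2) by auto
  qed
next
  assume irr: "irr n S"
  show "irreducible_in (zariski K) (pull ` S)"
    unfolding irreducible_in_def topspace_zariski[OF is_group]
  proof (intro conjI allI impI)
    show "pull ` S \<subseteq> carrier (char_group K)" using pull_in_chars S by blast
    show "pull ` S \<noteq> {}" using irr by (auto simp: irr_def)
    fix A B assume AB: "closedin (zariski K) A \<and> closedin (zariski K) B \<and> pull ` S \<subseteq> A \<union> B"
    show "pull ` S \<subseteq> A \<or> pull ` S \<subseteq> B"
    proof (rule ccontr)
      assume "\<not> ?thesis"
      then obtain z w where z: "z \<in> S" "pull z \<notin> A" and w: "w \<in> S" "pull w \<notin> B" by blast
      obtain f where f: "f \<in> carrier (complex_group_ring K)" "char_value (pull z) f \<noteq> 0" "\<forall>\<sigma>\<in>A. char_value \<sigma> f = 0"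
        using zariski_closed_separate[OF is_group, of A "pull z"] AB z S pull_in_chars by blast
      obtain g where g: "g \<in> carrier (complex_group_ring K)" "char_value (pull w) g \<noteq> 0" "\<forall>\<sigma>\<in>B. char_value \<sigma> g = 0"
        using zariski_closed_separate[OF is_group, of B "pull w"] AB w S pull_in_chars by blast
      have "\<forall>z\<in>S. cev z (push f) * cev z (push g) = 0"
        using AB f(3) g(3) unfolding eval_push[OF f(1)] eval_push[OF g(1)] by auto
      then have "(\<forall>z\<in>S. cev z (push f) = 0) \<or> (\<forall>z\<in>S. cev z (push g) = 0)"
        using irr push_in_laur[OF f(1)] push_in_laur[OF g(1)] unfolding irr_def by blast
      then show False using f g z w eval_push by metis
    qed
  qed
qed

lemma closed_pull_iff:
  assumes S: "S \<subseteq> torus n"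
  shows "closedin (zariski K) (pull ` S) \<longleftrightarrow> zclosed n S"
proof
  assume cl: "closedin (zariski K) (pull ` S)"
  have "z \<in> S" if z: "z \<in> zclosure n S" for z
  proof (rule ccontr)
    assume "z \<notin> S"
    have zT: "z \<in> torus n" using z zclosure_torus by blast
    then have "pull z \<notin> pull ` S" using pull_inj S \<open>z \<notin> S\<close> by blast
    then obtain f where f: "f \<in> carrier (complex_group_ring K)" "char_value (pull z) f \<noteq> 0" "\<forall>\<sigma>\<in>pull ` S. char_value \<sigma> f = 0"
      using zariski_closed_separate[OF is_group cl pull_in_chars[OF zT]] by blast
    then have "\<forall>w\<in>S. cev w (push f) = 0" using eval_push[OF f(1)] by simp
    then have "cev z (push f) = 0" using z push_in_laur[OF f(1)] by (auto simp: zclosure_def)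
    then show False using f eval_push[OF f(1)] by simp
  qed
  then show "zclosed n S" using zclosure_subset[OF S] unfolding zclosed_def by blast
next
  assume cl: "zclosed n S"
  show "closedin (zariski K) (pull ` S)"
  proof (rule zariski_closedI[OF is_group])
    show "pull ` S \<subseteq> carrier (char_group K)" using pull_in_chars S by blast
    fix \<rho> assume \<rho>: "\<rho> \<in> carrier (char_group K)" "\<rho> \<notin> pull ` S"
    show "\<exists>f\<in>carrier (complex_group_ring K). char_value \<rho> f \<noteq> 0 \<and> (\<forall>\<sigma>\<in>pull ` S. char_value \<sigma> f = 0)"
    proof (cases "\<rho> \<in> pull ` torus n")
      case True
      then obtain z where z: "z \<in> torus n" "\<rho> = pull z" by blast
      then have "z \<notin> zclosure n S" using \<rho> cl unfolding zclosed_def by auto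
      then obtain F where F: "F \<in> laur {..<n}" "\<forall>w\<in>S. cev w F = 0" "cev z F \<noteq> 0" using z unfolding zclosure_def by blast
      then obtain f where "f \<in> carrier (complex_group_ring K)" "\<And>z. char_value (pull z) f = cev z F" using push_surj[OF F(1)] by blast
      then show ?thesis using F z by (metis (no_types, lifting) imageE)
    next
      case False
      \<comment> \<open>Off the identity component the function \<open>x - 1\<close>, for a kernel
        element \<open>x\<close>, separates: it vanishes at every point that comes from the
        torus.\<close>
      then obtain x where x: "x \<in> carrier K" "\<pi> x = 0" "\<rho> x \<noteq> 1" using kernel_chars[OF \<rho>(1)] by blast
      let ?f = "Poly_Mapping.single x 1 - Poly_Mapping.single \<one> 1 :: 'a \<Rightarrow>\<^sub>0 complex"
      have f: "?f \<in> carrier (complex_group_ring K)"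
        using x Poly_Mapping.keys_diff[of "Poly_Mapping.single x (1::complex)" "Poly_Mapping.single \<one> 1"]
        by (auto simp: carrier_group_ring)
      have vf: "char_value \<sigma> ?f = \<sigma> x - 1" if "\<sigma> \<in> carrier (char_group K)" for \<sigma>
        using char_one[OF is_group that] by (simp add: char_value_diff char_value_single)
      show ?thesis
        using f vf[OF \<rho>(1)] vf[OF pull_in_chars] pull_kernel[OF x(1,2)] x(3) S
        by (intro bexI[of _ ?f]) auto
    qed
  qed
qed

lemma closed_irreducible_as_pull:
  assumes "irreducible_in (zariski K) Y" "Y \<inter> pull ` torus n \<noteq> {}"
  obtains S where "irr n S" "Y = pull ` S" "closedin (zariski K) Y \<Longrightarrow> zclosed n S"
proof -
  let ?S = "{z \<in> torus n. pull z \<in> Y}"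
  have Y: "Y = pull ` ?S" using irreducible_meets_component[OF assms] by blast
  have "irr n ?S" using irreducible_pull_iff[of ?S] assms(1) Y by simp
  moreover have "closedin (zariski K) Y \<Longrightarrow> zclosed n ?S" using closed_pull_iff[of ?S] Y by simp
  ultimately show thesis using that Y by blast
qed

text \<open>A closed irreducible set above the image of \<open>S\<close> meets the identity
  component and so lies in it. The chains on the two sides therefore correspond, and the image of
  the torus ends them.\<close>

lemma codimension_pull_iff:
  assumes S: "S \<subseteq> torus n"
  shows "codimension (zariski K) (pull ` S) = 1 \<longleftrightarrow> codim1 n S"
proof -
  have sub: "pull ` S1 \<subseteq> pull ` S2 \<longleftrightarrow> S1 \<subseteq> S2" if "S1 \<subseteq> torus n" "S2 \<subseteq> torus n" for S1 S2
    using that inj_on_image_mem_iff[OF inj_on_pull _ that(2)] by blast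
  have psub: "pull ` S1 \<subset> pull ` S2 \<longleftrightarrow> S1 \<subset> S2" if "S1 \<subseteq> torus n" "S2 \<subseteq> torus n" for S1 S2
    using sub[OF that] sub[OF that(2,1)] by blast
  have irrT: "irr n S' \<Longrightarrow> S' \<subseteq> torus n" for S' by (simp add: irr_def)
  have ci: "closedin (zariski K) (pull ` S') \<and> irreducible_in (zariski K) (pull ` S') \<longleftrightarrow> zclosed n S' \<and> irr n S'"
    if "S' \<subseteq> torus n" for S' using closed_pull_iff[OF that] irreducible_pull_iff[OF that] by blast
  have ex: "\<exists>S'. irr n S' \<and> zclosed n S' \<and> Y = pull ` S'"
    if "irr n S" "closedin (zariski K) Y" "irreducible_in (zariski K) Y" "pull ` S \<subseteq> Y" for Y
  proof -
    have "S \<noteq> {}" using that(1) unfolding irr_def by blast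
    then have "Y \<inter> pull ` torus n \<noteq> {}" using that(4) S by blast
    then show ?thesis using closed_irreducible_as_pull[OF that(3)] that(2) by metis
  qed
  show ?thesis
  proof
    assume c: "codimension (zariski K) (pull ` S) = 1"
    then have Sc: "irr n S" "zclosed n S" using codimension_1D ci[OF S] by blast+
    obtain Y where Y: "closedin (zariski K) Y" "irreducible_in (zariski K) Y" "pull ` S \<subset> Y"
      using c unfolding codimension_eq_1_iff by blast
    obtain S' where S': "irr n S'" "Y = pull ` S'" using ex[OF Sc(1) Y(1,2)] Y(3) by blast
    then have "S \<subset> S'" using psub[OF S irrT[OF S'(1)]] Y(3) by simp
    then have "S \<noteq> torus n" using irrT[OF S'(1)] by blast
    moreover have "Y = S \<or> Y = torus n" if Y: "irr n Y" "zclosed n Y" "S \<subseteq> Y" for Y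
    proof (rule ccontr)
      assume n: "\<not> ?thesis"
      have "S \<subset> Y" "Y \<subset> torus n" using n Y(3) irrT[OF Y(1)] by blast+
      then have "pull ` S \<subset> pull ` Y" "pull ` Y \<subset> pull ` torus n"
        using psub[OF S irrT[OF Y(1)]] psub[OF irrT[OF Y(1)] order_refl] by simp_all
      moreover have "closedin (zariski K) (pull ` Y) \<and> irreducible_in (zariski K) (pull ` Y)"
        using ci[OF irrT[OF Y(1)]] Y by blast
      moreover have "closedin (zariski K) (pull ` torus n) \<and> irreducible_in (zariski K) (pull ` torus n)"
        using ci[OF order_refl] irr_torus zclosed_torus by blast
      ultimately have "\<exists>Y Y'. closedin (zariski K) Y \<and> irreducible_in (zariski K) Y \<and>
          closedin (zariski K) Y' \<and> irreducible_in (zariski K) Y' \<and> pull ` S \<subset> Y \<and> Y \<subset> Y'"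
        by (intro exI[of _ "pull ` Y"] exI[of _ "pull ` torus n"]) simp
      then show False using c unfolding codimension_eq_1_iff by simp
    qed
    ultimately show "codim1 n S" using Sc unfolding codim1_def by blast
  next
    assume c: "codim1 n S"
    then have Sc: "irr n S" "zclosed n S" "S \<noteq> torus n" by (auto simp: codim1_def)
    have max: "Y = S \<or> Y = torus n" if "irr n Y" "zclosed n Y" "S \<subseteq> Y" for Y
      using c that unfolding codim1_def by blast
    have a1: "pull ` S \<subset> pull ` torus n" using psub[OF S order_refl] Sc(3) S by (simp add: psubset_eq)
    have a2: "closedin (zariski K) (pull ` torus n) \<and> irreducible_in (zariski K) (pull ` torus n)"
      using ci[OF order_refl] irr_torus zclosed_torus by blast
    have a3: "closedin (zariski K) (pull ` S) \<and> irreducible_in (zariski K) (pull ` S)" using ci[OF S] Sc by blast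
    have a4: False
      if Y: "closedin (zariski K) Y" "irreducible_in (zariski K) Y" "closedin (zariski K) Y'" "irreducible_in (zariski K) Y'"
        "pull ` S \<subset> Y" "Y \<subset> Y'" for Y Y'
    proof -
      obtain S1 where S1: "irr n S1" "zclosed n S1" "Y = pull ` S1" using ex[OF Sc(1) Y(1,2)] Y(5) by blast
      obtain S2 where S2: "irr n S2" "zclosed n S2" "Y' = pull ` S2" using ex[OF Sc(1) Y(3,4)] Y(5,6) by blast
      have "S \<subset> S1" "S1 \<subset> S2"
        using psub[OF S irrT[OF S1(1)]] psub[OF irrT[OF S1(1)] irrT[OF S2(1)]] Y(5,6) S1(3) S2(3) by simp_all
      then show False using max[OF S1(1,2)] irrT[OF S2(1)] by blast
    qed
    show "codimension (zariski K) (pull ` S) = 1" unfolding codimension_eq_1_iff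
    proof (intro conjI)
      show "\<exists>Y. closedin (zariski K) Y \<and> irreducible_in (zariski K) Y \<and> pull ` S \<subset> Y"
        using a1 a2 by (intro exI[of _ "pull ` torus n"]) simp
    qed (use a3 a4 in simp_all, metis)
  qed
qed

end

section \<open>Group rings and linear functionals\<close>

lemma group_ring_simps:
  "\<zero>\<^bsub>group_ring K\<^esub> = 0" "ring.add (group_ring K) = (+)" "monoid.one (group_ring K) = Poly_Mapping.single \<one>\<^bsub>K\<^esub> 1"
  by (simp_all add: group_ring_def)

lemma group_ring_mult_superset:
  assumes "finite A" "finite B" "Poly_Mapping.keys f \<subseteq> A" "Poly_Mapping.keys g \<subseteq> B"
  shows "f \<otimes>\<^bsub>group_ring K\<^esub> g = (\<Sum>x\<in>A. \<Sum>y\<in>B.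
    Poly_Mapping.single (x \<otimes>\<^bsub>K\<^esub> y) (Poly_Mapping.lookup f x * Poly_Mapping.lookup g y))"
proof -
  have "(\<Sum>x\<in>A. \<Sum>y\<in>B. Poly_Mapping.single (x \<otimes>\<^bsub>K\<^esub> y) (Poly_Mapping.lookup f x * Poly_Mapping.lookup g y))
    = (\<Sum>x\<in>A. \<Sum>y\<in>Poly_Mapping.keys g. Poly_Mapping.single (x \<otimes>\<^bsub>K\<^esub> y) (Poly_Mapping.lookup f x * Poly_Mapping.lookup g y))"
    using assms by (intro sum.cong refl sum.mono_neutral_right) (auto simp: in_keys_iff)
  also have "\<dots> = (\<Sum>x\<in>Poly_Mapping.keys f. \<Sum>y\<in>Poly_Mapping.keys g. Poly_Mapping.single (x \<otimes>\<^bsub>K\<^esub> y) (Poly_Mapping.lookup f x * Poly_Mapping.lookup g y))"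
    using assms by (intro sum.mono_neutral_right) (auto simp: in_keys_iff)
  finally show ?thesis by (simp add: group_ring_def)
qed

lemma group_ring_add_mult: "(f + f') \<otimes>\<^bsub>group_ring K\<^esub> g = f \<otimes>\<^bsub>group_ring K\<^esub> g + f' \<otimes>\<^bsub>group_ring K\<^esub> g"
proof -
  let ?A = "Poly_Mapping.keys f \<union> Poly_Mapping.keys f'"
  have k: "Poly_Mapping.keys (f + f') \<subseteq> ?A" by (rule Poly_Mapping.keys_add)
  show ?thesis
    using k by (simp add: group_ring_mult_superset[of ?A "Poly_Mapping.keys g"] lookup_add distrib_right single_add sum.distrib)
qed

lemma group_ring_mult_add: "g \<otimes>\<^bsub>group_ring K\<^esub> (f + f') = g \<otimes>\<^bsub>group_ring K\<^esub> f + g \<otimes>\<^bsub>group_ring K\<^esub> f'"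
proof -
  let ?A = "Poly_Mapping.keys f \<union> Poly_Mapping.keys f'"
  have k: "Poly_Mapping.keys (f + f') \<subseteq> ?A" by (rule Poly_Mapping.keys_add)
  show ?thesis
    using k by (simp add: group_ring_mult_superset[of "Poly_Mapping.keys g" ?A] lookup_add distrib_left single_add sum.distrib)
qed

lemma group_ring_zero_mult: "0 \<otimes>\<^bsub>group_ring K\<^esub> g = 0" "g \<otimes>\<^bsub>group_ring K\<^esub> 0 = 0"
  by (simp_all add: group_ring_def)

lemma group_ring_sum_mult: "sum f I \<otimes>\<^bsub>group_ring K\<^esub> g = (\<Sum>i\<in>I. f i \<otimes>\<^bsub>group_ring K\<^esub> g)"
  by (induction I rule: infinite_finite_induct) (auto simp: group_ring_zero_mult group_ring_add_mult)

lemma group_ring_mult_sum: "g \<otimes>\<^bsub>group_ring K\<^esub> sum f I = (\<Sum>i\<in>I. g \<otimes>\<^bsub>group_ring K\<^esub> f i)"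
  by (induction I rule: infinite_finite_induct) (auto simp: group_ring_zero_mult group_ring_mult_add)

lemma group_ring_single_mult:
  "Poly_Mapping.single x a \<otimes>\<^bsub>group_ring K\<^esub> g = (\<Sum>y\<in>Poly_Mapping.keys g. Poly_Mapping.single (x \<otimes>\<^bsub>K\<^esub> y) (a * Poly_Mapping.lookup g y))"
  by (subst group_ring_mult_superset[of "{x}" "Poly_Mapping.keys g"]) auto

lemma group_ring_mult_single:
  "g \<otimes>\<^bsub>group_ring K\<^esub> Poly_Mapping.single x a = (\<Sum>y\<in>Poly_Mapping.keys g. Poly_Mapping.single (y \<otimes>\<^bsub>K\<^esub> x) (Poly_Mapping.lookup g y * a))"
  by (subst group_ring_mult_superset[of "Poly_Mapping.keys g" "{x}"]) auto

lemma group_ring_mult_eq: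
  "f \<otimes>\<^bsub>group_ring K\<^esub> g = (\<Sum>x\<in>Poly_Mapping.keys f. \<Sum>y\<in>Poly_Mapping.keys g.
    Poly_Mapping.single (x \<otimes>\<^bsub>K\<^esub> y) (Poly_Mapping.lookup f x * Poly_Mapping.lookup g y))"
  by (simp add: group_ring_def)

lemma group_ring_assoc:
  assumes "group K" "f \<in> carrier (group_ring K)" "g \<in> carrier (group_ring K)" "h \<in> carrier (group_ring K)"
  shows "(f \<otimes>\<^bsub>group_ring K\<^esub> g) \<otimes>\<^bsub>group_ring K\<^esub> h = f \<otimes>\<^bsub>group_ring K\<^esub> (g \<otimes>\<^bsub>group_ring K\<^esub> h)"
proof -
  interpret group K by fact
  have "(f \<otimes>\<^bsub>group_ring K\<^esub> g) \<otimes>\<^bsub>group_ring K\<^esub> h = (\<Sum>x\<in>Poly_Mapping.keys f. \<Sum>y\<in>Poly_Mapping.keys g. \<Sum>z\<in>Poly_Mapping.keys h.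
      Poly_Mapping.single (x \<otimes>\<^bsub>K\<^esub> y \<otimes>\<^bsub>K\<^esub> z) (Poly_Mapping.lookup f x * Poly_Mapping.lookup g y * Poly_Mapping.lookup h z))"
    by (subst group_ring_mult_eq) (simp only: group_ring_sum_mult group_ring_single_mult)
  also have "\<dots> = (\<Sum>x\<in>Poly_Mapping.keys f. \<Sum>y\<in>Poly_Mapping.keys g. \<Sum>z\<in>Poly_Mapping.keys h.
      Poly_Mapping.single (x \<otimes>\<^bsub>K\<^esub> (y \<otimes>\<^bsub>K\<^esub> z)) (Poly_Mapping.lookup f x * (Poly_Mapping.lookup g y * Poly_Mapping.lookup h z)))"
    using assms(2-4) by (intro sum.cong refl) (auto simp: carrier_group_ring m_assoc mult.assoc subset_iff)
  also have "\<dots> = (\<Sum>y\<in>Poly_Mapping.keys g. \<Sum>x\<in>Poly_Mapping.keys f. \<Sum>z\<in>Poly_Mapping.keys h.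
      Poly_Mapping.single (x \<otimes>\<^bsub>K\<^esub> (y \<otimes>\<^bsub>K\<^esub> z)) (Poly_Mapping.lookup f x * (Poly_Mapping.lookup g y * Poly_Mapping.lookup h z)))"
    by (rule sum.swap)
  also have "\<dots> = (\<Sum>y\<in>Poly_Mapping.keys g. \<Sum>z\<in>Poly_Mapping.keys h. \<Sum>x\<in>Poly_Mapping.keys f.
      Poly_Mapping.single (x \<otimes>\<^bsub>K\<^esub> (y \<otimes>\<^bsub>K\<^esub> z)) (Poly_Mapping.lookup f x * (Poly_Mapping.lookup g y * Poly_Mapping.lookup h z)))"
    by (intro sum.cong refl sum.swap)
  also have "\<dots> = f \<otimes>\<^bsub>group_ring K\<^esub> (g \<otimes>\<^bsub>group_ring K\<^esub> h)"
    by (subst (2) group_ring_mult_eq) (simp only: group_ring_mult_sum group_ring_mult_single)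
  finally show ?thesis .
qed

lemma group_ring_one_mult:
  assumes "group K" "f \<in> carrier (group_ring K)"
  shows "\<one>\<^bsub>group_ring K\<^esub> \<otimes>\<^bsub>group_ring K\<^esub> f = f" "f \<otimes>\<^bsub>group_ring K\<^esub> \<one>\<^bsub>group_ring K\<^esub> = f"
proof -
  interpret group K by fact
  have "(\<Sum>y\<in>Poly_Mapping.keys f. Poly_Mapping.single (\<one>\<^bsub>K\<^esub> \<otimes>\<^bsub>K\<^esub> y) (1 * Poly_Mapping.lookup f y)) =
      (\<Sum>y\<in>Poly_Mapping.keys f. Poly_Mapping.single y (Poly_Mapping.lookup f y))"
    using assms(2) by (intro sum.cong refl) (auto simp: carrier_group_ring)
  also have "\<dots> = f" by (rule poly_mapping_sum_single[symmetric])
  finally show "\<one>\<^bsub>group_ring K\<^esub> \<otimes>\<^bsub>group_ring K\<^esub> f = f" unfolding group_ring_simps group_ring_single_mult .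
  have "(\<Sum>y\<in>Poly_Mapping.keys f. Poly_Mapping.single (y \<otimes>\<^bsub>K\<^esub> \<one>\<^bsub>K\<^esub>) (Poly_Mapping.lookup f y * 1)) =
      (\<Sum>y\<in>Poly_Mapping.keys f. Poly_Mapping.single y (Poly_Mapping.lookup f y))"
    using assms(2) by (intro sum.cong refl) (auto simp: carrier_group_ring)
  also have "\<dots> = f" by (rule poly_mapping_sum_single[symmetric])
  finally show "f \<otimes>\<^bsub>group_ring K\<^esub> \<one>\<^bsub>group_ring K\<^esub> = f" unfolding group_ring_simps group_ring_mult_single .
qed

lemma group_ring_comm:
  assumes "comm_group K" "f \<in> carrier (group_ring K)" "g \<in> carrier (group_ring K)"
  shows "f \<otimes>\<^bsub>group_ring K\<^esub> g = g \<otimes>\<^bsub>group_ring K\<^esub> f"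
proof -
  interpret comm_group K by fact
  show ?thesis
    unfolding group_ring_mult_eq
    by (subst sum.swap, intro sum.cong refl) (use assms(2,3) in \<open>auto simp: carrier_group_ring m_comm mult.commute subset_iff\<close>)
qed

lemma group_ring_add_closed:
  "f \<in> carrier (group_ring K) \<Longrightarrow> g \<in> carrier (group_ring K) \<Longrightarrow> f + g \<in> carrier (group_ring K)"
  using Poly_Mapping.keys_add[of f g] by (auto simp: carrier_group_ring)

lemma group_ring_uminus_closed:
  "f \<in> carrier (group_ring K) \<Longrightarrow> - f \<in> carrier (group_ring K)"
  by (simp add: carrier_group_ring)

lemma cring_group_ring:
  assumes "comm_group K"
  shows "cring (group_ring K :: ('a \<Rightarrow>\<^sub>0 'r::comm_ring_1) ring)"
proof (rule cringI)
  have gK: "group K" using assms by (simp add: comm_group_def)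
  interpret group K by (rule gK)
  show "abelian_group (group_ring K :: ('a \<Rightarrow>\<^sub>0 'r) ring)"
  proof (rule abelian_groupI)
    fix x :: "'a \<Rightarrow>\<^sub>0 'r" assume "x \<in> carrier (group_ring K)"
    then show "\<exists>y\<in>carrier (group_ring K). y \<oplus>\<^bsub>group_ring K\<^esub> x = \<zero>\<^bsub>group_ring K\<^esub>"
      by (intro bexI[of _ "- x"]) (auto simp: group_ring_simps group_ring_uminus_closed)
  qed (auto simp: group_ring_simps group_ring_add_closed ac_simps, simp add: carrier_group_ring)
  show "comm_monoid (group_ring K :: ('a \<Rightarrow>\<^sub>0 'r) ring)"
  proof (rule comm_monoidI)
    show "\<one>\<^bsub>group_ring K\<^esub> \<in> carrier (group_ring K :: ('a \<Rightarrow>\<^sub>0 'r) ring)"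
      unfolding group_ring_simps by (intro single_in_group_ring) simp
  qed (auto intro: group_ring_mult_closed[OF gK] group_ring_assoc[OF gK] group_ring_one_mult[OF gK] group_ring_comm[OF assms])
qed (simp add: group_ring_simps group_ring_add_mult)

text \<open>The complex-valued additive extension of \<open>e\<close>. It serves for evaluation of
  the integral group ring at a character and for the extension of a crossed homomorphism
  alike.\<close>

definition lin :: "('x \<Rightarrow> complex) \<Rightarrow> ('x \<Rightarrow>\<^sub>0 int) \<Rightarrow> complex" where
  "lin e f = (\<Sum>k\<in>Poly_Mapping.keys f. of_int (Poly_Mapping.lookup f k) * e k)"

lemma lin_superset:
  "finite K \<Longrightarrow> Poly_Mapping.keys f \<subseteq> K \<Longrightarrow> lin e f = (\<Sum>k\<in>K. of_int (Poly_Mapping.lookup f k) * e k)"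
  unfolding lin_def by (rule sum.mono_neutral_left) (auto simp: in_keys_iff)

lemma lin_0: "lin e 0 = 0" by (simp add: lin_def)

lemma lin_single: "lin e (Poly_Mapping.single k c) = of_int c * e k" by (simp add: lin_def)

lemma lin_add: "lin e (f + g) = lin e f + lin e g"
proof -
  let ?K = "Poly_Mapping.keys f \<union> Poly_Mapping.keys g"
  have K: "finite ?K" "Poly_Mapping.keys (f + g) \<subseteq> ?K" using Poly_Mapping.keys_add[of f g] by auto
  show ?thesis
    using K by (simp add: lin_superset[of ?K "f + g"] lin_superset[of ?K f] lin_superset[of ?K g]
        lookup_add distrib_right flip: sum.distrib)
qed

lemma lin_diff: "lin e (f - g) = lin e f - lin e g"
  using lin_add[of e "f - g" g] by simp

lemma lin_uminus: "lin e (- f) = - lin e f"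
  using lin_diff[of e 0 f] by (simp add: lin_0)

lemma lin_sum: "lin e (sum f I) = (\<Sum>i\<in>I. lin e (f i))"
  by (induction I rule: infinite_finite_induct) (auto simp: lin_0 lin_add)

lemma lin_frag_cmul: "lin e (frag_cmul c f) = of_int c * lin e f"
proof -
  have "lin e (frag_cmul c f) = (\<Sum>k\<in>Poly_Mapping.keys f. of_int (c * Poly_Mapping.lookup f k) * e k)"
    by (subst lin_superset[of "Poly_Mapping.keys f"]) (auto simp: keys_cmul)
  then show ?thesis by (simp add: lin_def sum_distrib_left ac_simps)
qed

lemma lin_frag_extend: "lin e (frag_extend f c) = lin (\<lambda>k. lin e (f k)) c"
  unfolding frag_extend_def lin_sum lin_frag_cmul by (simp add: lin_def)

lemma lin_group_ring_mult:
  "lin e (f \<otimes>\<^bsub>group_ring K\<^esub> g) = (\<Sum>x\<in>Poly_Mapping.keys f. \<Sum>y\<in>Poly_Mapping.keys g.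
    of_int (Poly_Mapping.lookup f x * Poly_Mapping.lookup g y) * e (x \<otimes>\<^bsub>K\<^esub> y))"
  by (simp add: group_ring_mult_eq lin_sum lin_single)

lemma lin_mult:
  assumes "\<And>x y. x \<in> carrier K \<Longrightarrow> y \<in> carrier K \<Longrightarrow> \<sigma> (x \<otimes>\<^bsub>K\<^esub> y) = \<sigma> x * \<sigma> y"
    and "f \<in> carrier (group_ring K)" "g \<in> carrier (group_ring K)"
  shows "lin \<sigma> (f \<otimes>\<^bsub>group_ring K\<^esub> g) = lin \<sigma> f * lin \<sigma> g"
proof -
  have "lin \<sigma> (f \<otimes>\<^bsub>group_ring K\<^esub> g) = (\<Sum>x\<in>Poly_Mapping.keys f. \<Sum>y\<in>Poly_Mapping.keys g.
    (of_int (Poly_Mapping.lookup f x) * \<sigma> x) * (of_int (Poly_Mapping.lookup g y) * \<sigma> y))"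
    unfolding lin_group_ring_mult using assms by (intro sum.cong refl) (auto simp: carrier_group_ring subset_iff)
  then show ?thesis by (simp add: lin_def sum_product)
qed

definition augmentation :: "('a \<Rightarrow>\<^sub>0 int) \<Rightarrow> int" where
  "augmentation f = (\<Sum>x\<in>Poly_Mapping.keys f. Poly_Mapping.lookup f x)"

lemma augmentation_lin: "complex_of_int (augmentation f) = lin (\<lambda>_. 1) f"
  by (simp add: augmentation_def lin_def)

lemma augmentation_add: "augmentation (f + g) = augmentation f + augmentation g"
proof -
  have "complex_of_int (augmentation (f + g)) = complex_of_int (augmentation f + augmentation g)"
    by (simp only: of_int_add augmentation_lin lin_add)
  then show ?thesis by (simp only: of_int_eq_iff)
qed

lemma augmentation_diff: "augmentation (f - g) = augmentation f - augmentation g"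
  using augmentation_add[of "f - g" g] by simp

lemma augmentation_single: "augmentation (Poly_Mapping.single x c) = c"
  by (simp add: augmentation_def)

lemma augmentation_0: "augmentation 0 = 0" by (simp add: augmentation_def)

lemma augmentation_mult: "augmentation (f \<otimes>\<^bsub>group_ring K\<^esub> g) = augmentation f * augmentation g"
proof -
  have "complex_of_int (augmentation (f \<otimes>\<^bsub>group_ring K\<^esub> g)) = complex_of_int (augmentation f * augmentation g)"
    by (simp only: of_int_mult augmentation_lin lin_group_ring_mult) (simp add: lin_def sum_product)
  then show ?thesis by (simp only: of_int_eq_iff)
qed

section \<open>Quotient modules\<close>

text \<open>Common ground for the Alexander module and for twisted homology. The addition of
  \<open>M\<close> is that of the type, so cosets can be compared by differences in the
  type.\<close>

locale quotient_setup =
  fixes M :: "('r, 'a::ab_group_add, 'k) module_scheme" and N :: "'a set"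
  assumes add_M: "ring.add M = (+)" and zero_M: "\<zero>\<^bsub>M\<^esub> = 0"
    and M_0: "0 \<in> carrier M" and M_add: "\<And>x y. x \<in> carrier M \<Longrightarrow> y \<in> carrier M \<Longrightarrow> x + y \<in> carrier M"
    and M_uminus: "\<And>x. x \<in> carrier M \<Longrightarrow> - x \<in> carrier M"
    and N_M: "N \<subseteq> carrier M" and N_0: "0 \<in> N"
    and N_add: "\<And>x y. x \<in> N \<Longrightarrow> y \<in> N \<Longrightarrow> x + y \<in> N" and N_uminus: "\<And>x. x \<in> N \<Longrightarrow> - x \<in> N"
begin

definition cl :: "'a \<Rightarrow> 'a set" where "cl x = (\<lambda>h. h + x) ` N"

lemma N_diff: "x \<in> N \<Longrightarrow> y \<in> N \<Longrightarrow> x - y \<in> N"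
  using N_add[of x "- y"] N_uminus[of y] by simp

lemma mem_cl: "y \<in> cl x \<longleftrightarrow> y - x \<in> N"
  by (auto simp: cl_def image_iff intro!: bexI[of _ "y - x"])

lemma cl_eq_iff: "cl x = cl y \<longleftrightarrow> x - y \<in> N"
proof
  assume "cl x = cl y"
  then have "x \<in> cl y" using mem_cl[of x x] N_0 by simp
  then show "x - y \<in> N" by (simp add: mem_cl)
next
  assume xy: "x - y \<in> N"
  have "w - x \<in> N \<longleftrightarrow> w - y \<in> N" for w
  proof
    assume "w - x \<in> N"
    then have "(w - x) + (x - y) \<in> N" using xy N_add by blast
    then show "w - y \<in> N" by simp
  next
    assume "w - y \<in> N"
    then have "(w - y) - (x - y) \<in> N" using xy N_diff by blast
    then show "w - x \<in> N" by simp
  qed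
  then show "cl x = cl y" by (auto simp: mem_cl)
qed

lemma coset_eq: "N +>\<^bsub>M\<^esub> x = cl x"
  unfolding a_r_coset_def r_coset_def cl_def by (auto simp: add_M)

lemma cl_0: "cl 0 = N" by (simp add: cl_def)

abbreviation "Q \<equiv> quotient_module M N"

lemma carrier_Q: "carrier Q = cl ` carrier M"
  unfolding quotient_module_def A_RCOSETS_def RCOSETS_def
  by (auto simp: coset_eq[unfolded a_r_coset_def])

lemma zero_Q: "\<zero>\<^bsub>Q\<^esub> = cl 0"
  by (simp add: quotient_module_def cl_0)

lemma add_Q: "cl x \<oplus>\<^bsub>Q\<^esub> cl y = cl (x + y)"
proof -
  have "cl x \<oplus>\<^bsub>Q\<^esub> cl y = {a + b | a b. a \<in> cl x \<and> b \<in> cl y}"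
    unfolding quotient_module_def set_add_def set_mult_def by (auto simp: add_M)
  also have "\<dots> = cl (x + y)"
  proof (intro equalityI subsetI)
    fix w assume "w \<in> {a + b | a b. a \<in> cl x \<and> b \<in> cl y}"
    then obtain a b where "w = a + b" "a - x \<in> N" "b - y \<in> N" by (auto simp: mem_cl)
    then show "w \<in> cl (x + y)" using N_add[of "a - x" "b - y"] by (simp add: mem_cl algebra_simps)
  next
    fix w assume "w \<in> cl (x + y)"
    then have "w - y \<in> cl x" "y \<in> cl y" using N_0 by (auto simp: mem_cl algebra_simps)
    then show "w \<in> {a + b | a b. a \<in> cl x \<and> b \<in> cl y}"
      by (intro CollectI exI[of _ "w - y"] exI[of _ y]) simp
  qed
  finally show ?thesis .
qed

lemma smult_Q:
  assumes x: "x \<in> carrier M" and sN: "\<And>y. y \<in> N \<Longrightarrow> s \<odot>\<^bsub>M\<^esub> y \<in> N"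
    and sadd: "\<And>x y. x \<in> carrier M \<Longrightarrow> y \<in> carrier M \<Longrightarrow> s \<odot>\<^bsub>M\<^esub> (x + y) = s \<odot>\<^bsub>M\<^esub> x + s \<odot>\<^bsub>M\<^esub> y"
  shows "s \<odot>\<^bsub>Q\<^esub> cl x = cl (s \<odot>\<^bsub>M\<^esub> x)"
proof -
  have "s \<odot>\<^bsub>Q\<^esub> cl x = (\<Union>w\<in>cl x. cl (s \<odot>\<^bsub>M\<^esub> w))"
    by (simp add: quotient_module_def coset_eq)
  \<comment> \<open>The union in \<open>smult\<close> runs over all representatives of the coset.
    They all yield the same coset, so the union is that coset.\<close>
  moreover have same: "cl (s \<odot>\<^bsub>M\<^esub> w) = cl (s \<odot>\<^bsub>M\<^esub> x)" if w: "w \<in> cl x" for w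
  proof -
    have wx: "w - x \<in> N" using w by (simp add: mem_cl)
    then have "w - x \<in> carrier M" using N_M by blast
    then have "s \<odot>\<^bsub>M\<^esub> ((w - x) + x) = s \<odot>\<^bsub>M\<^esub> (w - x) + s \<odot>\<^bsub>M\<^esub> x" by (rule sadd[OF _ x])
    then have e: "s \<odot>\<^bsub>M\<^esub> w = s \<odot>\<^bsub>M\<^esub> (w - x) + s \<odot>\<^bsub>M\<^esub> x" by (simp only: diff_add_cancel)
    have "s \<odot>\<^bsub>M\<^esub> w - s \<odot>\<^bsub>M\<^esub> x = s \<odot>\<^bsub>M\<^esub> (w - x)" by (subst e) simp
    then show ?thesis using sN[OF wx] by (simp only: cl_eq_iff)
  qed
  moreover have "(\<Union>w\<in>cl x. cl (s \<odot>\<^bsub>M\<^esub> w)) = (\<Union>w\<in>cl x. cl (s \<odot>\<^bsub>M\<^esub> x))"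
    by (intro SUP_cong refl same)
  moreover have "cl x \<noteq> {}" using N_0 by (auto simp: cl_def)
  ultimately show ?thesis by (simp only: UN_constant if_False)
qed

lemma abelian_group_Q: "abelian_group Q"
proof (rule abelian_groupI)
  fix x assume "x \<in> carrier Q"
  then obtain a where a: "a \<in> carrier M" "x = cl a" unfolding carrier_Q by blast
  then have "cl (- a) \<in> carrier Q" "cl (- a) \<oplus>\<^bsub>Q\<^esub> x = \<zero>\<^bsub>Q\<^esub>"
    using M_uminus by (auto simp: carrier_Q add_Q zero_Q)
  then show "\<exists>y\<in>carrier Q. y \<oplus>\<^bsub>Q\<^esub> x = \<zero>\<^bsub>Q\<^esub>" by blast
qed (auto simp: carrier_Q add_Q zero_Q M_add M_0 ac_simps)

end

section \<open>The Alexander module and crossed homomorphisms\<close>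

locale alexander_setup = G: group G + H: comm_group H
  for G :: "('a, 'm) monoid_scheme" (structure) and H :: "('b, 'l) monoid_scheme" +
  fixes p :: "'a \<Rightarrow> 'b"
  assumes p_hom: "p \<in> hom G H"
begin

abbreviation "R \<equiv> int_group_ring G"
abbreviation "S \<equiv> int_group_ring H"
abbreviation "I \<equiv> augmentation_ideal G"
abbreviation "F \<equiv> free_on_pairs S I"
abbreviation "rels \<equiv> tensor_relations R S (group_ring_map p) I"
abbreviation "N \<equiv> generate (free_Abelian_group (carrier S \<times> carrier I)) rels"
abbreviation "A \<equiv> extension_of_scalars R S (group_ring_map p) I"

lemma p_mult: "g \<in> carrier G \<Longrightarrow> h \<in> carrier G \<Longrightarrow> p (g \<otimes> h) = p g \<otimes>\<^bsub>H\<^esub> p h"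
  and p_closed: "g \<in> carrier G \<Longrightarrow> p g \<in> carrier H"
  using p_hom by (auto simp: hom_def)

interpretation S: cring S
  by (rule cring_group_ring) (rule H.comm_group_axioms)

lemma I_iff: "x \<in> carrier I \<longleftrightarrow> x \<in> carrier R \<and> augmentation x = 0"
  by (simp add: augmentation_ideal_def augmentation_def)

lemma I_add: "x \<oplus>\<^bsub>I\<^esub> y = x + y" by (simp add: augmentation_ideal_def)
lemma I_smult: "r \<odot>\<^bsub>I\<^esub> x = r \<otimes>\<^bsub>R\<^esub> x" by (simp add: augmentation_ideal_def)

lemma I_add_closed: "x \<in> carrier I \<Longrightarrow> y \<in> carrier I \<Longrightarrow> x + y \<in> carrier I"
  by (simp add: I_iff group_ring_add_closed augmentation_add)

lemma I_mult_closed: "r \<in> carrier R \<Longrightarrow> x \<in> carrier I \<Longrightarrow> r \<otimes>\<^bsub>R\<^esub> x \<in> carrier I"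
  by (simp add: I_iff group_ring_mult_closed[OF G.is_group] augmentation_mult)

lemma map_closed: "r \<in> carrier R \<Longrightarrow> group_ring_map p r \<in> carrier S"
  unfolding group_ring_map_def carrier_group_ring
  using keys_frag_extend[of "\<lambda>x. frag_of (p x)" r] p_closed by (auto simp: subset_iff)

lemma F_simps: "carrier F = {c. Poly_Mapping.keys c \<subseteq> carrier S \<times> carrier I}"
  "ring.add F = (+)" "\<zero>\<^bsub>F\<^esub> = 0" "s \<odot>\<^bsub>F\<^esub> c = frag_extend (\<lambda>(u, x). frag_of (s \<otimes>\<^bsub>S\<^esub> u, x)) c"
  by (simp_all add: free_on_pairs_def free_Abelian_group_def)

lemma frag_of_F: "s \<in> carrier S \<Longrightarrow> x \<in> carrier I \<Longrightarrow> frag_of (s, x) \<in> carrier F"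
  by (simp add: F_simps)

lemma F_add: "x \<in> carrier F \<Longrightarrow> y \<in> carrier F \<Longrightarrow> x + y \<in> carrier F"
  using Poly_Mapping.keys_add[of x y] by (auto simp: F_simps)

lemma F_diff: "x \<in> carrier F \<Longrightarrow> y \<in> carrier F \<Longrightarrow> x - y \<in> carrier F"
  using Poly_Mapping.keys_diff[of x y] by (auto simp: F_simps)

lemma rels_F: "rels \<subseteq> carrier F"
  unfolding tensor_relations_def I_add I_smult group_ring_simps
  using frag_of_F F_diff I_add_closed I_mult_closed group_ring_add_closed map_closed S.m_closed
  by (auto intro!: F_diff frag_of_F)

lemma N_props: "N \<subseteq> carrier F" "0 \<in> N" "x \<in> N \<Longrightarrow> y \<in> N \<Longrightarrow> x + y \<in> N" "x \<in> N \<Longrightarrow> - x \<in> N"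
  "rels \<subseteq> N"
proof -
  let ?P = "free_Abelian_group (carrier S \<times> carrier I)"
  have cP: "carrier ?P = carrier F" by (simp add: free_on_pairs_def)
  interpret P: group ?P by simp
  have sub: "subgroup N ?P" using P.generate_is_subgroup rels_F cP by simp
  show NF: "N \<subseteq> carrier F" using subgroup.subset[OF sub] cP by simp
  show "0 \<in> N" using subgroup.one_closed[OF sub] by simp
  show "x \<in> N \<Longrightarrow> y \<in> N \<Longrightarrow> x + y \<in> N" using subgroup.m_closed[OF sub] by simp
  show "- x \<in> N" if "x \<in> N"
  proof -
    have "Poly_Mapping.keys x \<subseteq> carrier S \<times> carrier I" using that NF by (auto simp: F_simps)
    then show ?thesis using subgroup.m_inv_closed[OF sub that] by simp
  qed
  show "rels \<subseteq> N" by (auto intro: generate.incl)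
qed

lemma N_induct:
  assumes "c \<in> N" "P 0" "\<And>x. x \<in> rels \<Longrightarrow> P x" "\<And>x. P x \<Longrightarrow> P (- x)" "\<And>x y. P x \<Longrightarrow> P y \<Longrightarrow> P (x + y)"
  shows "P c"
  using assms(1)
proof (induction rule: generate.induct)
  case (inv h)
  then have "Poly_Mapping.keys h \<subseteq> carrier S \<times> carrier I" using rels_F by (auto simp: F_simps)
  then show ?case using assms(3,4) inv by simp
qed (use assms in auto)

sublocale Q: quotient_setup F N
  using F_add N_props by unfold_locales (auto simp: F_simps)

lemma A_eq: "A = quotient_module F N"
  by (simp add: extension_of_scalars_def)

lemma F_induct:
  assumes "c \<in> carrier F" "P 0" "\<And>s x. s \<in> carrier S \<Longrightarrow> x \<in> carrier I \<Longrightarrow> P (frag_of (s, x))"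
    "\<And>x y. P x \<Longrightarrow> P y \<Longrightarrow> P (x - y)"
  shows "P c"
proof -
  have "Poly_Mapping.keys c \<subseteq> carrier S \<times> carrier I" using assms(1) by (simp add: F_simps)
  then show ?thesis by (induction rule: frag_induction) (use assms in auto)
qed

lemma act_add: "s \<odot>\<^bsub>F\<^esub> (x + y) = s \<odot>\<^bsub>F\<^esub> x + s \<odot>\<^bsub>F\<^esub> y"
  and act_diff: "s \<odot>\<^bsub>F\<^esub> (x - y) = s \<odot>\<^bsub>F\<^esub> x - s \<odot>\<^bsub>F\<^esub> y"
  and act_uminus: "s \<odot>\<^bsub>F\<^esub> (- x) = - (s \<odot>\<^bsub>F\<^esub> x)" and act_0: "s \<odot>\<^bsub>F\<^esub> 0 = 0"
  by (simp_all add: F_simps frag_extend_add frag_extend_diff frag_extend_minus)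

lemma act_frag: "s \<odot>\<^bsub>F\<^esub> frag_of (u, x) = frag_of (s \<otimes>\<^bsub>S\<^esub> u, x)"
  by (simp add: F_simps)

lemma act_closed: "s \<in> carrier S \<Longrightarrow> c \<in> carrier F \<Longrightarrow> s \<odot>\<^bsub>F\<^esub> c \<in> carrier F"
  by (erule F_induct) (auto simp: act_0 act_diff act_frag Q.M_0 F_diff intro!: frag_of_F)

lemma rel_add_l: "s \<in> carrier S \<Longrightarrow> s' \<in> carrier S \<Longrightarrow> x \<in> carrier I \<Longrightarrow>
    frag_of (s \<oplus>\<^bsub>S\<^esub> s', x) - frag_of (s, x) - frag_of (s', x) \<in> rels"
  and rel_add_r: "s \<in> carrier S \<Longrightarrow> x \<in> carrier I \<Longrightarrow> x' \<in> carrier I \<Longrightarrow>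
    frag_of (s, x + x') - frag_of (s, x) - frag_of (s, x') \<in> rels"
  and rel_balance: "s \<in> carrier S \<Longrightarrow> r \<in> carrier R \<Longrightarrow> x \<in> carrier I \<Longrightarrow>
    frag_of (s \<otimes>\<^bsub>S\<^esub> group_ring_map p r, x) - frag_of (s, r \<otimes>\<^bsub>R\<^esub> x) \<in> rels"
  unfolding tensor_relations_def I_add I_smult by blast+

lemma rels_cases:
  assumes "c \<in> rels"
  obtains (l) s s' x where "s \<in> carrier S" "s' \<in> carrier S" "x \<in> carrier I"
      "c = frag_of (s \<oplus>\<^bsub>S\<^esub> s', x) - frag_of (s, x) - frag_of (s', x)"
  | (r) s x x' where "s \<in> carrier S" "x \<in> carrier I" "x' \<in> carrier I"
      "c = frag_of (s, x + x') - frag_of (s, x) - frag_of (s, x')"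
  | (b) s r x where "s \<in> carrier S" "r \<in> carrier R" "x \<in> carrier I"
      "c = frag_of (s \<otimes>\<^bsub>S\<^esub> group_ring_map p r, x) - frag_of (s, r \<otimes>\<^bsub>R\<^esub> x)"
  using assms unfolding tensor_relations_def I_add I_smult
  by (elim UnE CollectE exE conjE) (rule l r b; assumption)+

lemma act_N:
  assumes s: "s \<in> carrier S" and c: "c \<in> N"
  shows "s \<odot>\<^bsub>F\<^esub> c \<in> N"
  using c
proof (rule N_induct)
  fix c assume "c \<in> rels"
  then have "s \<odot>\<^bsub>F\<^esub> c \<in> rels"
  proof (cases rule: rels_cases)
    case (l u u' x)
    have "s \<odot>\<^bsub>F\<^esub> c = frag_of (s \<otimes>\<^bsub>S\<^esub> u \<oplus>\<^bsub>S\<^esub> s \<otimes>\<^bsub>S\<^esub> u', x) - frag_of (s \<otimes>\<^bsub>S\<^esub> u, x) - frag_of (s \<otimes>\<^bsub>S\<^esub> u', x)"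
      by (simp only: l(4) act_diff act_frag S.r_distr[OF l(1,2) s])
    then show ?thesis using rel_add_l[OF S.m_closed[OF s l(1)] S.m_closed[OF s l(2)] l(3)] by (simp only:)
  next
    case (r u x x')
    have "s \<odot>\<^bsub>F\<^esub> c = frag_of (s \<otimes>\<^bsub>S\<^esub> u, x + x') - frag_of (s \<otimes>\<^bsub>S\<^esub> u, x) - frag_of (s \<otimes>\<^bsub>S\<^esub> u, x')"
      by (simp only: r(4) act_diff act_frag)
    then show ?thesis using rel_add_r[OF S.m_closed[OF s r(1)] r(2,3)] by (simp only:)
  next
    case (b u r x)
    have "s \<odot>\<^bsub>F\<^esub> c = frag_of (s \<otimes>\<^bsub>S\<^esub> u \<otimes>\<^bsub>S\<^esub> group_ring_map p r, x) - frag_of (s \<otimes>\<^bsub>S\<^esub> u, r \<otimes>\<^bsub>R\<^esub> x)"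
      by (simp only: b(4) act_diff act_frag S.m_assoc[OF s b(1) map_closed[OF b(2)]])
    then show ?thesis using rel_balance[OF S.m_closed[OF s b(1)] b(2,3)] by (simp only:)
  qed
  then show "s \<odot>\<^bsub>F\<^esub> c \<in> N" using N_props(5) by blast
qed (auto simp: act_0 act_uminus act_add N_props)

lemma smult_A: "s \<in> carrier S \<Longrightarrow> c \<in> carrier F \<Longrightarrow> s \<odot>\<^bsub>A\<^esub> Q.cl c = Q.cl (s \<odot>\<^bsub>F\<^esub> c)"
  unfolding A_eq by (rule Q.smult_Q) (auto simp: act_N act_add)

lemma A_simps: "carrier A = Q.cl ` carrier F" "\<zero>\<^bsub>A\<^esub> = Q.cl 0" "Q.cl x \<oplus>\<^bsub>A\<^esub> Q.cl y = Q.cl (x + y)"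
  by (simp_all add: A_eq Q.carrier_Q Q.zero_Q Q.add_Q)

text \<open>The module laws justify the computations with the sums in
  \<open>presentation_matrix\<close>. Additivity in the scalar fails for formal pairs and holds
  modulo the relations that are additive in the left factor.\<close>

lemma module_A: "module S A"
proof (rule moduleI)
  show "cring S" by (rule S.cring_axioms)
  show "abelian_group A" unfolding A_eq by (rule Q.abelian_group_Q)
  show "\<one>\<^bsub>S\<^esub> \<odot>\<^bsub>A\<^esub> x = x" if xA: "x \<in> carrier A" for x
  proof -
    obtain c where c: "c \<in> carrier F" "x = Q.cl c" using xA unfolding A_simps(1) by blast
    have "\<one>\<^bsub>S\<^esub> \<odot>\<^bsub>F\<^esub> c = c" using c(1) by (rule F_induct) (auto simp: act_0 act_diff act_frag)
    then show ?thesis using c smult_A by simp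
  qed
  fix a x assume a: "a \<in> carrier S" and x: "x \<in> carrier A"
  obtain c where c: "c \<in> carrier F" "x = Q.cl c" using x unfolding A_simps(1) by blast
  show "a \<odot>\<^bsub>A\<^esub> x \<in> carrier A" using a c act_closed by (auto simp: smult_A A_simps)
  { fix y assume "y \<in> carrier A"
    then obtain d where d: "d \<in> carrier F" "y = Q.cl d" by (auto simp: A_simps)
    show "a \<odot>\<^bsub>A\<^esub> (x \<oplus>\<^bsub>A\<^esub> y) = a \<odot>\<^bsub>A\<^esub> x \<oplus>\<^bsub>A\<^esub> a \<odot>\<^bsub>A\<^esub> y"
      using a c d by (simp add: A_simps smult_A F_add act_add) }
  fix b assume b: "b \<in> carrier S"
  show "(a \<otimes>\<^bsub>S\<^esub> b) \<odot>\<^bsub>A\<^esub> x = a \<odot>\<^bsub>A\<^esub> (b \<odot>\<^bsub>A\<^esub> x)"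
  proof -
    have "(a \<otimes>\<^bsub>S\<^esub> b) \<odot>\<^bsub>F\<^esub> c = a \<odot>\<^bsub>F\<^esub> (b \<odot>\<^bsub>F\<^esub> c)"
      using c(1) by (rule F_induct) (use a b in \<open>auto simp: act_0 act_diff act_frag S.m_assoc\<close>)
    then show ?thesis using a b c by (simp add: smult_A act_closed)
  qed
  show "(a \<oplus>\<^bsub>S\<^esub> b) \<odot>\<^bsub>A\<^esub> x = a \<odot>\<^bsub>A\<^esub> x \<oplus>\<^bsub>A\<^esub> b \<odot>\<^bsub>A\<^esub> x"
  proof -
    have "(a \<oplus>\<^bsub>S\<^esub> b) \<odot>\<^bsub>F\<^esub> c - a \<odot>\<^bsub>F\<^esub> c - b \<odot>\<^bsub>F\<^esub> c \<in> N"
      using c(1)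
    proof (rule F_induct)
      fix s x assume "s \<in> carrier S" "x \<in> carrier I"
      then show "(a \<oplus>\<^bsub>S\<^esub> b) \<odot>\<^bsub>F\<^esub> frag_of (s, x) - a \<odot>\<^bsub>F\<^esub> frag_of (s, x) - b \<odot>\<^bsub>F\<^esub> frag_of (s, x) \<in> N"
        using a b rel_add_l[of "a \<otimes>\<^bsub>S\<^esub> s" "b \<otimes>\<^bsub>S\<^esub> s" x] N_props(5) by (auto simp: act_frag S.l_distr)
    next
      fix x y assume "(a \<oplus>\<^bsub>S\<^esub> b) \<odot>\<^bsub>F\<^esub> x - a \<odot>\<^bsub>F\<^esub> x - b \<odot>\<^bsub>F\<^esub> x \<in> N" "(a \<oplus>\<^bsub>S\<^esub> b) \<odot>\<^bsub>F\<^esub> y - a \<odot>\<^bsub>F\<^esub> y - b \<odot>\<^bsub>F\<^esub> y \<in> N"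
      from Q.N_diff[OF this]
      show "(a \<oplus>\<^bsub>S\<^esub> b) \<odot>\<^bsub>F\<^esub> (x - y) - a \<odot>\<^bsub>F\<^esub> (x - y) - b \<odot>\<^bsub>F\<^esub> (x - y) \<in> N"
        by (simp add: act_diff algebra_simps)
    qed (simp add: act_0 N_props)
    then show ?thesis using a b c by (simp add: smult_A A_simps Q.cl_eq_iff diff_diff_eq)
  qed
qed

interpretation A: module S A by (rule module_A)

text \<open>The tensor \<open>1 \<otimes> (g - 1)\<close>; sending \<open>g\<close> to its class is
  the universal crossed homomorphism.\<close>

definition gen :: "'a \<Rightarrow> ('b \<Rightarrow>\<^sub>0 int) \<times> ('a \<Rightarrow>\<^sub>0 int) \<Rightarrow>\<^sub>0 int" where
  "gen g = frag_of (\<one>\<^bsub>S\<^esub>, frag_of g - frag_of \<one>)"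

lemma diff_one_I: "g \<in> carrier G \<Longrightarrow> frag_of g - frag_of \<one> \<in> carrier I"
  using Poly_Mapping.keys_diff[of "frag_of g" "frag_of \<one>"]
  by (auto simp: I_iff carrier_group_ring augmentation_diff augmentation_single)

lemma gen_F: "g \<in> carrier G \<Longrightarrow> gen g \<in> carrier F"
  unfolding gen_def using diff_one_I by (intro frag_of_F) auto

text \<open>This is \<open>gh - 1 = g (h - 1) + (g - 1)\<close>.\<close>

lemma gen_mult:
  assumes "g \<in> carrier G" "h \<in> carrier G"
  shows "Q.cl (gen (g \<otimes> h)) = (frag_of (p g) \<odot>\<^bsub>A\<^esub> Q.cl (gen h)) \<oplus>\<^bsub>A\<^esub> Q.cl (gen g)"
proof -
  let ?d = "\<lambda>g. frag_of g - frag_of \<one> :: 'a \<Rightarrow>\<^sub>0 int"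
  let ?r = "frag_of g \<otimes>\<^bsub>R\<^esub> ?d h"
  have gR: "frag_of g \<in> carrier R" using assms by (intro single_in_group_ring)
  have r: "?r \<in> carrier I" using gR diff_one_I assms by (intro I_mult_closed)
  have "?r = frag_of g \<otimes>\<^bsub>R\<^esub> frag_of h - frag_of g \<otimes>\<^bsub>R\<^esub> frag_of \<one>"
    using group_ring_mult_add[where K = G and g = "frag_of g" and f = "?d h" and f' = "frag_of \<one>"] by (simp add: eq_diff_eq)
  then have split: "?d (g \<otimes> h) = ?r + ?d g" using assms by (simp add: group_ring_single_mult)
  have map: "group_ring_map p (frag_of g) = frag_of (p g)" by (simp add: group_ring_map_def)
  have pS: "frag_of (p g) \<in> carrier S" using assms p_closed by (intro single_in_group_ring)
  have "gen (g \<otimes> h) - frag_of (\<one>\<^bsub>S\<^esub>, ?r) - gen g \<in> N"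
    unfolding gen_def split using rel_add_r[of "\<one>\<^bsub>S\<^esub>" ?r "?d g"] r diff_one_I assms N_props(5) by auto
  moreover have "frag_of (\<one>\<^bsub>S\<^esub> \<otimes>\<^bsub>S\<^esub> group_ring_map p (frag_of g), ?d h) - frag_of (\<one>\<^bsub>S\<^esub>, ?r) \<in> N"
    using rel_balance[OF _ gR diff_one_I[OF assms(2)], of "\<one>\<^bsub>S\<^esub>"] N_props(5) by auto
  ultimately have "(gen (g \<otimes> h) - frag_of (\<one>\<^bsub>S\<^esub>, ?r) - gen g) -
      (frag_of (\<one>\<^bsub>S\<^esub> \<otimes>\<^bsub>S\<^esub> group_ring_map p (frag_of g), ?d h) - frag_of (\<one>\<^bsub>S\<^esub>, ?r)) \<in> N"
    by (rule Q.N_diff)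
  then have "gen (g \<otimes> h) - (frag_of (p g) \<odot>\<^bsub>F\<^esub> gen h + gen g) \<in> N"
    using pS by (simp add: map gen_def act_frag algebra_simps)
  then show ?thesis using pS gen_F assms by (simp add: smult_A A_simps Q.cl_eq_iff)
qed


text \<open>A 1-cocycle of \<open>G\<close> with values in the complex numbers, on which
  \<open>g\<close> acts by \<open>\<sigma> (p g)\<close>.\<close>

definition crossed :: "('b \<Rightarrow> complex) \<Rightarrow> ('a \<Rightarrow> complex) \<Rightarrow> bool" where
  "crossed \<sigma> d \<longleftrightarrow> (\<forall>g\<in>carrier G. \<forall>h\<in>carrier G. d (g \<otimes> h) = \<sigma> (p g) * d h + d g)"

definition semilinear :: "('b \<Rightarrow> complex) \<Rightarrow> ((('b \<Rightarrow>\<^sub>0 int) \<times> ('a \<Rightarrow>\<^sub>0 int) \<Rightarrow>\<^sub>0 int) set \<Rightarrow> complex) \<Rightarrow> bool" where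
  "semilinear \<sigma> D \<longleftrightarrow> (\<forall>a\<in>carrier A. \<forall>b\<in>carrier A. D (a \<oplus>\<^bsub>A\<^esub> b) = D a + D b) \<and>
     (\<forall>s\<in>carrier S. \<forall>a\<in>carrier A. D (s \<odot>\<^bsub>A\<^esub> a) = lin \<sigma> s * D a)"

context
  fixes \<sigma> :: "'b \<Rightarrow> complex"
  assumes \<sigma>_mult: "\<And>x y. x \<in> carrier H \<Longrightarrow> y \<in> carrier H \<Longrightarrow> \<sigma> (x \<otimes>\<^bsub>H\<^esub> y) = \<sigma> x * \<sigma> y"
    and \<sigma>_one: "\<sigma> \<one>\<^bsub>H\<^esub> = 1"
begin

lemma lin_S: "s \<in> carrier S \<Longrightarrow> u \<in> carrier S \<Longrightarrow> lin \<sigma> (s \<otimes>\<^bsub>S\<^esub> u) = lin \<sigma> s * lin \<sigma> u"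
  "lin \<sigma> \<one>\<^bsub>S\<^esub> = 1" "lin \<sigma> (s \<oplus>\<^bsub>S\<^esub> u) = lin \<sigma> s + lin \<sigma> u" "lin \<sigma> \<zero>\<^bsub>S\<^esub> = 0"
  using lin_mult[of H \<sigma>] \<sigma>_mult \<sigma>_one by (auto simp: group_ring_simps lin_single lin_add lin_0)

text \<open>Expanding \<open>d (g \<otimes> h)\<close> leaves a second term, \<open>lin d r\<close>
  times the augmentation of \<open>x\<close>. It disappears on the augmentation ideal, which is why
  a crossed homomorphism is semilinear there.\<close>

lemma crossed_lin:
  assumes d: "crossed \<sigma> d" and r: "r \<in> carrier R" and x: "x \<in> carrier I"
  shows "lin d (r \<otimes>\<^bsub>R\<^esub> x) = lin \<sigma> (group_ring_map p r) * lin d x"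
proof -
  have "lin d (r \<otimes>\<^bsub>R\<^esub> x) = (\<Sum>g\<in>Poly_Mapping.keys r. \<Sum>h\<in>Poly_Mapping.keys x.
      of_int (Poly_Mapping.lookup r g * Poly_Mapping.lookup x h) * (\<sigma> (p g) * d h + d g))"
    unfolding lin_group_ring_mult
    using d r x by (intro sum.cong refl) (auto simp: crossed_def I_iff carrier_group_ring subset_iff)
  also have "\<dots> = (\<Sum>g\<in>Poly_Mapping.keys r. \<Sum>h\<in>Poly_Mapping.keys x.
      (of_int (Poly_Mapping.lookup r g) * \<sigma> (p g)) * (of_int (Poly_Mapping.lookup x h) * d h) +
      (of_int (Poly_Mapping.lookup r g) * d g) * of_int (Poly_Mapping.lookup x h))"
    by (intro sum.cong refl) (simp add: algebra_simps)
  also have "\<dots> = lin (\<lambda>g. \<sigma> (p g)) r * lin d x + lin d r * of_int (augmentation x)"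
    by (simp add: lin_def augmentation_def sum_product sum.distrib)
  also have "\<dots> = lin (\<lambda>g. \<sigma> (p g)) r * lin d x" using x by (simp add: I_iff)
  also have "lin (\<lambda>g. \<sigma> (p g)) r = lin \<sigma> (group_ring_map p r)"
    by (simp add: group_ring_map_def lin_frag_extend lin_single)
  finally show ?thesis .
qed

lemma crossed_extends:
  assumes d: "crossed \<sigma> d"
  shows "\<exists>D. semilinear \<sigma> D \<and> (\<forall>g\<in>carrier G. D (Q.cl (gen g)) = d g)"
proof -
  \<comment> \<open>The functional is first written on formal pairs. It kills the three kinds of
    relations and so descends to cosets, where it is evaluated at a chosen representative.\<close>
  define E where "E = lin (\<lambda>(s, x). lin \<sigma> s * lin d x)"
  have E_frag: "E (frag_of (s, x)) = lin \<sigma> s * lin d x" for s x by (simp add: E_def lin_single)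
  have E_add: "E (x + y) = E x + E y" and E_diff: "E (x - y) = E x - E y" and E_uminus: "E (- x) = - E x" and E_0: "E 0 = 0" for x y
    by (simp_all add: E_def lin_add lin_diff lin_uminus lin_0)
  have E_N: "E c = 0" if c: "c \<in> N" for c
    using c
  proof (rule N_induct)
    fix c assume "c \<in> rels"
    then show "E c = 0"
    proof (cases rule: rels_cases)
      case (l s s' x)
      then show ?thesis by (simp add: E_diff E_frag lin_S distrib_right)
    next
      case (r s x x')
      then show ?thesis by (simp add: E_diff E_frag lin_add distrib_left)
    next
      case (b s r x)
      have "lin \<sigma> (s \<otimes>\<^bsub>S\<^esub> group_ring_map p r) = lin \<sigma> s * lin \<sigma> (group_ring_map p r)"
        using b map_closed by (intro lin_S)
      then show ?thesis unfolding b(4) E_diff E_frag crossed_lin[OF d b(2,3)] by simp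
    qed
  qed (auto simp: E_0 E_uminus E_add)
  define D where "D T = E (SOME x. x \<in> T)" for T
  have D_cl: "D (Q.cl c) = E c" for c
  proof -
    have "c \<in> Q.cl c" using N_props(2) by (simp add: Q.mem_cl)
    then have "(SOME x. x \<in> Q.cl c) \<in> Q.cl c" by (rule someI)
    then have "(SOME x. x \<in> Q.cl c) - c \<in> N" by (simp only: Q.mem_cl)
    from E_N[OF this] show ?thesis by (simp add: D_def E_diff)
  qed
  have E_act: "E (s \<odot>\<^bsub>F\<^esub> c) = lin \<sigma> s * E c" if s: "s \<in> carrier S" and c: "c \<in> carrier F" for s c
    using c
  proof (rule F_induct)
    fix u x assume "u \<in> carrier S" "x \<in> carrier I"
    then show "E (s \<odot>\<^bsub>F\<^esub> frag_of (u, x)) = lin \<sigma> s * E (frag_of (u, x))"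
      using s by (simp add: act_frag E_frag lin_S)
  qed (auto simp: act_0 act_diff E_0 E_diff right_diff_distrib)
  have "semilinear \<sigma> D"
    unfolding semilinear_def
  proof (intro conjI ballI)
    fix a assume a: "a \<in> carrier A"
    then obtain x where x: "x \<in> carrier F" "a = Q.cl x" unfolding A_simps(1) by blast
    { fix b assume "b \<in> carrier A"
      then obtain y where y: "y \<in> carrier F" "b = Q.cl y" unfolding A_simps(1) by blast
      show "D (a \<oplus>\<^bsub>A\<^esub> b) = D a + D b" unfolding x y A_simps D_cl E_add .. }
  next
    fix s a assume s: "s \<in> carrier S" and a: "a \<in> carrier A"
    then obtain x where x: "x \<in> carrier F" "a = Q.cl x" unfolding A_simps(1) by blast
    show "D (s \<odot>\<^bsub>A\<^esub> a) = lin \<sigma> s * D a" unfolding x(2) smult_A[OF s x(1)] D_cl E_act[OF s x(1)] ..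
  qed
  moreover have "D (Q.cl (gen g)) = d g" if g: "g \<in> carrier G" for g
  proof -
    \<comment> \<open>The value at \<open>gen g\<close> is \<open>d g - d \<one>\<close>, so
      \<open>d \<one> = 0\<close> is needed; it follows because \<open>\<sigma> (p \<one>)\<close>
      is nonzero.\<close>
    have "d (\<one> \<otimes> \<one>) = \<sigma> (p \<one>) * d \<one> + d \<one>" using d unfolding crossed_def by blast
    then have "\<sigma> (p \<one>) * d \<one> = 0" by simp
    moreover have "\<sigma> (p \<one>) = \<sigma> (p \<one>) * \<sigma> (p \<one>)"
      using \<sigma>_mult[of "p \<one>" "p \<one>"] p_mult[of \<one> \<one>] p_closed by simp
    moreover have "\<sigma> (p \<one>) \<noteq> 0"
    proof -
      have "p \<one> \<otimes>\<^bsub>H\<^esub> inv\<^bsub>H\<^esub> (p \<one>) = \<one>\<^bsub>H\<^esub>" using p_closed by simp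
      then have "\<sigma> (p \<one>) * \<sigma> (inv\<^bsub>H\<^esub> (p \<one>)) = 1"
        using \<sigma>_mult[of "p \<one>" "inv\<^bsub>H\<^esub> (p \<one>)"] p_closed \<sigma>_one by simp
      then show ?thesis by auto
    qed
    ultimately have "d \<one> = 0" by simp
    then show ?thesis unfolding D_cl gen_def E_frag by (simp add: lin_S lin_diff lin_single)
  qed
  ultimately show ?thesis by blast
qed

lemma semilinear_crossed:
  assumes D: "semilinear \<sigma> D"
  shows "crossed \<sigma> (\<lambda>g. D (Q.cl (gen g)))"
  unfolding crossed_def
proof (intro ballI)
  fix g h assume gh: "g \<in> carrier G" "h \<in> carrier G"
  have A1: "Q.cl (gen h) \<in> carrier A" "Q.cl (gen g) \<in> carrier A" using gen_F gh by (auto simp: A_simps)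
  have pS: "frag_of (p g) \<in> carrier S" using gh p_closed by (intro single_in_group_ring)
  have "D (Q.cl (gen (g \<otimes> h))) = D (frag_of (p g) \<odot>\<^bsub>A\<^esub> Q.cl (gen h)) + D (Q.cl (gen g))"
    unfolding gen_mult[OF gh] using D A1 A.smult_closed[OF pS A1(1)] unfolding semilinear_def by blast
  also have "D (frag_of (p g) \<odot>\<^bsub>A\<^esub> Q.cl (gen h)) = lin \<sigma> (frag_of (p g)) * D (Q.cl (gen h))"
    using D A1 pS unfolding semilinear_def by blast
  finally show "D (Q.cl (gen (g \<otimes> h))) = \<sigma> (p g) * D (Q.cl (gen h)) + D (Q.cl (gen g))"
    by (simp add: lin_single)
qed

lemma semilinear_0:
  assumes "semilinear \<sigma> D"
  shows "D \<zero>\<^bsub>A\<^esub> = 0"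
proof -
  have "D (\<zero>\<^bsub>A\<^esub> \<oplus>\<^bsub>A\<^esub> \<zero>\<^bsub>A\<^esub>) = D \<zero>\<^bsub>A\<^esub> + D \<zero>\<^bsub>A\<^esub>"
    using assms A.M.zero_closed unfolding semilinear_def by blast
  then show ?thesis by simp
qed

lemma semilinear_cl_diff:
  assumes D: "semilinear \<sigma> D" and xy: "x \<in> carrier F" "y \<in> carrier F"
  shows "D (Q.cl (x - y)) = D (Q.cl x) - D (Q.cl y)"
proof -
  have "D (Q.cl (x - y) \<oplus>\<^bsub>A\<^esub> Q.cl y) = D (Q.cl (x - y)) + D (Q.cl y)"
    using D F_diff xy unfolding semilinear_def by (auto simp: A_simps(1))
  then show ?thesis by (simp add: A_simps)
qed

text \<open>The classes of \<open>gen g\<close> generate the module: the differences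
  \<open>g - 1\<close> span the augmentation ideal over the integers, and a pair
  \<open>(s, x)\<close> is \<open>s\<close> times the pair of 1 and \<open>x\<close>.\<close>

lemma semilinear_eq_0:
  assumes D: "semilinear \<sigma> D" and 0: "\<And>g. g \<in> carrier G \<Longrightarrow> D (Q.cl (gen g)) = 0" and a: "a \<in> carrier A"
  shows "D a = 0"
proof -
  let ?t = "\<lambda>x. frag_of (\<one>\<^bsub>S\<^esub>, x)"
  have tF: "?t x \<in> carrier F" if "x \<in> carrier I" for x using that by (intro frag_of_F) auto
  have t_diff: "D (Q.cl (?t (x - y))) = D (Q.cl (?t x)) - D (Q.cl (?t y))"
    if x: "x \<in> carrier I" and y: "y \<in> carrier I" and xy: "x - y \<in> carrier I" for x y
  proof -
    have "?t ((x - y) + y) - ?t (x - y) - ?t y \<in> N"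
      using rel_add_r[OF S.one_closed xy y] N_props(5) by blast
    then have "?t x - (?t (x - y) + ?t y) \<in> N" by (simp add: diff_diff_eq)
    then have "?t (x - y) - (?t x - ?t y) \<in> N" using N_props(4) by (force simp: algebra_simps)
    then have "Q.cl (?t (x - y)) = Q.cl (?t x - ?t y)" by (simp only: Q.cl_eq_iff)
    then show ?thesis using semilinear_cl_diff[OF D tF[OF x] tF[OF y]] by simp
  qed
  \<comment> \<open>Projection of the group ring onto the augmentation ideal along the multiples of
    the unit element. It sends \<open>g\<close> to \<open>g - 1\<close>, so the induction can run
    over arbitrary integral combinations of group elements.\<close>
  let ?r = "\<lambda>x. x - frag_cmul (augmentation x) (frag_of \<one>)"
  have r_diff: "?r (x - y) = ?r x - ?r y" for x y
    by (simp add: augmentation_diff frag_cmul_diff_distrib algebra_simps)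
  have aug: "?r x \<in> carrier I \<and> D (Q.cl (?t (?r x))) = 0" if x: "x \<in> carrier R" for x
  proof -
    have "Poly_Mapping.keys x \<subseteq> carrier G" using x by (simp add: carrier_group_ring)
    then show ?thesis
    proof (induction rule: frag_induction)
      case zero
      have z: "0 \<in> carrier I" by (simp add: I_iff augmentation_0 carrier_group_ring)
      then show ?case using t_diff[OF z z] by (simp add: augmentation_0)
    next
      case (one g)
      then show ?case using 0 diff_one_I[OF one] by (simp add: augmentation_single gen_def)
    next
      case (diff x y)
      have "?r x - ?r y \<in> carrier I"
        using diff Poly_Mapping.keys_diff[of "?r x" "?r y"] by (auto simp: I_iff augmentation_diff carrier_group_ring simp del: minus_frag_cmul)
      then show ?case unfolding r_diff using diff t_diff[of "?r x" "?r y"] by simp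
    qed
  qed
  have t0: "D (Q.cl (?t x)) = 0" if x: "x \<in> carrier I" for x
  proof -
    have "x \<in> carrier R" "?r x = x" using x by (simp_all add: I_iff)
    then show ?thesis using aug[of x] by simp
  qed
  obtain c where c: "c \<in> carrier F" "a = Q.cl c" using a unfolding A_simps(1) by blast
  have "c \<in> carrier F \<and> D (Q.cl c) = 0"
    using c(1)
  proof (rule F_induct)
    show "0 \<in> carrier F \<and> D (Q.cl 0) = 0" using semilinear_0[OF D] Q.M_0 by (simp add: A_simps)
    fix s x assume s: "s \<in> carrier S" and x: "x \<in> carrier I"
    have "Q.cl (frag_of (s, x)) = s \<odot>\<^bsub>A\<^esub> Q.cl (?t x)" using s x tF by (simp add: smult_A act_frag)
    moreover have "D (s \<odot>\<^bsub>A\<^esub> Q.cl (?t x)) = lin \<sigma> s * D (Q.cl (?t x))"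
      using D s tF[OF x] unfolding semilinear_def by (auto simp: A_simps(1))
    ultimately show "frag_of (s, x) \<in> carrier F \<and> D (Q.cl (frag_of (s, x))) = 0"
      using t0[OF x] frag_of_F[OF s x] by simp
  next
    fix x y assume "x \<in> carrier F \<and> D (Q.cl x) = 0" "y \<in> carrier F \<and> D (Q.cl y) = 0"
    then show "x - y \<in> carrier F \<and> D (Q.cl (x - y)) = 0" using semilinear_cl_diff[OF D] F_diff by simp
  qed
  then show ?thesis using c by simp
qed

lemma semilinear_finsum:
  assumes D: "semilinear \<sigma> D" and "finite T" "f \<in> T \<rightarrow> carrier A"
  shows "D (\<Oplus>\<^bsub>A\<^esub>i\<in>T. f i) = (\<Sum>i\<in>T. D (f i))"
  using assms(2,3)
proof (induction T)
  case empty
  then show ?case using semilinear_0[OF D] by simp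
next
  case (insert i T)
  have "D (f i \<oplus>\<^bsub>A\<^esub> (\<Oplus>\<^bsub>A\<^esub>i\<in>T. f i)) = D (f i) + D (\<Oplus>\<^bsub>A\<^esub>i\<in>T. f i)"
    using D insert A.M.finsum_closed[of f T] unfolding semilinear_def by blast
  then show ?case using insert by (simp add: Pi_iff)
qed

lemma lin_finsum:
  assumes "finite T" "f \<in> T \<rightarrow> carrier S"
  shows "lin \<sigma> (\<Oplus>\<^bsub>S\<^esub>i\<in>T. f i) = (\<Sum>i\<in>T. lin \<sigma> (f i))"
  using assms
proof (induction T)
  case (insert i T)
  then show ?case by (simp add: Pi_iff lin_S)
qed (simp add: lin_S)

definition left_kernel :: "nat \<Rightarrow> nat \<Rightarrow> (nat \<Rightarrow> nat \<Rightarrow> 'b \<Rightarrow>\<^sub>0 int) \<Rightarrow> (nat \<Rightarrow> complex) set" where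
  "left_kernel m h Q = {y. \<forall>j<h. (\<Sum>i<m. lin \<sigma> (Q i j) * y i) = 0}"

text \<open>Functionals on a cokernel are the functionals on the free module that kill the columns
  of \<open>Q\<close>. After evaluation at \<open>\<sigma>\<close> these are the row vectors
  \<open>y\<close> with \<open>y Q = 0\<close>.\<close>

lemma presentation_functionals:
  assumes pres: "presentation_matrix S A m h Q"
  obtains a where "a \<in> {..<m} \<rightarrow> carrier A"
    "\<And>D. semilinear \<sigma> D \<Longrightarrow> (\<lambda>i. D (a i)) \<in> left_kernel m h Q"
    "\<And>D x. semilinear \<sigma> D \<Longrightarrow> (\<And>i. i < m \<Longrightarrow> D (a i) = 0) \<Longrightarrow> x \<in> carrier A \<Longrightarrow> D x = 0"
    "\<And>y. y \<in> left_kernel m h Q \<Longrightarrow> \<exists>D. semilinear \<sigma> D \<and> (\<forall>i<m. D (a i) = y i)"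
proof -
  have QS: "\<And>i j. i < m \<Longrightarrow> j < h \<Longrightarrow> Q i j \<in> carrier S" using pres by (auto simp: presentation_matrix_def)
  obtain a where a: "a \<in> {..<m} \<rightarrow> carrier A"
    and span: "\<And>x. x \<in> carrier A \<Longrightarrow> \<exists>c \<in> {..<m} \<rightarrow> carrier S. x = (\<Oplus>\<^bsub>A\<^esub>i\<in>{..<m}. c i \<odot>\<^bsub>A\<^esub> a i)"
    and rel: "\<And>c. c \<in> {..<m} \<rightarrow> carrier S \<Longrightarrow> (\<Oplus>\<^bsub>A\<^esub>i\<in>{..<m}. c i \<odot>\<^bsub>A\<^esub> a i) = \<zero>\<^bsub>A\<^esub> \<longleftrightarrow>
       (\<exists>d \<in> {..<h} \<rightarrow> carrier S. \<forall>i<m. c i = (\<Oplus>\<^bsub>S\<^esub>j\<in>{..<h}. Q i j \<otimes>\<^bsub>S\<^esub> d j))"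
  proof -
    from pres[unfolded presentation_matrix_def, THEN conjunct2] obtain a where
      a: "a \<in> {..<m} \<rightarrow> carrier A" and
      r: "(\<forall>x\<in>carrier A. \<exists>c \<in> {..<m} \<rightarrow> carrier S. x = (\<Oplus>\<^bsub>A\<^esub>i\<in>{..<m}. c i \<odot>\<^bsub>A\<^esub> a i)) \<and>
        (\<forall>c \<in> {..<m} \<rightarrow> carrier S. (\<Oplus>\<^bsub>A\<^esub>i\<in>{..<m}. c i \<odot>\<^bsub>A\<^esub> a i) = \<zero>\<^bsub>A\<^esub> \<longleftrightarrow>
          (\<exists>d \<in> {..<h} \<rightarrow> carrier S. \<forall>i<m. c i = (\<Oplus>\<^bsub>S\<^esub>j\<in>{..<h}. Q i j \<otimes>\<^bsub>S\<^esub> d j)))"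
      by (rule bexE)
    show thesis using that[OF a bspec[OF r[THEN conjunct1]] bspec[OF r[THEN conjunct2]]] .
  qed
  define comb where "comb c = (\<Oplus>\<^bsub>A\<^esub>i\<in>{..<m}. c i \<odot>\<^bsub>A\<^esub> a i)" for c
  have term_closed: "(\<lambda>i. c i \<odot>\<^bsub>A\<^esub> a i) \<in> {..<m} \<rightarrow> carrier A" if "c \<in> {..<m} \<rightarrow> carrier S" for c
    using that a by auto
  have comb_closed: "comb c \<in> carrier A" if "c \<in> {..<m} \<rightarrow> carrier S" for c
    unfolding comb_def using term_closed[OF that] by (rule A.M.finsum_closed)
  have D_comb: "D (comb c) = (\<Sum>i<m. lin \<sigma> (c i) * D (a i))"
    if D: "semilinear \<sigma> D" and c: "c \<in> {..<m} \<rightarrow> carrier S" for D c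
  proof -
    have "D (comb c) = (\<Sum>i<m. D (c i \<odot>\<^bsub>A\<^esub> a i))"
      unfolding comb_def by (rule semilinear_finsum[OF D _ term_closed[OF c]]) simp
    also have "\<dots> = (\<Sum>i<m. lin \<sigma> (c i) * D (a i))"
    proof (intro sum.cong refl)
      fix i assume "i \<in> {..<m}"
      then have "c i \<in> carrier S" "a i \<in> carrier A" using c a by auto
      then show "D (c i \<odot>\<^bsub>A\<^esub> a i) = lin \<sigma> (c i) * D (a i)" using D unfolding semilinear_def by blast
    qed
    finally show ?thesis .
  qed
  have comb_add: "comb (\<lambda>i. c i + c' i) = comb c \<oplus>\<^bsub>A\<^esub> comb c'"
    if c: "c \<in> {..<m} \<rightarrow> carrier S" and c': "c' \<in> {..<m} \<rightarrow> carrier S" for c c'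
  proof -
    have "comb (\<lambda>i. c i + c' i) = (\<Oplus>\<^bsub>A\<^esub>i\<in>{..<m}. c i \<odot>\<^bsub>A\<^esub> a i \<oplus>\<^bsub>A\<^esub> c' i \<odot>\<^bsub>A\<^esub> a i)"
      unfolding comb_def
    proof (rule A.M.finsum_cong')
      fix i assume "i \<in> {..<m}"
      then have "c i \<in> carrier S" "c' i \<in> carrier S" "a i \<in> carrier A" using c c' a by auto
      from A.smult_l_distr[OF this] show "(c i + c' i) \<odot>\<^bsub>A\<^esub> a i = c i \<odot>\<^bsub>A\<^esub> a i \<oplus>\<^bsub>A\<^esub> c' i \<odot>\<^bsub>A\<^esub> a i"
        by (simp add: group_ring_simps)
    qed (use term_closed[OF c] term_closed[OF c'] in auto)
    also have "\<dots> = comb c \<oplus>\<^bsub>A\<^esub> comb c'"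
      unfolding comb_def by (rule A.M.finsum_addf[OF term_closed[OF c] term_closed[OF c']])
    finally show ?thesis .
  qed
  show thesis
  proof (rule that[OF a])
    fix D assume D: "semilinear \<sigma> D"
    show "(\<lambda>i. D (a i)) \<in> left_kernel m h Q"
      unfolding left_kernel_def
    proof (intro CollectI allI impI)
      fix j assume j: "j < h"
      have Qj: "(\<lambda>i. Q i j) \<in> {..<m} \<rightarrow> carrier S" using QS j by auto
      \<comment> \<open>Column \<open>j\<close> is the combination of the columns whose coefficients
        form the \<open>j\<close>-th unit vector, hence a relation.\<close>
      have "\<forall>i<m. Q i j = (\<Oplus>\<^bsub>S\<^esub>j'\<in>{..<h}. Q i j' \<otimes>\<^bsub>S\<^esub> (if j = j' then \<one>\<^bsub>S\<^esub> else \<zero>\<^bsub>S\<^esub>))"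
      proof (intro allI impI)
        fix i assume i: "i < m"
        have "(\<Oplus>\<^bsub>S\<^esub>j'\<in>{..<h}. Q i j' \<otimes>\<^bsub>S\<^esub> (if j = j' then \<one>\<^bsub>S\<^esub> else \<zero>\<^bsub>S\<^esub>)) = (\<Oplus>\<^bsub>S\<^esub>j'\<in>{..<h}. if j = j' then Q i j' else \<zero>\<^bsub>S\<^esub>)"
          using QS i by (intro S.finsum_cong') auto
        also have "\<dots> = Q i j" using j QS i by (intro S.finsum_singleton) auto
        finally show "Q i j = (\<Oplus>\<^bsub>S\<^esub>j'\<in>{..<h}. Q i j' \<otimes>\<^bsub>S\<^esub> (if j = j' then \<one>\<^bsub>S\<^esub> else \<zero>\<^bsub>S\<^esub>))" ..
      qed
      moreover have "(\<lambda>j'. if j = j' then \<one>\<^bsub>S\<^esub> else \<zero>\<^bsub>S\<^esub>) \<in> {..<h} \<rightarrow> carrier S" by simp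
      ultimately have "comb (\<lambda>i. Q i j) = \<zero>\<^bsub>A\<^esub>" unfolding comb_def rel[OF Qj] by (rule bexI)
      then show "(\<Sum>i<m. lin \<sigma> (Q i j) * D (a i)) = 0" using D_comb[OF D Qj] semilinear_0[OF D] by simp
    qed
  next
    fix D x assume D: "semilinear \<sigma> D" and 0: "\<And>i. i < m \<Longrightarrow> D (a i) = 0" and x: "x \<in> carrier A"
    obtain c where "c \<in> {..<m} \<rightarrow> carrier S" "x = comb c" using span[OF x] unfolding comb_def by blast
    then show "D x = 0" using D_comb[OF D] 0 by simp
  next
    fix y assume y: "y \<in> left_kernel m h Q"
    define L where "L c = (\<Sum>i<m. lin \<sigma> (c i) * y i)" for c
    \<comment> \<open>Two expressions of one element differ by a combination of the columns of
      \<open>Q\<close>, and \<open>y\<close> annihilates these; so \<open>L\<close> depends on the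
      element alone.\<close>
    have wd: "L c = L c'" if c: "c \<in> {..<m} \<rightarrow> carrier S" and c': "c' \<in> {..<m} \<rightarrow> carrier S" and eq: "comb c = comb c'" for c c'
    proof -
      let ?e = "\<lambda>i. c i - c' i"
      have e: "?e \<in> {..<m} \<rightarrow> carrier S"
      proof
        fix i assume "i \<in> {..<m}"
        then have "c i + - c' i \<in> carrier S" using c c' by (intro group_ring_add_closed group_ring_uminus_closed) auto
        then show "c i - c' i \<in> carrier S" by simp
      qed
      have "comb ?e \<oplus>\<^bsub>A\<^esub> comb c' = comb (\<lambda>i. ?e i + c' i)" using comb_add[OF e c'] by simp
      also have "\<dots> = \<zero>\<^bsub>A\<^esub> \<oplus>\<^bsub>A\<^esub> comb c'" using eq comb_closed[OF c'] by simp
      finally have "comb ?e = \<zero>\<^bsub>A\<^esub>"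
        by (rule A.M.add.r_cancel[OF _ comb_closed[OF e] A.M.zero_closed comb_closed[OF c']])
      then obtain d where d: "d \<in> {..<h} \<rightarrow> carrier S" "\<And>i. i < m \<Longrightarrow> ?e i = (\<Oplus>\<^bsub>S\<^esub>j\<in>{..<h}. Q i j \<otimes>\<^bsub>S\<^esub> d j)"
        using rel[OF e] unfolding comb_def by blast
      have "lin \<sigma> (?e i) = (\<Sum>j<h. lin \<sigma> (Q i j) * lin \<sigma> (d j))" if i: "i < m" for i
      proof -
        have "lin \<sigma> (?e i) = (\<Sum>j<h. lin \<sigma> (Q i j \<otimes>\<^bsub>S\<^esub> d j))"
          unfolding d(2)[OF i] using d(1) QS i by (intro lin_finsum) auto
        also have "\<dots> = (\<Sum>j<h. lin \<sigma> (Q i j) * lin \<sigma> (d j))"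
          using d(1) QS i by (intro sum.cong refl lin_S) auto
        finally show ?thesis .
      qed
      then have "(\<Sum>i<m. lin \<sigma> (?e i) * y i) = (\<Sum>i<m. \<Sum>j<h. lin \<sigma> (d j) * (lin \<sigma> (Q i j) * y i))"
        by (intro sum.cong refl) (simp add: sum_distrib_left ac_simps)
      also have "\<dots> = (\<Sum>j<h. lin \<sigma> (d j) * (\<Sum>i<m. lin \<sigma> (Q i j) * y i))"
        by (subst sum.swap) (simp add: sum_distrib_left)
      also have "\<dots> = 0" using y by (simp add: left_kernel_def)
      finally show ?thesis by (simp add: L_def lin_diff left_diff_distrib sum_subtractf)
    qed
    define D where "D x = L (SOME c. c \<in> {..<m} \<rightarrow> carrier S \<and> x = comb c)" for x
    have D_val: "D (comb c) = L c" if c: "c \<in> {..<m} \<rightarrow> carrier S" for c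
    proof -
      let ?c = "SOME c'. c' \<in> {..<m} \<rightarrow> carrier S \<and> comb c = comb c'"
      have "\<exists>c'. c' \<in> {..<m} \<rightarrow> carrier S \<and> comb c = comb c'" using c by (intro exI[of _ c]) simp
      from someI_ex[OF this] have "?c \<in> {..<m} \<rightarrow> carrier S" "comb c = comb ?c" by simp_all
      from wd[OF c this] show ?thesis unfolding D_def by simp
    qed
    have ex: "\<exists>c. c \<in> {..<m} \<rightarrow> carrier S \<and> x = comb c" if "x \<in> carrier A" for x
      using span[OF that] unfolding comb_def by blast
    have "semilinear \<sigma> D"
      unfolding semilinear_def
    proof (intro conjI ballI)
      fix x x' assume "x \<in> carrier A" "x' \<in> carrier A"
      then obtain c c' where c: "c \<in> {..<m} \<rightarrow> carrier S" "x = comb c" and c': "c' \<in> {..<m} \<rightarrow> carrier S" "x' = comb c'"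
        using ex by metis
      have cc: "(\<lambda>i. c i + c' i) \<in> {..<m} \<rightarrow> carrier S" using c c' by (auto intro: group_ring_add_closed)
      show "D (x \<oplus>\<^bsub>A\<^esub> x') = D x + D x'"
        unfolding c(2) c'(2) comb_add[OF c(1) c'(1), symmetric] D_val[OF cc] D_val[OF c(1)] D_val[OF c'(1)]
        by (simp add: L_def lin_add distrib_right sum.distrib)
    next
      fix s x assume s: "s \<in> carrier S" and "x \<in> carrier A"
      then obtain c where c: "c \<in> {..<m} \<rightarrow> carrier S" "x = comb c" using ex by metis
      have sc: "(\<lambda>i. s \<otimes>\<^bsub>S\<^esub> c i) \<in> {..<m} \<rightarrow> carrier S" using s c by auto
      have "s \<odot>\<^bsub>A\<^esub> comb c = (\<Oplus>\<^bsub>A\<^esub>i\<in>{..<m}. s \<odot>\<^bsub>A\<^esub> (c i \<odot>\<^bsub>A\<^esub> a i))"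
        unfolding comb_def by (rule A.finsum_smult_ldistr[OF _ s term_closed[OF c(1)]]) simp
      also have "\<dots> = comb (\<lambda>i. s \<otimes>\<^bsub>S\<^esub> c i)"
        unfolding comb_def
      proof (rule A.M.finsum_cong')
        fix i assume "i \<in> {..<m}"
        then have "c i \<in> carrier S" "a i \<in> carrier A" using c a by auto
        from A.smult_assoc1[OF s this] show "s \<odot>\<^bsub>A\<^esub> (c i \<odot>\<^bsub>A\<^esub> a i) = s \<otimes>\<^bsub>S\<^esub> c i \<odot>\<^bsub>A\<^esub> a i" ..
      qed (use term_closed[OF sc] in auto)
      finally have "D (s \<odot>\<^bsub>A\<^esub> x) = L (\<lambda>i. s \<otimes>\<^bsub>S\<^esub> c i)" using c(2) D_val[OF sc] by simp
      also have "\<dots> = lin \<sigma> s * L c"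
        unfolding L_def sum_distrib_left using c(1) s by (intro sum.cong refl) (auto simp: lin_S Pi_iff)
      finally show "D (s \<odot>\<^bsub>A\<^esub> x) = lin \<sigma> s * D x" using c(2) D_val[OF c(1)] by simp
    qed
    moreover have "D (a i) = y i" if i: "i < m" for i
    proof -
      let ?c = "\<lambda>i'. if i = i' then \<one>\<^bsub>S\<^esub> else \<zero>\<^bsub>S\<^esub>"
      have c: "?c \<in> {..<m} \<rightarrow> carrier S" by simp
      have "comb ?c = (\<Oplus>\<^bsub>A\<^esub>i'\<in>{..<m}. if i = i' then a i' else \<zero>\<^bsub>A\<^esub>)"
        unfolding comb_def
      proof (rule A.M.finsum_cong')
        fix i' assume "i' \<in> {..<m}"
        then have "a i' \<in> carrier A" using a by auto
        then show "(if i = i' then \<one>\<^bsub>S\<^esub> else \<zero>\<^bsub>S\<^esub>) \<odot>\<^bsub>A\<^esub> a i' = (if i = i' then a i' else \<zero>\<^bsub>A\<^esub>)" by simp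
      qed (use a in auto)
      also have "\<dots> = a i" using i a by (intro A.M.finsum_singleton) auto
      finally have "D (a i) = L ?c" using D_val[OF c] by simp
      also have "\<dots> = (\<Sum>i'<m. if i = i' then y i' else 0)"
        unfolding L_def by (intro sum.cong) (auto simp: lin_S)
      finally show ?thesis using i by simp
    qed
    ultimately show "\<exists>D. semilinear \<sigma> D \<and> (\<forall>i<m. D (a i) = y i)" by blast
  qed
qed

lemma semilinear_combination:
  assumes "semilinear \<sigma> D" "semilinear \<sigma> D'"
  shows "semilinear \<sigma> (\<lambda>x. \<alpha> * D x + \<beta> * D' x)"
  using assms unfolding semilinear_def by (simp add: algebra_simps)

end

text \<open>Both sides describe the space of semilinear functionals, once by the values on the
  classes of \<open>gen g\<close> and once by the values on the generators of the presentation.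
  Either set of values determines the functional, so independence is preserved both ways.\<close>

theorem crossed_iff_left_kernel:
  assumes \<sigma>_mult: "\<And>x y. x \<in> carrier H \<Longrightarrow> y \<in> carrier H \<Longrightarrow> \<sigma> (x \<otimes>\<^bsub>H\<^esub> y) = \<sigma> x * \<sigma> y"
    and \<sigma>_one: "\<sigma> \<one>\<^bsub>H\<^esub> = 1"
    and pres: "presentation_matrix S A m h Q"
  shows "(\<exists>d d'. crossed \<sigma> d \<and> crossed \<sigma> d' \<and> indep2 (carrier G) d d') \<longleftrightarrow>
    (\<exists>y\<in>left_kernel \<sigma> m h Q. \<exists>y'\<in>left_kernel \<sigma> m h Q. indep2 {..<m} y y')"
proof -
  note c = \<sigma>_mult \<sigma>_one
  obtain a where a: "a \<in> {..<m} \<rightarrow> carrier A"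
    and ker: "\<And>D. semilinear \<sigma> D \<Longrightarrow> (\<lambda>i. D (a i)) \<in> left_kernel \<sigma> m h Q"
    and zero: "\<And>D x. semilinear \<sigma> D \<Longrightarrow> (\<And>i. i < m \<Longrightarrow> D (a i) = 0) \<Longrightarrow> x \<in> carrier A \<Longrightarrow> D x = 0"
    and ext: "\<And>y. y \<in> left_kernel \<sigma> m h Q \<Longrightarrow> \<exists>D. semilinear \<sigma> D \<and> (\<forall>i<m. D (a i) = y i)"
    using presentation_functionals[OF c pres] by blast
  show ?thesis
  proof
    assume "\<exists>d d'. crossed \<sigma> d \<and> crossed \<sigma> d' \<and> indep2 (carrier G) d d'"
    then obtain d d' where d: "crossed \<sigma> d" "crossed \<sigma> d'" "indep2 (carrier G) d d'" by blast
    obtain D where D: "semilinear \<sigma> D" "\<And>g. g \<in> carrier G \<Longrightarrow> D (Q.cl (gen g)) = d g"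
      using crossed_extends[OF c d(1)] by blast
    obtain D' where D': "semilinear \<sigma> D'" "\<And>g. g \<in> carrier G \<Longrightarrow> D' (Q.cl (gen g)) = d' g"
      using crossed_extends[OF c d(2)] by blast
    have "indep2 {..<m} (\<lambda>i. D (a i)) (\<lambda>i. D' (a i))"
      unfolding indep2_def
    proof (intro allI impI)
      fix \<alpha> \<beta> assume "\<forall>i\<in>{..<m}. \<alpha> * D (a i) + \<beta> * D' (a i) = 0"
      then have "\<alpha> * D x + \<beta> * D' x = 0" if "x \<in> carrier A" for x
        using zero[OF semilinear_combination[OF c D(1) D'(1)] _ that] by blast
      moreover have "Q.cl (gen g) \<in> carrier A" if "g \<in> carrier G" for g using gen_F[OF that] by (simp add: A_simps)
      ultimately have "\<forall>g\<in>carrier G. \<alpha> * d g + \<beta> * d' g = 0" using D(2) D'(2) by metis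
      then show "\<alpha> = 0 \<and> \<beta> = 0" using d(3) unfolding indep2_def by blast
    qed
    then show "\<exists>y\<in>left_kernel \<sigma> m h Q. \<exists>y'\<in>left_kernel \<sigma> m h Q. indep2 {..<m} y y'"
      using ker[OF D(1)] ker[OF D'(1)] by blast
  next
    assume "\<exists>y\<in>left_kernel \<sigma> m h Q. \<exists>y'\<in>left_kernel \<sigma> m h Q. indep2 {..<m} y y'"
    then obtain y y' where y: "y \<in> left_kernel \<sigma> m h Q" "y' \<in> left_kernel \<sigma> m h Q" "indep2 {..<m} y y'" by blast
    obtain D where D: "semilinear \<sigma> D" "\<And>i. i < m \<Longrightarrow> D (a i) = y i" using ext[OF y(1)] by blast
    obtain D' where D': "semilinear \<sigma> D'" "\<And>i. i < m \<Longrightarrow> D' (a i) = y' i" using ext[OF y(2)] by blast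
    have "indep2 (carrier G) (\<lambda>g. D (Q.cl (gen g))) (\<lambda>g. D' (Q.cl (gen g)))"
      unfolding indep2_def
    proof (intro allI impI)
      fix \<alpha> \<beta> assume "\<forall>g\<in>carrier G. \<alpha> * D (Q.cl (gen g)) + \<beta> * D' (Q.cl (gen g)) = 0"
      then have "\<alpha> * D x + \<beta> * D' x = 0" if "x \<in> carrier A" for x
        using semilinear_eq_0[OF c semilinear_combination[OF c D(1) D'(1)] _ that] by blast
      then have "\<forall>i\<in>{..<m}. \<alpha> * y i + \<beta> * y' i = 0" using a D(2) D'(2) by (metis PiE lessThan_iff)
      then show "\<alpha> = 0 \<and> \<beta> = 0" using y(3) unfolding indep2_def by blast
    qed
    then show "\<exists>d d'. crossed \<sigma> d \<and> crossed \<sigma> d' \<and> indep2 (carrier G) d d'"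
      using semilinear_crossed[OF c D(1)] semilinear_crossed[OF c D'(1)] by blast
  qed
qed

end

section \<open>Twisted homology in degree one\<close>

definition scale :: "complex \<Rightarrow> ('x \<Rightarrow>\<^sub>0 complex) \<Rightarrow> ('x \<Rightarrow>\<^sub>0 complex)" where
  "scale z = Poly_Mapping.map ((*) z)"

lemma lookup_scale: "Poly_Mapping.lookup (scale z f) k = z * Poly_Mapping.lookup f k"
  by (simp add: scale_def Poly_Mapping.map.rep_eq when_def)

lemma keys_scale: "Poly_Mapping.keys (scale z f) \<subseteq> Poly_Mapping.keys f"
  by (auto simp: in_keys_iff lookup_scale)

lemma scale_simps: "scale z (f + g) = scale z f + scale z g" "scale (a + b) f = scale a f + scale b f"
  "scale a (scale b f) = scale (a * b) f" "scale 1 f = f" "scale z 0 = 0" "scale 0 f = 0" "scale (- 1) f = - f"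
  by (auto intro!: poly_mapping_eqI simp: lookup_scale lookup_add algebra_simps)

lemma scale_single: "scale z (Poly_Mapping.single x c) = Poly_Mapping.single x (z * c)"
  by (auto intro!: poly_mapping_eqI simp: lookup_scale lookup_single when_def)

lemma char_value_scale: "char_value d (scale z f) = z * char_value d f"
proof -
  have "char_value d (scale z f) = (\<Sum>x\<in>Poly_Mapping.keys f. Poly_Mapping.lookup (scale z f) x * d x)"
    by (rule char_value_superset) (auto simp: keys_scale)
  then show ?thesis by (simp add: char_value_def lookup_scale sum_distrib_left ac_simps)
qed

lemma bar_boundary1_char_value: "bar_boundary1 \<rho> = char_value (\<lambda>g. \<rho> g - 1)"
  by (auto simp: bar_boundary1_def char_value_def)

locale twisted = group G for G :: "('a, 'm) monoid_scheme" (structure) +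
  fixes \<rho> :: "'a \<Rightarrow> complex"
  assumes \<rho>: "\<rho> \<in> carrier (char_group G)"
begin

text \<open>The condition \<open>crossed\<close>, with \<open>\<rho>\<close> in place of
  \<open>\<sigma>\<close> after \<open>p\<close>: homology refers to characters of \<open>G\<close>
  itself and not of a quotient.\<close>

definition crossed_hom :: "('a \<Rightarrow> complex) \<Rightarrow> bool" where
  "crossed_hom d \<longleftrightarrow> (\<forall>g\<in>carrier G. \<forall>h\<in>carrier G. d (g \<otimes> h) = \<rho> g * d h + d g)"

text \<open>One summand of \<open>bar_boundary2\<close>, with the coefficient as an argument so that
  additivity in the coefficient can be stated.\<close>

definition cell :: "'a \<times> 'a \<Rightarrow> complex \<Rightarrow> ('a \<Rightarrow>\<^sub>0 complex)" where
  "cell = (\<lambda>(g, h) c. Poly_Mapping.single h (c * \<rho> g) - Poly_Mapping.single (g \<otimes> h) c + Poly_Mapping.single g c)"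

abbreviation "Z1 \<equiv> twisted_cycles1 G \<rho>"
abbreviation "B1 \<equiv> twisted_boundaries1 G \<rho>"

lemma \<rho>_mult: "g \<in> carrier G \<Longrightarrow> h \<in> carrier G \<Longrightarrow> \<rho> (g \<otimes> h) = \<rho> g * \<rho> h"
  using \<rho> by (simp add: char_group_iff)

lemma cell_add: "cell k (a + b) = cell k a + cell k b" and cell_0: "cell k 0 = 0"
  and cell_scale: "scale z (cell k a) = cell k (z * a)"
  by (auto simp: cell_def single_add distrib_right lookup_scale lookup_single lookup_add lookup_minus when_def
      algebra_simps intro!: poly_mapping_eqI split: prod.splits)

lemma boundary2_eq: "bar_boundary2 G \<rho> c = (\<Sum>k\<in>Poly_Mapping.keys c. cell k (Poly_Mapping.lookup c k))"
  by (simp add: bar_boundary2_def cell_def case_prod_unfold)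

lemma boundary2_superset:
  "finite K \<Longrightarrow> Poly_Mapping.keys c \<subseteq> K \<Longrightarrow> bar_boundary2 G \<rho> c = (\<Sum>k\<in>K. cell k (Poly_Mapping.lookup c k))"
  unfolding boundary2_eq by (rule sum.mono_neutral_left) (auto simp: in_keys_iff cell_0)

lemma boundary2_add: "bar_boundary2 G \<rho> (c + c') = bar_boundary2 G \<rho> c + bar_boundary2 G \<rho> c'"
proof -
  let ?K = "Poly_Mapping.keys c \<union> Poly_Mapping.keys c'"
  have "Poly_Mapping.keys (c + c') \<subseteq> ?K" by (rule Poly_Mapping.keys_add)
  then show ?thesis
    by (simp add: boundary2_superset[of ?K "c + c'"] boundary2_superset[of ?K c] boundary2_superset[of ?K c']
        lookup_add cell_add sum.distrib)
qed

lemma boundary2_scale: "bar_boundary2 G \<rho> (scale z c) = scale z (bar_boundary2 G \<rho> c)"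
proof -
  have s: "scale z (sum f K) = (\<Sum>k\<in>K. scale z (f k))" for f :: "'x \<Rightarrow> 'a \<Rightarrow>\<^sub>0 complex" and K
    by (induction K rule: infinite_finite_induct) (auto simp: scale_simps)
  show ?thesis
    by (subst boundary2_superset[OF finite_keys keys_scale]) (simp add: lookup_scale boundary2_eq s cell_scale)
qed

lemma boundary2_single: "bar_boundary2 G \<rho> (Poly_Mapping.single (g, h) c) = cell (g, h) c"
  by (simp add: boundary2_eq cell_0)

lemma B1_scale: "c \<in> B1 \<Longrightarrow> scale z c \<in> B1"
  unfolding twisted_boundaries1_def
  using boundary2_scale[of z, symmetric] keys_scale[of z] by (fastforce simp: image_iff)

lemma B1_add: "c \<in> B1 \<Longrightarrow> c' \<in> B1 \<Longrightarrow> c + c' \<in> B1"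
proof -
  assume "c \<in> B1" "c' \<in> B1"
  then obtain b b' where b: "Poly_Mapping.keys b \<subseteq> carrier G \<times> carrier G" "c = bar_boundary2 G \<rho> b"
    and b': "Poly_Mapping.keys b' \<subseteq> carrier G \<times> carrier G" "c' = bar_boundary2 G \<rho> b'"
    unfolding twisted_boundaries1_def by blast
  have "Poly_Mapping.keys (b + b') \<subseteq> carrier G \<times> carrier G" using b b' Poly_Mapping.keys_add[of b b'] by blast
  then show "c + c' \<in> B1" unfolding twisted_boundaries1_def b(2) b'(2) boundary2_add[symmetric] by blast
qed

lemma B1_0: "0 \<in> B1"
proof -
  have "bar_boundary2 G \<rho> 0 = 0" by (simp add: boundary2_eq)
  then show ?thesis unfolding twisted_boundaries1_def by (metis (mono_tags, lifting) empty_subsetI imageI keys_zero mem_Collect_eq)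
qed

lemma crossed_boundary:
  assumes d: "crossed_hom d" and c: "c \<in> B1"
  shows "char_value d c = 0"
proof -
  obtain b where b: "Poly_Mapping.keys b \<subseteq> carrier G \<times> carrier G" "c = bar_boundary2 G \<rho> b"
    using c unfolding twisted_boundaries1_def by blast
  have "char_value d (cell k (Poly_Mapping.lookup b k)) = 0" if "k \<in> Poly_Mapping.keys b" for k
  proof -
    obtain g h where k: "k = (g, h)" by (cases k)
    then have "d (g \<otimes> h) = \<rho> g * d h + d g" using d b that unfolding crossed_hom_def by blast
    then show ?thesis
      by (simp add: k cell_def char_value_add char_value_diff char_value_single algebra_simps)
  qed
  then show ?thesis unfolding b(2) boundary2_eq char_value_sum by simp
qed

lemma crossed_principal: "crossed_hom (\<lambda>g. \<rho> g - 1)"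
  by (simp add: crossed_hom_def \<rho>_mult algebra_simps)

lemma Z1_iff: "c \<in> carrier Z1 \<longleftrightarrow> Poly_Mapping.keys c \<subseteq> carrier G \<and> char_value (\<lambda>g. \<rho> g - 1) c = 0"
  by (simp add: twisted_cycles1_def bar_boundary1_char_value)

lemma B1_Z1: "B1 \<subseteq> carrier Z1"
proof
  fix c assume c: "c \<in> B1"
  obtain b where b: "Poly_Mapping.keys b \<subseteq> carrier G \<times> carrier G" "c = bar_boundary2 G \<rho> b"
    using c unfolding twisted_boundaries1_def by blast
  have "Poly_Mapping.keys (cell k a) \<subseteq> carrier G" if "k \<in> Poly_Mapping.keys b" for k a
  proof -
    obtain g h where k: "k = (g, h)" by (cases k)
    then have gh: "g \<in> carrier G" "h \<in> carrier G" using b that by auto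
    let ?u = "Poly_Mapping.single h (a * \<rho> g)" and ?v = "Poly_Mapping.single (g \<otimes> h) a" and ?w = "Poly_Mapping.single g a"
    have "Poly_Mapping.keys (?u - ?v + ?w) \<subseteq> Poly_Mapping.keys (?u - ?v) \<union> Poly_Mapping.keys ?w" by (rule Poly_Mapping.keys_add)
    also have "\<dots> \<subseteq> (Poly_Mapping.keys ?u \<union> Poly_Mapping.keys ?v) \<union> Poly_Mapping.keys ?w" using Poly_Mapping.keys_diff[of ?u ?v] by blast
    also have "\<dots> \<subseteq> carrier G" using gh by auto
    finally show ?thesis by (simp add: k cell_def)
  qed
  then have "Poly_Mapping.keys c \<subseteq> carrier G" unfolding b(2) boundary2_eq by (intro keys_sum_subset)
  then show "c \<in> carrier Z1" using crossed_boundary[OF crossed_principal c] by (simp add: Z1_iff)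
qed

lemma Z1_scale: "c \<in> carrier Z1 \<Longrightarrow> scale z c \<in> carrier Z1"
  using keys_scale[of z c] by (auto simp: Z1_iff char_value_scale)

lemma Z1_add: "c \<in> carrier Z1 \<Longrightarrow> c' \<in> carrier Z1 \<Longrightarrow> c + c' \<in> carrier Z1"
  using Poly_Mapping.keys_add[of c c'] by (auto simp: Z1_iff char_value_add)

lemma smult_Z1: "z \<odot>\<^bsub>Z1\<^esub> c = scale z c"
  by (simp add: twisted_cycles1_def scale_def)

sublocale H1: quotient_setup Z1 B1
proof
  fix c assume "c \<in> carrier Z1"
  then show "- c \<in> carrier Z1" using Z1_scale[of c "- 1"] by (simp add: scale_simps)
next
  fix c assume "c \<in> B1"
  then show "- c \<in> B1" using B1_scale[of c "- 1"] by (simp add: scale_simps)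
qed (use B1_Z1 B1_0 B1_add Z1_add in \<open>auto simp: twisted_cycles1_def\<close>)

lemma smult_H1: "c \<in> carrier Z1 \<Longrightarrow> z \<odot>\<^bsub>twisted_H1 G \<rho>\<^esub> H1.cl c = H1.cl (scale z c)"
  unfolding twisted_H1_def
  by (subst H1.smult_Q) (auto simp: smult_Z1 B1_scale scale_simps)

text \<open>Positive dimension is mere nontriviality: a nonzero class is independent on its own, and
  in a zero space the coefficients 1 show every nonempty set to be dependent.\<close>

lemma vs_dim_iff: "vs_dim complex_field (twisted_H1 G \<rho>) \<ge> 1 \<longleftrightarrow> (\<exists>c\<in>carrier Z1. c \<notin> B1)"
proof -
  let ?V = "twisted_H1 G \<rho>"
  interpret V: abelian_group ?V unfolding twisted_H1_def by (rule H1.abelian_group_Q)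
  have zero: "\<zero>\<^bsub>?V\<^esub> = H1.cl 0" unfolding twisted_H1_def by (rule H1.zero_Q)
  have carr: "carrier ?V = H1.cl ` carrier Z1" unfolding twisted_H1_def by (rule H1.carrier_Q)
  have K: "carrier complex_field = UNIV" "\<zero>\<^bsub>complex_field\<^esub> = 0" by (simp_all add: ring_of_type_algebra_def)
  have sm: "z \<odot>\<^bsub>?V\<^esub> v \<in> carrier ?V" if "v \<in> carrier ?V" for z v
    using that Z1_scale by (auto simp: carr smult_H1)
  show ?thesis
  proof
    assume ge: "vs_dim complex_field ?V \<ge> 1"
    show "\<exists>c\<in>carrier Z1. c \<notin> B1"
    proof (rule ccontr)
      assume no: "\<not> ?thesis"
      then have zc: "v = \<zero>\<^bsub>?V\<^esub>" if v: "v \<in> carrier ?V" for v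
      proof -
        obtain c where "c \<in> carrier Z1" "v = H1.cl c" using v unfolding carr by blast
        then show ?thesis using no by (simp add: zero H1.cl_eq_iff)
      qed
      have "card T = 0" if T: "finite T" "T \<subseteq> carrier ?V" "lin_indep complex_field ?V T" for T
      proof -
        have "(\<Oplus>\<^bsub>?V\<^esub>v\<in>T. 1 \<odot>\<^bsub>?V\<^esub> v) \<in> carrier ?V" using sm T(2) by (intro V.finsum_closed) auto
        then have "(\<Oplus>\<^bsub>?V\<^esub>v\<in>T. (\<lambda>_. 1) v \<odot>\<^bsub>?V\<^esub> v) = \<zero>\<^bsub>?V\<^esub>" using zc by simp
        then have "\<forall>v\<in>T. (1 :: complex) = 0"
          using T(3)[unfolded lin_indep_def K, THEN bspec[of _ _ "\<lambda>_. 1"]] by simp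
        then show ?thesis using T(1) by auto
      qed
      then have "vs_dim complex_field ?V \<le> 0"
        unfolding vs_dim_def by (intro Sup_least) (auto simp: zero_enat_def)
      then show False using ge by simp
    qed
  next
    assume "\<exists>c\<in>carrier Z1. c \<notin> B1"
    then obtain c where c: "c \<in> carrier Z1" "c \<notin> B1" by blast
    have cV: "H1.cl c \<in> carrier ?V" using c by (simp add: carr)
    have "lin_indep complex_field ?V {H1.cl c}"
      unfolding lin_indep_def K
    proof (intro ballI impI)
      fix f v assume f: "(\<Oplus>\<^bsub>?V\<^esub>v\<in>{H1.cl c}. f v \<odot>\<^bsub>?V\<^esub> v) = \<zero>\<^bsub>?V\<^esub>" and v: "v \<in> {H1.cl c}"
      have "(\<Oplus>\<^bsub>?V\<^esub>v\<in>{H1.cl c}. f v \<odot>\<^bsub>?V\<^esub> v) = f (H1.cl c) \<odot>\<^bsub>?V\<^esub> H1.cl c"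
        using V.finsum_insert[of "{}" "H1.cl c" "\<lambda>v. f v \<odot>\<^bsub>?V\<^esub> v"] sm[OF cV] by simp
      then have "H1.cl (scale (f (H1.cl c)) c) = H1.cl 0" using f c by (simp add: smult_H1 zero)
      then have s: "scale (f (H1.cl c)) c \<in> B1" by (simp add: H1.cl_eq_iff)
      show "f v = 0"
      proof (rule ccontr)
        assume "f v \<noteq> 0"
        then have "scale (inverse (f v)) (scale (f (H1.cl c)) c) = c" using v by (simp add: scale_simps)
        then show False using B1_scale[OF s] c(2) by metis
      qed
    qed
    then have "enat (card {H1.cl c}) \<in> {enat (card S) | S. finite S \<and> S \<subseteq> carrier ?V \<and> lin_indep complex_field ?V S}"
      using cV by blast
    then have "enat (card {H1.cl c}) \<le> vs_dim complex_field ?V" unfolding vs_dim_def by (rule Sup_upper)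
    then show "vs_dim complex_field ?V \<ge> 1" by (simp add: one_enat_def)
  qed
qed

lemma vector_space_scale: "vector_space (scale :: complex \<Rightarrow> ('x \<Rightarrow>\<^sub>0 complex) \<Rightarrow> _)"
  by unfold_locales (simp_all add: scale_simps)

text \<open>A basis of the boundaries together with \<open>c\<close> is independent, which gives a
  linear functional that is 0 on boundaries and 1 at \<open>c\<close>. Its vanishing on the boundary
  of a cell \<open>(x, y)\<close> is the crossed homomorphism identity.\<close>

lemma nonboundary_functional:
  assumes c: "c \<notin> B1"
  obtains d where "crossed_hom d" "char_value d c = 1"
proof -
  interpret C: vector_space "scale :: complex \<Rightarrow> ('a \<Rightarrow>\<^sub>0 complex) \<Rightarrow> _" by (rule vector_space_scale)
  interpret P: vector_space_pair "scale :: complex \<Rightarrow> ('a \<Rightarrow>\<^sub>0 complex) \<Rightarrow> _" "(*) :: complex \<Rightarrow> complex \<Rightarrow> complex"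
    by unfold_locales (simp_all add: algebra_simps)
  have sub: "C.subspace B1" unfolding C.subspace_def using B1_0 B1_add B1_scale by blast
  obtain b where b: "b \<subseteq> B1" "C.independent b" "B1 \<subseteq> C.span b" using C.maximal_independent_subset[of B1] by blast
  have "C.span b \<subseteq> B1" using C.span_minimal[OF b(1) sub] .
  then have "c \<notin> C.span b" using c by blast
  then have "C.independent (insert c b)" using b(2) C.independent_insertI by blast
  then obtain g where g: "Vector_Spaces.linear scale (*) g" "\<forall>x\<in>insert c b. g x = (if x = c then 1 else 0)"
    using P.linear_independent_extend[of "insert c b" "\<lambda>x. if x = c then 1 else 0"] by blast
  interpret g: Vector_Spaces.linear "scale :: complex \<Rightarrow> ('a \<Rightarrow>\<^sub>0 complex) \<Rightarrow> _" "(*)" g by (rule g(1))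
  have gb: "g x = 0" if "x \<in> b" for x
    using g(2) that c b(1) by auto
  have gB: "g x = 0" if "x \<in> B1" for x
    using P.linear_eq_0_on_span[OF g(1) gb] b(3) that by blast
  define d where "d x = g (Poly_Mapping.single x 1)" for x
  have gs: "g (Poly_Mapping.single x a) = a * d x" for x a
    using g.scale[of a "Poly_Mapping.single x 1"] by (simp add: scale_single d_def)
  have gd: "g f = char_value d f" for f
  proof -
    have "g f = g (\<Sum>x\<in>Poly_Mapping.keys f. Poly_Mapping.single x (Poly_Mapping.lookup f x))"
      using poly_mapping_sum_single[of f] by simp
    also have "\<dots> = char_value d f" by (simp add: g.sum gs char_value_def)
    finally show ?thesis .
  qed
  have "crossed_hom d"
    unfolding crossed_hom_def
  proof (intro ballI)
    fix x y assume xy: "x \<in> carrier G" "y \<in> carrier G"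
    have "Poly_Mapping.keys (Poly_Mapping.single (x, y) (1::complex)) \<subseteq> carrier G \<times> carrier G" using xy by simp
    then have "cell (x, y) 1 \<in> B1"
      unfolding twisted_boundaries1_def boundary2_single[symmetric] by blast
    then have "char_value d (cell (x, y) 1) = 0" using gB gd by metis
    then show "d (x \<otimes> y) = \<rho> x * d y + d x"
      by (simp add: cell_def char_value_add char_value_diff char_value_single algebra_simps)
  qed
  moreover have "char_value d c = 1" using g(2) by (simp flip: gd)
  ultimately show thesis using that by blast
qed

lemma char_value_cmult: "char_value (\<lambda>g. \<alpha> * e g) f = \<alpha> * char_value e f"
  by (simp add: char_value_def sum_distrib_left ac_simps)

text \<open>Duality: the first homology is nonzero exactly when the crossed homomorphisms modulo the
  principal ones are. Cycles form the kernel of the principal functional, so a functional with value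
  1 on a cycle is not principal.\<close>

lemma V1_iff_crossed:
  "\<rho> \<in> V1 G \<longleftrightarrow> (\<exists>d. crossed_hom d \<and> \<not> (\<exists>\<alpha>. \<forall>g\<in>carrier G. d g = \<alpha> * (\<rho> g - 1)))"
proof -
  have "\<rho> \<in> V1 G \<longleftrightarrow> (\<exists>c\<in>carrier Z1. c \<notin> B1)"
    unfolding V1_def using \<rho> vs_dim_iff by simp
  also have "\<dots> \<longleftrightarrow> (\<exists>d. crossed_hom d \<and> \<not> (\<exists>\<alpha>. \<forall>g\<in>carrier G. d g = \<alpha> * (\<rho> g - 1)))"
  proof
    assume "\<exists>c\<in>carrier Z1. c \<notin> B1"
    then obtain c where c: "c \<in> carrier Z1" "c \<notin> B1" by blast
    obtain d where d: "crossed_hom d" "char_value d c = 1" using nonboundary_functional[OF c(2)] .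
    have "\<not> (\<forall>g\<in>carrier G. d g = \<alpha> * (\<rho> g - 1))" for \<alpha>
    proof
      assume a: "\<forall>g\<in>carrier G. d g = \<alpha> * (\<rho> g - 1)"
      have "char_value d c = char_value (\<lambda>g. \<alpha> * (\<rho> g - 1)) c"
        unfolding char_value_def using a c by (intro sum.cong) (auto simp: Z1_iff subset_iff)
      also have "\<dots> = 0" using c(1) char_value_cmult[of \<alpha> "\<lambda>g. \<rho> g - 1" c] by (simp add: Z1_iff)
      finally show False using d by simp
    qed
    then show "\<exists>d. crossed_hom d \<and> \<not> (\<exists>\<alpha>. \<forall>g\<in>carrier G. d g = \<alpha> * (\<rho> g - 1))" using d by blast
  next
    assume "\<exists>d. crossed_hom d \<and> \<not> (\<exists>\<alpha>. \<forall>g\<in>carrier G. d g = \<alpha> * (\<rho> g - 1))"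
    then obtain d where d: "crossed_hom d" "\<And>\<alpha>. \<exists>g\<in>carrier G. d g \<noteq> \<alpha> * (\<rho> g - 1)" by blast
    show "\<exists>c\<in>carrier Z1. c \<notin> B1"
    proof (cases "\<forall>g\<in>carrier G. \<rho> g = 1")
      case True
      obtain g where g: "g \<in> carrier G" "d g \<noteq> 0" using d(2)[of 0] by auto
      have "Poly_Mapping.single g 1 \<in> carrier Z1" using g True by (simp add: Z1_iff char_value_single)
      moreover have "Poly_Mapping.single g 1 \<notin> B1" using crossed_boundary[OF d(1)] g by (force simp: char_value_single)
      ultimately show ?thesis by blast
    next
      case False
      then obtain g0 where g0: "g0 \<in> carrier G" "\<rho> g0 \<noteq> 1" by blast
      obtain g where g: "g \<in> carrier G" "d g \<noteq> d g0 / (\<rho> g0 - 1) * (\<rho> g - 1)" using d(2) by blast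
      \<comment> \<open>The simplest cycle built from two group elements. A crossed homomorphism
        that vanishes on it takes at \<open>g\<close> the multiple of \<open>\<rho> g - 1\<close>
        fixed by its value at \<open>g0\<close>.\<close>
      let ?c = "Poly_Mapping.single g (\<rho> g0 - 1) - Poly_Mapping.single g0 (\<rho> g - 1)"
      have "Poly_Mapping.keys ?c \<subseteq> carrier G"
        using g(1) g0(1) Poly_Mapping.keys_diff[of "Poly_Mapping.single g (\<rho> g0 - 1)" "Poly_Mapping.single g0 (\<rho> g - 1)"]
        by (auto split: if_splits)
      then have "?c \<in> carrier Z1" by (simp add: Z1_iff char_value_diff char_value_single)
      moreover have "char_value d ?c \<noteq> 0"
        using g(2) g0(2) by (simp add: char_value_diff char_value_single field_simps)
      then have "?c \<notin> B1" using crossed_boundary[OF d(1)] by blast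
      ultimately show ?thesis by blast
    qed
  qed
  finally show ?thesis .
qed

text \<open>For trivial \<open>\<rho>\<close> the principal crossed homomorphism \<open>\<rho> - 1\<close> vanishes and cannot serve as the
  second member of an independent pair.\<close>

lemma V1_iff_indep:
  assumes "(\<exists>g\<in>carrier G. \<rho> g \<noteq> 1) \<or> (\<exists>d d'. crossed_hom d \<and> crossed_hom d' \<and> indep2 (carrier G) d d')"
  shows "\<rho> \<in> V1 G \<longleftrightarrow> (\<exists>d d'. crossed_hom d \<and> crossed_hom d' \<and> indep2 (carrier G) d d')"
proof
  assume "\<rho> \<in> V1 G"
  then obtain d where d: "crossed_hom d" "\<And>\<alpha>. \<exists>g\<in>carrier G. d g \<noteq> \<alpha> * (\<rho> g - 1)" using V1_iff_crossed by blast
  show "\<exists>d d'. crossed_hom d \<and> crossed_hom d' \<and> indep2 (carrier G) d d'"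
    using assms
  proof
    assume "\<exists>g\<in>carrier G. \<rho> g \<noteq> 1"
    then obtain g0 where g0: "g0 \<in> carrier G" "\<rho> g0 \<noteq> 1" by blast
    have "indep2 (carrier G) d (\<lambda>g. \<rho> g - 1)"
      unfolding indep2_def
    proof (intro allI impI)
      fix \<alpha> \<beta> assume e: "\<forall>g\<in>carrier G. \<alpha> * d g + \<beta> * (\<rho> g - 1) = 0"
      have "\<alpha> = 0"
      proof (rule ccontr)
        assume a: "\<alpha> \<noteq> 0"
        obtain g where g: "g \<in> carrier G" "d g \<noteq> (- \<beta> / \<alpha>) * (\<rho> g - 1)" using d(2) by blast
        have "\<alpha> * d g = - \<beta> * (\<rho> g - 1)" using e g(1) by (simp add: eq_neg_iff_add_eq_0)
        then have "d g = (- \<beta> / \<alpha>) * (\<rho> g - 1)" using a by (simp add: field_simps)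
        then show False using g(2) by simp
      qed
      then show "\<alpha> = 0 \<and> \<beta> = 0" using e g0 by auto
    qed
    then show ?thesis using d(1) crossed_principal by blast
  qed
next
  assume "\<exists>d d'. crossed_hom d \<and> crossed_hom d' \<and> indep2 (carrier G) d d'"
  then obtain d d' where d: "crossed_hom d" "crossed_hom d'" "indep2 (carrier G) d d'" by blast
  show "\<rho> \<in> V1 G"
  proof (rule ccontr)
    assume "\<rho> \<notin> V1 G"
    then obtain \<alpha> \<beta> where ab: "\<forall>g\<in>carrier G. d g = \<alpha> * (\<rho> g - 1)" "\<forall>g\<in>carrier G. d' g = \<beta> * (\<rho> g - 1)"
      using V1_iff_crossed d by blast
    \<comment> \<open>Both functions are multiples of \<open>\<rho> - 1\<close>, so this combination
      vanishes. If both of its coefficients are zero, \<open>d\<close> itself is zero, which is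
      again a dependence.\<close>
    have "\<forall>g\<in>carrier G. \<beta> * d g + (- \<alpha>) * d' g = 0"
    proof
      fix g assume g: "g \<in> carrier G"
      show "\<beta> * d g + (- \<alpha>) * d' g = 0"
        unfolding bspec[OF ab(1) g] bspec[OF ab(2) g] by (simp add: algebra_simps)
    qed
    then have "\<beta> = 0 \<and> - \<alpha> = 0" using d(3) unfolding indep2_def by blast
    then have "\<beta> = 0" "\<alpha> = 0" by simp_all
    then have "\<forall>g\<in>carrier G. 1 * d g + 0 * d' g = 0" using ab by simp
    then show False using d(3) unfolding indep2_def by (metis zero_neq_one)
  qed
qed

end

section \<open>The free abelian quotient\<close>

lemma exps_eq_carrier: "carrier (free_Abelian_group J) = exps J"
  by (auto simp: exps_def)

text \<open>Euclid's algorithm on the coordinates of \<open>a\<close>.\<close>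

lemma lattice_automorphism:
  fixes a :: "nat \<Rightarrow>\<^sub>0 int"
  assumes "finite J" "a \<in> exps J" "a \<noteq> 0"
  shows "\<exists>\<theta> \<theta>' j m. (\<forall>u v. \<theta> (u + v) = \<theta> u + \<theta> v) \<and> bij_betw \<theta> (exps J) (exps J) \<and>
    (\<forall>u. \<theta>' (\<theta> u) = u) \<and> j \<in> J \<and> m \<noteq> 0 \<and> \<theta> a = Poly_Mapping.single j m"
  using assms(2,3)
proof (induction "nat (\<Sum>i\<in>J. \<bar>Poly_Mapping.lookup a i\<bar>)" arbitrary: a rule: less_induct)
  case (less a)
  obtain j where j: "Poly_Mapping.lookup a j \<noteq> 0" using less(3) by (metis lookup_zero poly_mapping_eqI)
  have jJ: "j \<in> J" using j less(2) by (auto simp: exps_def in_keys_iff subset_iff)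
  show ?case
  proof (cases "\<exists>i. i \<noteq> j \<and> Poly_Mapping.lookup a i \<noteq> 0")
    case False
    then have "a = Poly_Mapping.single j (Poly_Mapping.lookup a j)"
      by (intro poly_mapping_eqI) (auto simp: lookup_single when_def)
    then show ?thesis using j jJ
      by (intro exI[of _ "\<lambda>u. u"] exI[of _ j] exI[of _ "Poly_Mapping.lookup a j"]) (auto simp: bij_betw_def)
  next
    case True
    then obtain i0 where i0: "i0 \<noteq> j" "Poly_Mapping.lookup a i0 \<noteq> 0" by blast
    obtain i k where ik: "i \<noteq> k" "Poly_Mapping.lookup a i \<noteq> 0" "Poly_Mapping.lookup a k \<noteq> 0"
      "\<bar>Poly_Mapping.lookup a k\<bar> \<le> \<bar>Poly_Mapping.lookup a i\<bar>"
    proof (cases "\<bar>Poly_Mapping.lookup a j\<bar> \<le> \<bar>Poly_Mapping.lookup a i0\<bar>")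
      case True
      then show thesis using that[of i0 j] i0 j by simp
    next
      case False
      then show thesis using that[of j i0] i0 j by simp
    qed
    have iJ: "i \<in> J" and kJ: "k \<in> J" using ik less(2) by (auto simp: exps_def in_keys_iff subset_iff)
    \<comment> \<open>With this sign the entry at \<open>k\<close> reduces the entry at
      \<open>i\<close> in absolute value. As it is nonzero and not larger, the reduction is
      strict.\<close>
    define c where "c = - sgn (Poly_Mapping.lookup a i) * sgn (Poly_Mapping.lookup a k)"
    define E where "E s u = u + Poly_Mapping.single i (s * c * Poly_Mapping.lookup u k)" for s and u :: "nat \<Rightarrow>\<^sub>0 int"
    have E_lookup: "Poly_Mapping.lookup (E s u) l = Poly_Mapping.lookup u l + (if l = i then s * c * Poly_Mapping.lookup u k else 0)" for s u l
      by (auto simp: E_def lookup_add lookup_single when_def)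
    have E_add: "E s (u + v) = E s u + E s v" for s u v
      by (rule poly_mapping_eqI) (auto simp: E_lookup lookup_add algebra_simps)
    have E_inv: "E (- s) (E s u) = u" for s u
      using ik(1) by (intro poly_mapping_eqI) (auto simp: E_lookup)
    have E_exps: "E s u \<in> exps J" if "u \<in> exps J" for s u
      unfolding E_def using that iJ by (intro exps_add single_in_exps)
    have E_bij: "bij_betw (E 1) (exps J) (exps J)"
      using E_inv[of 1] E_inv[of "- 1"] E_exps by (intro bij_betwI[of _ _ _ "E (- 1)"]) auto
    let ?b = "E 1 a"
    have bi: "\<bar>Poly_Mapping.lookup ?b i\<bar> < \<bar>Poly_Mapping.lookup a i\<bar>"
      using ik unfolding E_lookup c_def by (auto simp: sgn_if)
    have bl: "Poly_Mapping.lookup ?b l = Poly_Mapping.lookup a l" if "l \<noteq> i" for l using that by (simp add: E_lookup)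
    have "(\<Sum>l\<in>J. \<bar>Poly_Mapping.lookup ?b l\<bar>) < (\<Sum>l\<in>J. \<bar>Poly_Mapping.lookup a l\<bar>)"
    proof (rule sum_strict_mono_ex1[OF assms(1)])
      show "\<forall>l\<in>J. \<bar>Poly_Mapping.lookup ?b l\<bar> \<le> \<bar>Poly_Mapping.lookup a l\<bar>" using bi bl by (metis less_imp_le order_refl)
      show "\<exists>l\<in>J. \<bar>Poly_Mapping.lookup ?b l\<bar> < \<bar>Poly_Mapping.lookup a l\<bar>" using bi iJ by blast
    qed
    moreover have "0 \<le> (\<Sum>l\<in>J. \<bar>Poly_Mapping.lookup ?b l\<bar>)" by (intro sum_nonneg) simp
    ultimately have "nat (\<Sum>l\<in>J. \<bar>Poly_Mapping.lookup ?b l\<bar>) < nat (\<Sum>l\<in>J. \<bar>Poly_Mapping.lookup a l\<bar>)" by linarith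
    moreover have "?b \<in> exps J" using E_exps less(2) by blast
    moreover have "?b \<noteq> 0" using bl[of k] ik by (metis lookup_zero)
    ultimately obtain \<theta> \<theta>' j' m where \<theta>: "\<forall>u v. \<theta> (u + v) = \<theta> u + \<theta> v" "bij_betw \<theta> (exps J) (exps J)"
      "\<forall>u. \<theta>' (\<theta> u) = u" "j' \<in> J" "m \<noteq> 0" "\<theta> ?b = Poly_Mapping.single j' m"
      using less(1)[of ?b] by blast
    show ?thesis
    proof (intro exI conjI allI)
      show "(\<lambda>u. \<theta> (E 1 u)) (u + v) = \<theta> (E 1 u) + \<theta> (E 1 v)" for u v using \<theta>(1) E_add by simp
      show "bij_betw (\<lambda>u. \<theta> (E 1 u)) (exps J) (exps J)" using bij_betw_trans[OF E_bij \<theta>(2)] by (simp add: comp_def)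
      show "(\<lambda>u. E (- 1) (\<theta>' u)) (\<theta> (E 1 u)) = u" for u using \<theta>(3) E_inv by simp
    qed (use \<theta> in auto)
  qed
qed

text \<open>A surjection from a free abelian group of least rank is injective. A nonzero kernel
  element becomes \<open>m\<close> times a basis vector after a change of basis; torsion-freeness
  sends that basis vector to the unit, and the remaining ones still generate, against
  minimality.\<close>

lemma free_quotient_of_torsion_free:
  assumes H: "comm_group H" and tf: "\<And>x k. x \<in> carrier H \<Longrightarrow> k > (0::nat) \<Longrightarrow> x [^]\<^bsub>H\<^esub> k = \<one>\<^bsub>H\<^esub> \<Longrightarrow> x = \<one>\<^bsub>H\<^esub>"
    and fg: "finite T" "T \<subseteq> carrier H" "generate H T = carrier H"
  shows "\<exists>n. H \<cong> free_Abelian_group {..<n::nat}"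
proof -
  interpret H: comm_group H by fact
  define good where "good J \<longleftrightarrow> finite J \<and> (\<exists>h\<in>hom (free_Abelian_group J) H. h ` exps J = carrier H)" for J :: "nat set"
  obtain e where e: "bij_betw e {..<card T} T" using ex_bij_betw_nat_finite[OF fg(1)] by (auto simp: lessThan_atLeast0)
  have "good {..<card T}"
  proof -
    have "e ` {..<card T} \<subseteq> carrier H" using e fg(2) by (auto simp: bij_betw_def)
    then obtain h where h: "h \<in> hom (free_Abelian_group {..<card T}) H" "\<And>x. x \<in> {..<card T} \<Longrightarrow> h (frag_of x) = e x"
      using H.free_Abelian_group_universal by blast
    interpret h: group_hom "free_Abelian_group {..<card T}" H h
      using h(1) by (simp add: group_hom_def group_hom_axioms_def)
    have "T \<subseteq> h ` exps {..<card T}"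
    proof
      fix x assume "x \<in> T"
      then obtain i where "i < card T" "x = e i" using e by (auto simp: bij_betw_def)
      then have "x = h (frag_of i)" "frag_of i \<in> exps {..<card T}" using h(2)[of i] single_in_exps[of i "{..<card T}" 1] by auto
      then show "x \<in> h ` exps {..<card T}" by blast
    qed
    moreover have "subgroup (h ` exps {..<card T}) H" using h.img_is_subgroup by (simp add: exps_eq_carrier)
    ultimately have "carrier H \<subseteq> h ` exps {..<card T}" using H.generate_subgroup_incl fg(3) by metis
    moreover have "h ` exps {..<card T} \<subseteq> carrier H" using h.hom_closed by (auto simp flip: exps_eq_carrier)
    ultimately show ?thesis unfolding good_def using h(1) by blast
  qed
  then obtain J where J: "good J" "\<And>J'. good J' \<Longrightarrow> card J \<le> card J'"
    using ex_has_least_nat[of good "{..<card T}" card] by blast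
  then obtain h where fin: "finite J" and h: "h \<in> hom (free_Abelian_group J) H" "h ` exps J = carrier H"
    unfolding good_def by blast
  interpret h: group_hom "free_Abelian_group J" H h
    using h(1) by (simp add: group_hom_def group_hom_axioms_def)
  have h_add: "h (u + v) = h u \<otimes>\<^bsub>H\<^esub> h v" if "u \<in> exps J" "v \<in> exps J" for u v
    using h.hom_mult[of u v] that by (simp add: exps_def)
  have ker: "a = 0" if a: "a \<in> exps J" "h a = \<one>\<^bsub>H\<^esub>" for a
  proof (rule ccontr)
    assume "a \<noteq> 0"
    then obtain \<theta> \<theta>' j m where \<theta>: "\<forall>u v. \<theta> (u + v) = \<theta> u + \<theta> v" "bij_betw \<theta> (exps J) (exps J)"
      "\<forall>u. \<theta>' (\<theta> u) = u" "j \<in> J" "m \<noteq> 0" "\<theta> a = Poly_Mapping.single j m"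
      using lattice_automorphism[OF fin a(1)] by metis
    have \<theta>'_exps: "\<theta>' v \<in> exps J" if "v \<in> exps J" for v using \<theta>(2,3) that by (metis bij_betw_iff_bijections)
    have \<theta>\<theta>': "\<theta> (\<theta>' v) = v" if "v \<in> exps J" for v using \<theta>(2,3) that by (metis bij_betw_iff_bijections)
    have \<theta>'_add: "\<theta>' (u + v) = \<theta>' u + \<theta>' v" if "u \<in> exps J" "v \<in> exps J" for u v
      using \<theta>(1,3) \<theta>\<theta>' that by metis
    let ?h = "\<lambda>v. h (\<theta>' v)"
    have h'_add: "?h (u + v) = ?h u \<otimes>\<^bsub>H\<^esub> ?h v" if "u \<in> exps J" "v \<in> exps J" for u v
      using that by (simp add: \<theta>'_add h_add \<theta>'_exps)
    have h'_closed: "?h u \<in> carrier H" if "u \<in> exps J" for u using \<theta>'_exps[OF that] h(2) by blast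
    have h'0: "?h 0 = \<one>\<^bsub>H\<^esub>"
      using h'_add[OF exps_0 exps_0] h'_closed[OF exps_0] by simp
    have sJ: "Poly_Mapping.single j k \<in> exps J" for k using \<theta>(4) by (rule single_in_exps)
    have pow: "?h (Poly_Mapping.single j (int k)) = ?h (Poly_Mapping.single j 1) [^]\<^bsub>H\<^esub> k" for k
    proof (induction k)
      case (Suc k)
      have "Poly_Mapping.single j (int (Suc k)) = Poly_Mapping.single j (int k) + Poly_Mapping.single j 1"
        by (simp add: add.commute flip: single_add)
      then show ?case using h'_add[OF sJ sJ] Suc by simp
    qed (simp add: h'0)
    have m1: "?h (Poly_Mapping.single j m) = \<one>\<^bsub>H\<^esub>" using \<theta>(3,6) a(2) by metis
    have m2: "?h (Poly_Mapping.single j (- m)) = \<one>\<^bsub>H\<^esub>"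
    proof -
      have "?h (Poly_Mapping.single j m + Poly_Mapping.single j (- m)) = ?h (Poly_Mapping.single j (- m))"
        using h'_add[OF sJ sJ] m1 h'_closed[OF sJ] by simp
      then show ?thesis using h'0 by (simp flip: single_add)
    qed
    have "?h (Poly_Mapping.single j 1) [^]\<^bsub>H\<^esub> nat \<bar>m\<bar> = \<one>\<^bsub>H\<^esub>"
      using pow[of "nat \<bar>m\<bar>"] m1 m2 by (cases "m \<ge> 0") auto
    moreover have "nat \<bar>m\<bar> > 0" using \<theta>(5) by simp
    ultimately have e1: "?h (Poly_Mapping.single j 1) = \<one>\<^bsub>H\<^esub>" by (intro tf[OF h'_closed[OF sJ]])
    have ek: "?h (Poly_Mapping.single j k) = \<one>\<^bsub>H\<^esub>" for k
    proof (cases "k \<ge> 0")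
      case True
      then show ?thesis using pow[of "nat k"] e1 by simp
    next
      case False
      then have p: "?h (Poly_Mapping.single j (- k)) = \<one>\<^bsub>H\<^esub>" using pow[of "nat (- k)"] e1 by simp
      have "?h (Poly_Mapping.single j (- k) + Poly_Mapping.single j k) = ?h (Poly_Mapping.single j k)"
        using h'_add[OF sJ sJ] p h'_closed[OF sJ] by simp
      then show ?thesis using h'0 by (simp flip: single_add)
    qed
    let ?J = "J - {j}"
    have sub: "exps ?J \<subseteq> exps J" by (rule exps_mono) blast
    have "?h \<in> hom (free_Abelian_group ?J) H"
    proof (rule homI)
      fix x y assume "x \<in> carrier (free_Abelian_group ?J)" "y \<in> carrier (free_Abelian_group ?J)"
      then have "x \<in> exps J" "y \<in> exps J" using sub exps_eq_carrier by blast+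
      then show "?h (x \<otimes>\<^bsub>free_Abelian_group ?J\<^esub> y) = ?h x \<otimes>\<^bsub>H\<^esub> ?h y"
        using h'_add by simp
    next
      fix x assume "x \<in> carrier (free_Abelian_group ?J)"
      then show "?h x \<in> carrier H" using sub exps_eq_carrier h'_closed by blast
    qed
    moreover have "?h ` exps ?J = carrier H"
    proof
      show "?h ` exps ?J \<subseteq> carrier H" using sub h'_closed by auto
      show "carrier H \<subseteq> ?h ` exps ?J"
      proof
        fix x assume "x \<in> carrier H"
        then obtain u where u: "u \<in> exps J" "x = h u" using h(2) by blast
        let ?v = "\<theta> u"
        have v: "?v \<in> exps J" using \<theta>(2) u(1) by (meson bij_betw_apply)
        let ?w = "?v - Poly_Mapping.single j (Poly_Mapping.lookup ?v j)"
        have w: "?w \<in> exps ?J"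
          using v by (auto simp: exps_def in_keys_iff lookup_minus lookup_single when_def split: if_splits)
        have wJ: "?w \<in> exps J" using w sub by blast
        have "?h ?v = ?h (?w + Poly_Mapping.single j (Poly_Mapping.lookup ?v j))" by simp
        also have "\<dots> = ?h ?w" unfolding h'_add[OF wJ sJ] ek using h'_closed[OF wJ] by simp
        finally show "x \<in> ?h ` exps ?J" using u \<theta>(3) w by (metis imageI)
      qed
    qed
    ultimately have "good ?J" unfolding good_def using fin by blast
    then have "card J \<le> card ?J" by (rule J(2))
    then show False using fin \<theta>(4) by (metis card_Diff1_less not_less)
  qed
  have "inj_on h (carrier (free_Abelian_group J))"
    using h.inj_on_one_iff ker by (simp add: exps_eq_carrier)
  then have "h \<in> iso (free_Abelian_group J) H"
    using h by (auto simp: iso_def bij_betw_def exps_eq_carrier)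
  then have "free_Abelian_group J \<cong> H" by (rule is_isoI)
  then have "H \<cong> free_Abelian_group J" by (rule group.iso_sym[OF group_free_Abelian_group])
  moreover have "J \<approx> {..<card J}" using fin by (metis eqpoll_iff_finite_card finite_lessThan card_lessThan)
  then have "free_Abelian_group J \<cong> free_Abelian_group {..<card J}" by (simp add: isomorphic_free_Abelian_groups)
  ultimately show ?thesis using iso_trans by blast
qed

section \<open>Torsion and the free abelian quotient of \<open>G\<close>\<close>

lemma subgroup_torsion:
  assumes "comm_group H"
  shows "subgroup (torsion H) H"
proof -
  interpret comm_group H by fact
  show ?thesis
  proof (rule subgroupI)
    show "torsion H \<noteq> {}" unfolding torsion_def using nat_pow_one by (auto intro!: exI[of _ "\<one>\<^bsub>H\<^esub>"] exI[of _ 1])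
    fix a assume a: "a \<in> torsion H"
    then obtain k where k: "a \<in> carrier H" "k > 0" "a [^]\<^bsub>H\<^esub> (k::nat) = \<one>\<^bsub>H\<^esub>" by (auto simp: torsion_def)
    then show "inv\<^bsub>H\<^esub> a \<in> torsion H" unfolding torsion_def by (auto simp: nat_pow_inv intro!: exI[of _ k])
    fix b assume "b \<in> torsion H"
    then obtain l where l: "b \<in> carrier H" "l > 0" "b [^]\<^bsub>H\<^esub> (l::nat) = \<one>\<^bsub>H\<^esub>" by (auto simp: torsion_def)
    have "(a \<otimes>\<^bsub>H\<^esub> b) [^]\<^bsub>H\<^esub> (k * l) = (a [^]\<^bsub>H\<^esub> k) [^]\<^bsub>H\<^esub> l \<otimes>\<^bsub>H\<^esub> (b [^]\<^bsub>H\<^esub> l) [^]\<^bsub>H\<^esub> k"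
      using k(1) l(1) by (simp add: nat_pow_distrib nat_pow_pow mult.commute)
    also have "\<dots> = \<one>\<^bsub>H\<^esub>" unfolding k(3) l(3) by simp
    finally show "a \<otimes>\<^bsub>H\<^esub> b \<in> torsion H" unfolding torsion_def using k l by (auto intro!: exI[of _ "k * l"])
  qed (auto simp: torsion_def)
qed

context group
begin

lemma comm_group_G_ab: "comm_group (G_ab G)"
  unfolding G_ab_def by (rule derived_quot_is_comm_group)

lemma comm_group_G_abf: "comm_group (G_abf G)"
  unfolding G_abf_def by (intro comm_group.abelian_FactGroup comm_group_G_ab subgroup_torsion)

lemma normal_torsion: "torsion (G_ab G) \<lhd> G_ab G"
  by (intro comm_group.subgroup_imp_normal comm_group_G_ab subgroup_torsion)

lemma abf_proj_hom: "abf_proj G \<in> hom G (G_abf G)"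
proof -
  have "(\<lambda>g. derived G (carrier G) #> g) \<in> hom G (G_ab G)"
    unfolding G_ab_def by (rule normal.r_coset_hom_Mod[OF derived_self_is_normal])
  moreover have "(\<lambda>a. torsion (G_ab G) #>\<^bsub>G_ab G\<^esub> a) \<in> hom (G_ab G) (G_abf G)"
    unfolding G_abf_def by (rule normal.r_coset_hom_Mod[OF normal_torsion])
  ultimately have "(\<lambda>a. torsion (G_ab G) #>\<^bsub>G_ab G\<^esub> a) \<circ> (\<lambda>g. derived G (carrier G) #> g) \<in> hom G (G_abf G)"
    by (rule Group.hom_compose)
  then show ?thesis by (simp add: comp_def abf_proj_def[abs_def])
qed

lemma abf_proj_surj: "abf_proj G ` carrier G = carrier (G_abf G)"
  unfolding G_abf_def carrier_FactGroup
  unfolding G_ab_def carrier_FactGroup abf_proj_def[abs_def] by (simp add: image_image G_ab_def)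

lemma pow_G_ab: "x \<in> carrier G \<Longrightarrow> (derived G (carrier G) #> x) [^]\<^bsub>G_ab G\<^esub> (k::nat) = derived G (carrier G) #> (x [^] k)"
  unfolding G_ab_def by (rule normal.FactGroup_pow[OF derived_self_is_normal])

lemma G_abf_torsion_free:
  assumes y: "y \<in> carrier (G_abf G)" and k: "k > (0::nat)" "y [^]\<^bsub>G_abf G\<^esub> k = \<one>\<^bsub>G_abf G\<^esub>"
  shows "y = \<one>\<^bsub>G_abf G\<^esub>"
proof -
  interpret A: comm_group "G_ab G" by (rule comm_group_G_ab)
  have sT: "subgroup (torsion (G_ab G)) (G_ab G)" by (rule subgroup_torsion[OF comm_group_G_ab])
  obtain a where a: "a \<in> carrier (G_ab G)" "y = torsion (G_ab G) #>\<^bsub>G_ab G\<^esub> a"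
    using y unfolding G_abf_def carrier_FactGroup by blast
  have "torsion (G_ab G) #>\<^bsub>G_ab G\<^esub> (a [^]\<^bsub>G_ab G\<^esub> k) = torsion (G_ab G)"
    using k(2) normal.FactGroup_pow[OF normal_torsion a(1), of k] unfolding a(2) G_abf_def by simp
  then have "a [^]\<^bsub>G_ab G\<^esub> k \<in> torsion (G_ab G)"
    using A.coset_join1[OF _ _ sT] a(1) by simp
  then obtain l where l: "l > 0" "(a [^]\<^bsub>G_ab G\<^esub> k) [^]\<^bsub>G_ab G\<^esub> (l::nat) = \<one>\<^bsub>G_ab G\<^esub>" by (auto simp: torsion_def)
  then have "a [^]\<^bsub>G_ab G\<^esub> (k * l) = \<one>\<^bsub>G_ab G\<^esub>" using a(1) by (simp add: A.nat_pow_pow)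
  then have "a \<in> torsion (G_ab G)" unfolding torsion_def using a(1) k(1) l(1) by (auto intro!: exI[of _ "k * l"])
  then show ?thesis unfolding a(2) G_abf_def using A.coset_join2[OF a(1) sT] by simp
qed

text \<open>Existence of a rank comes from torsion-freeness. Its uniqueness is needed as well, since
  \<open>b1\<close> is a definite description.\<close>

lemma G_abf_free:
  assumes "finitely_generated G"
  shows "G_abf G \<cong> free_Abelian_group {..<b1 G}"
proof -
  obtain S where S: "finite S" "S \<subseteq> carrier G" "generate G S = carrier G" using assms by (auto simp: finitely_generated_def)
  interpret p: group_hom G "G_abf G" "abf_proj G"
    using abf_proj_hom comm_group_G_abf is_group by (simp add: group_hom_def group_hom_axioms_def comm_group_def)
  have gen: "generate (G_abf G) (abf_proj G ` S) = carrier (G_abf G)"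
    using p.generate_img[OF S(2)] S(3) abf_proj_surj by simp
  have "finite (abf_proj G ` S)" "abf_proj G ` S \<subseteq> carrier (G_abf G)" using S p.hom_closed by auto
  from free_quotient_of_torsion_free[OF comm_group_G_abf G_abf_torsion_free this gen]
  obtain n where n: "G_abf G \<cong> free_Abelian_group {..<n::nat}" ..
  have uniq: "n' = n" if n': "G_abf G \<cong> free_Abelian_group {..<n'}" for n'
  proof -
    have "free_Abelian_group {..<n'} \<cong> G_abf G"
      using n' comm_group_G_abf by (simp add: group.iso_sym comm_group_def)
    then have "free_Abelian_group {..<n'} \<cong> free_Abelian_group {..<n}" using n iso_trans by blast
    then have "{..<n'} \<approx> {..<n}" by (simp only: isomorphic_free_Abelian_groups)
    then have "card {..<n'} = card {..<n}" by (meson eqpoll_iff_card finite_lessThan)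
    then show ?thesis by simp
  qed
  have "b1 G = n" unfolding b1_def using n uniq by (rule the_equality)
  then show ?thesis using n by simp
qed

lemma char_derived:
  assumes \<rho>: "\<rho> \<in> carrier (char_group G)" and x: "x \<in> derived G (carrier G)"
  shows "\<rho> x = 1"
proof -
  have comm: "\<rho> h = 1" "h \<in> carrier G" if h: "h \<in> derived_set G (carrier G)" for h
  proof -
    obtain u v where uv: "u \<in> carrier G" "v \<in> carrier G" "h = u \<otimes> v \<otimes> inv u \<otimes> inv v" using h by blast
    have "\<rho> h = \<rho> u * \<rho> v * inverse (\<rho> u) * inverse (\<rho> v)"
      using uv \<rho> char_inv[OF is_group \<rho>] by (simp add: char_group_iff)
    moreover have "\<rho> u \<noteq> 0" "\<rho> v \<noteq> 0" using \<rho> uv by (simp_all add: char_group_iff)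
    ultimately show "\<rho> h = 1" by (simp add: field_simps)
    show "h \<in> carrier G" using uv by simp
  qed
  have "x \<in> carrier G \<and> \<rho> x = 1"
    using x unfolding derived_def
  proof (induction rule: generate.induct)
    case one
    then show ?case using char_one[OF is_group \<rho>] by simp
  next
    case (incl h)
    then show ?case using comm by blast
  next
    case (inv h)
    then have h: "\<rho> h = 1" "h \<in> carrier G" by (rule comm)+
    then show ?case using char_inv[OF is_group \<rho> h(2)] by simp
  next
    case (eng h1 h2)
    then show ?case using \<rho> by (simp add: char_group_iff)
  qed
  then show ?thesis by simp
qed

text \<open>An element that the coordinates send to 0 is torsion modulo commutators. Some power
  \<open>x [^] k\<close> lies in the derived subgroup, where every character is 1, so
  \<open>k\<close> is an exponent common to all characters.\<close>

lemma torus_coordinates_G: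
  assumes \<phi>: "\<phi> \<in> iso (G_abf G) (free_Abelian_group {..<n})"
  shows "torus_coordinates G n (\<lambda>g. \<phi> (abf_proj G g))"
proof
  have \<phi>h: "\<phi> \<in> hom (G_abf G) (free_Abelian_group {..<n})" "bij_betw \<phi> (carrier (G_abf G)) (exps {..<n})"
    using \<phi> by (auto simp: iso_def exps_eq_carrier)
  have pc: "abf_proj G x \<in> carrier (G_abf G)" if "x \<in> carrier G" for x using abf_proj_hom that by (auto simp: hom_def)
  show "\<phi> (abf_proj G (x \<otimes> y)) = \<phi> (abf_proj G x) + \<phi> (abf_proj G y)" if "x \<in> carrier G" "y \<in> carrier G" for x y
    using that hom_mult[OF abf_proj_hom that] hom_mult[OF \<phi>h(1) pc pc] by simp
  show "(\<lambda>g. \<phi> (abf_proj G g)) ` carrier G = exps {..<n}"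
    using abf_proj_surj \<phi>h(2) by (metis bij_betw_def image_image)
  fix x assume x: "x \<in> carrier G" "\<phi> (abf_proj G x) = 0"
  have gH: "group (G_abf G)" using comm_group_G_abf by (simp add: comm_group_def)
  have "\<phi> \<one>\<^bsub>G_abf G\<^esub> = 0" using hom_one[OF \<phi>h(1) gH] by simp
  then have "abf_proj G x = \<one>\<^bsub>G_abf G\<^esub>"
    using x \<phi>h(2) pc group.is_monoid[OF gH] monoid.one_closed unfolding bij_betw_def by (metis inj_on_eq_iff)
  then have "torsion (G_ab G) #>\<^bsub>G_ab G\<^esub> (derived G (carrier G) #> x) = torsion (G_ab G)"
    by (simp add: abf_proj_def G_abf_def)
  moreover have xA: "derived G (carrier G) #> x \<in> carrier (G_ab G)"
    using x unfolding G_ab_def carrier_FactGroup by blast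
  moreover have sT: "subgroup (torsion (G_ab G)) (G_ab G)" by (rule subgroup_torsion[OF comm_group_G_ab])
  ultimately have "derived G (carrier G) #> x \<in> torsion (G_ab G)"
    using group.coset_join1[OF _ _ xA sT] comm_group_G_ab by (simp add: comm_group_def)
  then obtain k where k: "k > 0" "(derived G (carrier G) #> x) [^]\<^bsub>G_ab G\<^esub> (k::nat) = \<one>\<^bsub>G_ab G\<^esub>"
    by (auto simp: torsion_def)
  have sD: "subgroup (derived G (carrier G)) G" using derived_self_is_normal by (simp add: normal_def)
  have "derived G (carrier G) #> (x [^] k) = derived G (carrier G)" using k(2) x(1) pow_G_ab by (simp add: G_ab_def)
  then have "x [^] k \<in> derived G (carrier G)" using coset_join1[OF _ _ sD] x by simp
  then have "\<rho> x ^ k = 1" if "\<rho> \<in> carrier (char_group G)" for \<rho>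
    using char_derived[OF that] char_pow[OF is_group that x(1)] by metis
  then show "\<exists>N>0. \<forall>\<rho>\<in>carrier (char_group G). \<rho> x ^ N = 1" using k(1) by blast
qed

end

section \<open>Charts of a lattice\<close>

text \<open>A chart is a choice of basis of \<open>H\<close>. It stays a parameter so that a basis
  adapted to a given element can be taken afterwards by \<open>lattice_chart_adapt\<close>.\<close>

locale lattice_chart = comm_group H for H (structure) +
  fixes n :: nat and \<phi> :: "'a \<Rightarrow> (nat \<Rightarrow>\<^sub>0 int)"
  assumes \<phi>_mult: "\<And>x y. x \<in> carrier H \<Longrightarrow> y \<in> carrier H \<Longrightarrow> \<phi> (x \<otimes> y) = \<phi> x + \<phi> y"
    and \<phi>_bij: "bij_betw \<phi> (carrier H) (exps {..<n})"
begin

lemma \<phi>_inj: "x \<in> carrier H \<Longrightarrow> y \<in> carrier H \<Longrightarrow> \<phi> x = \<phi> y \<longleftrightarrow> x = y"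
  using \<phi>_bij by (auto simp: bij_betw_def inj_on_def)

lemma \<phi>_one: "\<phi> \<one> = 0"
  using \<phi>_mult[of \<one> \<one>] by simp

lemma \<phi>_surj: "u \<in> exps {..<n} \<Longrightarrow> \<exists>x\<in>carrier H. \<phi> x = u"
  using \<phi>_bij unfolding bij_betw_def by (metis imageE)

sublocale torus_coordinates H n \<phi>
proof
  show "\<phi> ` carrier H = exps {..<n}" using \<phi>_bij by (simp add: bij_betw_def)
next
  fix x assume x: "x \<in> carrier H" "\<phi> x = 0"
  then have "x = \<one>" using \<phi>_inj[OF x(1) one_closed] \<phi>_one by simp
  then show "\<exists>N>0. \<forall>\<rho>\<in>carrier (char_group H). \<rho> x ^ N = 1"
    using char_one[OF is_group] by (intro exI[of _ 1]) simp
qed (rule \<phi>_mult)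

lemma char_group_pull: "carrier (char_group H) = pull ` torus n"
proof -
  have "s \<in> pull ` torus n" if s: "s \<in> carrier (char_group H)" for s
  proof (rule kernel_chars[OF s])
    fix x assume x: "x \<in> carrier H" "\<phi> x = 0"
    then have "x = \<one>" using \<phi>_inj[OF x(1) one_closed] \<phi>_one by simp
    then show "s x = 1" using char_one[OF is_group s] by simp
  qed
  then show ?thesis using pull_in_chars by blast
qed

abbreviation "S \<equiv> int_group_ring H"

lemma cring_S: "cring S" by (rule cring_group_ring) (rule comm_group_axioms)

lemma push_superset:
  "finite T \<Longrightarrow> Poly_Mapping.keys f \<subseteq> T \<Longrightarrow> push f = (\<Sum>x\<in>T. Poly_Mapping.single (\<phi> x) (Poly_Mapping.lookup f x))"
  unfolding push_def by (rule sum.mono_neutral_left) (auto simp: in_keys_iff)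

lemma push_single: "push (Poly_Mapping.single x c) = Poly_Mapping.single (\<phi> x) c"
  by (simp add: push_superset[of "{x}"])

lemma push_0: "push 0 = 0" by (simp add: push_def)

lemma push_add: "push (f + g) = push f + push g"
proof -
  let ?T = "Poly_Mapping.keys f \<union> Poly_Mapping.keys g"
  have "Poly_Mapping.keys (f + g) \<subseteq> ?T" by (rule keys_add)
  then show ?thesis
    by (simp add: push_superset[of ?T] lookup_add single_add sum.distrib)
qed

lemma push_sum: "push (sum f T) = (\<Sum>i\<in>T. push (f i))"
  by (induction T rule: infinite_finite_induct) (simp_all add: push_0 push_add)

lemma push_mult:
  assumes "f \<in> carrier (group_ring H)" "g \<in> carrier (group_ring H)"
  shows "push (f \<otimes>\<^bsub>group_ring H\<^esub> g) = push f * push g"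
proof -
  have c: "x \<in> carrier H" if "x \<in> Poly_Mapping.keys f \<or> x \<in> Poly_Mapping.keys g" for x
    using that assms by (auto simp: carrier_group_ring)
  have "push f * push g = (\<Sum>x\<in>Poly_Mapping.keys f. \<Sum>y\<in>Poly_Mapping.keys g.
      Poly_Mapping.single (\<phi> x) (Poly_Mapping.lookup f x) * Poly_Mapping.single (\<phi> y) (Poly_Mapping.lookup g y))"
    unfolding push_def by (rule sum_product)
  also have "\<dots> = push (f \<otimes>\<^bsub>group_ring H\<^esub> g)"
    unfolding group_ring_mult_eq push_sum push_single
    by (intro sum.cong refl) (simp add: mult_single c \<phi>_mult)
  finally show ?thesis ..
qed

lemma lookup_push:
  assumes "f \<in> carrier (group_ring H)" "x \<in> carrier H"
  shows "Poly_Mapping.lookup (push f) (\<phi> x) = Poly_Mapping.lookup f x"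
proof -
  have "Poly_Mapping.lookup (push f) (\<phi> x) =
      (\<Sum>y\<in>Poly_Mapping.keys f. if y = x then Poly_Mapping.lookup f x else 0)"
    unfolding push_def lookup_sum
  proof (rule sum.cong)
    fix y assume "y \<in> Poly_Mapping.keys f"
    then have "\<phi> y = \<phi> x \<longleftrightarrow> y = x" using assms by (intro \<phi>_inj) (auto simp: carrier_group_ring)
    then show "Poly_Mapping.lookup (Poly_Mapping.single (\<phi> y) (Poly_Mapping.lookup f y)) (\<phi> x) =
        (if y = x then Poly_Mapping.lookup f x else 0)"
      by (auto simp: lookup_single when_def)
  qed simp
  also have "\<dots> = Poly_Mapping.lookup f x" by (auto simp: in_keys_iff)
  finally show ?thesis .
qed

lemma push_inj:
  assumes "f \<in> carrier (group_ring H)" "g \<in> carrier (group_ring H)" "push f = push g"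
  shows "f = g"
proof (rule poly_mapping_eqI)
  fix x show "Poly_Mapping.lookup f x = Poly_Mapping.lookup g x"
  proof (cases "x \<in> carrier H")
    case True
    then show ?thesis using lookup_push[OF assms(1) True] lookup_push[OF assms(2) True] assms(3) by simp
  next
    case False
    then have "x \<notin> Poly_Mapping.keys f" "x \<notin> Poly_Mapping.keys g" using assms(1,2) by (auto simp: carrier_group_ring)
    then show ?thesis by (simp add: in_keys_iff)
  qed
qed

lemma push_onto:
  assumes F: "F \<in> laur {..<n}"
  shows "\<exists>f\<in>carrier (group_ring H). push f = F"
proof -
  define \<psi> where "\<psi> u = (SOME x. x \<in> carrier H \<and> \<phi> x = u)" for u
  have \<psi>: "\<psi> u \<in> carrier H \<and> \<phi> (\<psi> u) = u" if "u \<in> Poly_Mapping.keys F" for u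
    unfolding \<psi>_def
    by (rule someI_ex) (use that F \<phi>_surj in \<open>auto simp: laur_def\<close>)
  let ?f = "\<Sum>u\<in>Poly_Mapping.keys F. Poly_Mapping.single (\<psi> u) (Poly_Mapping.lookup F u)"
  have "push ?f = (\<Sum>u\<in>Poly_Mapping.keys F. Poly_Mapping.single u (Poly_Mapping.lookup F u))"
    unfolding push_sum push_single by (rule sum.cong) (simp_all add: \<psi>)
  also have "\<dots> = F" by (rule poly_mapping_sum_single[symmetric])
  finally have "push ?f = F" .
  moreover have "?f \<in> carrier (group_ring H)"
    unfolding carrier_group_ring mem_Collect_eq by (rule keys_sum_subset) (simp add: \<psi>)
  ultimately show ?thesis by blast
qed

lemma divides_push:
  assumes a: "a \<in> carrier (group_ring H)" and b: "b \<in> carrier (group_ring H)"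
  shows "a divides\<^bsub>group_ring H\<^esub> b \<longleftrightarrow> dvd_in (laur {..<n}) (push a) (push b)"
proof
  assume "a divides\<^bsub>group_ring H\<^esub> b"
  then obtain c where c: "c \<in> carrier (group_ring H)" "b = a \<otimes>\<^bsub>group_ring H\<^esub> c" by (auto simp: factor_def)
  then have "push b = push a * push c" using push_mult[OF a] by simp
  then show "dvd_in (laur {..<n}) (push a) (push b)" by (rule dvd_inI[OF push_in_laur[OF c(1)]])
next
  assume "dvd_in (laur {..<n}) (push a) (push b)"
  then obtain C where C: "C \<in> laur {..<n}" "push b = push a * C" by (auto simp: dvd_in_def)
  obtain c where c: "c \<in> carrier (group_ring H)" "push c = C" using push_onto[OF C(1)] by blast
  have "push (a \<otimes>\<^bsub>group_ring H\<^esub> c) = push b" using push_mult[OF a c(1)] C c by simp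
  then have "a \<otimes>\<^bsub>group_ring H\<^esub> c = b"
    by (rule push_inj[OF group_ring_mult_closed[OF is_group a c(1)] b])
  then show "a divides\<^bsub>group_ring H\<^esub> b" using c by (auto simp: factor_def)
qed

lemma lin_pull:
  assumes "f \<in> carrier S"
  shows "lin (pull z) f = zev z (push f)"
proof -
  have "zev z (push f) = (\<Sum>x\<in>Poly_Mapping.keys f. of_int (Poly_Mapping.lookup f x) * monom_at z (\<phi> x))"
    unfolding push_def by (simp add: eval_sum[OF coeff_hom_of_int] eval_single[OF coeff_hom_of_int])
  also have "\<dots> = lin (pull z) f"
    unfolding lin_def by (rule sum.cong) (use assms in \<open>auto simp: pull_def carrier_group_ring\<close>)
  finally show ?thesis ..
qed

text \<open>A common divisor \<open>x\<close> of the generators divides the whole ideal, because the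
  ideal is contained in the principal ideal of \<open>x\<close>. The gcd condition thus concerns the
  generators alone and can be moved to Laurent polynomials.\<close>

lemma is_gcd_of_Idl:
  assumes M: "M \<subseteq> carrier S" and gcd: "is_gcd_of S d (Idl\<^bsub>S\<^esub> M)"
  shows "d \<in> carrier S" "e \<in> M \<Longrightarrow> dvd_in (laur {..<n}) (push d) (push e)"
    "c \<in> laur {..<n} \<Longrightarrow> (\<And>e. e \<in> M \<Longrightarrow> dvd_in (laur {..<n}) c (push e)) \<Longrightarrow> dvd_in (laur {..<n}) c (push d)"
proof -
  interpret S: cring S by (rule cring_S)
  have low: "x \<in> Lower (division_rel S) (Idl\<^bsub>S\<^esub> M) \<longleftrightarrow> x \<in> carrier S \<and> (\<forall>e\<in>M. x divides\<^bsub>S\<^esub> e)" for x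
  proof -
    have I: "Idl\<^bsub>S\<^esub> M \<subseteq> carrier S" using S.genideal_ideal[OF M] by (meson additive_subgroup.a_subset ideal.axioms(1))
    have eq: "(\<forall>e\<in>Idl\<^bsub>S\<^esub> M. x divides\<^bsub>S\<^esub> e) \<longleftrightarrow> (\<forall>e\<in>M. x divides\<^bsub>S\<^esub> e)" if x: "x \<in> carrier S"
    proof
      show "\<forall>e\<in>M. x divides\<^bsub>S\<^esub> e" if "\<forall>e\<in>Idl\<^bsub>S\<^esub> M. x divides\<^bsub>S\<^esub> e"
        using that S.genideal_self[OF M] by blast
      assume *: "\<forall>e\<in>M. x divides\<^bsub>S\<^esub> e"
      have "M \<subseteq> PIdl\<^bsub>S\<^esub> x"
      proof
        fix e assume "e \<in> M"
        then obtain c where c: "c \<in> carrier S" "e = x \<otimes>\<^bsub>S\<^esub> c" using * by (auto simp: factor_def)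
        then have "e = c \<otimes>\<^bsub>S\<^esub> x" using S.m_comm[OF x c(1)] by simp
        then show "e \<in> PIdl\<^bsub>S\<^esub> x" using c(1) by (auto simp: cgenideal_def)
      qed
      then have "Idl\<^bsub>S\<^esub> M \<subseteq> PIdl\<^bsub>S\<^esub> x" by (rule S.genideal_minimal[OF S.cgenideal_ideal[OF x]])
      moreover have "x divides\<^bsub>S\<^esub> e" if e: "e \<in> PIdl\<^bsub>S\<^esub> x" for e
      proof -
        obtain c where c: "c \<in> carrier S" "e = c \<otimes>\<^bsub>S\<^esub> x" using e by (auto simp: cgenideal_def)
        then have "e = x \<otimes>\<^bsub>S\<^esub> c" using S.m_comm[OF x c(1)] by simp
        then show ?thesis using c(1) by (auto simp: factor_def)
      qed
      ultimately show "\<forall>e\<in>Idl\<^bsub>S\<^esub> M. x divides\<^bsub>S\<^esub> e" by blast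
    qed
    have "x \<in> Lower (division_rel S) (Idl\<^bsub>S\<^esub> M) \<longleftrightarrow> x \<in> carrier S \<and> (\<forall>e\<in>Idl\<^bsub>S\<^esub> M. x divides\<^bsub>S\<^esub> e)"
      using I by (auto simp: Lower_def)
    then show ?thesis using eq by blast
  qed
  have g: "d \<in> Lower (division_rel S) (Idl\<^bsub>S\<^esub> M)" "\<And>x. x \<in> Lower (division_rel S) (Idl\<^bsub>S\<^esub> M) \<Longrightarrow> x divides\<^bsub>S\<^esub> d"
    using gcd by (auto simp: is_gcd_of_def greatest_def)
  show d: "d \<in> carrier S" using g(1) low by blast
  show "dvd_in (laur {..<n}) (push d) (push e)" if "e \<in> M"
    using g(1) low that divides_push[OF d] M by blast
  assume c: "c \<in> laur {..<n}" "\<And>e. e \<in> M \<Longrightarrow> dvd_in (laur {..<n}) c (push e)"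
  obtain f where f: "f \<in> carrier S" "push f = c" using push_onto[OF c(1)] by blast
  have "f \<in> Lower (division_rel S) (Idl\<^bsub>S\<^esub> M)"
    using low f c(2) divides_push[OF f(1)] M by blast
  then show "dvd_in (laur {..<n}) c (push d)" using g(2) divides_push[OF f(1) d] f(2) by blast
qed

end

section \<open>Determinants under ring homomorphisms\<close>

lemma add_pow_sign:
  assumes "abelian_group T" "x \<in> carrier T"
  shows "[(sign \<sigma> :: int)] \<cdot>\<^bsub>T\<^esub> x = (if sign \<sigma> = (1::int) then x else \<ominus>\<^bsub>T\<^esub> x)"
proof -
  interpret T: abelian_group T by fact
  have "[(1::int)] \<cdot>\<^bsub>T\<^esub> x = x" using assms(2) T.add.int_pow_1 by blast
  moreover have "[(-1::int)] \<cdot>\<^bsub>T\<^esub> x = \<ominus>\<^bsub>T\<^esub> x"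
    using T.add.int_pow_neg[OF assms(2), of 1] calculation by (simp add: a_inv_def)
  ultimately show ?thesis by (cases rule: sign_cases[of \<sigma>]) auto
qed

lemma ring_det_hom:
  fixes \<alpha> :: "'r \<Rightarrow> complex"
  assumes T: "cring T" and B: "\<And>i j. i < k \<Longrightarrow> j < k \<Longrightarrow> B i j \<in> carrier T"
    and add: "\<And>x y. x \<in> carrier T \<Longrightarrow> y \<in> carrier T \<Longrightarrow> \<alpha> (x \<oplus>\<^bsub>T\<^esub> y) = \<alpha> x + \<alpha> y"
    and mult: "\<And>x y. x \<in> carrier T \<Longrightarrow> y \<in> carrier T \<Longrightarrow> \<alpha> (x \<otimes>\<^bsub>T\<^esub> y) = \<alpha> x * \<alpha> y"
    and one: "\<alpha> \<one>\<^bsub>T\<^esub> = 1"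
  shows "\<alpha> (ring_det T k B) = leibniz k (\<lambda>i j. \<alpha> (B i j))" "ring_det T k B \<in> carrier T"
proof -
  interpret T: cring T by fact
  have zero: "\<alpha> \<zero>\<^bsub>T\<^esub> = 0" using add[of "\<zero>\<^bsub>T\<^esub>" "\<zero>\<^bsub>T\<^esub>"] by simp
  have neg: "\<alpha> (\<ominus>\<^bsub>T\<^esub> x) = - \<alpha> x" if "x \<in> carrier T" for x
  proof -
    have "\<alpha> x + \<alpha> (\<ominus>\<^bsub>T\<^esub> x) = 0" using add[of x "\<ominus>\<^bsub>T\<^esub> x"] that zero by (simp add: T.r_neg)
    then show ?thesis by (simp add: add_eq_0_iff)
  qed
  have sum: "\<alpha> (\<Oplus>\<^bsub>T\<^esub>i\<in>A. f i) = (\<Sum>i\<in>A. \<alpha> (f i))" if "finite A" "f \<in> A \<rightarrow> carrier T" for f :: "'x \<Rightarrow> _" and A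
    using that
  proof (induction A rule: finite_induct)
    case (insert a A)
    then have f: "f \<in> A \<rightarrow> carrier T" "f a \<in> carrier T" by auto
    then have "(\<Oplus>\<^bsub>T\<^esub>i\<in>insert a A. f i) = f a \<oplus>\<^bsub>T\<^esub> (\<Oplus>\<^bsub>T\<^esub>i\<in>A. f i)" using insert by simp
    then show ?case using add[OF f(2) T.finsum_closed[OF f(1)]] insert f by simp
  qed (simp add: zero)
  have prod: "\<alpha> (\<Otimes>\<^bsub>T\<^esub>i\<in>A. f i) = (\<Prod>i\<in>A. \<alpha> (f i))" if "finite A" "f \<in> A \<rightarrow> carrier T" for f :: "'x \<Rightarrow> _" and A
    using that
  proof (induction A rule: finite_induct)
    case (insert a A)
    then have f: "f \<in> A \<rightarrow> carrier T" "f a \<in> carrier T" by auto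
    then have "(\<Otimes>\<^bsub>T\<^esub>i\<in>insert a A. f i) = f a \<otimes>\<^bsub>T\<^esub> (\<Otimes>\<^bsub>T\<^esub>i\<in>A. f i)" using insert by simp
    then show ?case using mult[OF f(2) T.finprod_closed[OF f(1)]] insert f by simp
  qed (simp add: one)
  let ?p = "\<lambda>\<sigma>. \<Otimes>\<^bsub>T\<^esub>i\<in>{..<k}. B i (\<sigma> i)" and ?P = "{\<sigma>. \<sigma> permutes {..<k}}"
  have Bp: "(\<lambda>i. B i (\<sigma> i)) \<in> {..<k} \<rightarrow> carrier T" if "\<sigma> \<in> ?P" for \<sigma>
  proof
    fix i assume "i \<in> {..<k}"
    moreover then have "\<sigma> i \<in> {..<k}" using that permutes_in_image by fastforce
    ultimately show "B i (\<sigma> i) \<in> carrier T" using B by simp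
  qed
  have pc: "?p \<sigma> \<in> carrier T" if "\<sigma> \<in> ?P" for \<sigma> using Bp[OF that] by (rule T.finprod_closed)
  have tc: "[(sign \<sigma> :: int)] \<cdot>\<^bsub>T\<^esub> ?p \<sigma> \<in> carrier T" if "\<sigma> \<in> ?P" for \<sigma>
    using pc[OF that] by (simp add: add_pow_sign[OF T.abelian_group_axioms])
  have tv: "\<alpha> ([(sign \<sigma> :: int)] \<cdot>\<^bsub>T\<^esub> ?p \<sigma>) = of_int (sign \<sigma>) * (\<Prod>i<k. \<alpha> (B i (\<sigma> i)))" if "\<sigma> \<in> ?P" for \<sigma>
  proof -
    have "\<alpha> (?p \<sigma>) = (\<Prod>i<k. \<alpha> (B i (\<sigma> i)))" using Bp[OF that] by (intro prod) simp
    then show ?thesis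
      using neg[OF pc[OF that]] unfolding add_pow_sign[OF T.abelian_group_axioms pc[OF that]]
      by (cases rule: sign_cases[of \<sigma>]) simp_all
  qed
  have fin: "finite ?P" by (rule finite_permutations) simp
  show "ring_det T k B \<in> carrier T" unfolding ring_det_def by (rule T.finsum_closed) (use tc in blast)
  show "\<alpha> (ring_det T k B) = leibniz k (\<lambda>i j. \<alpha> (B i j))"
    unfolding ring_det_def leibniz_def
    by (subst sum[OF fin]) (use tc tv in \<open>auto intro: sum.cong\<close>)
qed

section \<open>The characteristic variety in coordinates\<close>

text \<open>The presentation and \<open>\<Delta>\<close> are kept apart from the chart
  \<open>\<phi>\<close>, so that the same data can be read in two bases within one argument.\<close>

locale alexander_chart = group G for G :: "('a, 'm) monoid_scheme" (structure) +
  fixes n :: nat and \<phi> :: "'a set set \<Rightarrow> (nat \<Rightarrow>\<^sub>0 int)"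
    and m h :: nat and Q :: "nat \<Rightarrow> nat \<Rightarrow> ('a set set \<Rightarrow>\<^sub>0 int)" and \<Delta> :: "'a set set \<Rightarrow>\<^sub>0 int"
  assumes chart: "lattice_chart (G_abf G) n \<phi>" and n2: "n \<ge> 2"
    and pres: "presentation_matrix (int_group_ring (G_abf G)) (alexander_module G) m h Q"
    and gcd: "is_gcd_of (int_group_ring (G_abf G)) \<Delta> (elementary_ideal_1 (int_group_ring (G_abf G)) m h Q)"
begin

sublocale H: lattice_chart "G_abf G" n \<phi> by (rule chart)

sublocale G: torus_coordinates G n "\<lambda>g. \<phi> (abf_proj G g)"
  by (rule torus_coordinates_G) (use H.\<phi>_mult H.\<phi>_bij in \<open>auto simp: iso_def hom_def bij_betw_def exps_eq_carrier\<close>)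

lemma abf_proj_closed: "g \<in> carrier G \<Longrightarrow> abf_proj G g \<in> carrier (G_abf G)"
  using abf_proj_surj by blast

lemma abf_pullback_pull: "abf_pullback G (H.pull z) = G.pull z"
  by (rule ext) (auto simp: abf_pullback_def compose_def H.pull_def G.pull_def abf_proj_closed)

lemma T0_eq: "T0 G = G.pull ` torus n"
  unfolding T0_def H.char_group_pull image_image abf_pullback_pull ..

lemma in_abf_chars_pull:
  assumes "C \<subseteq> torus n"
  shows "in_abf_chars G (G.pull ` C) = H.pull ` C"
proof -
  have "z \<in> C" if "z \<in> torus n" "G.pull z \<in> G.pull ` C" for z
    using that G.pull_inj assms by blast
  then show ?thesis using assms unfolding in_abf_chars_def H.char_group_pull by (auto simp: abf_pullback_pull)
qed

definition minor_set :: "('a set set \<Rightarrow>\<^sub>0 int) set" where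
  "minor_set = minors H.S m h Q (m - 1)"

definition variety :: "(nat \<Rightarrow> complex) set" where
  "variety = {z \<in> torus n. \<forall>e\<in>minor_set. zev z (H.push e) = 0}"

lemma Q_closed: "i < m \<Longrightarrow> j < h \<Longrightarrow> Q i j \<in> carrier H.S"
  using pres by (simp add: presentation_matrix_def)

lemma minor_entry:
  assumes "r ` {..<m - 1} \<subseteq> {..<m}" "c ` {..<m - 1} \<subseteq> {..<h}" "i < m - 1" "j < m - 1"
  shows "Q (r i) (c j) \<in> carrier H.S"
  using assms by (intro Q_closed) auto

lemma minor_set_closed: "minor_set \<subseteq> carrier H.S"
proof
  fix e assume "e \<in> minor_set"
  then obtain r c where e: "e = ring_det H.S (m - 1) (\<lambda>i j. Q (r i) (c j))"
    "r ` {..<m - 1} \<subseteq> {..<m}" "c ` {..<m - 1} \<subseteq> {..<h}" unfolding minor_set_def minors_def by blast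
  \<comment> \<open>\<open>ring_det_hom\<close> asks for some homomorphism to the complex numbers
    even where closedness alone is wanted; the augmentation is one.\<close>
  show "e \<in> carrier H.S" unfolding e(1)
  proof (rule ring_det_hom(2)[where \<alpha> = "lin (\<lambda>_. 1)", OF H.cring_S])
    show "lin (\<lambda>_. 1) \<one>\<^bsub>H.S\<^esub> = 1" by (simp add: group_ring_simps lin_single)
  qed (use minor_entry[OF e(2,3)] in \<open>auto simp: group_ring_simps lin_add lin_mult\<close>)
qed

lemma Delta_closed: "\<Delta> \<in> carrier H.S"
  and Delta_dvd: "e \<in> minor_set \<Longrightarrow> dvd_in (laur {..<n}) (H.push \<Delta>) (H.push e)"
  and Delta_greatest: "c \<in> laur {..<n} \<Longrightarrow> (\<And>e. e \<in> minor_set \<Longrightarrow> dvd_in (laur {..<n}) c (H.push e)) \<Longrightarrow>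
    dvd_in (laur {..<n}) c (H.push \<Delta>)"
  using H.is_gcd_of_Idl[OF minor_set_closed gcd[unfolded elementary_ideal_1_def, folded minor_set_def]] by blast+

lemma push_Delta: "H.push \<Delta> \<in> laur {..<n}"
  by (rule H.push_in_laur[OF Delta_closed])

lemma pull_simps:
  assumes "z \<in> torus n"
  shows "x \<in> carrier (G_abf G) \<Longrightarrow> y \<in> carrier (G_abf G) \<Longrightarrow> H.pull z (x \<otimes>\<^bsub>G_abf G\<^esub> y) = H.pull z x * H.pull z y"
    "H.pull z \<one>\<^bsub>G_abf G\<^esub> = 1"
  using H.pull_in_chars[OF assms] char_one[OF H.is_group] by (auto simp: char_group_iff)

lemma variety_iff_left_kernel:
  fixes z
  defines "K \<equiv> {y. \<forall>j<h. (\<Sum>i<m. lin (H.pull z) (Q i j) * y i) = 0}"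
  assumes z: "z \<in> torus n"
  shows "z \<in> variety \<longleftrightarrow> (\<exists>y\<in>K. \<exists>y'\<in>K. indep2 {..<m} y y')"
proof -
  have det: "zev z (H.push (ring_det H.S (m - 1) (\<lambda>i j. Q (r i) (c j)))) = leibniz (m - 1) (\<lambda>i j. lin (H.pull z) (Q (r i) (c j)))"
    if rc: "r ` {..<m - 1} \<subseteq> {..<m}" "c ` {..<m - 1} \<subseteq> {..<h}" for r c
  proof -
    have hom: "\<And>x y. x \<in> carrier H.S \<Longrightarrow> y \<in> carrier H.S \<Longrightarrow> lin (H.pull z) (x \<oplus>\<^bsub>H.S\<^esub> y) = lin (H.pull z) x + lin (H.pull z) y"
      "\<And>x y. x \<in> carrier H.S \<Longrightarrow> y \<in> carrier H.S \<Longrightarrow> lin (H.pull z) (x \<otimes>\<^bsub>H.S\<^esub> y) = lin (H.pull z) x * lin (H.pull z) y"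
      "lin (H.pull z) \<one>\<^bsub>H.S\<^esub> = 1"
      by (simp_all add: group_ring_simps lin_add lin_single lin_mult pull_simps[OF z])
    note d = ring_det_hom[where \<alpha> = "lin (H.pull z)", OF H.cring_S minor_entry[OF rc] hom]
    show ?thesis using d H.lin_pull by simp
  qed
  let ?mono = "\<lambda>r c. strict_mono_on {..<m - 1} r \<and> r ` {..<m - 1} \<subseteq> {..<m} \<and>
      strict_mono_on {..<m - 1} c \<and> c ` {..<m - 1} \<subseteq> {..<h}"
  have "z \<in> variety \<longleftrightarrow>
      (\<forall>r c. ?mono r c \<longrightarrow> zev z (H.push (ring_det H.S (m - 1) (\<lambda>i j. Q (r i) (c j)))) = 0)"
    using z unfolding variety_def minor_set_def minors_def by blast
  also have "\<dots> \<longleftrightarrow> (\<forall>r c. ?mono r c \<longrightarrow> leibniz (m - 1) (\<lambda>i j. lin (H.pull z) (Q (r i) (c j))) = 0)"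
    by (intro iff_allI imp_cong refl) (simp only: det)
  finally show ?thesis
    unfolding K_def two_left_kernel_vectors_iff[where k = "m - 1", OF refl] .
qed

lemma pull_V1_iff:
  assumes z: "z \<in> torus n"
  shows "G.pull z \<in> V1 G \<longleftrightarrow> z \<in> variety"
proof -
  interpret A: alexander_setup G "G_abf G" "abf_proj G"
    by unfold_locales (rule abf_proj_hom)
  interpret tw: twisted G "G.pull z" by unfold_locales (rule G.pull_in_chars[OF z])
  have val: "G.pull z g = H.pull z (abf_proj G g)" if "g \<in> carrier G" for g
    using that by (simp add: G.pull_def H.pull_def abf_proj_closed)
  have crossed: "A.crossed (H.pull z) d \<longleftrightarrow> tw.crossed_hom d" for d
    by (simp add: A.crossed_def tw.crossed_hom_def val)
  have eq: "(\<exists>d d'. tw.crossed_hom d \<and> tw.crossed_hom d' \<and> indep2 (carrier G) d d') \<longleftrightarrow> z \<in> variety"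
  proof -
    note \<sigma> = pull_simps[OF z]
    have "A.left_kernel (H.pull z) m h Q = {y. \<forall>j<h. (\<Sum>i<m. lin (H.pull z) (Q i j) * y i) = 0}"
      by (rule A.left_kernel_def) (simp_all only: \<sigma>)
    moreover have "(\<exists>d d'. A.crossed (H.pull z) d \<and> A.crossed (H.pull z) d' \<and> indep2 (carrier G) d d') \<longleftrightarrow>
        (\<exists>y\<in>A.left_kernel (H.pull z) m h Q. \<exists>y'\<in>A.left_kernel (H.pull z) m h Q. indep2 {..<m} y y')"
      using pres unfolding alexander_module_def by (intro A.crossed_iff_left_kernel) (simp_all only: \<sigma>)
    ultimately show ?thesis unfolding crossed variety_iff_left_kernel[OF z] by simp
  qed
  have "\<exists>d d'. tw.crossed_hom d \<and> tw.crossed_hom d' \<and> indep2 (carrier G) d d'"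
    if triv: "\<forall>g\<in>carrier G. G.pull z g = 1"
  proof -
    \<comment> \<open>At the trivial character crossed homomorphisms are additive maps. Coordinates
      0 and 1 of the lattice supply two independent ones; this is where \<open>n \<ge> 2\<close>
      enters.\<close>
    define d where "d i g = complex_of_int (Poly_Mapping.lookup (\<phi> (abf_proj G g)) i)" for i g
    have c: "tw.crossed_hom (d i)" for i
      unfolding tw.crossed_hom_def d_def using triv by (simp add: G.\<pi>_mult lookup_add)
    have "\<exists>g\<in>carrier G. \<forall>k. d k g = (if k = i then 1 else 0)" if i: "i < 2" for i
    proof -
      have "Poly_Mapping.single i 1 \<in> exps {..<n}" using i n2 by (intro single_in_exps) simp
      then obtain g where "g \<in> carrier G" "\<phi> (abf_proj G g) = Poly_Mapping.single i 1"
        using G.\<pi>_image by (metis (no_types, lifting) imageE)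
      then show ?thesis by (intro bexI[of _ g]) (auto simp: d_def lookup_single when_def)
    qed
    then obtain g0 g1 where g: "g0 \<in> carrier G" "\<And>k. d k g0 = (if k = 0 then 1 else 0)"
      "g1 \<in> carrier G" "\<And>k. d k g1 = (if k = 1 then 1 else 0)"
      by (metis one_less_numeral_iff semiring_norm(76) zero_less_numeral)
    have "indep2 (carrier G) (d 0) (d 1)" unfolding indep2_def
    proof (intro allI impI)
      fix \<alpha> \<beta> assume *: "\<forall>x\<in>carrier G. \<alpha> * d 0 x + \<beta> * d 1 x = 0"
      show "\<alpha> = 0 \<and> \<beta> = 0" using *[rule_format, OF g(1)] *[rule_format, OF g(3)] g(2,4) by simp
    qed
    then show ?thesis using c by blast
  qed
  then show ?thesis using tw.V1_iff_indep eq by blast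
qed

lemma zclosed_variety: "zclosed n variety"
proof -
  have "variety = {z \<in> torus n. \<forall>f\<in>(\<lambda>e. complexify (H.push e)) ` minor_set. cev z f = 0}"
    by (auto simp: variety_def eval_complexify)
  moreover have "(\<lambda>e. complexify (H.push e)) ` minor_set \<subseteq> laur {..<n}"
  proof
    fix f assume "f \<in> (\<lambda>e. complexify (H.push e)) ` minor_set"
    then obtain e where "e \<in> minor_set" "f = complexify (H.push e)" by (rule imageE)
    moreover have "H.push e \<in> laur {..<n}" if "e \<in> minor_set" for e
      by (rule H.push_in_laur) (rule subsetD[OF minor_set_closed that])
    ultimately show "f \<in> laur {..<n}" by (simp only: complexify_in_laur)
  qed
  ultimately show ?thesis by (simp only: zclosed_zeros)
qed

lemma variety_torus: "variety \<subseteq> torus n" by (auto simp: variety_def)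

lemma Delta_0:
  assumes "\<Delta> = 0"
  shows "variety = torus n"
proof -
  have "H.push e = 0" if "e \<in> minor_set" for e
    using Delta_dvd[OF that] by (auto simp: assms H.push_0 dvd_in_def)
  then show ?thesis by (auto simp: variety_def eval_0[OF coeff_hom_of_int])
qed

lemma push_Delta_nonzero: "\<Delta> \<noteq> 0 \<Longrightarrow> H.push \<Delta> \<noteq> 0"
  using H.push_inj[OF Delta_closed, of 0] by (auto simp: H.push_0 carrier_group_ring)

text \<open>If every minor were zero, 0 would be a common divisor and would divide
  \<open>\<Delta>\<close>. A nonzero minor is nonzero at some point of the torus.\<close>

lemma variety_proper:
  assumes "\<Delta> \<noteq> 0"
  shows "variety \<noteq> torus n"
proof -
  have "\<exists>e\<in>minor_set. H.push e \<noteq> 0"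
  proof (rule ccontr)
    assume "\<not> ?thesis"
    then have "dvd_in (laur {..<n}) 0 (H.push e)" if "e \<in> minor_set" for e
      using that by (auto simp: dvd_in_def intro!: bexI[of _ 0] laurD)
    then have "dvd_in (laur {..<n}) 0 (H.push \<Delta>)" by (rule Delta_greatest[OF laurD(1)])
    then have "H.push \<Delta> = 0" by (auto simp: dvd_in_def)
    then show False using push_Delta_nonzero assms by blast
  qed
  then obtain e where e: "e \<in> minor_set" "H.push e \<noteq> 0" by blast
  have "complexify (H.push e) \<in> laur {..<n}" "complexify (H.push e) \<noteq> 0"
    using e minor_set_closed H.push_in_laur by (auto simp: complexify_in_laur complexify_eq_0)
  then obtain z where "z \<in> torus n" "cev z (complexify (H.push e)) \<noteq> 0" using torus_nonvanishing by blast
  then have "z \<in> torus n" "z \<notin> variety" using e(1) by (auto simp: variety_def eval_complexify)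
  then show ?thesis by blast
qed

lemma Delta_zeros: "z \<in> torus n \<Longrightarrow> zev z (H.push \<Delta>) = 0 \<Longrightarrow> z \<in> variety"
  unfolding variety_def using eval_dvd[OF coeff_hom_of_int Delta_dvd] torus_nonzero by blast

lemma hypersurface_Delta:
  assumes "\<Delta> \<noteq> 0" "codim1 n C" "C \<subseteq> variety" "z \<in> C"
  shows "zev z (H.push \<Delta>) = 0"
proof (rule codim1_subset_gcd[of n C "H.push \<Delta>" "H.push ` minor_set"])
  show "H.push ` minor_set \<subseteq> laur {..<n}" using minor_set_closed H.push_in_laur by blast
  show "dvd_in (laur {..<n}) d (H.push \<Delta>)"
    if "d \<in> laur {..<n}" "\<And>e. e \<in> H.push ` minor_set \<Longrightarrow> dvd_in (laur {..<n}) d e" for d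
    using that by (intro Delta_greatest) auto
qed (use assms push_Delta push_Delta_nonzero Delta_dvd in \<open>auto simp: variety_def\<close>)

lemma pull_image_subset:
  assumes "A \<subseteq> torus n" "B \<subseteq> torus n"
  shows "G.pull ` A \<subseteq> G.pull ` B \<longleftrightarrow> A \<subseteq> B"
proof
  assume *: "G.pull ` A \<subseteq> G.pull ` B"
  show "A \<subseteq> B"
  proof
    fix z assume z: "z \<in> A"
    then obtain w where "w \<in> B" "G.pull z = G.pull w" using * by blast
    moreover then have "z = w" using assms z by (intro G.pull_inj) auto
    ultimately show "z \<in> B" by simp
  qed
qed blast

section \<open>Hypersurfaces and the components of \<open>W1 G\<close>\<close>

definition hypersurfaces :: "(nat \<Rightarrow> complex) set set" where
  "hypersurfaces = {C. codim1 n C \<and> C \<subseteq> variety}"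

lemma hypersurface_torus: "C \<in> hypersurfaces \<Longrightarrow> C \<subseteq> torus n"
  using variety_torus by (auto simp: hypersurfaces_def)

lemma V1_pull: "C \<subseteq> torus n \<Longrightarrow> G.pull ` C \<subseteq> V1 G \<longleftrightarrow> C \<subseteq> variety"
  using pull_V1_iff by blast

text \<open>The closure of \<open>C'\<close> stays in the proper closed set \<open>variety\<close>,
  so it is not the torus, and maximality of \<open>C\<close> identifies it with
  \<open>C\<close>.\<close>

lemma irr_subset_variety:
  assumes "\<Delta> \<noteq> 0" "C \<in> hypersurfaces" "irr n C'" "C' \<subseteq> variety" "C \<subseteq> C'"
  shows "C' = C"
proof -
  have C: "codim1 n C" using assms(2) by (simp add: hypersurfaces_def)
  have sub: "C' \<subseteq> zclosure n C'" using assms(3) by (intro zclosure_subset) (simp add: irr_def)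
  have "zclosure n C' \<subseteq> variety" by (rule zclosure_le[OF assms(4) zclosed_variety])
  then have "zclosure n C' \<noteq> torus n" using variety_proper[OF assms(1)] variety_torus by blast
  then have "zclosure n C' = C"
    using C irr_zclosure[OF assms(3)] zclosed_zclosure[of n C'] sub assms(5) unfolding codim1_def by blast
  then show ?thesis using sub assms(5) by blast
qed

text \<open>Here \<open>V1 G\<close> contains the whole irreducible set \<open>T0 G\<close>. A
  component inside \<open>T0 G\<close> is then \<open>T0 G\<close> itself, and its codimension is
  not one.\<close>

lemma W1_zero:
  assumes "\<Delta> = 0"
  shows "W1 G = {}"
proof (rule ccontr)
  assume "W1 G \<noteq> {}"
  then obtain C where C: "C \<in> irreducible_components (zariski G) (V1 G)" "codimension (zariski G) C = 1" "C \<subseteq> T0 G"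
    unfolding W1_def by blast
  have "irreducible_in (zariski G) (T0 G)" "T0 G \<subseteq> V1 G"
    unfolding T0_eq using G.irreducible_pull_iff[of "torus n"] irr_torus V1_pull Delta_0[OF assms] by auto
  then have "C = T0 G" using C unfolding irreducible_components_def by blast
  then have "codim1 n (torus n)" using C(2) G.codimension_pull_iff[of "torus n"] by (simp add: T0_eq)
  then show False by (simp add: codim1_def)
qed

text \<open>Maximality of a component has to be tested against all irreducible subsets of
  \<open>V1 G\<close>. Those that meet the identity component stay inside it and can be compared in
  coordinates.\<close>

lemma hypersurface_iff:
  fixes C :: "('a \<Rightarrow> complex) set"
  assumes "\<Delta> \<noteq> 0"
  shows "C \<in> irreducible_components (zariski G) (V1 G) \<and> codimension (zariski G) C = 1 \<and> C \<subseteq> T0 G \<longleftrightarrow>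
    (\<exists>S\<in>hypersurfaces. C = G.pull ` S)" (is "?L \<longleftrightarrow> ?R")
proof
  assume L: ?L
  then obtain S where S: "S \<subseteq> torus n" "C = G.pull ` S" unfolding T0_eq using subset_imageE by metis
  moreover have "C \<subseteq> V1 G" using L by (simp add: irreducible_components_def)
  ultimately show ?R using L G.codimension_pull_iff[OF S(1)] V1_pull[OF S(1)]
    by (auto simp: hypersurfaces_def)
next
  assume ?R
  then obtain S where S: "S \<in> hypersurfaces" "C = G.pull ` S" by blast
  have St: "S \<subseteq> torus n" by (rule hypersurface_torus[OF S(1)])
  have cod: "codimension (zariski G) C = 1" using S St G.codimension_pull_iff by (simp add: hypersurfaces_def)
  have CV: "C \<subseteq> V1 G" using S V1_pull[OF St] by (simp add: hypersurfaces_def)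
  have "C' = C" if C': "irreducible_in (zariski G) C'" "C' \<subseteq> V1 G" "C \<subseteq> C'" for C'
  proof -
    have "C \<noteq> {}" using codimension_1D(2)[OF cod] by (simp add: irreducible_in_def)
    then have "C' \<inter> G.pull ` torus n \<noteq> {}" using S(2) St C'(3) by blast
    then obtain S' where S': "irr n S'" "C' = G.pull ` S'" using G.closed_irreducible_as_pull[OF C'(1)] by metis
    have S't: "S' \<subseteq> torus n" using S'(1) by (simp add: irr_def)
    have "S \<subseteq> S'" using C'(3) S(2) S'(2) pull_image_subset[OF St S't] by simp
    moreover have "S' \<subseteq> variety" using C'(2) S'(2) V1_pull[OF S't] by simp
    ultimately have "S' = S" using irr_subset_variety[OF assms S(1) S'(1)] by blast
    then show ?thesis using S S' by simp
  qed
  then show ?L using cod CV codimension_1D(2)[OF cod] St S(2) by (auto simp: irreducible_components_def T0_eq)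
qed

lemma W1_eq:
  assumes "\<Delta> \<noteq> 0"
  shows "W1 G = G.pull ` \<Union>hypersurfaces"
proof -
  have "{C \<in> irreducible_components (zariski G) (V1 G). codimension (zariski G) C = 1 \<and> C \<subseteq> T0 G} =
      (\<lambda>S. G.pull ` S) ` hypersurfaces"
    using hypersurface_iff[OF assms] by (intro Set.set_eqI) (simp add: image_iff)
  then show ?thesis unfolding W1_def by (simp add: image_Union)
qed

text \<open>\<open>W1 G\<close> is formed as a union, so its own components have to be identified
  again; a hypersurface remains maximal in this smaller set.\<close>

lemma hypersurface_component:
  assumes "\<Delta> \<noteq> 0" "C \<in> hypersurfaces"
  shows "G.pull ` C \<in> irreducible_components (zariski G) (W1 G)"
proof -
  have Ct: "C \<subseteq> torus n" by (rule hypersurface_torus[OF assms(2)])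
  have irr: "irr n C" using assms(2) by (simp add: hypersurfaces_def codim1_def)
  have "Y = G.pull ` C" if Y: "irreducible_in (zariski G) Y" "Y \<subseteq> W1 G" "G.pull ` C \<subseteq> Y" for Y
  proof -
    have W: "\<Union>hypersurfaces \<subseteq> torus n" using hypersurface_torus by blast
    have "Y \<subseteq> G.pull ` torus n" using Y(2) W1_eq[OF assms(1)] W by blast
    moreover have "Y \<noteq> {}" using Y(1) by (simp add: irreducible_in_def)
    ultimately have "Y \<inter> G.pull ` torus n \<noteq> {}" by blast
    then obtain S where S: "irr n S" "Y = G.pull ` S" using G.closed_irreducible_as_pull[OF Y(1)] by metis
    have St: "S \<subseteq> torus n" using S(1) by (simp add: irr_def)
    have "C \<subseteq> S" using Y(3) S(2) pull_image_subset[OF Ct St] by simp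
    moreover have "S \<subseteq> \<Union>hypersurfaces" using Y(2) unfolding W1_eq[OF assms(1)] S(2)
      using pull_image_subset[OF St W] by simp
    ultimately have "S = C" using irr_subset_variety[OF assms S(1)] by (auto simp: hypersurfaces_def)
    then show ?thesis using S by simp
  qed
  moreover have "G.pull ` C \<subseteq> W1 G" using W1_eq[OF assms(1)] assms(2) by blast
  ultimately show ?thesis
    using G.irreducible_pull_iff[OF Ct] irr by (auto simp: irreducible_components_def)
qed

end

section \<open>Subtori\<close>

text \<open>A character factors through the epimorphism \<open>f\<close> exactly when it is trivial
  on the kernel. A direction is thus the annihilator of a subgroup, which allows comparison without
  reference to \<open>f\<close>.\<close>

lemma direction_annihilator:
  assumes H: "group H" and f: "f \<in> epi H (free_Abelian_group {..<k::nat})"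
  shows "(\<lambda>\<chi>. compose (carrier H) \<chi> f) ` carrier (char_group (free_Abelian_group {..<k})) =
    {s \<in> carrier (char_group H). \<forall>x\<in>carrier H. f x = 0 \<longrightarrow> s x = 1}" (is "?I = ?A")
proof -
  interpret H: group H by fact
  let ?F = "free_Abelian_group {..<k}"
  have fm: "f (x \<otimes>\<^bsub>H\<^esub> y) = f x + f y" if "x \<in> carrier H" "y \<in> carrier H" for x y
    using f that by (auto simp: epi_def hom_def)
  have fim: "f ` carrier H = carrier ?F" using f by (simp add: epi_def)
  have fc: "f x \<in> carrier ?F" if "x \<in> carrier H" for x using fim that by blast
  have f1: "f \<one>\<^bsub>H\<^esub> = 0" using fm[of "\<one>\<^bsub>H\<^esub>" "\<one>\<^bsub>H\<^esub>"] by simp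
  have finv: "f (inv\<^bsub>H\<^esub> x) = - f x" if "x \<in> carrier H" for x
    using fm[of x "inv\<^bsub>H\<^esub> x"] that f1 by (simp add: add_eq_0_iff)
  have F: "group ?F" by simp
  show ?thesis
  proof (rule subset_antisym; rule subsetI)
    fix s assume "s \<in> ?I"
    then obtain \<chi> where \<chi>: "\<chi> \<in> carrier (char_group ?F)" "s = compose (carrier H) \<chi> f" by blast
    have "\<chi> 0 = 1" using char_one[OF F \<chi>(1)] by simp
    then show "s \<in> ?A" using \<chi> fc unfolding mem_Collect_eq char_group_iff
      by (auto simp: compose_def fm char_group_iff)
  next
    fix s assume "s \<in> ?A"
    then have s: "s \<in> carrier (char_group H)" "\<And>x. x \<in> carrier H \<Longrightarrow> f x = 0 \<Longrightarrow> s x = 1" by auto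
    have s_eq: "s x = s y" if xy: "x \<in> carrier H" "y \<in> carrier H" "f x = f y" for x y
    proof -
      have "f (inv\<^bsub>H\<^esub> y \<otimes>\<^bsub>H\<^esub> x) = 0" using fm[of "inv\<^bsub>H\<^esub> y" x] finv xy by simp
      then have "s (inv\<^bsub>H\<^esub> y \<otimes>\<^bsub>H\<^esub> x) = 1" using s(2) xy by simp
      moreover have "s (inv\<^bsub>H\<^esub> y \<otimes>\<^bsub>H\<^esub> x) = inverse (s y) * s x" "s y \<noteq> 0"
        using s(1) xy char_inv[OF H s(1) xy(2)] by (simp_all add: char_group_iff)
      ultimately show ?thesis by (simp add: field_simps)
    qed
    define \<chi> where "\<chi> = (\<lambda>u\<in>carrier ?F. s (inv_into (carrier H) f u))"
    have inv: "inv_into (carrier H) f u \<in> carrier H" "f (inv_into (carrier H) f u) = u" if "u \<in> carrier ?F" for u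
      using that fim inv_into_into[of u f "carrier H"] f_inv_into_f[of u f "carrier H"] by auto
    have \<chi>f: "\<chi> (f x) = s x" if "x \<in> carrier H" for x
      using s_eq[OF inv(1) that inv(2)] fc[OF that] by (simp add: \<chi>_def)
    have "\<chi> \<in> carrier (char_group ?F)"
      unfolding char_group_iff
    proof (intro conjI ballI)
      show "\<chi> \<in> extensional (carrier ?F)" by (simp add: \<chi>_def)
    next
      fix u assume "u \<in> carrier ?F"
      then show "\<chi> u \<noteq> 0" using \<chi>f[OF inv(1)] inv s(1) by (simp add: char_group_iff)
    next
      fix u v assume uv: "u \<in> carrier ?F" "v \<in> carrier ?F"
      obtain x y where xy: "x \<in> carrier H" "f x = u" "y \<in> carrier H" "f y = v" using inv uv by metis
      have "s (x \<otimes>\<^bsub>H\<^esub> y) = s x * s y" using s(1) xy(1,3) by (simp add: char_group_iff)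
      then have "\<chi> (f (x \<otimes>\<^bsub>H\<^esub> y)) = \<chi> (f x) * \<chi> (f y)" using xy(1,3) \<chi>f by simp
      then show "\<chi> (u \<otimes>\<^bsub>?F\<^esub> v) = \<chi> u * \<chi> v" using xy fm[OF xy(1,3)] by simp
    qed
    moreover have "s = compose (carrier H) \<chi> f"
      using s(1) \<chi>f by (intro ext) (auto simp: compose_def char_group_iff extensional_def)
    ultimately show "s \<in> ?I" by blast
  qed
qed

definition annihilator :: "('a, 'm) monoid_scheme \<Rightarrow> 'a set \<Rightarrow> ('a \<Rightarrow> complex) set" where
  "annihilator H N = {s \<in> carrier (char_group H). \<forall>x\<in>N. s x = 1}"

lemma is_direction_iff:
  assumes "group H"
  shows "is_direction H S \<longleftrightarrow>
    (\<exists>k::nat. \<exists>f\<in>epi H (free_Abelian_group {..<k}). S = annihilator H {x \<in> carrier H. f x = 0})"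
proof -
  have "(\<lambda>\<chi>. compose (carrier H) \<chi> f) ` carrier (char_group (free_Abelian_group {..<k})) =
      annihilator H {x \<in> carrier H. f x = 0}" if "f \<in> epi H (free_Abelian_group {..<k})" for f and k :: nat
    using direction_annihilator[OF assms that] by (auto simp: annihilator_def)
  then show ?thesis unfolding is_direction_def by (metis (no_types, lifting))
qed

text \<open>\<open>N\<close> is the kernel of a map to a torsion-free group and hence saturated: it
  contains every root of its elements. This last clause later supplies a basis vector inside
  \<open>N\<close>.\<close>

lemma subtorusE:
  assumes H: "group H" and W: "is_subtorus_along H W S"
  obtains \<rho> N where "N \<subseteq> carrier H" "S = annihilator H N" "\<rho> \<in> carrier (char_group H)"
    "W = {\<lambda>x\<in>carrier H. \<rho> x * s x | s. s \<in> S}"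
    "\<And>x k. x \<in> carrier H \<Longrightarrow> k \<noteq> (0::int) \<Longrightarrow> x [^]\<^bsub>H\<^esub> k \<in> N \<Longrightarrow> x \<in> N"
proof -
  obtain k f where f: "f \<in> epi H (free_Abelian_group {..<k::nat})" "S = annihilator H {x \<in> carrier H. f x = 0}"
    using W is_direction_iff[OF H] unfolding is_subtorus_along_def by blast
  obtain \<rho> where \<rho>: "\<rho> \<in> carrier (char_group H)" "W = \<rho> <#\<^bsub>char_group H\<^esub> S"
    using W unfolding is_subtorus_along_def by blast
  have hom: "f \<in> hom H (free_Abelian_group {..<k})" using f(1) by (simp add: epi_def)
  show ?thesis
  proof (rule that[OF _ f(2) \<rho>(1)])
    show "W = {\<lambda>x\<in>carrier H. \<rho> x * s x | s. s \<in> S}" unfolding \<rho>(2) by (auto simp: l_coset_def char_group_def)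
    fix x and l :: int assume x: "x \<in> carrier H" "l \<noteq> 0" "x [^]\<^bsub>H\<^esub> l \<in> {x \<in> carrier H. f x = 0}"
    have "f x \<in> carrier (free_Abelian_group {..<k})" using hom x(1) by (rule hom_in_carrier)
    then have "Poly_Mapping.keys (f x) \<subseteq> {..<k}" by (simp add: exps_eq_carrier exps_def)
    then have "f (x [^]\<^bsub>H\<^esub> l) = frag_cmul l (f x)"
      using hom_int_pow[OF hom x(1) H] by simp
    then have "frag_cmul l (f x) = 0" using x(3) by simp
    then show "x \<in> {x \<in> carrier H. f x = 0}" using x(1,2) by simp
  qed auto
qed

text \<open>The direction is recovered from the coset as the set of quotients of its points, which
  makes the definite description in \<open>dir\<close> meaningful.\<close>

lemma subtorus_direction_unique:
  assumes H: "group H" and W: "is_subtorus_along H W S"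
  shows "S = {\<lambda>x\<in>carrier H. a x * inverse (b x) | a b. a \<in> W \<and> b \<in> W}"
proof -
  obtain \<rho> N where S: "N \<subseteq> carrier H" "S = annihilator H N" "\<rho> \<in> carrier (char_group H)"
    "W = {\<lambda>x\<in>carrier H. \<rho> x * s x | s. s \<in> S}" by (rule subtorusE[OF H W])
  have \<rho>0: "\<rho> x \<noteq> 0" if "x \<in> carrier H" for x using S(3) that by (simp add: char_group_iff)
  show ?thesis
  proof (rule subset_antisym; rule subsetI)
    fix s assume s: "s \<in> S"
    define e where "e = (\<lambda>x\<in>carrier H. 1::complex)"
    have e: "e \<in> S" using S(1) group.is_monoid[OF H]
      by (auto simp: S(2) annihilator_def char_group_iff e_def monoid.m_closed)
    have "s = (\<lambda>x\<in>carrier H. (\<lambda>x\<in>carrier H. \<rho> x * s x) x * inverse ((\<lambda>x\<in>carrier H. \<rho> x * e x) x))"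
      using s \<rho>0 by (intro ext) (auto simp: e_def S(2) annihilator_def char_group_iff extensional_def)
    then show "s \<in> {\<lambda>x\<in>carrier H. a x * inverse (b x) | a b. a \<in> W \<and> b \<in> W}"
      using s e S(4) by blast
  next
    fix t assume "t \<in> {\<lambda>x\<in>carrier H. a x * inverse (b x) | a b. a \<in> W \<and> b \<in> W}"
    then obtain a b where ab: "a \<in> W" "b \<in> W" "t = (\<lambda>x\<in>carrier H. a x * inverse (b x))" by blast
    obtain s s' where s: "s \<in> S" "s' \<in> S" "a = (\<lambda>x\<in>carrier H. \<rho> x * s x)" "b = (\<lambda>x\<in>carrier H. \<rho> x * s' x)"
      using ab(1,2) S(4) by blast
    have t: "t = (\<lambda>x\<in>carrier H. s x * inverse (s' x))"
      unfolding ab(3) s(3,4) using \<rho>0 by (intro ext) (auto simp: field_simps)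
    show "t \<in> S" using s(1,2) S(1) monoid.m_closed[OF group.is_monoid[OF H]] unfolding t S(2) annihilator_def mem_Collect_eq char_group_iff
      by (auto simp: subset_iff)
  qed
qed

lemma dir_eq:
  assumes "group H" "is_subtorus_along H W S"
  shows "dir H W = S"
  unfolding dir_def
  by (rule the_equality) (use assms subtorus_direction_unique in blast)+

section \<open>Level sets as subtori\<close>

context lattice_chart
begin

text \<open>The epimorphism \<open>f\<close> drops coordinate \<open>j\<close>. Its kernel consists
  of the multiples of the \<open>j\<close>-th unit vector, whose annihilator is the level
  \<open>z j = 1\<close>. The level \<open>w\<close> is the translate by the point \<open>z0\<close>
  with entry \<open>w\<close> at \<open>j\<close> and 1 elsewhere.\<close>

lemma level_subtorus:
  assumes j: "j < n" and w: "w \<noteq> 0"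
  shows "is_subtorus_along H (pull ` {z \<in> torus n. z j = w}) (annihilator H {x \<in> carrier H. \<phi> x \<in> exps {j}})"
proof -
  define f where "f x = (\<Sum>i<n - 1. Poly_Mapping.single i (Poly_Mapping.lookup (\<phi> x) (row_skip j i)))" for x
  have look: "Poly_Mapping.lookup (f x) l = (if l < n - 1 then Poly_Mapping.lookup (\<phi> x) (row_skip j l) else 0)" for x l
    by (auto simp: f_def lookup_sum lookup_single when_def)
  have skip_inj: "row_skip j i = row_skip j l \<longleftrightarrow> i = l" for i l by (auto simp: row_skip_def)
  have "f \<in> epi H (free_Abelian_group {..<n - 1})"
  proof -
    have cl: "f x \<in> exps {..<n - 1}" for x
      unfolding exps_def mem_Collect_eq by (rule subsetI) (auto simp: in_keys_iff look split: if_splits)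
    have "f ` carrier H = exps {..<n - 1}"
    proof (rule subset_antisym; rule subsetI)
      fix v assume v: "v \<in> exps {..<n - 1}"
      let ?u = "\<Sum>i<n - 1. Poly_Mapping.single (row_skip j i) (Poly_Mapping.lookup v i)"
      have "?u \<in> exps {..<n}"
        unfolding exps_def mem_Collect_eq
        by (rule keys_sum_subset) (use row_skip_image[OF j] in auto)
      then obtain x where x: "x \<in> carrier H" "\<phi> x = ?u" using \<phi>_surj by blast
      have "f x = v"
      proof (rule poly_mapping_eqI)
        fix l
        have "Poly_Mapping.lookup v l = 0" if "\<not> l < n - 1" using v that by (auto simp: exps_def in_keys_iff)
        then show "Poly_Mapping.lookup (f x) l = Poly_Mapping.lookup v l"
          by (auto simp: look x(2) lookup_sum lookup_single when_def skip_inj)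
      qed
      then show "v \<in> f ` carrier H" using x(1) by blast
    qed (use cl in blast)
    moreover have "f (x \<otimes> y) = f x + f y" if "x \<in> carrier H" "y \<in> carrier H" for x y
      by (rule poly_mapping_eqI) (simp add: look lookup_add \<phi>_mult that)
    moreover have "f \<in> carrier H \<rightarrow> exps {..<n - 1}" using cl by blast
    ultimately show ?thesis by (simp add: epi_def hom_def exps_eq_carrier)
  qed
  moreover have "f x = 0 \<longleftrightarrow> \<phi> x \<in> exps {j}" if x: "x \<in> carrier H" for x
  proof -
    have "f x = 0 \<longleftrightarrow> (\<forall>l<n - 1. Poly_Mapping.lookup (\<phi> x) (row_skip j l) = 0)"
      by (auto simp: poly_mapping_eq_iff fun_eq_iff look)
    also have "\<dots> \<longleftrightarrow> (\<forall>i\<in>{..<n} - {j}. Poly_Mapping.lookup (\<phi> x) i = 0)"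
      unfolding row_skip_image[OF j, symmetric] by auto
    also have "\<dots> \<longleftrightarrow> \<phi> x \<in> exps {j}" using \<pi>_in_exps[OF x] unfolding exps_def by (auto simp: in_keys_iff)
    finally show ?thesis .
  qed
  then have "{x \<in> carrier H. \<phi> x \<in> exps {j}} = {x \<in> carrier H. f x = 0}" by blast
  ultimately have dir: "is_direction H (annihilator H {x \<in> carrier H. \<phi> x \<in> exps {j}})"
    unfolding is_direction_iff[OF is_group] by (intro exI[of _ "n - 1"] bexI[of _ f]) simp_all
  define z0 where "z0 = (\<lambda>_. 1::complex)(j := w)"
  have z0: "z0 \<in> torus n" using j w by (auto simp: z0_def torus_def)
  obtain y where y: "y \<in> carrier H" "\<phi> y = Poly_Mapping.single j 1" using \<phi>_surj[OF single_in_exps] j by (metis lessThan_iff)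
  have monom: "monom_at (z(j := w)) u = monom_at z0 u * monom_at z u" if "z j = 1" for z u
  proof -
    have "z0 i powi k * z i powi k = (z(j := w)) i powi k" for i and k :: int using that by (simp add: z0_def)
    then show ?thesis unfolding monom_at_def prod.distrib[symmetric] by simp
  qed
  have pm: "(\<lambda>x\<in>carrier H. pull z0 x * pull z x) = pull (z(j := w))" if "z j = 1" for z
    using monom[of z, OF that] by (intro ext) (simp add: pull_def)
  have "pull ` {z \<in> torus n. z j = w} = pull z0 <#\<^bsub>char_group H\<^esub> annihilator H {x \<in> carrier H. \<phi> x \<in> exps {j}}"
    (is "?L = ?R")
  proof (rule subset_antisym; rule subsetI)
    fix t assume "t \<in> ?L"
    then obtain z where z: "z \<in> torus n" "z j = w" "t = pull z" by blast
    let ?z = "z(j := 1)"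
    have zt: "?z \<in> torus n" using torus_upd[OF z(1) j] by simp
    have "pull ?z x = 1" if "x \<in> carrier H" "\<phi> x \<in> exps {j}" for x
    proof -
      have "monom_at ?z (\<phi> x) = (\<Prod>i\<in>{j}. ?z i powi Poly_Mapping.lookup (\<phi> x) i)"
        by (rule monom_at_superset) (use that(2) in \<open>auto simp: exps_def\<close>)
      then show ?thesis using that(1) by (simp add: pull_def)
    qed
    then have "pull ?z \<in> annihilator H {x \<in> carrier H. \<phi> x \<in> exps {j}}"
      using pull_in_chars[OF zt] by (simp add: annihilator_def)
    moreover have "t = (\<lambda>x\<in>carrier H. pull z0 x * pull ?z x)" using pm[of ?z] z by auto
    ultimately show "t \<in> ?R" unfolding l_coset_def by (auto simp: char_group_def)
  next
    fix t assume "t \<in> ?R"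
    then obtain s where s: "s \<in> annihilator H {x \<in> carrier H. \<phi> x \<in> exps {j}}" "t = (\<lambda>x\<in>carrier H. pull z0 x * s x)"
      unfolding l_coset_def by (auto simp: char_group_def)
    then obtain z where z: "z \<in> torus n" "s = pull z" using char_group_pull by (auto simp: annihilator_def)
    have "s y = 1" using s(1) y by (simp add: annihilator_def single_in_exps)
    then have "z j = 1" using y z(2) by (simp add: pull_def monom_at_single)
    then have "t = pull (z(j := w))" using s(2) z(2) pm by simp
    then show "t \<in> ?L" using torus_upd[OF z(1) j w] by simp
  qed
  then show ?thesis unfolding is_subtorus_along_def using dir pull_in_chars[OF z0] by blast
qed

text \<open>With a trivial \<open>N\<close> the annihilator is the full character group, and a coset
  of it would be the whole torus.\<close>

lemma proper_subtorus_kernel: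
  assumes N: "N \<subseteq> carrier H" "\<rho> \<in> carrier (char_group H)"
    "pull ` C = {\<lambda>x\<in>carrier H. \<rho> x * s x | s. s \<in> annihilator H N}" and C: "C \<subseteq> torus n" "C \<noteq> torus n"
  shows "\<exists>x\<in>N. x \<noteq> \<one>"
proof (rule ccontr)
  assume "\<not> ?thesis"
  then have ann: "s \<in> annihilator H N" if "s \<in> carrier (char_group H)" for s
    using that char_one[OF is_group that] by (auto simp: annihilator_def)
  have "z \<in> C" if z: "z \<in> torus n" for z
  proof -
    let ?s = "\<lambda>x\<in>carrier H. pull z x * inverse (\<rho> x)"
    have "?s \<in> annihilator H N"
      using pull_in_chars[OF z] N(2) by (intro ann) (auto simp: char_group_iff)
    moreover have "pull z = (\<lambda>x\<in>carrier H. \<rho> x * ?s x)"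
      using N(2) pull_in_chars[OF z] by (intro ext) (auto simp: char_group_iff extensional_def)
    ultimately have "pull z \<in> pull ` C" unfolding N(3) by blast
    then show ?thesis using pull_inj z C(1) by blast
  qed
  then show False using C by blast
qed

text \<open>Characters in the direction are 1 at \<open>y\<close>, so the \<open>j\<close>-th
  coordinate is constant on \<open>C\<close>; a codimension-one set inside a level set fills
  it.\<close>

lemma codim1_subtorus_level:
  assumes C: "codim1 n C" and W: "is_subtorus_along H (pull ` C) U"
    and S: "U = annihilator H N" "N \<subseteq> carrier H" "y \<in> N" "\<phi> y = Poly_Mapping.single j 1" "j < n"
  shows "\<exists>w. w \<noteq> 0 \<and> C = {z \<in> torus n. z j = w}"
proof -
  obtain \<rho> N' where \<rho>: "U = annihilator H N'" "\<rho> \<in> carrier (char_group H)"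
    "pull ` C = {\<lambda>x\<in>carrier H. \<rho> x * s x | s. s \<in> U}" by (rule subtorusE[OF is_group W])
  have y: "y \<in> carrier H" using S by blast
  have "z j = \<rho> y" if z: "z \<in> C" for z
  proof -
    have "pull z \<in> pull ` C" using z by blast
    then obtain s where s: "s \<in> U" "pull z = (\<lambda>x\<in>carrier H. \<rho> x * s x)" unfolding \<rho>(3) by blast
    have "s y = 1" using s(1) S by (simp add: annihilator_def)
    then have "pull z y = \<rho> y" using s(2) y by simp
    then show ?thesis using y S(4) by (simp add: pull_def monom_at_single)
  qed
  moreover have "\<rho> y \<noteq> 0" using \<rho>(2) y by (simp add: char_group_iff)
  moreover have "C \<subseteq> torus n" using C by (simp add: codim1_def irr_def)
  ultimately have "C = {z \<in> torus n. z j = \<rho> y}" using C S(5) by (intro codim1_subset_level) auto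
  then show ?thesis using \<open>\<rho> y \<noteq> 0\<close> by blast
qed

lemma essential_hypersurface_not_parallel:
  assumes ij: "i < n" "j < n" "i \<noteq> j" and w: "w \<noteq> 0"
    and p: "prime_in (laur {..<n}) p" "essential_in n i p"
    and C: "C = {z \<in> torus n. z j = w}" and V: "V = {z \<in> torus n. cev z p = 0}"
    and sub: "is_subtorus H (pull ` V)" and par: "parallel H (pull ` C) (pull ` V)"
  shows False
proof -
  obtain S1 where S1: "is_subtorus_along H (pull ` V) S1" using sub by (auto simp: is_subtorus_def)
  obtain \<rho> N where N: "N \<subseteq> carrier H" "S1 = annihilator H N" "\<rho> \<in> carrier (char_group H)"
    "pull ` V = {\<lambda>x\<in>carrier H. \<rho> x * s x | s. s \<in> S1}" by (rule subtorusE[OF is_group S1])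
  let ?S0 = "annihilator H {x \<in> carrier H. \<phi> x \<in> exps {j}}"
  have "?S0 \<subseteq> S1 \<or> S1 \<subseteq> ?S0"
    using par unfolding parallel_def C dir_eq[OF is_group level_subtorus[OF ij(2) w]] dir_eq[OF is_group S1] .
  \<comment> \<open>A nonzero multiple of the \<open>j\<close>-th unit vector on which the direction
    of \<open>V\<close> is trivial makes a power of \<open>z j\<close> constant on \<open>V\<close>.
    One inclusion of directions gives the unit vector itself; the other gives an element of
    \<open>N\<close>, which is then shown to be such a multiple.\<close>
  then have "\<exists>x\<in>carrier H. \<phi> x \<in> exps {j} \<and> \<phi> x \<noteq> 0 \<and> (\<forall>s\<in>S1. s x = 1)"
  proof
    assume le: "S1 \<subseteq> ?S0"
    obtain y where y: "y \<in> carrier H" "\<phi> y = Poly_Mapping.single j 1"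
      using \<phi>_surj[OF single_in_exps] ij by (metis lessThan_iff)
    have "\<forall>s\<in>S1. s y = 1" using le y by (auto simp: annihilator_def single_in_exps)
    then show ?thesis using y by (intro bexI[of _ y]) (simp_all add: single_in_exps single_zero)
  next
    assume le: "?S0 \<subseteq> S1"
    have "V \<subseteq> torus n" "V \<noteq> torus n"
      using hypersurface_codim1[OF ij(1) p] unfolding V by (auto simp: codim1_def)
    then obtain x where x: "x \<in> N" "x \<noteq> \<one>" using proper_subtorus_kernel[OF N(1,3)] N(2,4) by blast
    have xc: "x \<in> carrier H" using x N by blast
    have "Poly_Mapping.lookup (\<phi> x) l = 0" if l: "l \<noteq> j" "l < n" for l
    proof -
      \<comment> \<open>A test point in the direction of the level set. Its entry 2 is not a root of
        unity, so a power of it is 1 only for the exponent 0.\<close>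
      define z where "z = (\<lambda>_. 1::complex)(l := 2)"
      have z: "z \<in> torus n" "z j = 1" using l by (auto simp: z_def torus_def)
      have "pull z \<in> ?S0"
      proof -
        have "pull z v = 1" if "v \<in> carrier H" "\<phi> v \<in> exps {j}" for v
        proof -
          have "monom_at z (\<phi> v) = (\<Prod>i\<in>{j}. z i powi Poly_Mapping.lookup (\<phi> v) i)"
            by (rule monom_at_superset) (use that(2) in \<open>auto simp: exps_def\<close>)
          then show ?thesis using that(1) z(2) by (simp add: pull_def)
        qed
        then show ?thesis using pull_in_chars[OF z(1)] by (simp add: annihilator_def)
      qed
      then have "pull z x = 1" using le x(1) unfolding N(2) by (auto simp: annihilator_def)
      then have "monom_at z (\<phi> x) = 1" using xc by (simp add: pull_def)
      moreover have "monom_at z (\<phi> x) = (\<Prod>i<n. z i powi Poly_Mapping.lookup (\<phi> x) i)"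
        by (rule monom_at_superset) (use \<pi>_in_exps[OF xc] in \<open>auto simp: exps_def\<close>)
      moreover have "(\<Prod>i<n. z i powi Poly_Mapping.lookup (\<phi> x) i) = 2 powi Poly_Mapping.lookup (\<phi> x) l"
        using l(2) by (subst prod.remove[of _ l]) (auto simp: z_def)
      ultimately have "(2::complex) powi Poly_Mapping.lookup (\<phi> x) l = 1" by simp
      then have "norm ((2::complex) powi Poly_Mapping.lookup (\<phi> x) l) = 1" by simp
      then have "(2::real) powi Poly_Mapping.lookup (\<phi> x) l = 2 powi 0" by (simp add: norm_power_int)
      then show ?thesis
        using power_int_strict_increasing[of 0 "Poly_Mapping.lookup (\<phi> x) l" "2::real"]
          power_int_strict_increasing[of "Poly_Mapping.lookup (\<phi> x) l" 0 "2::real"] by (cases rule: linorder_cases) auto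
    qed
    then have "\<phi> x \<in> exps {j}" using \<pi>_in_exps[OF xc] unfolding exps_def by (auto simp: in_keys_iff)
    moreover have "\<phi> x \<noteq> 0" using x(2) xc \<phi>_inj[of x \<one>] \<phi>_one by simp
    moreover have "\<forall>s\<in>S1. s x = 1" using x(1) N(2) by (simp add: annihilator_def)
    ultimately show ?thesis using xc by blast
  qed
  then obtain x where x: "x \<in> carrier H" "\<phi> x \<in> exps {j}" "\<phi> x \<noteq> 0" "\<And>s. s \<in> S1 \<Longrightarrow> s x = 1" by blast
  have const: "monom_at z (\<phi> x) = \<rho> x" if z: "z \<in> V" for z
  proof -
    have "pull z \<in> pull ` V" using z by blast
    then obtain s where s: "s \<in> S1" "pull z = (\<lambda>x\<in>carrier H. \<rho> x * s x)" unfolding N(4) by blast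
    have "pull z x = \<rho> x" using s x by simp
    then show ?thesis using x(1) by (simp add: pull_def)
  qed
  \<comment> \<open>This binomial is free of \<open>t_i\<close> because \<open>i \<noteq> j\<close>,
    and it vanishes on \<open>V\<close>; divisibility by the prime \<open>p\<close>, which involves
    \<open>t_i\<close>, forces it to be zero.\<close>
  let ?g = "Poly_Mapping.single (\<phi> x) 1 - Poly_Mapping.single 0 (\<rho> x) :: complex laurent"
  have "exps {j} \<subseteq> exps (others n i)" using ij by (intro exps_mono) auto
  then have g: "?g \<in> laur (others n i)" using x(2) exps_0 by (intro laurD single_in_laur) auto
  then have g': "?g \<in> laur {..<n}" using laur_mono[of "others n i" "{..<n}"] by auto
  have "cev z ?g = 0" if "z \<in> torus n" "cev z p = 0" for z
    using const[of z] that by (simp add: V eval_diff[OF coeff_hom_id] eval_single[OF coeff_hom_id] monom_at_0)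
  then have "dvd_in (laur {..<n}) p ?g" by (rule hypersurface_nullstellensatz[OF ij(1) p g'])
  then have "?g = 0" by (rule ess_const[OF ij(1) p(2) g])
  then have "Poly_Mapping.lookup ?g (\<phi> x) = 0" by (simp only: lookup_zero)
  then show False using x(3) by (simp add: lookup_minus lookup_single)
qed

end

lemma lattice_chart_adapt:
  assumes "lattice_chart H n \<phi>" and x: "x \<in> carrier H" "x \<noteq> \<one>\<^bsub>H\<^esub>"
  obtains \<phi>' j m where "lattice_chart H n \<phi>'" "j < n" "m \<noteq> 0" "\<phi>' x = Poly_Mapping.single j m"
proof -
  interpret lattice_chart H n \<phi> by fact
  have "\<phi> x \<noteq> 0" using \<phi>_inj[OF x(1), of "\<one>\<^bsub>H\<^esub>"] \<phi>_one x(2) by simp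
  then obtain \<theta> \<theta>' j m where \<theta>: "\<And>u v. \<theta> (u + v) = \<theta> u + \<theta> v" "bij_betw \<theta> (exps {..<n}) (exps {..<n})"
    "j \<in> {..<n}" "m \<noteq> 0" "\<theta> (\<phi> x) = Poly_Mapping.single j m"
    using lattice_automorphism[OF finite_lessThan \<pi>_in_exps[OF x(1)]] by metis
  have "lattice_chart H n (\<theta> \<circ> \<phi>)"
    by unfold_locales (use \<phi>_mult \<theta>(1) bij_betw_trans[OF \<phi>_bij \<theta>(2)] in auto)
  then show ?thesis using \<theta> by (intro that[of "\<theta> \<circ> \<phi>" j m]) auto
qed

section \<open>Alexander polynomials with a single essential variable\<close>

text \<open>The product of \<open>t_j - w\<close> over the finitely many values \<open>w\<close>
  vanishes on \<open>S\<close>, so by irreducibility a single factor does.\<close>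

lemma irr_finite_values:
  assumes S: "irr n S" and j: "j < n" and R: "finite R" "\<And>z. z \<in> S \<Longrightarrow> z j \<in> R"
  shows "\<exists>w\<in>R. \<forall>z\<in>S. z j = w"
proof -
  obtain ws where ws: "set ws = R" using finite_list[OF R(1)] by blast
  let ?f = "\<lambda>w. lvar j 1 - Poly_Mapping.single 0 w :: complex laurent"
  have ev: "cev z (?f w) = z j - w" for z w
    by (simp add: eval_diff[OF coeff_hom_id] eval_lvar[OF coeff_hom_id] eval_single[OF coeff_hom_id] monom_at_0)
  have "\<exists>f\<in>set (map ?f ws). \<forall>z\<in>S. cev z f = 0"
  proof (rule irr_prod_list[OF S])
    have "?f w \<in> laur {..<n}" for w
      using j by (intro laurD lvar_in_laur single_in_laur exps_0) auto
    then show "set (map ?f ws) \<subseteq> laur {..<n}" by auto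
    show "\<forall>z\<in>S. cev z (prod_list (map ?f ws)) = 0"
    proof
      fix z assume z: "z \<in> S"
      then have "\<forall>i. z i \<noteq> 0" using S torus_nonzero by (auto simp: irr_def)
      then have "cev z (prod_list (map ?f ws)) = (\<Prod>p\<leftarrow>map ?f ws. cev z p)" by (rule eval_prod_list[OF coeff_hom_id])
      also have "\<dots> = (\<Prod>w\<leftarrow>ws. z j - w)" by (simp only: map_map comp_def ev)
      also have "\<dots> = 0" using R(2)[OF z] ws by (auto simp: prod_list_zero_iff)
      finally show "cev z (prod_list (map ?f ws)) = 0" .
    qed
  qed
  then show ?thesis using ws by (auto simp: ev)
qed

lemma eval_at_cong:
  assumes "f \<in> laur J" "\<And>i. i \<in> J \<Longrightarrow> z i = z' i"
  shows "eval_at g z f = eval_at g z' f"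
proof -
  have "monom_at z u = monom_at z' u" if "u \<in> Poly_Mapping.keys f" for u
  proof -
    have "Poly_Mapping.keys u \<subseteq> J" using assms(1) that by (auto simp: laur_def exps_def)
    then show ?thesis unfolding monom_at_def using assms(2) by (intro prod.cong refl) (metis subsetD)
  qed
  then show ?thesis by (simp add: eval_at_def)
qed

lemma group_ring_single_single:
  "Poly_Mapping.single x a \<otimes>\<^bsub>group_ring K\<^esub> Poly_Mapping.single y b = Poly_Mapping.single (x \<otimes>\<^bsub>K\<^esub> y) (a * b)"
  by (subst group_ring_mult_superset[of "{x}" "{y}"]) simp_all

lemma group_ring_map_single: "group_ring_map \<nu> (Poly_Mapping.single k c) = Poly_Mapping.single (\<nu> k) c"
proof -
  have "Poly_Mapping.single k c = frag_cmul c (frag_of k)"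
    by (rule poly_mapping_eqI) (simp add: lookup_single when_def)
  moreover have "Poly_Mapping.single (\<nu> k) c = frag_cmul c (frag_of (\<nu> k))"
    by (rule poly_mapping_eqI) (simp add: lookup_single when_def)
  ultimately show ?thesis by (simp add: group_ring_map_def frag_extend_cmul)
qed

context lattice_chart
begin

lemma \<phi>_int_pow:
  assumes "y \<in> carrier H" "\<phi> y = Poly_Mapping.single j 1"
  shows "\<phi> (y [^] (k::int)) = Poly_Mapping.single j k"
proof -
  have "\<phi> \<in> hom H (free_Abelian_group {..<n})" using \<phi>_mult \<pi>_in_exps by (auto simp: hom_def exps_eq_carrier)
  then have "\<phi> (y [^] k) = \<phi> y [^]\<^bsub>free_Abelian_group {..<n}\<^esub> k" using assms(1) is_group by (intro hom_int_pow) simp_all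
  also have "\<dots> = frag_cmul k (\<phi> y)" using \<pi>_in_exps[OF assms(1)] by (intro int_pow_free_Abelian_group) (simp add: exps_def)
  also have "\<dots> = Poly_Mapping.single j k" unfolding assms(2) by (rule poly_mapping_eqI) (simp add: lookup_single when_def)
  finally show ?thesis .
qed

lemma \<phi>_hom_int:
  assumes \<nu>: "\<nu> \<in> hom integer_group H" and 1: "\<phi> (\<nu> 1) \<in> exps J"
  shows "\<phi> (\<nu> k) \<in> exps J"
proof -
  have c: "\<nu> k \<in> carrier H" for k using \<nu> by (auto simp: hom_def)
  have add: "\<phi> (\<nu> (k + l)) = \<phi> (\<nu> k) + \<phi> (\<nu> l)" for k l
    using \<nu> c by (simp add: hom_def \<phi>_mult[symmetric])
  show ?thesis
  proof (induction k rule: int_induct[where k = 0])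
    case base
    have "\<phi> (\<nu> 0) = 0" using add[of 0 0] by simp
    then show ?case by (simp add: exps_0)
  next
    case (step1 k)
    then show ?case using add[of k 1] 1 by (simp add: exps_add)
  next
    case (step2 k)
    have "\<phi> (\<nu> (k - 1)) = \<phi> (\<nu> k) - \<phi> (\<nu> 1)" using add[of "k - 1" 1] by simp
    then show ?case using step2 1 by (simp add: exps_diff)
  qed
qed

text \<open>All exponents lie on one line in direction \<open>j\<close>. Dividing by one monomial
  \<open>g\<close>, a unit, leaves powers of the basis element \<open>y\<close>, that is, the image
  of a one-variable polynomial under the homomorphism sending \<open>k\<close> to
  \<open>y [^] k\<close>.\<close>

lemma single_essential_variableI:
  assumes f: "f \<in> carrier S" "f \<noteq> 0" and j: "j < n"
    and agree: "\<And>u v i. u \<in> Poly_Mapping.keys (push f) \<Longrightarrow> v \<in> Poly_Mapping.keys (push f) \<Longrightarrow> i < n \<Longrightarrow> i \<noteq> j \<Longrightarrow>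
      Poly_Mapping.lookup u i = Poly_Mapping.lookup v i"
  shows "single_essential_variable H f"
proof -
  obtain y where y: "y \<in> carrier H" "\<phi> y = Poly_Mapping.single j 1"
    using \<phi>_surj[OF single_in_exps] j by (metis lessThan_iff)
  obtain g where g: "g \<in> Poly_Mapping.keys f" using f(2) by (metis all_not_in_conv keys_eq_empty)
  have c: "x \<in> carrier H" if "x \<in> Poly_Mapping.keys f" for x using f(1) that by (auto simp: carrier_group_ring)
  have push_keys: "\<phi> x \<in> Poly_Mapping.keys (push f)" if "x \<in> Poly_Mapping.keys f" for x
    using lookup_push[OF f(1) c[OF that]] that by (simp add: in_keys_iff)
  define e where "e x = Poly_Mapping.lookup (\<phi> x) j - Poly_Mapping.lookup (\<phi> g) j" for x
  have x_eq: "x = g \<otimes> y [^] e x" if x: "x \<in> Poly_Mapping.keys f" for x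
  proof -
    have "\<phi> x = \<phi> g + Poly_Mapping.single j (e x)"
    proof (rule poly_mapping_eqI)
      fix i
      have "Poly_Mapping.lookup (\<phi> x) i = Poly_Mapping.lookup (\<phi> g) i" if "i \<noteq> j"
      proof (cases "i < n")
        case True
        then show ?thesis using agree[OF push_keys[OF x] push_keys[OF g]] that by simp
      next
        case False
        then have "i \<notin> Poly_Mapping.keys (\<phi> x)" "i \<notin> Poly_Mapping.keys (\<phi> g)"
          using \<pi>_in_exps[OF c[OF x]] \<pi>_in_exps[OF c[OF g]] by (auto simp: exps_def)
        then show ?thesis by (simp add: in_keys_iff)
      qed
      then show "Poly_Mapping.lookup (\<phi> x) i = Poly_Mapping.lookup (\<phi> g + Poly_Mapping.single j (e x)) i"
        by (auto simp: lookup_add lookup_single when_def e_def)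
    qed
    also have "\<dots> = \<phi> (g \<otimes> y [^] e x)"
      using \<phi>_mult[OF c[OF g] int_pow_closed[OF y(1)]] \<phi>_int_pow[OF y] by simp
    finally show ?thesis using \<phi>_inj[OF c[OF x]] c[OF g] y(1) by simp
  qed
  let ?P = "\<Sum>x\<in>Poly_Mapping.keys f. Poly_Mapping.single (e x) (Poly_Mapping.lookup f x)"
  let ?\<nu> = "\<lambda>k::int. y [^] k"
  have map: "group_ring_map ?\<nu> ?P = (\<Sum>x\<in>Poly_Mapping.keys f. Poly_Mapping.single (y [^] e x) (Poly_Mapping.lookup f x))"
    unfolding group_ring_map_def
    by (subst frag_extend_sum) (simp_all add: comp_def group_ring_map_single[unfolded group_ring_map_def])
  have "Poly_Mapping.single g 1 \<otimes>\<^bsub>S\<^esub> group_ring_map ?\<nu> ?P = (\<Sum>x\<in>Poly_Mapping.keys f. Poly_Mapping.single x (Poly_Mapping.lookup f x))"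
    unfolding map group_ring_mult_sum group_ring_single_single
    by (rule sum.cong) (simp_all add: x_eq[symmetric])
  then have eq: "f = Poly_Mapping.single g 1 \<otimes>\<^bsub>S\<^esub> group_ring_map ?\<nu> ?P" by (simp add: poly_mapping_sum_single[symmetric])
  have unit: "Poly_Mapping.single g 1 \<in> Units S"
    unfolding Units_def mem_Collect_eq
  proof (intro conjI bexI[of _ "Poly_Mapping.single (inv g) 1"])
    show "Poly_Mapping.single (inv g) 1 \<otimes>\<^bsub>S\<^esub> Poly_Mapping.single g 1 = \<one>\<^bsub>S\<^esub>"
      "Poly_Mapping.single g 1 \<otimes>\<^bsub>S\<^esub> Poly_Mapping.single (inv g) 1 = \<one>\<^bsub>S\<^esub>"
      using c[OF g] by (simp_all add: group_ring_single_single group_ring_simps)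
  qed (use c[OF g] in \<open>simp_all add: single_in_group_ring\<close>)
  have "?\<nu> \<in> hom integer_group H" using y(1) by (auto simp: hom_def int_pow_mult)
  moreover have "?P \<in> carrier (int_group_ring integer_group)" by (simp add: carrier_group_ring)
  ultimately show ?thesis
    unfolding single_essential_variable_def equal_up_to_units_def using eq unit by blast
qed

end

section \<open>The two implications in a fixed chart\<close>

context alexander_chart
begin

text \<open>The prime factor is taken over the complex numbers, since an integral prime need not
  stay prime there and its zero set need not be irreducible.\<close>

lemma essential_hypersurface:
  assumes i: "i < n" and uv: "u \<in> Poly_Mapping.keys (H.push \<Delta>)" "v \<in> Poly_Mapping.keys (H.push \<Delta>)"
    "Poly_Mapping.lookup u i \<noteq> Poly_Mapping.lookup v i"
  obtains p where "prime_in (laur {..<n}) p" "essential_in n i p" "{z \<in> torus n. cev z p = 0} \<in> hypersurfaces"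
proof -
  let ?D = "complexify (H.push \<Delta>)"
  have D: "?D \<in> laur {..<n}" using push_Delta by (simp add: complexify_in_laur)
  have "essential_in n i ?D" by (rule essential_of_exponents[OF D i]) (use uv in \<open>auto simp: keys_complexify\<close>)
  then obtain p c where p: "prime_in (laur {..<n}) p" "essential_in n i p" "c \<in> laur {..<n}" "?D = p * c"
    using ess_factor[OF i D] by metis
  have "z \<in> variety" if z: "z \<in> torus n" "cev z p = 0" for z
  proof -
    have "cev z ?D = 0" using z eval_mult[OF coeff_hom_id torus_nonzero[OF z(1)]] by (simp add: p(4))
    then show ?thesis using Delta_zeros z(1) by (simp add: eval_complexify)
  qed
  then show ?thesis using hypersurface_codim1[OF i p(1,2)] by (intro that[OF p(1,2)]) (auto simp: hypersurfaces_def)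
qed

text \<open>Up to a unit \<open>\<Delta>\<close> involves \<open>t_j\<close> alone and has a finite
  set \<open>R\<close> of nonzero roots. Every hypersurface therefore lies in, and hence equals, a
  level set with value in \<open>R\<close>, and all these levels share the direction
  \<open>U\<close>.\<close>

lemma parallel_levels:
  assumes nz: "\<Delta> \<noteq> 0" and eq: "\<Delta> = u \<otimes>\<^bsub>H.S\<^esub> g" and u: "u \<in> Units H.S" and g: "g \<in> carrier H.S"
    and j: "j < n" "H.push g \<in> laur {j}"
  shows "\<exists>U. \<forall>C\<in>irreducible_components (zariski G) (W1 G).
    is_subtorus_along (G_abf G) (in_abf_chars G C) U \<and> codimension (zariski (G_abf G)) (in_abf_chars G C) = 1"
proof -
  let ?base = "\<lambda>w. (\<lambda>_. 1::complex)(j := w)" and ?level = "\<lambda>w. {z \<in> torus n. z j = w}"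
  have uc: "u \<in> carrier H.S" using u by (simp add: Units_def)
  have pD: "H.push \<Delta> = H.push u * H.push g" unfolding eq by (rule H.push_mult[OF uc g])
  have u_nz: "zev z (H.push u) \<noteq> 0" if z: "z \<in> torus n" for z
  proof -
    obtain v where v: "v \<in> carrier H.S" "u \<otimes>\<^bsub>H.S\<^esub> v = \<one>\<^bsub>H.S\<^esub>" using u by (auto simp: Units_def)
    have "H.push u * H.push v = 1"
      using H.push_mult[OF uc v(1)] v(2) by (simp add: group_ring_simps H.push_single H.\<phi>_one)
    then have "zev z (H.push u) * zev z (H.push v) = 1"
      using eval_mult[OF coeff_hom_of_int torus_nonzero[OF z], of "H.push u" "H.push v"] by (simp add: eval_1[OF coeff_hom_of_int])
    then show ?thesis by auto
  qed
  have ev: "zev z (H.push g) = zev (?base (z j)) (H.push g)" for z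
    by (rule eval_at_cong[OF j(2)]) simp
  define R where "R = {w. w \<noteq> 0 \<and> zev (?base w) (H.push g) = 0}"
  \<comment> \<open>Infinitely many roots would make \<open>g\<close> vanish on the whole torus, and
    \<open>\<Delta>\<close> would be zero.\<close>
  have fin: "finite R"
  proof (rule ccontr)
    assume inf: "infinite R"
    have one: "(\<lambda>_. 1) \<in> torus n" by (simp add: torus_def)
    have gl: "complexify (H.push g) \<in> laur {..<n}" using H.push_in_laur[OF g] by (simp add: complexify_in_laur)
    have "cev z (complexify (H.push g)) = 0" if z: "z \<in> torus n" for z
    proof -
      have zj: "z j \<noteq> 0" using torus_nonzero[OF z] by simp
      have "infinite {s. s \<noteq> 0 \<and> cev (?base s) (complexify (H.push g)) = 0}" using inf by (simp add: eval_complexify R_def)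
      then have "cev (?base (z j)) (complexify (H.push g)) = 0" by (rule fiber_zero[OF j(1) one gl _ zj])
      then show ?thesis using ev[of z] by (simp add: eval_complexify)
    qed
    then have "complexify (H.push g) = 0" using torus_nonvanishing[OF gl] by blast
    then have "H.push \<Delta> = 0" by (simp add: complexify_eq_0 pD)
    then show False using push_Delta_nonzero nz by blast
  qed
  have hyp: "\<exists>w. w \<noteq> 0 \<and> w \<in> R \<and> C = ?level w" if C: "C \<in> hypersurfaces" for C
  proof -
    have c: "codim1 n C" "C \<subseteq> variety" using C by (simp_all add: hypersurfaces_def)
    have Ct: "C \<subseteq> torus n" by (rule hypersurface_torus[OF C])
    have "z j \<in> R" if z: "z \<in> C" for z
    proof -
      have zt: "z \<in> torus n" using z Ct by blast
      have "zev z (H.push u) * zev z (H.push g) = 0"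
        using hypersurface_Delta[OF nz c z] eval_mult[OF coeff_hom_of_int torus_nonzero[OF zt]] by (simp add: pD)
      then have "zev (?base (z j)) (H.push g) = 0" using u_nz[OF zt] ev[of z] by simp
      then show ?thesis using torus_nonzero[OF zt] by (simp add: R_def)
    qed
    moreover have "irr n C" using c(1) by (simp add: codim1_def)
    ultimately have "\<exists>w\<in>R. \<forall>z\<in>C. z j = w" by (intro irr_finite_values[OF _ j(1) fin])
    then obtain w where w: "w \<in> R" "\<forall>z\<in>C. z j = w" by blast
    have "w \<noteq> 0" using w(1) by (simp add: R_def)
    then show ?thesis using codim1_subset_level[OF c(1) j(1)] w Ct by blast
  qed
  let ?U = "annihilator (G_abf G) {x \<in> carrier (G_abf G). \<phi> x \<in> exps {j}}"
  have "is_subtorus_along (G_abf G) (in_abf_chars G C) ?U \<and> codimension (zariski (G_abf G)) (in_abf_chars G C) = 1"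
    if C: "C \<in> irreducible_components (zariski G) (W1 G)" for C
  proof -
    have irrC: "irreducible_in (zariski G) C" and CW: "C \<subseteq> G.pull ` \<Union>hypersurfaces"
      and max: "\<And>C'. irreducible_in (zariski G) C' \<Longrightarrow> C' \<subseteq> G.pull ` \<Union>hypersurfaces \<Longrightarrow> C \<subseteq> C' \<Longrightarrow> C' = C"
      using C unfolding irreducible_components_def W1_eq[OF nz] by auto
    have Wt: "\<Union>hypersurfaces \<subseteq> torus n" using hypersurface_torus by blast
    have "C \<noteq> {}" using irrC by (simp add: irreducible_in_def)
    moreover have "C \<subseteq> G.pull ` torus n" using CW Wt by blast
    ultimately have "C \<inter> G.pull ` torus n \<noteq> {}" by blast
    then obtain T where T: "irr n T" "C = G.pull ` T" using G.closed_irreducible_as_pull[OF irrC] by metis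
    have Tt: "T \<subseteq> torus n" using T(1) by (simp add: irr_def)
    have TW: "T \<subseteq> \<Union>hypersurfaces" using CW unfolding T(2) pull_image_subset[OF Tt Wt] .
    \<comment> \<open>A component of \<open>W1 G\<close> lies in a union of finitely many levels, so
      its \<open>j\<close>-th coordinate takes finitely many values, and irreducibility leaves a
      single one.\<close>
    have "finite {w \<in> R. ?level w \<in> hypersurfaces}" using fin by simp
    moreover have "z j \<in> {w \<in> R. ?level w \<in> hypersurfaces}" if z: "z \<in> T" for z
    proof -
      obtain B where "B \<in> hypersurfaces" "z \<in> B" using TW z by blast
      then show ?thesis using hyp[of B] by auto
    qed
    ultimately obtain w where w: "w \<in> R" "?level w \<in> hypersurfaces" "\<forall>z\<in>T. z j = w"
      using irr_finite_values[OF T(1) j(1), of "{w \<in> R. ?level w \<in> hypersurfaces}"] by blast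
    have lt: "?level w \<subseteq> torus n" by blast
    have cod: "codim1 n (?level w)" using w(2) by (simp add: hypersurfaces_def)
    then have "irreducible_in (zariski G) (G.pull ` ?level w)" using G.irreducible_pull_iff[OF lt] by (simp add: codim1_def)
    moreover have "C \<subseteq> G.pull ` ?level w" unfolding T(2) using w(3) Tt by (intro image_mono) blast
    ultimately have "C = G.pull ` ?level w" using max[of "G.pull ` ?level w"] w(2) by blast
    then have chars: "in_abf_chars G C = H.pull ` ?level w" using in_abf_chars_pull[OF lt] by simp
    have "w \<noteq> 0" using w(1) by (simp add: R_def)
    then show ?thesis unfolding chars using H.level_subtorus[OF j(1)] H.codimension_pull_iff[OF lt] cod by blast
  qed
  then show ?thesis by blast
qed

lemma single_essential_variable_if_parallel:
  assumes nz: "\<Delta> \<noteq> 0" and C: "C \<in> hypersurfaces" "y \<in> carrier (G_abf G)" "\<phi> y = Poly_Mapping.single j 1" "j < n"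
    and dir: "is_subtorus_along (G_abf G) (H.pull ` C) (annihilator (G_abf G) N)" "N \<subseteq> carrier (G_abf G)" "y \<in> N"
    and sub: "\<And>V. V \<in> hypersurfaces \<Longrightarrow> is_subtorus (G_abf G) (H.pull ` V) \<and> parallel (G_abf G) (H.pull ` C) (H.pull ` V)"
  shows "single_essential_variable (G_abf G) \<Delta>"
proof (rule H.single_essential_variableI[OF Delta_closed nz C(4)])
  have "codim1 n C" using C(1) by (simp add: hypersurfaces_def)
  then obtain w where w: "w \<noteq> 0" "C = {z \<in> torus n. z j = w}"
    using H.codim1_subtorus_level[OF _ dir(1) refl dir(2,3) C(3,4)] by blast
  fix u v i assume uv: "u \<in> Poly_Mapping.keys (H.push \<Delta>)" "v \<in> Poly_Mapping.keys (H.push \<Delta>)" and i: "i < n" "i \<noteq> j"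
  show "Poly_Mapping.lookup u i = Poly_Mapping.lookup v i"
  proof (rule ccontr)
    assume ne: "\<not> ?thesis"
    obtain p where p: "prime_in (laur {..<n}) p" "essential_in n i p" "{z \<in> torus n. cev z p = 0} \<in> hypersurfaces"
      by (rule essential_hypersurface[OF i(1) uv ne])
    show False
      using H.essential_hypersurface_not_parallel[OF i(1) C(4) i(2) w(1) p(1,2) w(2) refl] sub[OF p(3)] by blast
  qed
qed

lemma single_essential_variable_if_no_hypersurface:
  assumes "\<Delta> \<noteq> 0" "hypersurfaces = {}"
  shows "single_essential_variable (G_abf G) \<Delta>"
proof (rule H.single_essential_variableI[OF Delta_closed assms(1)])
  show "0 < n" using n2 by simp
  fix u v i assume uv: "u \<in> Poly_Mapping.keys (H.push \<Delta>)" "v \<in> Poly_Mapping.keys (H.push \<Delta>)" "i < n"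
  show "Poly_Mapping.lookup u i = Poly_Mapping.lookup v i"
  proof (rule ccontr)
    assume ne: "\<not> ?thesis"
    show False by (rule essential_hypersurface[OF uv(3,1,2) ne]) (simp add: assms(2))
  qed
qed

end

text \<open>The statement covers every representative of the Alexander polynomial. Subtori and
  codimension refer to the characters of \<open>G_abf G\<close>, that is, to the identity component,
  whereas the components of \<open>W1 G\<close> are formed in the full character group.\<close>

theorem proposition3p7:
  fixes G :: "('a, 'm) monoid_scheme"
    and \<Delta> :: "'a set set \<Rightarrow>\<^sub>0 int"
  assumes "group G"
    and "finitely_generated G"
    and "b1 G \<ge> 2"
    and "is_alexander_polynomial G \<Delta>"
  shows "single_essential_variable (G_abf G) \<Delta> \<longleftrightarrow>
    W1 G = {} \<or>
    ((\<forall>C \<in> irreducible_components (zariski G) (W1 G).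
        is_subtorus (G_abf G) (in_abf_chars G C) \<and>
        codimension (zariski (G_abf G)) (in_abf_chars G C) = 1) \<and>
     (\<forall>C \<in> irreducible_components (zariski G) (W1 G).
      \<forall>C' \<in> irreducible_components (zariski G) (W1 G).
        parallel (G_abf G) (in_abf_chars G C) (in_abf_chars G C')))"
  (is "?L \<longleftrightarrow> ?R")
proof -
  interpret G: group G by fact
  let ?H = "G_abf G" and ?n = "b1 G"
  obtain \<phi>0 where \<phi>0: "\<phi>0 \<in> iso ?H (free_Abelian_group {..<?n})"
    using G.G_abf_free[OF assms(2)] by (auto simp: is_iso_def)
  interpret c0: lattice_chart ?H ?n \<phi>0
    by (intro lattice_chart.intro G.comm_group_G_abf lattice_chart_axioms.intro)
      (use \<phi>0 in \<open>auto simp: iso_def hom_def exps_eq_carrier\<close>)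
  obtain m h Q where pres: "presentation_matrix (int_group_ring ?H) (alexander_module G) m h Q"
    "is_gcd_of (int_group_ring ?H) \<Delta> (elementary_ideal_1 (int_group_ring ?H) m h Q)"
    using assms(4) unfolding is_alexander_polynomial_def by blast
  have ac: "alexander_chart G ?n \<phi> m h Q \<Delta>" if "lattice_chart ?H ?n \<phi>" for \<phi>
    by (intro alexander_chart.intro alexander_chart_axioms.intro assms(1) that assms(3) pres)
  interpret a0: alexander_chart G ?n \<phi>0 m h Q \<Delta> by (rule ac) (rule c0.lattice_chart_axioms)
  show ?thesis
  proof (cases "\<Delta> = 0")
    case True
    \<comment> \<open>The zero polynomial is the image of 0 under the trivial homomorphism. As
      \<open>W1 G\<close> is empty in this case, both sides hold.\<close>
    have "single_essential_variable ?H \<Delta>"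
      unfolding single_essential_variable_def
    proof (intro bexI[of _ 0] bexI[of _ "\<lambda>_. \<one>\<^bsub>?H\<^esub>"])
      have "\<one>\<^bsub>int_group_ring ?H\<^esub> \<in> Units (int_group_ring ?H)"
        using c0.cring_S by (intro monoid.Units_one_closed) (simp add: cring_def ring_def)
      then show "equal_up_to_units (int_group_ring ?H) \<Delta> (group_ring_map (\<lambda>_. \<one>\<^bsub>?H\<^esub>) 0)"
        unfolding equal_up_to_units_def
        by (intro bexI[of _ "\<one>\<^bsub>int_group_ring ?H\<^esub>"]) (simp_all add: True group_ring_map_def group_ring_zero_mult)
    qed (auto simp: hom_def carrier_group_ring)
    then show ?thesis using a0.W1_zero[OF True] by simp
  next
    case nz: False
    show ?thesis
    proof
      assume ?L
      then obtain P \<nu> u where \<nu>: "\<nu> \<in> hom integer_group ?H" and u: "u \<in> Units (int_group_ring ?H)"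
        and eq: "\<Delta> = u \<otimes>\<^bsub>int_group_ring ?H\<^esub> group_ring_map \<nu> P"
        unfolding single_essential_variable_def equal_up_to_units_def by blast
      have \<nu>c: "\<nu> k \<in> carrier ?H" for k using \<nu> by (auto simp: hom_def)
      have keys: "Poly_Mapping.keys (group_ring_map \<nu> P) \<subseteq> range \<nu>"
        unfolding group_ring_map_def by (rule order_trans[OF keys_frag_extend]) auto
      \<comment> \<open>A basis in which \<open>\<nu> 1\<close> is a multiple of one basis vector
        puts the image of \<open>P\<close> into a single variable. For trivial \<open>\<nu>\<close>
        any chart serves, with coordinate 0.\<close>
      have "\<exists>\<phi> j. lattice_chart ?H ?n \<phi> \<and> j < ?n \<and> \<phi> (\<nu> 1) \<in> exps {j}"
      proof (cases "\<nu> 1 = \<one>\<^bsub>?H\<^esub>")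
        case True
        then show ?thesis using c0.lattice_chart_axioms c0.\<phi>_one assms(3)
          by (intro exI[of _ \<phi>0] exI[of _ 0]) (simp add: exps_0)
      next
        case False
        then show ?thesis using lattice_chart_adapt[OF c0.lattice_chart_axioms \<nu>c, of 1]
          by (metis single_in_exps singletonI)
      qed
      then obtain \<phi> j where \<phi>: "lattice_chart ?H ?n \<phi>" "j < ?n" "\<phi> (\<nu> 1) \<in> exps {j}" by blast
      interpret a: alexander_chart G ?n \<phi> m h Q \<Delta> by (rule ac) (rule \<phi>(1))
      have g: "group_ring_map \<nu> P \<in> carrier (int_group_ring ?H)"
        using keys \<nu>c by (auto simp: carrier_group_ring)
      have "a.H.push (group_ring_map \<nu> P) \<in> laur {j}"
        unfolding a.H.push_def laur_def mem_Collect_eq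
        by (rule keys_sum_subset) (use keys a.H.\<phi>_hom_int[OF \<nu> \<phi>(3)] in auto)
      then obtain U where U: "\<And>C. C \<in> irreducible_components (zariski G) (W1 G) \<Longrightarrow>
          is_subtorus_along ?H (in_abf_chars G C) U \<and> codimension (zariski ?H) (in_abf_chars G C) = 1"
        using a.parallel_levels[OF nz eq u g \<phi>(2)] by blast
      have "dir ?H (in_abf_chars G C) = U" if "C \<in> irreducible_components (zariski G) (W1 G)" for C
        using dir_eq[OF c0.is_group] U[OF that] by blast
      then show ?R using U by (auto simp: is_subtorus_def parallel_def)
    next
      assume R: ?R
      show ?L
      proof (cases "W1 G = {}")
        case True
        have "C = {}" if "C \<in> a0.hypersurfaces" for C using True that unfolding a0.W1_eq[OF nz] by auto
        moreover have "C \<noteq> {}" if "C \<in> a0.hypersurfaces" for C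
          using that by (auto simp: a0.hypersurfaces_def codim1_def irr_def)
        ultimately have "a0.hypersurfaces = {}" by blast
        then show ?thesis by (rule a0.single_essential_variable_if_no_hypersurface[OF nz])
      next
        case False
        then obtain C0 where C0: "C0 \<in> a0.hypersurfaces" unfolding a0.W1_eq[OF nz] by blast
        let ?W = "in_abf_chars G (a0.G.pull ` C0)"
        have C0t: "C0 \<subseteq> torus ?n" by (rule a0.hypersurface_torus[OF C0])
        have comp: "a0.G.pull ` C0 \<in> irreducible_components (zariski G) (W1 G)"
          by (rule a0.hypersurface_component[OF nz C0])
        have par: "is_subtorus ?H (in_abf_chars G C) \<and> parallel ?H ?W (in_abf_chars G C)"
          if "C \<in> irreducible_components (zariski G) (W1 G)" for C
          using R False comp that by blast
        obtain U where U: "is_subtorus_along ?H ?W U" using par[OF comp] by (auto simp: is_subtorus_def)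
        obtain \<rho> N where N: "N \<subseteq> carrier ?H" "U = annihilator ?H N" "\<rho> \<in> carrier (char_group ?H)"
          "?W = {\<lambda>x\<in>carrier ?H. \<rho> x * s x | s. s \<in> U}"
          "\<And>x k. x \<in> carrier ?H \<Longrightarrow> k \<noteq> (0::int) \<Longrightarrow> x [^]\<^bsub>?H\<^esub> k \<in> N \<Longrightarrow> x \<in> N"
          by (rule subtorusE[OF c0.is_group U]) blast
        have "C0 \<noteq> torus ?n" using C0 by (auto simp: a0.hypersurfaces_def codim1_def)
        \<comment> \<open>A nontrivial element on which the direction of the chosen component is
          trivial. The basis is then adapted to it.\<close>
        then obtain x where x: "x \<in> N" "x \<noteq> \<one>\<^bsub>?H\<^esub>"
          using c0.proper_subtorus_kernel[OF N(1,3)] N(2,4) C0t a0.in_abf_chars_pull[OF C0t] by metis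
        obtain \<phi> j l where \<phi>: "lattice_chart ?H ?n \<phi>" "j < ?n" "l \<noteq> 0" "\<phi> x = Poly_Mapping.single j l"
          using lattice_chart_adapt[OF c0.lattice_chart_axioms _ x(2)] x(1) N(1) by blast
        interpret a: alexander_chart G ?n \<phi> m h Q \<Delta> by (rule ac) (rule \<phi>(1))
        obtain y where y: "y \<in> carrier ?H" "\<phi> y = Poly_Mapping.single j 1"
          using a.H.\<phi>_surj[OF single_in_exps] \<phi>(2) by (metis lessThan_iff)
        \<comment> \<open>\<open>x\<close> is only a multiple of a basis vector. Saturation of
          \<open>N\<close> passes to the basis vector \<open>y\<close> itself, which makes
          coordinate \<open>j\<close>, rather than a power of it, constant on the component.\<close>
        have "y [^]\<^bsub>?H\<^esub> l = x"
          using a.H.\<phi>_inj[of "y [^]\<^bsub>?H\<^esub> l" x] a.H.\<phi>_int_pow[OF y, of l] y(1) x(1) N(1) \<phi>(4) c0.int_pow_closed[OF y(1)] by auto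
        then have yN: "y \<in> N" using N(5)[OF y(1) \<phi>(3)] x(1) by simp
        \<comment> \<open>The two charts parametrize one component of \<open>V1 G\<close> by
          different subsets of the torus; \<open>B\<close> is \<open>C0\<close> seen in the adapted
          chart.\<close>
        obtain B where B: "B \<in> a.hypersurfaces" "a0.G.pull ` C0 = a.G.pull ` B"
          using a0.hypersurface_iff[OF nz] a.hypersurface_iff[OF nz] C0 by metis
        have W: "?W = a.H.pull ` B" unfolding B(2) by (rule a.in_abf_chars_pull[OF a.hypersurface_torus[OF B(1)]])
        have "is_subtorus ?H (a.H.pull ` V) \<and> parallel ?H (a.H.pull ` B) (a.H.pull ` V)" if V: "V \<in> a.hypersurfaces" for V
          using par[OF a.hypersurface_component[OF nz V]]
          unfolding W a.in_abf_chars_pull[OF a.hypersurface_torus[OF V]] .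
        then show ?thesis
          using a.single_essential_variable_if_parallel[OF nz B(1) y \<phi>(2) _ N(1) yN] U unfolding W N(2) by blast
      qed
    qed
  qed
qed

end
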